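(* Let $\alpha\in\mathbb{T}\setminus\mathbb{Q}$ and let $(\alpha,A(\cdot))$, with $A\in C^\infty(\mathbb{T},SO(3))$, be a $C^\infty$-smooth cocycle in $\mathbb{T}\times SO(3)$ which has degree $0$ and such that $A:\mathbb{T}\to SO(3)$ is not homotopic to the constant map $\mathrm{Id}$. Suppose, moreover, that $\alpha\in\widetilde{RDC}$. Then $(\alpha,A(\cdot))$ admits infinitely many renormalization representatives whose second iterate is almost reducible by sequences of $1$-periodic conjugations. That is, for infinitely many $n$ there is a $C^\infty$ renormalization representative $(\alpha_n,N(\cdot))$ of $(\alpha,A(\cdot))$ at step $n$ such that, with $N_2(x)=N(x+\alpha_n)N(x)$, there exist sequences $D_m\in C^\infty(\mathbb{T},SO(3))$, $A_m\in SO(3)$ and $U_m\in C^\infty(\mathbb{T},so(3))$ with $U_m\to0$ in the $C^\infty$ topology as $m\to\infty$ and $$D_m(x+2\alpha_n)\,N_2(x)\,D_m(x)^{-1}=A_m\exp(U_m(x))\quad\text{for all }m\text{ and all }x.$$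
   Context: $\mathbb{T}=\mathbb{R}/\mathbb{Z}$, and irrational elements of $\mathbb{T}$ are identified with irrational numbers in $(0,1)$; functions on $\mathbb{T}$ are identified with $1$-periodic functions on $\mathbb{R}$. A $C^\infty$ cocycle $(\alpha,A(\cdot))$ in $\mathbb{T}\times SO(3)$, with $\alpha\in\mathbb{T}$ and $A\in C^\infty(\mathbb{T},SO(3))$, is the map $(x,S)\mapsto(x+\alpha,A(x)S)$. Its iterates are $(\alpha,A)^n=(n\alpha,A_n)$, $n\in\mathbb{Z}$, where $A_0=\mathrm{Id}$, $A_n(x)=A(x+(n-1)\alpha)\cdots A(x)$ for $n\ge1$, and $A_{-n}(x)=A_n(x-n\alpha)^{-1}$ (in the claim, the sequence of constants $A_m\in SO(3)$ is unrelated to these iterates). Degree $0$: for irrational $\alpha$, the cocycle has degree $0$ if and only if $\frac1n(\partial_xA_n)A_n^{-1}\to0$ in $L^2(\mathbb{T},so(3))$ as $n\to\infty$. Arithmetic condition: $|\cdot|_{\mathbb{Z}}$ denotes the distance to the nearest integer. For $\gamma,\tau>0$, $\widetilde{DC}(\gamma,\tau)$ is the set of $\alpha\in\mathbb{T}$ such that $|k\alpha-\tfrac12|_{\mathbb{Z}}\ge\gamma^{-1}|k|^{-\tau}$ for all $k\in\mathbb{Z}\setminus\{0\}$. Let $\mathrm{G}(\alpha)=\{\alpha^{-1}\}$ (fractional part) be the Gauss map on $(0,1)\setminus\mathbb{Q}$, and $\alpha_n=\mathrm{G}^n(\alpha)$. $\widetilde{RDC}(\gamma,\tau)$ is the set of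 $\alpha\in\mathbb{T}\setminus\mathbb{Q}$ such that $\mathrm{G}^n(\alpha)\in\widetilde{DC}(\gamma,\tau)$ for infinitely many $n$, and $\widetilde{RDC}=\bigcup_{\gamma,\tau>0}\widetilde{RDC}(\gamma,\tau)$. Renormalization representatives: let $p_n/q_n$ be the continued fraction convergents of $\alpha\in(0,1)\setminus\mathbb{Q}$ (with $q_{-1}=0,\,p_{-1}=1,\,q_0=1,\,p_0=0$) and $\beta_n=(-1)^n(q_n\alpha-p_n)>0$, so that $\alpha_n=\beta_n/\beta_{n-1}$. The $n$-th renormalization of the $\mathbb{Z}^2$-action generated by $(1,\mathrm{Id})$ and $(\alpha,A(\cdot))$ is the action generated by the commuting pair $(1,\tilde C_n(\cdot))$, $(\alpha_n,\tilde A_n(\cdot))$ on $\mathbb{R}\times SO(3)$, where $\tilde C_n(x)=A_{(-1)^{n-1}q_{n-1}}(\beta_{n-1}x)$ and $\tilde A_n(x)=A_{(-1)^nq_n}(\beta_{n-1}x)$. A $C^\infty$ renormalization representative of $(\alpha,A(\cdot))$ at step $n$ is any cocycle $(\alpha_n,B(\cdot+\alpha_n)\tilde A_n(\cdot)B(\cdot)^{-1})$, where $B\in C^\infty(\mathbb{R},SO(3))$ is a normalizing conjugation, i.e. $B(x+1)\tilde C_n(x)B(x)^{-1}=\mathrm{Id}$ for all $x$; such a cocycle is automatically $1$-periodic. *)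

theory Defs
  imports "HOL-Analysis.Analysis"
begin

text \<open>
  The torus \<open>\<real>/\<int>\<close> is handled through \<open>1\<close>-periodic functions on the reals, and its elements
  through their representatives in \<open>[0,1)\<close>. Matrices are elements of \<^typ>\<open>real^3^3\<close>, with the
  product \<open>**\<close>; the class operations \<open>*\<close> and \<open>^\<close> on this type act entrywise and are not used
  on matrices.
\<close>

subsection \<open>Smooth functions with values in \<open>SO(3)\<close> and \<open>so(3)\<close>\<close>

definition SO3 :: "(real^3^3) set" where
  "SO3 = {M. rotation_matrix M}"

definition so3 :: "(real^3^3) set" where
  "so3 = {M. transpose M = - M}"

definition nth_derivative :: "nat \<Rightarrow> (real \<Rightarrow> 'a::real_normed_vector) \<Rightarrow> real \<Rightarrow> 'a" where
  "nth_derivative k f = ((\<lambda>g x. vector_derivative g (at x)) ^^ k) f"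

definition smooth :: "(real \<Rightarrow> 'a::real_normed_vector) \<Rightarrow> bool" where
  "smooth f \<longleftrightarrow> (\<forall>k x. nth_derivative k f differentiable (at x))"

definition periodic1 :: "(real \<Rightarrow> 'a) \<Rightarrow> bool" where
  "periodic1 f \<longleftrightarrow> (\<forall>x. f (x + 1) = f x)"

definition smooth_line :: "'a::real_normed_vector set \<Rightarrow> (real \<Rightarrow> 'a) set" where
  "smooth_line S = {f. smooth f \<and> range f \<subseteq> S}"

definition smooth_torus :: "'a::real_normed_vector set \<Rightarrow> (real \<Rightarrow> 'a) set" where
  "smooth_torus S = {f. smooth f \<and> periodic1 f \<and> range f \<subseteq> S}"

definition smooth_tendsto_zero :: "(nat \<Rightarrow> real \<Rightarrow> 'a::real_normed_vector) \<Rightarrow> bool" where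
  "smooth_tendsto_zero U \<longleftrightarrow>
     (\<forall>k. uniform_limit UNIV (\<lambda>m. nth_derivative k (U m)) (\<lambda>_. 0) sequentially)"

definition matrix_power :: "real^3^3 \<Rightarrow> nat \<Rightarrow> real^3^3" where
  "matrix_power M n = ((**) M ^^ n) (mat 1)"

definition matrix_exp :: "real^3^3 \<Rightarrow> real^3^3" where
  "matrix_exp M = (\<Sum>n. (1 / fact n) *\<^sub>R matrix_power M n)"

subsection \<open>Cocycles\<close>

primrec cocycle_iter_nat :: "real \<Rightarrow> (real \<Rightarrow> real^3^3) \<Rightarrow> nat \<Rightarrow> real \<Rightarrow> real^3^3" where
  "cocycle_iter_nat \<alpha> A 0 x = mat 1"
| "cocycle_iter_nat \<alpha> A (Suc n) x = A (x + real n * \<alpha>) ** cocycle_iter_nat \<alpha> A n x"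

text \<open>For \<open>n < 0\<close> the shift \<open>x + n * \<alpha>\<close> is \<open>x - \<bar>n\<bar> * \<alpha>\<close>.\<close>

definition cocycle_iter :: "real \<Rightarrow> (real \<Rightarrow> real^3^3) \<Rightarrow> int \<Rightarrow> real \<Rightarrow> real^3^3" where
  "cocycle_iter \<alpha> A n x =
     (if n \<ge> 0 then cocycle_iter_nat \<alpha> A (nat n) x
      else matrix_inv (cocycle_iter_nat \<alpha> A (nat (- n)) (x + real_of_int n * \<alpha>)))"

definition L2_norm_torus :: "(real \<Rightarrow> real^3^3) \<Rightarrow> real" where
  "L2_norm_torus f = sqrt (integral {0..1} (\<lambda>x. (norm (f x))\<^sup>2))"

definition degree_zero :: "real \<Rightarrow> (real \<Rightarrow> real^3^3) \<Rightarrow> bool" where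
  "degree_zero \<alpha> A \<longleftrightarrow>
     (\<lambda>n. L2_norm_torus (\<lambda>x. (1 / real n) *\<^sub>R
        (vector_derivative (cocycle_iter \<alpha> A (int n)) (at x)
           ** matrix_inv (cocycle_iter \<alpha> A (int n) x)))) \<longlonglongrightarrow> 0"

text \<open>Homotopies of maps from the torus are homotopies through \<open>1\<close>-periodic maps.\<close>

definition homotopic_torus_SO3 :: "(real \<Rightarrow> real^3^3) \<Rightarrow> (real \<Rightarrow> real^3^3) \<Rightarrow> bool" where
  "homotopic_torus_SO3 f g \<longleftrightarrow> homotopic_with_canon periodic1 UNIV SO3 f g"

text \<open>
  The translation number \<open>a\<close> matters only modulo \<open>1\<close>, as the conjugations are \<open>1\<close>-periodic.
\<close>

definition almost_reducible :: "real \<Rightarrow> (real \<Rightarrow> real^3^3) \<Rightarrow> bool" where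
  "almost_reducible a F \<longleftrightarrow>
     (\<exists>D C U. (\<forall>m. D m \<in> smooth_torus SO3) \<and> (\<forall>m. C m \<in> SO3) \<and>
        (\<forall>m. U m \<in> smooth_torus so3) \<and> smooth_tendsto_zero U \<and>
        (\<forall>m x. D m (x + a) ** F x ** matrix_inv (D m x) = C m ** matrix_exp (U m x)))"

subsection \<open>Arithmetic conditions\<close>

definition DC_tilde :: "real \<Rightarrow> real \<Rightarrow> real set" where
  "DC_tilde \<gamma> \<tau> = {\<alpha>. 0 \<le> \<alpha> \<and> \<alpha> < 1 \<and>
     (\<forall>k::int. k \<noteq> 0 \<longrightarrow>
        infdist (real_of_int k * \<alpha> - 1 / 2) \<int> \<ge> (1 / \<gamma>) * real_of_int \<bar>k\<bar> powr (- \<tau>))}"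

definition gauss_map :: "real \<Rightarrow> real" where
  "gauss_map \<alpha> = frac (1 / \<alpha>)"

definition gauss_iter :: "real \<Rightarrow> nat \<Rightarrow> real" where
  "gauss_iter \<alpha> n = (gauss_map ^^ n) \<alpha>"

definition RDC_tilde_const :: "real \<Rightarrow> real \<Rightarrow> real set" where
  "RDC_tilde_const \<gamma> \<tau> = {\<alpha>. 0 < \<alpha> \<and> \<alpha> < 1 \<and> \<alpha> \<notin> \<rat> \<and>
     infinite {n. gauss_iter \<alpha> n \<in> DC_tilde \<gamma> \<tau>}}"

definition RDC_tilde :: "real set" where
  "RDC_tilde = (\<Union>\<gamma>\<in>{0<..}. \<Union>\<tau>\<in>{0<..}. RDC_tilde_const \<gamma> \<tau>)"

subsection \<open>Renormalization\<close>

text \<open>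
  The convergents \<open>p\<^sub>n / q\<^sub>n\<close> start at \<open>n = -1\<close>, so the functions below have their index shifted
  by one: \<open>conv_num \<alpha> k\<close>, \<open>conv_den \<alpha> k\<close> and \<open>conv_beta \<alpha> k\<close> stand for \<open>p\<^sub>n\<close>, \<open>q\<^sub>n\<close> and
  \<open>\<beta>\<^sub>n = (-1)\<^sup>n (q\<^sub>n \<alpha> - p\<^sub>n)\<close> with \<open>n = k - 1\<close>. The partial quotient multiplying
  \<open>p\<^sub>n\<close> and \<open>q\<^sub>n\<close> in the recursion for \<open>p\<close> and \<open>q\<close> at \<open>n + 1\<close> is the integer part of
  the inverse of the \<open>n\<close>-th iterate of \<open>\<alpha>\<close> under the Gauss map.
\<close>

fun conv_num :: "real \<Rightarrow> nat \<Rightarrow> int" where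
  "conv_num \<alpha> 0 = 1"
| "conv_num \<alpha> (Suc 0) = 0"
| "conv_num \<alpha> (Suc (Suc n)) =
     \<lfloor>1 / gauss_iter \<alpha> n\<rfloor> * conv_num \<alpha> (Suc n) + conv_num \<alpha> n"

fun conv_den :: "real \<Rightarrow> nat \<Rightarrow> int" where
  "conv_den \<alpha> 0 = 0"
| "conv_den \<alpha> (Suc 0) = 1"
| "conv_den \<alpha> (Suc (Suc n)) =
     \<lfloor>1 / gauss_iter \<alpha> n\<rfloor> * conv_den \<alpha> (Suc n) + conv_den \<alpha> n"

definition conv_beta :: "real \<Rightarrow> nat \<Rightarrow> real" where
  "conv_beta \<alpha> k =
     (- 1) ^ (k + 1) * (real_of_int (conv_den \<alpha> k) * \<alpha> - real_of_int (conv_num \<alpha> k))"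

text \<open>
  With the shift, \<open>conv_beta \<alpha> n\<close> is \<open>\<beta>\<close> at \<open>n - 1\<close> and \<open>(-1)\<^sup>n\<^sup>-\<^sup>1\<close> is written with
  exponent \<open>n + 1\<close>. The two functions are the fibre maps over the translations by \<open>1\<close> and by
  \<open>gauss_iter \<alpha> n\<close> of the \<open>n\<close>-th renormalized action.
\<close>

definition renorm_C :: "real \<Rightarrow> (real \<Rightarrow> real^3^3) \<Rightarrow> nat \<Rightarrow> real \<Rightarrow> real^3^3" where
  "renorm_C \<alpha> A n x = cocycle_iter \<alpha> A ((- 1) ^ (n + 1) * conv_den \<alpha> n) (conv_beta \<alpha> n * x)"

definition renorm_A :: "real \<Rightarrow> (real \<Rightarrow> real^3^3) \<Rightarrow> nat \<Rightarrow> real \<Rightarrow> real^3^3" where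
  "renorm_A \<alpha> A n x = cocycle_iter \<alpha> A ((- 1) ^ n * conv_den \<alpha> (Suc n)) (conv_beta \<alpha> n * x)"

definition normalizing_conjugation ::
    "real \<Rightarrow> (real \<Rightarrow> real^3^3) \<Rightarrow> nat \<Rightarrow> (real \<Rightarrow> real^3^3) \<Rightarrow> bool" where
  "normalizing_conjugation \<alpha> A n B \<longleftrightarrow>
     B \<in> smooth_line SO3 \<and> (\<forall>x. B (x + 1) ** renorm_C \<alpha> A n x ** matrix_inv (B x) = mat 1)"

text \<open>\<open>(gauss_iter \<alpha> n, N)\<close> is a representative of \<open>(\<alpha>, A)\<close> at step \<open>n\<close>.\<close>

definition renorm_representative ::
    "real \<Rightarrow> (real \<Rightarrow> real^3^3) \<Rightarrow> nat \<Rightarrow> (real \<Rightarrow> real^3^3) \<Rightarrow> bool" where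
  "renorm_representative \<alpha> A n N \<longleftrightarrow>
     (\<exists>B. normalizing_conjugation \<alpha> A n B \<and>
        N = (\<lambda>x. B (x + gauss_iter \<alpha> n) ** renorm_A \<alpha> A n x ** matrix_inv (B x)))"

end

theory Submission
  imports Defs "HOL-Real_Asymp.Real_Asymp"
begin

text \<open>
  Lift \<open>A\<close> to unit quaternions. As \<open>A\<close> is not homotopic to the identity, the lift changes sign over
  a period, so the lifts of the two generators of each renormalized action anticommute. Degree zero
  makes these lifts almost constant at late steps, hence close to two anticommuting unit quaternions,
  and such a pair is conjugate to \<open>(i, j)\<close>. A gauge conjugates the first generator to \<open>i\<close> exactly
  and the second one close to \<open>j\<close>; the latter is then periodic up to conjugation by \<open>i\<close>, so that its
  derivative of top order controls the error. Passing to a later step shrinks that derivative by a high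
  power of the ratio of the scales, at the expense of a fixed negative power coming from the
  normalization. When the ratio is too small for this to be a gain, a single step of small ratio has
  been taken, and there an adiabatic iteration removes the error to any order in the ratio. Therefore
  the errors along a subsequence of steps decay faster than any power of the scale, and gauges pulled
  back from these steps give arbitrarily small errors at every given step. Finally, the square of a
  cocycle close to \<open>j\<close> is close to \<open>-1\<close>, which is the identity rotation; the factor
  \<open>exp (- pi i y / 2)\<close> makes the conjugations \<open>1\<close>-periodic, and the logarithm is explicit.
\<close>

section \<open>Quaternions\<close>

text \<open>All pairs of anticommuting unit quaternions are conjugate, so the model pair (i, j) is
  the same at every step and has no parameter to adjust. Once the first generator is exactly i,
  anticommutation reads F (x + \<open>b n\<close>) = i F x i for the second one: F has period 2
  \<open>b n\<close>, and its components along 1 and i change sign over \<open>b n\<close>. The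
  obstacle is the cost of passing from step n to a later step m: words of length about
  \<open>b n / b m\<close> multiply errors by that ratio, and straightening the new first generator
  costs its square, in all a cube. If the error is not below the inverse cube, the scale has dropped
  so fast that the last single step has small ratio. There a shift by \<open>b (Suc n)\<close> is
  nearly the identity at scale \<open>b n\<close>, and difference equations are nearly differential
  ones: components along i and k are removed by aligning axes pointwise, the one along 1 by an
  antiperiodic primitive. Going back from m to n also costs a power of \<open>b n / b m\<close>;
  therefore decay of the errors like a high power of \<open>b m\<close> is needed, not merely
  convergence to 0.\<close>

datatype quat = Quat (qRe: real) (qIm1: real) (qIm2: real) (qIm3: real)

lemma quat_eq_iff:
  "p = q \<longleftrightarrow> qRe p = qRe q \<and> qIm1 p = qIm1 q \<and> qIm2 p = qIm2 q \<and> qIm3 p = qIm3 q"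
  by (cases p; cases q) auto

instantiation quat :: real_vector
begin

definition "0 = Quat 0 0 0 0"
definition "p + q = Quat (qRe p + qRe q) (qIm1 p + qIm1 q) (qIm2 p + qIm2 q) (qIm3 p + qIm3 q)"
definition "p - q = Quat (qRe p - qRe q) (qIm1 p - qIm1 q) (qIm2 p - qIm2 q) (qIm3 p - qIm3 q)"
definition "- q = Quat (- qRe q) (- qIm1 q) (- qIm2 q) (- qIm3 q)"
definition "r *\<^sub>R q = Quat (r * qRe q) (r * qIm1 q) (r * qIm2 q) (r * qIm3 q)"

instance
  by standard
    (simp_all add: quat_eq_iff zero_quat_def plus_quat_def minus_quat_def uminus_quat_def
      scaleR_quat_def algebra_simps)

end

lemma quat_sel_linear [simp]:
  "qRe 0 = 0" "qIm1 0 = 0" "qIm2 0 = 0" "qIm3 0 = 0"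
  "qRe (p + q) = qRe p + qRe q" "qIm1 (p + q) = qIm1 p + qIm1 q"
  "qIm2 (p + q) = qIm2 p + qIm2 q" "qIm3 (p + q) = qIm3 p + qIm3 q"
  "qRe (p - q) = qRe p - qRe q" "qIm1 (p - q) = qIm1 p - qIm1 q"
  "qIm2 (p - q) = qIm2 p - qIm2 q" "qIm3 (p - q) = qIm3 p - qIm3 q"
  "qRe (- q) = - qRe q" "qIm1 (- q) = - qIm1 q" "qIm2 (- q) = - qIm2 q" "qIm3 (- q) = - qIm3 q"
  "qRe (r *\<^sub>R q) = r * qRe q" "qIm1 (r *\<^sub>R q) = r * qIm1 q"
  "qIm2 (r *\<^sub>R q) = r * qIm2 q" "qIm3 (r *\<^sub>R q) = r * qIm3 q"
  by (simp_all add: zero_quat_def plus_quat_def minus_quat_def uminus_quat_def scaleR_quat_def)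

instantiation quat :: real_inner
begin

definition "inner p q = qRe p * qRe q + qIm1 p * qIm1 q + qIm2 p * qIm2 q + qIm3 p * qIm3 q"
definition "norm q = sqrt (inner q q)" for q :: quat
definition "dist p q = norm (p - q)" for p q :: quat
definition "sgn q = q /\<^sub>R norm q" for q :: quat
definition "uniformity = (INF e\<in>{0<..}. principal {(p, q :: quat). dist p q < e})"
definition "open (U :: quat set) \<longleftrightarrow> (\<forall>p\<in>U. eventually (\<lambda>(p', q). p' = p \<longrightarrow> q \<in> U) uniformity)"

instance
proof
  fix p q r :: quat and c :: real
  show "inner p q = inner q p" by (simp add: inner_quat_def mult.commute)
  show "inner (p + q) r = inner p r + inner q r" by (simp add: inner_quat_def algebra_simps)
  show "inner (c *\<^sub>R p) q = c * inner p q" by (simp add: inner_quat_def algebra_simps)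
  show "0 \<le> inner p p" by (simp add: inner_quat_def)
  show "inner p p = 0 \<longleftrightarrow> p = 0"
    by (simp add: inner_quat_def quat_eq_iff add_nonneg_eq_0_iff)
qed (simp_all add: norm_quat_def dist_quat_def sgn_quat_def uniformity_quat_def open_quat_def)

end

instantiation quat :: real_normed_div_algebra
begin

definition "1 = Quat 1 0 0 0"
definition "p * q = Quat
  (qRe p * qRe q - qIm1 p * qIm1 q - qIm2 p * qIm2 q - qIm3 p * qIm3 q)
  (qRe p * qIm1 q + qIm1 p * qRe q + qIm2 p * qIm3 q - qIm3 p * qIm2 q)
  (qRe p * qIm2 q - qIm1 p * qIm3 q + qIm2 p * qRe q + qIm3 p * qIm1 q)
  (qRe p * qIm3 q + qIm1 p * qIm2 q - qIm2 p * qIm1 q + qIm3 p * qRe q)"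
definition "inverse q = (1 / inner q q) *\<^sub>R Quat (qRe q) (- qIm1 q) (- qIm2 q) (- qIm3 q)"
definition "p div q = p * inverse q" for p q :: quat

instance
proof
  fix p q r :: quat and c :: real
  show "p * q * r = p * (q * r)" "(p + q) * r = p * r + q * r" "p * (q + r) = p * q + p * r"
    "(c *\<^sub>R p) * q = c *\<^sub>R (p * q)" "p * (c *\<^sub>R q) = c *\<^sub>R (p * q)"
    by (simp_all add: quat_eq_iff times_quat_def algebra_simps)
  show "1 * p = p" "p * 1 = p" "(0 :: quat) \<noteq> 1" "p div q = p * inverse q" "inverse 0 = (0 :: quat)"
    by (simp_all add: quat_eq_iff times_quat_def one_quat_def divide_quat_def inverse_quat_def)
  show "inverse p * p = 1" "p * inverse p = 1" if "p \<noteq> 0"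
  proof -
    have "inner p p \<noteq> 0" using that by simp
    then show "inverse p * p = 1" "p * inverse p = 1"
      by (simp_all add: quat_eq_iff times_quat_def one_quat_def inverse_quat_def field_simps,
          simp_all add: inner_quat_def algebra_simps)
  qed
  \<comment> \<open>Euler's four-square identity.\<close>
  have "inner (p * q) (p * q) = inner p p * inner q q"
    by (simp add: inner_quat_def times_quat_def) algebra
  then show "norm (p * q) = norm p * norm q"
    by (simp add: norm_quat_def real_sqrt_mult)
qed

end

lemma quat_sel_ring [simp]:
  "qRe 1 = 1" "qIm1 1 = 0" "qIm2 1 = 0" "qIm3 1 = 0"
  "qRe (p * q) = qRe p * qRe q - qIm1 p * qIm1 q - qIm2 p * qIm2 q - qIm3 p * qIm3 q"
  "qIm1 (p * q) = qRe p * qIm1 q + qIm1 p * qRe q + qIm2 p * qIm3 q - qIm3 p * qIm2 q"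
  "qIm2 (p * q) = qRe p * qIm2 q - qIm1 p * qIm3 q + qIm2 p * qRe q + qIm3 p * qIm1 q"
  "qIm3 (p * q) = qRe p * qIm3 q + qIm1 p * qIm2 q - qIm2 p * qIm1 q + qIm3 p * qRe q"
  by (simp_all add: one_quat_def times_quat_def)

definition qi :: quat where "qi = Quat 0 1 0 0"
definition qj :: quat where "qj = Quat 0 0 1 0"
definition qk :: quat where "qk = Quat 0 0 0 1"
definition qcnj :: "quat \<Rightarrow> quat" where "qcnj q = Quat (qRe q) (- qIm1 q) (- qIm2 q) (- qIm3 q)"

lemma quat_sel_units [simp]:
  "qRe qi = 0" "qIm1 qi = 1" "qIm2 qi = 0" "qIm3 qi = 0"
  "qRe qj = 0" "qIm1 qj = 0" "qIm2 qj = 1" "qIm3 qj = 0"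
  "qRe qk = 0" "qIm1 qk = 0" "qIm2 qk = 0" "qIm3 qk = 1"
  "qRe (qcnj q) = qRe q" "qIm1 (qcnj q) = - qIm1 q" "qIm2 (qcnj q) = - qIm2 q" "qIm3 (qcnj q) = - qIm3 q"
  by (simp_all add: qi_def qj_def qk_def qcnj_def)

lemma quat_sel_of_real [simp]:
  "qRe (of_real r) = r" "qIm1 (of_real r) = 0" "qIm2 (of_real r) = 0" "qIm3 (of_real r) = 0"
  by (simp_all add: of_real_def)

lemma quat_sel_numeral [simp]:
  "qRe (numeral n) = numeral n" "qIm1 (numeral n) = 0" "qIm2 (numeral n) = 0" "qIm3 (numeral n) = 0"
  by (metis of_real_numeral quat_sel_of_real)+

instantiation quat :: euclidean_space
begin

definition "Basis = {1, qi, qj, qk}"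

instance
proof
  fix p q :: quat
  show "inner p q = (if p = q then 1 else 0)" if "p \<in> Basis" "q \<in> Basis"
    using that by (auto simp: Basis_quat_def inner_quat_def quat_eq_iff)
  show "(\<forall>q\<in>Basis. inner p q = 0) \<longleftrightarrow> p = 0"
    by (simp add: Basis_quat_def inner_quat_def) (simp add: quat_eq_iff)
qed (auto simp: Basis_quat_def)

end

lemma DIM_quat: "DIM(quat) = 4"
  by (simp add: Basis_quat_def quat_eq_iff)

lemma norm_quat_sq: "(norm q)\<^sup>2 = (qRe q)\<^sup>2 + (qIm1 q)\<^sup>2 + (qIm2 q)\<^sup>2 + (qIm3 q)\<^sup>2"
  by (simp add: power2_norm_eq_inner) (simp add: inner_quat_def power2_eq_square)

lemma norm_units [simp]: "norm qi = 1" "norm qj = 1" "norm qk = 1" "norm (qcnj q) = norm q"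
  by (simp_all add: norm_quat_def inner_quat_def)

lemma qi_nonzero [simp]: "qi \<noteq> 0" "qj \<noteq> 0" "qk \<noteq> 0"
  by (simp_all add: quat_eq_iff)

lemma units_mult:
  "qi * qi = -1" "qj * qj = -1" "qk * qk = -1"
  "qi * qj = qk" "qj * qk = qi" "qk * qi = qj" "qj * qi = - qk" "qk * qj = - qi" "qi * qk = - qj"
  by (simp_all add: quat_eq_iff)

lemma abs_sel_le_norm:
  "\<bar>qRe q\<bar> \<le> norm q" "\<bar>qIm1 q\<bar> \<le> norm q" "\<bar>qIm2 q\<bar> \<le> norm q" "\<bar>qIm3 q\<bar> \<le> norm q"
  by (rule power2_le_imp_le; simp add: norm_quat_sq)+

lemma norm_le_sum_sel: "norm q \<le> \<bar>qRe q\<bar> + \<bar>qIm1 q\<bar> + \<bar>qIm2 q\<bar> + \<bar>qIm3 q\<bar>"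
proof -
  have "norm q = norm (qRe q *\<^sub>R 1 + qIm1 q *\<^sub>R qi + qIm2 q *\<^sub>R qj + qIm3 q *\<^sub>R qk)"
    by (rule arg_cong[where f = norm]) (simp add: quat_eq_iff)
  also have "\<dots> \<le> norm (qRe q *\<^sub>R (1::quat)) + norm (qIm1 q *\<^sub>R qi) + norm (qIm2 q *\<^sub>R qj) + norm (qIm3 q *\<^sub>R qk)"
    by (intro norm_triangle_mono order_refl)
  finally show ?thesis by simp
qed

lemma bounded_linear_sel:
  "bounded_linear qRe" "bounded_linear qIm1" "bounded_linear qIm2" "bounded_linear qIm3"
  by (rule bounded_linear_intro[where K = 1]; simp add: abs_sel_le_norm)+

lemma bounded_linear_qcnj: "bounded_linear qcnj"
  by (rule bounded_linear_intro[where K = 1]) (simp_all add: quat_eq_iff)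

lemma qcnj_simps [simp]: "qcnj (qcnj q) = q" "qcnj 1 = 1" "qcnj 0 = 0" "qcnj (- q) = - qcnj q"
  "qcnj qi = - qi" "qcnj qj = - qj" "qcnj qk = - qk" "qcnj (p + q) = qcnj p + qcnj q"
  "qcnj (p - q) = qcnj p - qcnj q" "qcnj (r *\<^sub>R q) = r *\<^sub>R qcnj q"
  by (simp_all add: quat_eq_iff)

lemma inverse_eq_qcnj: "inverse q = (1 / (norm q)\<^sup>2) *\<^sub>R qcnj q"
  by (simp add: inverse_quat_def qcnj_def power2_norm_eq_inner)

lemma inverse_unit: "norm q = 1 \<Longrightarrow> inverse q = qcnj q"
  by (simp add: inverse_eq_qcnj)

text \<open>Such a pair generates a copy of the quaternion group, whose image under
  \<open>rot\<close> is a Klein four-group of half-turns. It is the shape of the limits of the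
  lifted generators.\<close>

definition anticommuting_units :: "quat \<Rightarrow> quat \<Rightarrow> bool" where
  "anticommuting_units u v \<longleftrightarrow> u * u = -1 \<and> v * v = -1 \<and> u * v = - (v * u)"

lemma norm_square_minus_one: "norm u = 1" if "u * u = -1" for u :: quat
proof -
  have "norm u * norm u = 1" by (metis norm_minus_cancel norm_mult norm_one that)
  then show ?thesis
    by (metis norm_ge_zero abs_of_nonneg real_sqrt_abs2 real_sqrt_one)
qed

lemma anticommuting_units_norm: "anticommuting_units u v \<Longrightarrow> norm u = 1 \<and> norm v = 1"
  by (simp add: anticommuting_units_def norm_square_minus_one)

lemma anticommuting_units_ij: "anticommuting_units qi qj"
  by (simp add: anticommuting_units_def units_mult)

lemma inverse_square_minus_one: "inverse u = - u" if "u * u = -1" for u :: quat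
  by (metis minus_mult_right minus_minus that inverse_unique)

lemma anticommuting_units_mult:
  assumes "anticommuting_units u v"
  shows "anticommuting_units v (u * v)" "anticommuting_units u (u * v)"
proof -
  have *: "u * u = -1" "v * v = -1" "v * u = - (u * v)"
    using assms by (auto simp: anticommuting_units_def)
  have 1: "u * v * (u * v) = -1"
    by (metis (no_types, lifting) "*" minus_mult_right mult.assoc mult_1_left mult_minus1 mult_minus_left minus_minus)
  have uvv: "u * v * v = - u"
    by (simp add: mult.assoc *(2))
  have uuv: "u * (u * v) = - v"
    by (simp add: *(1) flip: mult.assoc)
  have vuv: "v * (u * v) = u"
    using uvv by (simp add: *(3) flip: mult.assoc)
  have uvu: "u * v * u = v"
    using uuv by (simp add: *(3) mult.assoc)
  show "anticommuting_units v (u * v)" "anticommuting_units u (u * v)"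
    using 1 uvv uuv vuv uvu * by (simp_all add: anticommuting_units_def)
qed

lemma qRe_square_minus_one: "qRe u = 0" if "u * u = -1"
proof (rule ccontr)
  assume "qRe u \<noteq> 0"
  moreover have "qRe (u * u) = -1" "qIm1 (u * u) = 0" "qIm2 (u * u) = 0" "qIm3 (u * u) = 0"
    unfolding that by simp_all
  ultimately have "qIm1 u = 0" "qIm2 u = 0" "qIm3 u = 0" "qRe u * qRe u = -1"
    by auto
  then show False by (metis not_one_le_zero zero_le_square neg_0_le_iff_le)
qed

text \<open>Averaging over the quaternion group produces an element intertwining two of its
  representations by unit quaternions.\<close>

lemma anticommuting_units_conjugate:
  assumes uv: "anticommuting_units u v" and xy: "anticommuting_units x y"
  obtains q where "q \<noteq> 0" "q * u = x * q" "q * v = y * q"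
proof -
  define f where "f p = p - x * p * u - y * p * v - (x * y) * p * (u * v)" for p
  have u: "u * u = -1" and v: "v * v = -1" and vu: "v * u = - (u * v)"
    and x: "x * x = -1" and y: "y * y = -1" and yx: "y * x = - (x * y)"
    using assms by (auto simp: anticommuting_units_def)
  have uvu: "u * v * u = v" "u * v * v = - u"
    by (simp_all add: mult.assoc vu v) (simp add: u flip: mult.assoc)
  have xxy: "x * (x * y) = - y" "y * (x * y) = x"
    by (simp_all add: yx x flip: mult.assoc) (simp add: y mult.assoc)
  have "f p * u = x * f p" "f p * v = y * f p" for p
  proof -
    have "f p * u = p * u - x * p * (u * u) - y * p * (v * u) - (x * y) * p * (u * v * u)"
      by (simp add: f_def left_diff_distrib mult.assoc)
    also have "\<dots> = x * p - x * x * p * u - x * (y * p * v) - x * (x * y) * p * (u * v)"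
      by (simp add: u vu uvu x xxy) (simp add: mult.assoc)
    also have "\<dots> = x * f p" by (simp add: f_def right_diff_distrib mult.assoc)
    finally show "f p * u = x * f p" .
    have "f p * v = p * v - x * p * (u * v) - y * p * (v * v) - (x * y) * p * (u * v * v)"
      by (simp add: f_def left_diff_distrib mult.assoc)
    also have "\<dots> = y * p - y * x * p * u - y * y * p * v - y * (x * y) * p * (u * v)"
      by (simp add: v uvu y xxy yx) 
    also have "\<dots> = y * f p" by (simp add: f_def right_diff_distrib mult.assoc)
    finally show "f p * v = y * f p" .
  qed
  moreover have "\<exists>p. f p \<noteq> 0"
  proof (rule ccontr)
    assume "\<nexists>p. f p \<noteq> 0"
    then have *: "f 1 = 0" "f qi = 0" "f qj = 0" "f qk = 0" by auto
    \<comment> \<open>\<open>S z\<close> is four times the real part of z. The combination of the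
      values of f at the four units equals \<open>S 1\<close> minus multiples of \<open>S x\<close>,
      \<open>S y\<close> and \<open>S (x * y)\<close>, and these three vanish because x, y and their
      product are purely imaginary. So f cannot vanish at all four units.\<close>
    define S where "S z = z - qi * z * qi - qj * z * qj - qk * z * qk" for z
    have S: "S z = of_real (4 * qRe z)" for z
      by (simp add: S_def quat_eq_iff)
    have "f 1 - qi * f qi - qj * f qj - qk * f qk = S 1 - S x * u - S y * v - S (x * y) * (u * v)"
      by (simp add: f_def S_def left_diff_distrib right_diff_distrib mult.assoc)
    moreover have "qRe x = 0" "qRe y = 0" "qRe (x * y) = 0"
      using anticommuting_units_mult(1)[OF xy] x y
      by (simp_all add: qRe_square_minus_one anticommuting_units_def del: quat_sel_ring)
    ultimately show False using * by (simp add: S quat_sel_ring(1) del: quat_sel_ring(2-))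
  qed
  ultimately show thesis using that by blast
qed

section \<open>Smooth functions of a real variable\<close>

abbreviation vd :: "(real \<Rightarrow> 'a::real_normed_vector) \<Rightarrow> real \<Rightarrow> 'a" where
  "vd f \<equiv> \<lambda>x. vector_derivative f (at x)"

text \<open>Derivatives are peeled off from the inside, so that closure properties follow by
  induction on the order with the function generalized; \<open>smooth\<close>, which quantifies over
  all orders at once, admits no such induction.\<close>

primrec smooth_upto :: "nat \<Rightarrow> real set \<Rightarrow> (real \<Rightarrow> 'a::real_normed_vector) \<Rightarrow> bool" where
  "smooth_upto 0 S f \<longleftrightarrow> True"
| "smooth_upto (Suc n) S f \<longleftrightarrow> (\<forall>x\<in>S. f differentiable at x) \<and> smooth_upto n S (vd f)"

definition smooth_on :: "real set \<Rightarrow> (real \<Rightarrow> 'a::real_normed_vector) \<Rightarrow> bool" where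
  "smooth_on S f \<longleftrightarrow> (\<forall>n. smooth_upto n S f)"

lemma nth_derivative_0 [simp]: "nth_derivative 0 f = f"
  by (simp add: nth_derivative_def)

lemma nth_derivative_Suc: "nth_derivative (Suc k) f = nth_derivative k (vd f)"
  unfolding nth_derivative_def funpow_Suc_right by simp

lemma nth_derivative_Suc': "nth_derivative (Suc k) f = vd (nth_derivative k f)"
  by (simp add: nth_derivative_def)

lemma smooth_upto_iff:
  "smooth_upto n S f \<longleftrightarrow> (\<forall>k<n. \<forall>x\<in>S. nth_derivative k f differentiable at x)"
proof (induction n arbitrary: f)
  case (Suc n)
  show ?case
    unfolding smooth_upto.simps Suc
    by (auto simp: less_Suc_eq_0_disj nth_derivative_Suc)
qed simp

lemma smooth_on_iff: "smooth_on S f \<longleftrightarrow> (\<forall>k. \<forall>x\<in>S. nth_derivative k f differentiable at x)"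
  unfolding smooth_on_def smooth_upto_iff by blast

lemma smooth_iff_smooth_on: "smooth f \<longleftrightarrow> smooth_on UNIV f"
  by (simp add: smooth_def smooth_on_iff)

lemma smooth_upto_le: "smooth_upto n S f \<Longrightarrow> m \<le> n \<Longrightarrow> smooth_upto m S f"
  by (simp add: smooth_upto_iff)

lemma smooth_onD: "smooth_on S f \<Longrightarrow> smooth_upto n S f"
  by (simp add: smooth_on_def)

lemma smooth_onI: "(\<And>n. smooth_upto n S f) \<Longrightarrow> smooth_on S f"
  by (simp add: smooth_on_def)

lemma smooth_on_Suc: "smooth_on S f \<longleftrightarrow> (\<forall>x\<in>S. f differentiable at x) \<and> smooth_on S (vd f)"
proof
  assume L: "smooth_on S f"
  then have "smooth_upto (Suc n) S f" for n
    by (rule smooth_onD)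
  then show "(\<forall>x\<in>S. f differentiable at x) \<and> smooth_on S (vd f)"
    by (simp add: smooth_on_def)
next
  assume R: "(\<forall>x\<in>S. f differentiable at x) \<and> smooth_on S (vd f)"
  have "smooth_upto n S f" for n
    using R by (cases n) (simp_all add: smooth_on_def)
  then show "smooth_on S f"
    by (simp add: smooth_on_def)
qed

lemma smooth_on_differentiable: "smooth_on S f \<Longrightarrow> x \<in> S \<Longrightarrow> f differentiable at x"
  using smooth_on_Suc by blast

lemma smooth_on_has_vd: "smooth_on S f \<Longrightarrow> x \<in> S \<Longrightarrow> (f has_vector_derivative vd f x) (at x)"
  using smooth_on_differentiable vector_derivative_works by blast

lemma smooth_on_vd: "smooth_on S f \<Longrightarrow> smooth_on S (vd f)"
  using smooth_on_Suc by blast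

lemma smooth_on_nth_derivative: "smooth_on S f \<Longrightarrow> smooth_on S (nth_derivative k f)"
  by (induction k) (simp_all add: nth_derivative_Suc' smooth_on_vd)

lemma smooth_on_continuous_on: "smooth_on S f \<Longrightarrow> continuous_on S f"
  by (simp add: continuous_at_imp_continuous_on differentiable_imp_continuous_within smooth_on_differentiable)

lemma smooth_on_subset: "smooth_on S f \<Longrightarrow> T \<subseteq> S \<Longrightarrow> smooth_on T f"
  by (auto simp: smooth_on_iff)

lemma smooth_on_Union: "(\<And>x. x \<in> S \<Longrightarrow> \<exists>T. x \<in> T \<and> smooth_on T f) \<Longrightarrow> smooth_on S f"
  unfolding smooth_on_iff by blast

lemma vd_eqI: "(f has_vector_derivative f') (at x) \<Longrightarrow> vd f x = f'"
  by (rule vector_derivative_at)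

lemma has_vector_derivative_cong_open:
  assumes "open S" "x \<in> S" "\<And>y. y \<in> S \<Longrightarrow> f y = g y"
  shows "(f has_vector_derivative d) (at x) \<longleftrightarrow> (g has_vector_derivative d) (at x)"
proof
  show "(g has_vector_derivative d) (at x)" if "(f has_vector_derivative d) (at x)"
    by (rule has_vector_derivative_transform_within_open[OF that assms])
  show "(f has_vector_derivative d) (at x)" if "(g has_vector_derivative d) (at x)"
    by (rule has_vector_derivative_transform_within_open[OF that assms(1,2)]) (simp add: assms(3))
qed

lemma vd_cong_open:
  assumes "open S" "x \<in> S" "\<And>y. y \<in> S \<Longrightarrow> f y = g y"
  shows "vd f x = vd g x"
  unfolding vector_derivative_def using has_vector_derivative_cong_open[OF assms] by presburger

lemma smooth_upto_cong:
  assumes "open S" "\<And>y. y \<in> S \<Longrightarrow> f y = g y" "smooth_upto n S f"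
  shows "smooth_upto n S g"
  using assms(2,3)
proof (induction n arbitrary: f g)
  case (Suc n)
  have "g differentiable at x" if "x \<in> S" for x
  proof -
    have "(f has_vector_derivative vd f x) (at x)"
      using Suc.prems(2) that by (simp add: vector_derivative_works)
    then show ?thesis
      using has_vector_derivative_cong_open[OF assms(1) that Suc.prems(1)] 
      by (meson differentiableI_vector)
  qed
  moreover have "smooth_upto n S (vd g)"
    using Suc.IH[of "vd f" "vd g"] vd_cong_open[OF assms(1) _ Suc.prems(1)] Suc.prems(2) by auto
  ultimately show ?case by simp
qed simp

lemma smooth_on_cong:
  assumes "open S" "\<And>y. y \<in> S \<Longrightarrow> f y = g y" "smooth_on S f"
  shows "smooth_on S g"
  using assms smooth_upto_cong unfolding smooth_on_def by blast

text \<open>The step of nearly every closure proof below: on an open set any formula for the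
  derivative may replace the one selected by \<open>vector_derivative\<close>.\<close>

lemma smooth_upto_SucI:
  assumes "open S" "\<And>x. x \<in> S \<Longrightarrow> (f has_vector_derivative f' x) (at x)" "smooth_upto n S f'"
  shows "smooth_upto (Suc n) S f"
proof -
  have "smooth_upto n S (vd f)"
    using vd_eqI[OF assms(2)] by (intro smooth_upto_cong[OF assms(1) _ assms(3)]) simp
  moreover have "f differentiable at x" if "x \<in> S" for x
    using assms(2)[OF that] by (rule differentiableI_vector)
  ultimately show ?thesis by simp
qed

lemma smooth_upto_has_vd:
  "smooth_upto (Suc n) S f \<Longrightarrow> x \<in> S \<Longrightarrow> (f has_vector_derivative vd f x) (at x)"
  by (simp add: vector_derivative_works)

lemma smooth_upto_const: "open S \<Longrightarrow> smooth_upto n S (\<lambda>_. c)"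
proof (induction n arbitrary: c)
  case (Suc n)
  show ?case
    by (rule smooth_upto_SucI[where f' = "\<lambda>_. 0"]) (use Suc in auto)
qed simp

lemma smooth_upto_id: "open S \<Longrightarrow> smooth_upto n S (\<lambda>x. x)"
proof (cases n)
  case (Suc m)
  assume "open S"
  then show ?thesis
    unfolding Suc by (rule smooth_upto_SucI[where f' = "\<lambda>_. 1"]) (simp_all add: smooth_upto_const \<open>open S\<close>)
qed simp

lemma smooth_upto_add:
  assumes S: "open S"
  shows "smooth_upto n S f \<Longrightarrow> smooth_upto n S g \<Longrightarrow> smooth_upto n S (\<lambda>x. f x + g x)"
proof (induction n arbitrary: f g)
  case (Suc n)
  show ?case
  proof (rule smooth_upto_SucI[OF S])
    show "((\<lambda>x. f x + g x) has_vector_derivative vd f x + vd g x) (at x)" if "x \<in> S" for x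
      by (intro has_vector_derivative_add smooth_upto_has_vd[OF Suc.prems(1) that]
          smooth_upto_has_vd[OF Suc.prems(2) that])
    show "smooth_upto n S (\<lambda>x. vd f x + vd g x)"
      using Suc by simp
  qed
qed simp

lemma smooth_upto_bilinear:
  assumes "bounded_bilinear pr" and S: "open S"
  shows "smooth_upto n S f \<Longrightarrow> smooth_upto n S g \<Longrightarrow> smooth_upto n S (\<lambda>x. pr (f x) (g x))"
proof (induction n arbitrary: f g)
  case (Suc n)
  interpret bounded_bilinear pr by fact
  have "smooth_upto n S f" "smooth_upto n S g"
    using Suc.prems by (meson le_SucI order_refl smooth_upto_le)+
  then have "smooth_upto n S (\<lambda>x. pr (f x) (vd g x) + pr (vd f x) (g x))"
    using Suc S by (intro smooth_upto_add) auto
  moreover have "((\<lambda>x. pr (f x) (g x)) has_vector_derivative pr (f x) (vd g x) + pr (vd f x) (g x)) (at x)"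
    if "x \<in> S" for x
    by (intro has_vector_derivative smooth_upto_has_vd[OF Suc.prems(1) that]
        smooth_upto_has_vd[OF Suc.prems(2) that])
  ultimately show ?case
    by (intro smooth_upto_SucI[OF S])
qed simp

lemma smooth_upto_linear:
  assumes "bounded_linear T" and S: "open S"
  shows "smooth_upto n S f \<Longrightarrow> smooth_upto n S (\<lambda>x. T (f x))"
proof (induction n arbitrary: f)
  case (Suc n)
  show ?case
  proof (rule smooth_upto_SucI[OF S])
    show "((\<lambda>x. T (f x)) has_vector_derivative T (vd f x)) (at x)" if "x \<in> S" for x
      by (intro bounded_linear.has_vector_derivative[OF assms(1)] smooth_upto_has_vd[OF Suc.prems that])
    show "smooth_upto n S (\<lambda>x. T (vd f x))"
      using Suc by simp
  qed
qed simp

lemma smooth_upto_compose: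
  fixes f :: "real \<Rightarrow> real"
  assumes S: "open S" and T: "open T" and fS: "\<And>x. x \<in> S \<Longrightarrow> f x \<in> T"
  shows "smooth_upto n T \<phi> \<Longrightarrow> smooth_upto n S f \<Longrightarrow> smooth_upto n S (\<lambda>x. \<phi> (f x))"
proof (induction n arbitrary: \<phi>)
  case (Suc n)
  have "smooth_upto n S f" "smooth_upto n T \<phi>"
    using Suc.prems by (meson le_SucI order_refl smooth_upto_le)+
  then have "smooth_upto n S (\<lambda>x. vd f x *\<^sub>R vd \<phi> (f x))"
    using Suc S by (intro smooth_upto_bilinear[OF bounded_bilinear_scaleR]) auto
  moreover have "((\<lambda>x. \<phi> (f x)) has_vector_derivative vd f x *\<^sub>R vd \<phi> (f x)) (at x)" if x: "x \<in> S" for x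
    using vector_diff_chain_at[OF smooth_upto_has_vd[OF Suc.prems(2) x]
        smooth_upto_has_vd[OF Suc.prems(1) fS[OF x]]] by (simp add: o_def)
  ultimately show ?case
    by (intro smooth_upto_SucI[OF S])
qed simp

lemma has_vector_derivative_inverse:
  fixes f :: "real \<Rightarrow> 'a::real_normed_div_algebra"
  assumes "(f has_vector_derivative f') (at x)" "f x \<noteq> 0"
  shows "((\<lambda>x. inverse (f x)) has_vector_derivative - (inverse (f x) * f' * inverse (f x))) (at x)"
  using Deriv.has_derivative_inverse[OF assms(2) assms(1)[unfolded has_vector_derivative_def]]
  unfolding has_vector_derivative_def by simp

text \<open>The derivative of the inverse contains the inverse again, but it is needed to one order
  less, where the induction hypothesis supplies it.\<close>

lemma smooth_upto_inverse:
  fixes f :: "real \<Rightarrow> 'a::real_normed_div_algebra"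
  assumes S: "open S" and f: "\<And>x. x \<in> S \<Longrightarrow> f x \<noteq> 0"
  shows "smooth_upto n S f \<Longrightarrow> smooth_upto n S (\<lambda>x. inverse (f x))"
proof (induction n)
  case (Suc n)
  then have n: "smooth_upto n S (\<lambda>x. inverse (f x))"
    by (meson le_SucI order_refl smooth_upto_le)
  have "smooth_upto n S (\<lambda>x. (-1) * (inverse (f x) * vd f x * inverse (f x)))"
    using Suc.prems n S
    by (intro smooth_upto_bilinear[OF bounded_bilinear_mult] smooth_upto_const) auto
  then show ?case
    by (intro smooth_upto_SucI[OF S, where f' = "\<lambda>x. - (inverse (f x) * vd f x * inverse (f x))"]
        has_vector_derivative_inverse smooth_upto_has_vd[OF Suc.prems] f) auto
qed simp

lemma smooth_on_const: "open S \<Longrightarrow> smooth_on S (\<lambda>_. c)"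
  by (simp add: smooth_onI smooth_upto_const)

lemma smooth_on_id: "open S \<Longrightarrow> smooth_on S (\<lambda>x. x)"
  by (simp add: smooth_onI smooth_upto_id)

lemma smooth_on_bilinear:
  "bounded_bilinear pr \<Longrightarrow> open S \<Longrightarrow> smooth_on S f \<Longrightarrow> smooth_on S g
    \<Longrightarrow> smooth_on S (\<lambda>x. pr (f x) (g x))"
  by (simp add: smooth_on_def smooth_upto_bilinear)

lemma smooth_on_linear:
  "bounded_linear T \<Longrightarrow> open S \<Longrightarrow> smooth_on S f \<Longrightarrow> smooth_on S (\<lambda>x. T (f x))"
  by (simp add: smooth_on_def smooth_upto_linear)

lemma smooth_on_add: "open S \<Longrightarrow> smooth_on S f \<Longrightarrow> smooth_on S g \<Longrightarrow> smooth_on S (\<lambda>x. f x + g x)"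
  by (simp add: smooth_on_def smooth_upto_add)

lemma smooth_on_minus: "open S \<Longrightarrow> smooth_on S f \<Longrightarrow> smooth_on S (\<lambda>x. - f x)"
  using smooth_on_linear[OF bounded_linear_minus[OF bounded_linear_ident]] .

lemma smooth_on_diff: "open S \<Longrightarrow> smooth_on S f \<Longrightarrow> smooth_on S g \<Longrightarrow> smooth_on S (\<lambda>x. f x - g x)"
  using smooth_on_add[of S f "\<lambda>x. - g x"] smooth_on_minus[of S g] by simp

lemma smooth_on_mult:
  fixes f g :: "real \<Rightarrow> 'a::real_normed_algebra"
  shows "open S \<Longrightarrow> smooth_on S f \<Longrightarrow> smooth_on S g \<Longrightarrow> smooth_on S (\<lambda>x. f x * g x)"
  by (rule smooth_on_bilinear[OF bounded_bilinear_mult])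

lemma smooth_on_scaleR:
  "open S \<Longrightarrow> smooth_on S f \<Longrightarrow> smooth_on S g \<Longrightarrow> smooth_on S (\<lambda>x. f x *\<^sub>R g x)"
  by (rule smooth_on_bilinear[OF bounded_bilinear_scaleR])

lemma smooth_on_inverse:
  fixes f :: "real \<Rightarrow> 'a::real_normed_div_algebra"
  shows "open S \<Longrightarrow> (\<And>x. x \<in> S \<Longrightarrow> f x \<noteq> 0) \<Longrightarrow> smooth_on S f \<Longrightarrow> smooth_on S (\<lambda>x. inverse (f x))"
  by (simp add: smooth_on_def smooth_upto_inverse)

lemma smooth_on_compose:
  fixes f :: "real \<Rightarrow> real"
  shows "open S \<Longrightarrow> open T \<Longrightarrow> (\<And>x. x \<in> S \<Longrightarrow> f x \<in> T) \<Longrightarrow> smooth_on T \<phi> \<Longrightarrow> smooth_on S f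
    \<Longrightarrow> smooth_on S (\<lambda>x. \<phi> (f x))"
  using smooth_upto_compose unfolding smooth_on_def by blast

lemma smooth_const [simp]: "smooth (\<lambda>_. c)"
  by (simp add: smooth_iff_smooth_on smooth_on_const)

lemma smooth_id [simp]: "smooth (\<lambda>x. x)"
  by (simp add: smooth_iff_smooth_on smooth_on_id)

lemma smooth_linear: "bounded_linear T \<Longrightarrow> smooth f \<Longrightarrow> smooth (\<lambda>x. T (f x))"
  by (simp add: smooth_iff_smooth_on smooth_on_linear)

lemma smooth_bilinear:
  "bounded_bilinear pr \<Longrightarrow> smooth f \<Longrightarrow> smooth g \<Longrightarrow> smooth (\<lambda>x. pr (f x) (g x))"
  by (simp add: smooth_iff_smooth_on smooth_on_bilinear)

lemma smooth_add: "smooth f \<Longrightarrow> smooth g \<Longrightarrow> smooth (\<lambda>x. f x + g x)"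
  by (simp add: smooth_iff_smooth_on smooth_on_add)

lemma smooth_minus: "smooth f \<Longrightarrow> smooth (\<lambda>x. - f x)"
  by (simp add: smooth_iff_smooth_on smooth_on_minus)

lemma smooth_diff: "smooth f \<Longrightarrow> smooth g \<Longrightarrow> smooth (\<lambda>x. f x - g x)"
  by (simp add: smooth_iff_smooth_on smooth_on_diff)

lemma smooth_mult:
  fixes f g :: "real \<Rightarrow> 'a::real_normed_algebra"
  shows "smooth f \<Longrightarrow> smooth g \<Longrightarrow> smooth (\<lambda>x. f x * g x)"
  by (simp add: smooth_iff_smooth_on smooth_on_mult)

lemma smooth_scaleR: "smooth f \<Longrightarrow> smooth g \<Longrightarrow> smooth (\<lambda>x. f x *\<^sub>R g x)"
  by (simp add: smooth_iff_smooth_on smooth_on_scaleR)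

lemma smooth_inverse:
  fixes f :: "real \<Rightarrow> 'a::real_normed_div_algebra"
  shows "smooth f \<Longrightarrow> (\<And>x. f x \<noteq> 0) \<Longrightarrow> smooth (\<lambda>x. inverse (f x))"
  by (simp add: smooth_iff_smooth_on smooth_on_inverse)

lemma smooth_compose:
  fixes f :: "real \<Rightarrow> real"
  assumes "smooth_on T \<phi>" "open T" "smooth f" "\<And>x. f x \<in> T"
  shows "smooth (\<lambda>x. \<phi> (f x))"
  using assms unfolding smooth_iff_smooth_on by (auto intro: smooth_on_compose[of UNIV T])

lemma smooth_affine:
  assumes "smooth f" shows "smooth (\<lambda>x. f (c * x + d))"
  by (rule smooth_compose[of UNIV f])
    (use assms in \<open>simp_all add: smooth_add smooth_mult flip: smooth_iff_smooth_on\<close>)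

lemma smooth_shift: assumes "smooth f" shows "smooth (\<lambda>x. f (x + d))"
  using smooth_affine[OF assms, of 1 d] by simp

lemma smooth_vd: "smooth f \<Longrightarrow> smooth (vd f)"
  by (simp add: smooth_iff_smooth_on smooth_on_vd)

lemma smooth_has_vd: "smooth f \<Longrightarrow> (f has_vector_derivative vd f x) (at x)"
  by (simp add: smooth_iff_smooth_on smooth_on_has_vd)

lemma smooth_continuous: "smooth f \<Longrightarrow> continuous_on S f"
  by (simp add: smooth_iff_smooth_on smooth_on_continuous_on smooth_on_subset)

lemma smooth_nth_derivative: "smooth f \<Longrightarrow> smooth (nth_derivative k f)"
  by (simp add: smooth_iff_smooth_on smooth_on_nth_derivative)

lemma smooth_local:
  assumes "\<And>x. \<exists>S h. open S \<and> x \<in> S \<and> smooth_on S h \<and> (\<forall>y\<in>S. f y = h y)"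
  shows "smooth f"
  unfolding smooth_iff_smooth_on
proof (rule smooth_on_Union)
  fix x
  obtain S h where "open S" "x \<in> S" "smooth_on S h" "\<forall>y\<in>S. f y = h y"
    using assms by blast
  then have "smooth_on S f"
    by (intro smooth_on_cong[of S h f]) auto
  then show "\<exists>T. x \<in> T \<and> smooth_on T f"
    using \<open>x \<in> S\<close> by blast
qed

text \<open>The factor c is present because the family with both parameters is closed under
  differentiation, which makes the induction work.\<close>

lemma smooth_upto_powr: "smooth_upto n {0<..} (\<lambda>x. c * x powr p :: real)"
proof (induction n arbitrary: c p)
  case (Suc n)
  show ?case
  proof (rule smooth_upto_SucI)
    show "((\<lambda>x. c * x powr p) has_vector_derivative (c * p) * x powr (p - 1)) (at x)"
      if "x \<in> {0<..}" for x
      using that unfolding has_real_derivative_iff_has_vector_derivative[symmetric]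
      by (auto intro!: derivative_eq_intros)
  qed (simp_all add: Suc)
qed simp

lemma smooth_on_powr: "smooth_on {0<..} (\<lambda>x. x powr p :: real)"
  using smooth_upto_powr[of _ 1 p] by (simp add: smooth_on_def)

lemma smooth_sin_cos: "smooth (\<lambda>x. a * sin x + b * cos x :: real)"
proof -
  have "smooth_upto n UNIV (\<lambda>x. a * sin x + b * cos x :: real)" for n
  proof (induction n arbitrary: a b)
    case (Suc n)
    show ?case
    proof (rule smooth_upto_SucI)
      show "((\<lambda>x. a * sin x + b * cos x) has_vector_derivative (- b) * sin x + a * cos x) (at x)" for x
        unfolding has_real_derivative_iff_has_vector_derivative[symmetric]
        by (auto intro!: derivative_eq_intros)
    qed (simp_all only: Suc open_UNIV)
  qed simp
  then show ?thesis by (simp add: smooth_iff_smooth_on smooth_on_def)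
qed

lemma smooth_sin: "smooth (sin :: real \<Rightarrow> real)" and smooth_cos: "smooth (cos :: real \<Rightarrow> real)"
  using smooth_sin_cos[of 1 0] smooth_sin_cos[of 0 1] by simp_all

lemma smooth_norm:
  fixes f :: "real \<Rightarrow> 'a::real_inner"
  assumes "smooth f" "\<And>x. f x \<noteq> 0"
  shows "smooth (\<lambda>x. norm (f x) powr p)"
proof -
  have "smooth (\<lambda>x. inner (f x) (f x))"
    using assms bounded_bilinear_inner smooth_bilinear by blast
  then have "smooth (\<lambda>x. (inner (f x) (f x)) powr (p/2))"
    using assms by (rule_tac smooth_compose[OF smooth_on_powr]) auto
  moreover have "(inner (f x) (f x)) powr (p/2) = norm (f x) powr p" for x
  proof -
    have "(inner (f x) (f x)) powr (p/2) = (norm (f x) powr 2) powr (p/2)"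
      using assms(2)[of x] by (simp add: dot_square_norm)
    then show ?thesis by (simp only: powr_powr) simp
  qed
  ultimately show ?thesis by simp
qed

section \<open>A submultiplicative norm of order \<open>r\<close> at scale \<open>t\<close>\<close>

text \<open>Expanding the recursion gives \<open>\<Sum>k\<le>r. (r choose k) * t ^ k * norm (f\<^sup>(\<^sup>k\<^sup>) x)\<close>. The norm is
  submultiplicative at every single point, so that bounds on inverses need no supremum.\<close>

primrec cn :: "nat \<Rightarrow> real \<Rightarrow> (real \<Rightarrow> 'a::real_normed_vector) \<Rightarrow> real \<Rightarrow> real" where
  "cn 0 t f x = norm (f x)"
| "cn (Suc r) t f x = cn r t f x + t * cn r t (vd f) x"

lemma cn_nonneg [simp]: "0 \<le> t \<Longrightarrow> 0 \<le> cn r t f x"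
  by (induction r arbitrary: f) auto

lemma cn_cong_open:
  assumes "open S" "x \<in> S" "\<And>y. y \<in> S \<Longrightarrow> f y = g y"
  shows "cn r t f x = cn r t g x"
  using assms(2,3)
proof (induction r arbitrary: f g)
  case (Suc r)
  have "cn r t f x = cn r t g x"
    by (rule Suc.IH[OF Suc.prems])
  moreover have "cn r t (vd f) x = cn r t (vd g) x"
    by (rule Suc.IH[OF Suc.prems(1)]) (rule vd_cong_open[OF assms(1) _ Suc.prems(2)])
  ultimately show ?case by simp
qed auto

lemma vd_add: "smooth f \<Longrightarrow> smooth g \<Longrightarrow> vd (\<lambda>x. f x + g x) = (\<lambda>x. vd f x + vd g x)"
  by (rule ext, rule vd_eqI) (intro has_vector_derivative_add smooth_has_vd)

lemma vd_linear: "bounded_linear T \<Longrightarrow> smooth f \<Longrightarrow> vd (\<lambda>x. T (f x)) = (\<lambda>x. T (vd f x))"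
  by (rule ext, rule vd_eqI) (rule bounded_linear.has_vector_derivative[OF _ smooth_has_vd])

lemma vd_minus: "smooth f \<Longrightarrow> vd (\<lambda>x. - f x) = (\<lambda>x. - vd f x)"
  by (rule vd_linear[OF bounded_linear_minus[OF bounded_linear_ident]])

lemma vd_diff: "smooth f \<Longrightarrow> smooth g \<Longrightarrow> vd (\<lambda>x. f x - g x) = (\<lambda>x. vd f x - vd g x)"
  by (rule ext, rule vd_eqI) (intro has_vector_derivative_diff smooth_has_vd)

lemma vd_diff_const: "smooth f \<Longrightarrow> vd (\<lambda>x. f x - c) = vd f"
  using vd_diff[of f "\<lambda>_. c"] by simp

lemma vd_bilinear:
  "bounded_bilinear pr \<Longrightarrow> smooth f \<Longrightarrow> smooth g
    \<Longrightarrow> vd (\<lambda>x. pr (f x) (g x)) = (\<lambda>x. pr (f x) (vd g x) + pr (vd f x) (g x))"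
  by (rule ext, rule vd_eqI) (rule bounded_bilinear.has_vector_derivative[OF _ smooth_has_vd smooth_has_vd])

lemma vd_affine: "smooth f \<Longrightarrow> vd (\<lambda>x. f (c * x + d)) = (\<lambda>x. c *\<^sub>R vd f (c * x + d))"
  by (rule ext, rule vd_eqI, rule vector_diff_chain_at[of "\<lambda>x. c * x + d" c _ f, unfolded o_def])
    (auto intro!: derivative_eq_intros smooth_has_vd)

lemma vd_shift: "smooth f \<Longrightarrow> vd (\<lambda>x. f (x + d)) = (\<lambda>x. vd f (x + d))"
  using vd_affine[of f 1 d] by simp

lemma nth_derivative_vd_shift:
  "smooth f \<Longrightarrow> nth_derivative k (\<lambda>x. f (x + d)) = (\<lambda>x. nth_derivative k f (x + d))"
proof (induction k arbitrary: f)
  case (Suc k)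
  show ?case
    unfolding nth_derivative_Suc vd_shift[OF Suc.prems] by (rule Suc.IH[OF smooth_vd[OF Suc.prems]])
qed simp

lemma nth_derivative_diff:
  "smooth f \<Longrightarrow> smooth g \<Longrightarrow> nth_derivative k (\<lambda>x. f x - g x) = (\<lambda>x. nth_derivative k f x - nth_derivative k g x)"
proof (induction k arbitrary: f g)
  case (Suc k)
  show ?case
    unfolding nth_derivative_Suc vd_diff[OF Suc.prems] by (rule Suc.IH) (intro smooth_vd Suc.prems)+
qed simp

lemma nth_derivative_linear:
  "bounded_linear T \<Longrightarrow> smooth f \<Longrightarrow> nth_derivative k (\<lambda>x. T (f x)) = (\<lambda>x. T (nth_derivative k f x))"
proof (induction k arbitrary: f)
  case (Suc k)
  show ?case
    unfolding nth_derivative_Suc vd_linear[OF Suc.prems] by (rule Suc.IH) (intro smooth_vd Suc.prems)+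
qed simp

lemma vd_nth_derivative: "vd (nth_derivative k f) x = nth_derivative k (vd f) x"
  using nth_derivative_Suc[of k f] nth_derivative_Suc'[of k f] by metis

lemma cn_const [simp]: "cn r t (\<lambda>_. c) x = norm c"
proof (induction r arbitrary: c)
  case (Suc r)
  show ?case by (simp add: Suc)
qed simp

lemma cn_add:
  "0 \<le> t \<Longrightarrow> smooth f \<Longrightarrow> smooth g \<Longrightarrow> cn r t (\<lambda>x. f x + g x) x \<le> cn r t f x + cn r t g x"
proof (induction r arbitrary: f g)
  case (Suc r)
  have "t * cn r t (\<lambda>x. vd f x + vd g x) x \<le> t * (cn r t (vd f) x + cn r t (vd g) x)"
    using Suc by (intro mult_left_mono Suc.IH) (auto simp: smooth_vd)
  moreover have "cn r t (\<lambda>x. f x + g x) x \<le> cn r t f x + cn r t g x"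
    using Suc by blast
  ultimately show ?case
    unfolding cn.simps vd_add[OF Suc.prems(2,3)] by (simp add: algebra_simps)
qed (simp add: norm_triangle_ineq)

lemma cn_isometry:
  assumes "bounded_linear T" "\<And>z. norm (T z) = norm z"
  shows "smooth f \<Longrightarrow> cn r t (\<lambda>x. T (f x)) x = cn r t f x"
proof (induction r arbitrary: f)
  case (Suc r)
  show ?case
    unfolding cn.simps vd_linear[OF assms(1) Suc.prems] Suc.IH[OF Suc.prems]
      Suc.IH[OF smooth_vd[OF Suc.prems]] by (rule refl)
qed (simp add: assms)

lemma cn_minus: "smooth f \<Longrightarrow> cn r t (\<lambda>x. - f x) x = cn r t f x"
  by (rule cn_isometry[OF bounded_linear_minus[OF bounded_linear_ident]]) auto

lemma cn_linear:
  assumes T: "bounded_linear T" "\<And>z. norm (T z) \<le> K * norm z" and t: "0 \<le> t"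
  shows "smooth f \<Longrightarrow> cn r t (\<lambda>x. T (f x)) x \<le> K * cn r t f x"
proof (induction r arbitrary: f)
  case (Suc r)
  have "t * cn r t (\<lambda>x. T (vd f x)) x \<le> t * (K * cn r t (vd f) x)"
    using Suc t by (intro mult_left_mono Suc.IH) (auto simp: smooth_vd)
  then show ?case
    using Suc.IH[OF Suc.prems] by (simp add: vd_linear[OF T(1) Suc.prems] algebra_simps)
qed (simp add: T)

lemma cn_scaleR_const: "smooth f \<Longrightarrow> cn r t (\<lambda>x. c *\<^sub>R f x) x = \<bar>c\<bar> * cn r t f x"
proof (induction r arbitrary: f)
  case (Suc r)
  show ?case
    unfolding cn.simps vd_linear[OF bounded_linear_scaleR_right Suc.prems] Suc.IH[OF Suc.prems]
      Suc.IH[OF smooth_vd[OF Suc.prems]] by (simp add: algebra_simps)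
qed simp

lemma cn_unit_mult:
  fixes u :: "'a::real_normed_div_algebra"
  assumes "norm u = 1" "smooth f"
  shows "cn r t (\<lambda>x. u * f x) x = cn r t f x" "cn r t (\<lambda>x. f x * u) x = cn r t f x"
  using assms by (simp_all add: norm_mult cn_isometry[OF bounded_linear_mult_right] cn_isometry[OF bounded_linear_mult_left])

text \<open>The product rule yields every term of the product of the two recursions except the one
  with both derivatives, and this one is nonnegative and may be added.\<close>

lemma cn_bilinear:
  assumes pr: "bounded_bilinear pr" "\<And>a b. norm (pr a b) \<le> norm a * norm b" and t: "0 \<le> t"
  shows "smooth f \<Longrightarrow> smooth g \<Longrightarrow> cn r t (\<lambda>x. pr (f x) (g x)) x \<le> cn r t f x * cn r t g x"
proof (induction r arbitrary: f g)
  case (Suc r)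
  have "cn r t (\<lambda>x. pr (f x) (vd g x) + pr (vd f x) (g x)) x
      \<le> cn r t (\<lambda>x. pr (f x) (vd g x)) x + cn r t (\<lambda>x. pr (vd f x) (g x)) x"
    using Suc.prems by (intro cn_add smooth_bilinear[OF pr(1)] t) (auto simp: smooth_vd)
  also have "\<dots> \<le> cn r t f x * cn r t (vd g) x + cn r t (vd f) x * cn r t g x"
    using Suc by (intro add_mono Suc.IH) (auto simp: smooth_vd)
  finally have "t * cn r t (\<lambda>x. pr (f x) (vd g x) + pr (vd f x) (g x)) x
      \<le> t * (cn r t f x * cn r t (vd g) x + cn r t (vd f) x * cn r t g x)"
    using t by (rule mult_left_mono)
  moreover have "cn r t (\<lambda>x. pr (f x) (g x)) x \<le> cn r t f x * cn r t g x"
    using Suc by blast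
  moreover have "0 \<le> (t * cn r t (vd f) x) * (t * cn r t (vd g) x)"
    using t by simp
  ultimately show ?case
    unfolding cn.simps vd_bilinear[OF pr(1) Suc.prems] by (simp add: algebra_simps)
qed (simp add: pr)

lemma cn_mult:
  fixes f g :: "real \<Rightarrow> 'a::real_normed_algebra"
  shows "0 \<le> t \<Longrightarrow> smooth f \<Longrightarrow> smooth g \<Longrightarrow> cn r t (\<lambda>x. f x * g x) x \<le> cn r t f x * cn r t g x"
  by (rule cn_bilinear[OF bounded_bilinear_mult norm_mult_ineq])

lemma cn_scaleR:
  "0 \<le> t \<Longrightarrow> smooth f \<Longrightarrow> smooth g \<Longrightarrow> cn r t (\<lambda>x. f x *\<^sub>R g x) x \<le> cn r t f x * cn r t g x"
  by (rule cn_bilinear[OF bounded_bilinear_scaleR]) auto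

lemma cn_shift: "smooth f \<Longrightarrow> cn r t (\<lambda>x. f (x + d)) x = cn r t f (x + d)"
proof (induction r arbitrary: f)
  case (Suc r)
  show ?case
    unfolding cn.simps vd_shift[OF Suc.prems] Suc.IH[OF Suc.prems]
      Suc.IH[OF smooth_vd[OF Suc.prems]] by (rule refl)
qed simp

lemma cn_affine: "smooth f \<Longrightarrow> 0 \<le> c \<Longrightarrow> cn r t (\<lambda>x. f (c * x + d)) x = cn r (c * t) f (c * x + d)"
proof (induction r arbitrary: f)
  case (Suc r)
  show ?case
    unfolding cn.simps vd_affine[OF Suc.prems(1)] Suc.IH[OF Suc.prems]
      cn_scaleR_const[OF smooth_affine[OF smooth_vd[OF Suc.prems(1)]]]
      Suc.IH[OF smooth_vd[OF Suc.prems(1)] Suc.prems(2)] 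
    using Suc.prems(2) by simp
qed auto

lemma cn_mono_scale: "0 \<le> t \<Longrightarrow> t \<le> t' \<Longrightarrow> cn r t f x \<le> cn r t' f x"
  by (induction r arbitrary: f) (auto intro!: add_mono mult_mono)

text \<open>At most r factors t occur, each growing by t' / t. This is the price of measuring at a
  coarser scale, paid in \<open>gauge_pull_back\<close>.\<close>

lemma cn_change_scale:
  assumes "0 < t" "t \<le> t'"
  shows "cn r t' f x \<le> (t' / t) ^ r * cn r t f x"
proof (induction r arbitrary: f)
  case (Suc r)
  have 1: "1 \<le> t' / t" using assms by simp
  have "cn r t' f x \<le> (t' / t) ^ r * cn r t f x" by (rule Suc)
  also have "\<dots> \<le> (t' / t) ^ Suc r * cn r t f x"
    using assms 1 by (intro mult_right_mono power_increasing) auto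
  finally have a: "cn r t' f x \<le> (t' / t) ^ Suc r * cn r t f x" .
  have "t' * cn r t' (vd f) x \<le> t' * ((t' / t) ^ r * cn r t (vd f) x)"
    using assms by (intro mult_left_mono Suc) auto
  also have "\<dots> = (t' / t) ^ Suc r * (t * cn r t (vd f) x)"
    using assms by (simp add: field_simps)
  finally show ?case using a by (simp add: algebra_simps)
qed simp

lemma cn_le_Suc: "0 \<le> t \<Longrightarrow> cn r t f x \<le> cn (Suc r) t f x"
  by simp

lemma cn_mono: "0 \<le> t \<Longrightarrow> r \<le> s \<Longrightarrow> cn r t f x \<le> cn s t f x"
  by (rule lift_Suc_mono_le[of "\<lambda>r. cn r t f x"]) simp_all

lemma norm_le_cn: "0 \<le> t \<Longrightarrow> norm (f x) \<le> cn r t f x"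
  using cn_mono[of t 0 r f x] by simp

lemma cn_vd_le: "0 \<le> t \<Longrightarrow> t * cn r t (vd f) x \<le> cn (Suc r) t f x"
  by simp

lemma nth_derivative_le_cn: "0 \<le> t \<Longrightarrow> k \<le> r \<Longrightarrow> t ^ k * norm (nth_derivative k f x) \<le> cn r t f x"
proof (induction r arbitrary: f k)
  case (Suc r)
  show ?case
  proof (cases k)
    case 0
    then show ?thesis using norm_le_cn[OF Suc.prems(1), of f x "Suc r"] by simp
  next
    case (Suc k')
    have "t * (t ^ k' * norm (nth_derivative k' (vd f) x)) \<le> t * cn r t (vd f) x"
      using Suc Suc.prems by (intro mult_left_mono Suc.IH) auto
    also have "\<dots> \<le> cn (Suc r) t f x" by (rule cn_vd_le) fact
    finally show ?thesis by (simp add: Suc nth_derivative_Suc mult.assoc)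
  qed
qed simp

text \<open>The factor is the sum of the binomial coefficients in the expansion of
  \<open>cn\<close>.\<close>

lemma cn_le_nth_derivative:
  assumes "0 \<le> t" "\<And>k. k \<le> r \<Longrightarrow> t ^ k * norm (nth_derivative k f x) \<le> c"
  shows "cn r t f x \<le> 2 ^ r * c"
  using assms(2)
proof (induction r arbitrary: f c)
  case 0
  then show ?case using "0"[of 0] by simp
next
  case (Suc r)
  have "cn r t f x \<le> 2 ^ r * c"
    by (rule Suc.IH) (use Suc.prems in auto)
  moreover have "t * cn r t (vd f) x \<le> 2 ^ r * c"
  proof (cases "t = 0")
    case True
    have "0 \<le> c" using Suc.prems[of 0] norm_ge_zero[of "f x"] by (simp del: norm_ge_zero)
    then show ?thesis using True by simp
  next
    case False
    have "cn r t (vd f) x \<le> 2 ^ r * (c / t)"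
      by (rule Suc.IH) (use Suc.prems[of "Suc _"] False assms(1) in \<open>auto simp: nth_derivative_Suc field_simps\<close>)
    then show ?thesis using False assms(1) by (simp add: field_simps)
  qed
  ultimately show ?case by simp
qed

text \<open>Write f g - u v as (f - u)(g - v) + u (g - v) + (f - u) v, where multiplication by u and
  v preserves the norm. In this multiplicative form the errors along a word of length L add up to a
  power (1 + d) ^ L.\<close>

lemma cn_mult_near:
  fixes f g :: "real \<Rightarrow> 'a::real_normed_div_algebra"
  assumes "0 \<le> t" "smooth f" "smooth g" "norm u = 1" "norm v = 1"
  shows "1 + cn r t (\<lambda>x. f x * g x - u * v) x
    \<le> (1 + cn r t (\<lambda>x. f x - u) x) * (1 + cn r t (\<lambda>x. g x - v) x)"
proof -
  have sm: "smooth (\<lambda>x. f x - u)" "smooth (\<lambda>x. g x - v)"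
    using assms smooth_diff smooth_const by blast+
  have "(\<lambda>x. f x * g x - u * v) = (\<lambda>x. ((f x - u) * (g x - v) + u * (g x - v)) + (f x - u) * v)"
    by (simp add: algebra_simps)
  then have "cn r t (\<lambda>x. f x * g x - u * v) x
    \<le> cn r t (\<lambda>x. (f x - u) * (g x - v) + u * (g x - v)) x + cn r t (\<lambda>x. (f x - u) * v) x"
    using sm assms(1) by (simp only:) (intro cn_add smooth_add smooth_mult smooth_const)
  also have "\<dots> \<le> (cn r t (\<lambda>x. (f x - u) * (g x - v)) x + cn r t (\<lambda>x. u * (g x - v)) x)
      + cn r t (\<lambda>x. (f x - u) * v) x"
    using sm assms(1) by (intro add_right_mono cn_add smooth_add smooth_mult smooth_const)
  also have "\<dots> \<le> (cn r t (\<lambda>x. f x - u) x * cn r t (\<lambda>x. g x - v) x + cn r t (\<lambda>x. g x - v) x)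
      + cn r t (\<lambda>x. f x - u) x"
    using sm assms by (intro add_mono cn_mult) (auto simp: cn_unit_mult)
  finally show ?thesis by (simp add: algebra_simps)
qed

text \<open>This takes the place of a Neumann series: the error z satisfies z = w z + w u^-1 with w
  = u^-1 (u - f), and submultiplicativity of \<open>cn\<close> at the single point x bounds (1 - d)
  times its norm by d.\<close>

lemma cn_inverse_near:
  fixes f :: "real \<Rightarrow> 'a::real_normed_div_algebra"
  assumes "0 \<le> t" "smooth f" "\<And>x. f x \<noteq> 0" "norm u = 1" "cn r t (\<lambda>x. f x - u) x \<le> d" "d < 1"
  shows "cn r t (\<lambda>x. inverse (f x) - inverse u) x \<le> d / (1 - d)"
proof -
  define z where "z = (\<lambda>x. inverse (f x) - inverse u)"
  define w where "w = (\<lambda>x. inverse u * (u - f x))"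
  have u: "u \<noteq> 0" "norm (inverse u) = 1" using assms(4) by (auto simp: norm_inverse)
  have sm: "smooth z" "smooth w" "smooth (\<lambda>x. u - f x)"
    unfolding z_def w_def using assms(2,3)
    by (intro smooth_diff smooth_inverse smooth_mult smooth_const; simp)+
  have "cn r t w x = cn r t (\<lambda>x. - (f x - u)) x"
    unfolding w_def cn_unit_mult(1)[OF u(2) sm(3)] by simp
  also have "\<dots> \<le> d"
    using assms(2,5) by (subst cn_minus) (auto intro!: smooth_diff)
  finally have w: "cn r t w x \<le> d" .
  have "z = (\<lambda>x. w x * z x + w x * inverse u)"
  proof
    fix x
    have "w x * (z x + inverse u) = inverse u * u * inverse (f x) - inverse u * (f x * inverse (f x))"
      by (simp add: w_def z_def algebra_simps)
    also have "\<dots> = z x"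
      using u assms(3) by (simp add: z_def)
    finally show "z x = w x * z x + w x * inverse u" by (simp add: algebra_simps)
  qed
  then have "cn r t z x \<le> cn r t (\<lambda>x. w x * z x) x + cn r t (\<lambda>x. w x * inverse u) x"
    using cn_add[OF assms(1) smooth_mult[OF sm(2,1)] smooth_mult[OF sm(2) smooth_const[of "inverse u"]], of r x]
    by simp
  also have "\<dots> \<le> cn r t w x * cn r t z x + cn r t w x"
    using sm assms(1) u by (intro add_mono cn_mult) (auto simp: cn_unit_mult)
  also have "\<dots> \<le> d * cn r t z x + d"
    using w assms(1) by (intro add_mono mult_right_mono) auto
  finally show ?thesis
    using assms(6) by (simp add: z_def field_simps)
qed

section \<open>Mean value and Taylor estimates, periodic functions, compositions\<close>

lemma vector_differentiable_bound:
  fixes f :: "real \<Rightarrow> 'a::real_normed_vector"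
  assumes "convex S" "\<And>x. x \<in> S \<Longrightarrow> (f has_vector_derivative f' x) (at x within S)"
    "\<And>x. x \<in> S \<Longrightarrow> norm (f' x) \<le> B" "x \<in> S" "y \<in> S"
  shows "norm (f x - f y) \<le> B * norm (x - y)"
proof (rule differentiable_bound[OF assms(1) _ _ assms(4,5)])
  fix z assume z: "z \<in> S"
  show "(f has_derivative (\<lambda>h. h *\<^sub>R f' z)) (at z within S)"
    using assms(2)[OF z] by (simp add: has_vector_derivative_def)
  show "onorm (\<lambda>h. h *\<^sub>R f' z) \<le> B"
    using assms(3)[OF z] by (intro onorm_le) (simp add: mult.commute[of B] mult_left_mono)
qed

lemma norm_difference_le:
  assumes "smooth f" "\<And>y. norm (vd f y) \<le> M"
  shows "norm (f (x + s) - f x) \<le> \<bar>s\<bar> * M"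
proof -
  have "norm (f (x + s) - f x) \<le> M * norm (x + s - x)"
    by (rule vector_differentiable_bound[of UNIV f "vd f"])
      (use assms smooth_has_vd in auto)
  then show ?thesis by (simp add: mult.commute)
qed

lemma vector_differentiable_bound_UNIV:
  assumes "smooth f" "\<And>y. norm (vd f y) \<le> M"
  shows "norm (f x - f y) \<le> M * \<bar>x - y\<bar>"
  using norm_difference_le[OF assms, of y "x - y"] by (simp add: mult.commute)

lemma cn_difference:
  assumes "0 \<le> t" "smooth f" "\<And>y. cn r t (vd f) y \<le> M"
  shows "cn r t (\<lambda>x. f (x + s) - f x) x \<le> 2 ^ r * (\<bar>s\<bar> * M)"
proof (rule cn_le_nth_derivative[OF assms(1)])
  fix k assume k: "k \<le> r"
  define g where "g = (\<lambda>y. t ^ k *\<^sub>R nth_derivative k f y)"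
  have g: "smooth g" unfolding g_def by (intro smooth_scaleR smooth_const smooth_nth_derivative assms)
  have "vd g = (\<lambda>y. t ^ k *\<^sub>R nth_derivative k (vd f) y)"
    unfolding g_def vd_linear[OF bounded_linear_scaleR_right smooth_nth_derivative[OF assms(2)]]
    by (simp only: vd_nth_derivative)
  then have "norm (vd g y) \<le> M" for y
    unfolding fun_cong[OF \<open>vd g = _\<close>, of y] using nth_derivative_le_cn[OF assms(1) k, of "vd f" y] assms(1) assms(3)[of y] by simp
  then have "norm (g (x + s) - g x) \<le> \<bar>s\<bar> * M"
    by (rule norm_difference_le[OF g])
  moreover have "nth_derivative k (\<lambda>x. f (x + s) - f x) x = nth_derivative k f (x + s) - nth_derivative k f x"
    using assms(2) by (simp add: nth_derivative_diff nth_derivative_vd_shift smooth_shift)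
  ultimately show "t ^ k * norm (nth_derivative k (\<lambda>x. f (x + s) - f x) x) \<le> \<bar>s\<bar> * M"
    using assms(1) by (simp add: g_def flip: scaleR_diff_right)
qed

lemma cn_taylor:
  assumes "0 \<le> t" "smooth f" "\<And>y. cn r t (vd (vd f)) y \<le> M"
  shows "cn r t (\<lambda>x. f (x + s) - f x - s *\<^sub>R vd f x) x \<le> 2 ^ r * (s\<^sup>2 * M)"
proof (rule cn_le_nth_derivative[OF assms(1)])
  fix k assume k: "k \<le> r"
  define g where "g = (\<lambda>y. t ^ k *\<^sub>R nth_derivative k f y)"
  have g: "smooth g" unfolding g_def by (intro smooth_scaleR smooth_const smooth_nth_derivative assms)
  have vg: "vd g = (\<lambda>y. t ^ k *\<^sub>R nth_derivative k (vd f) y)"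
    unfolding g_def vd_linear[OF bounded_linear_scaleR_right smooth_nth_derivative[OF assms(2)]]
    by (simp only: vd_nth_derivative)
  then have "vd (vd g) = (\<lambda>y. t ^ k *\<^sub>R nth_derivative k (vd (vd f)) y)"
    unfolding vg vd_linear[OF bounded_linear_scaleR_right smooth_nth_derivative[OF smooth_vd[OF assms(2)]]]
    by (simp only: vd_nth_derivative)
  then have vvg: "norm (vd (vd g) y) \<le> M" for y
    unfolding fun_cong[OF \<open>vd (vd g) = _\<close>, of y] using nth_derivative_le_cn[OF assms(1) k, of "vd (vd f)" y] assms(1) assms(3)[of y] by simp
  \<comment> \<open>The mean value inequality is applied to g minus its linear part at x, whose
    derivative on the segment is at most |s| M. The factor 1 / 2 of Taylor's formula is
    lost.\<close>
  have "norm ((g (x + s) - (x + s) *\<^sub>R vd g x) - (g x - x *\<^sub>R vd g x)) \<le> (\<bar>s\<bar> * M) * norm (x + s - x)"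
  proof (rule vector_differentiable_bound[of "closed_segment x (x + s)"])
    fix y assume y: "y \<in> closed_segment x (x + s)"
    show "((\<lambda>y. g y - y *\<^sub>R vd g x) has_vector_derivative vd g y - vd g x) (at y within closed_segment x (x + s))"
      by (auto intro!: derivative_eq_intros has_vector_derivative_at_within[OF smooth_has_vd[OF g]])
    have "norm (vd g y - vd g x) \<le> M * \<bar>y - x\<bar>"
      by (rule vector_differentiable_bound_UNIV[OF smooth_vd[OF g] vvg])
    also have "\<dots> \<le> M * \<bar>s\<bar>"
      using y vvg[of 0] norm_ge_zero[of "vd (vd g) 0"]
      by (intro mult_left_mono) (auto simp: closed_segment_eq_real_ivl split: if_splits simp del: norm_ge_zero)
    finally show "norm (vd g y - vd g x) \<le> \<bar>s\<bar> * M" by (simp add: mult.commute)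
  qed auto
  then have "norm (g (x + s) - g x - s *\<^sub>R vd g x) \<le> s\<^sup>2 * M"
    by (simp add: algebra_simps power2_eq_square)
  moreover have "nth_derivative k (\<lambda>x. f (x + s) - f x - s *\<^sub>R vd f x) x
      = nth_derivative k f (x + s) - nth_derivative k f x - s *\<^sub>R nth_derivative k (vd f) x"
    using assms(2)
    by (simp add: nth_derivative_diff nth_derivative_vd_shift smooth_shift smooth_diff smooth_vd smooth_scaleR
        nth_derivative_linear[OF bounded_linear_scaleR_right])
  moreover have "t ^ k *\<^sub>R (nth_derivative k f (x + s) - nth_derivative k f x - s *\<^sub>R nth_derivative k (vd f) x)
     = g (x + s) - g x - s *\<^sub>R vd g x"
    unfolding fun_cong[OF vg, of x] by (simp add: g_def scaleR_diff_right mult.commute)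
  ultimately show "t ^ k * norm (nth_derivative k (\<lambda>x. f (x + s) - f x - s *\<^sub>R vd f x) x) \<le> s\<^sup>2 * M"
    using assms(1) by (metis abs_of_nonneg norm_scaleR zero_le_power)
qed

text \<open>Only the term of order zero sees the constant, all others being derivatives of f. In
  this way small derivatives become closeness to a constant in
  \<open>initial_gauges\<close>.\<close>

lemma cn_diff_const_le:
  assumes "0 \<le> t" "smooth f"
  shows "cn r t (\<lambda>x. f x - c) x \<le> norm (f x - c) + r * (t * cn r t (vd f) x)"
proof (induction r)
  case (Suc r)
  define a b where "a = t * cn r t (vd f) x" and "b = t * cn (Suc r) t (vd f) x"
  have "a \<le> b"
    unfolding a_def b_def using assms(1) by (intro mult_left_mono cn_le_Suc)
  then have "real r * a + a \<le> real (Suc r) * b"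
    by (metis (no_types, opaque_lifting) add.commute distrib_right mult_1 mult_left_mono of_nat_0_le_iff of_nat_Suc)
  moreover have "cn (Suc r) t (\<lambda>x. f x - c) x = cn r t (\<lambda>x. f x - c) x + a"
    by (simp add: vd_diff_const assms a_def)
  ultimately show ?case
    using Suc unfolding a_def[symmetric] b_def[symmetric] by linarith
qed simp

lemma cn_le_const_add:
  assumes "0 \<le> t" "smooth f"
  shows "cn r t f x \<le> norm c + cn r t (\<lambda>x. f x - c) x"
  using cn_add[OF assms(1), of "\<lambda>_. c" "\<lambda>x. f x - c" r x] assms(2) by (simp add: smooth_diff)

lemma periodic_nth_derivative:
  assumes "smooth f" "\<And>x. f (x + p) = f x"
  shows "nth_derivative k f (x + p) = nth_derivative k f x"
  using nth_derivative_vd_shift[OF assms(1), of k p] assms(2) by (metis (no_types, lifting) ext)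

text \<open>A derivative of a periodic function has mean zero and is therefore controlled by the next
  derivative, with a gain of one period.\<close>

lemma periodic_vd_bound_real:
  fixes f :: "real \<Rightarrow> real"
  assumes f: "smooth f" and p: "0 < p" "\<And>x. f (x + p) = f x" and D: "\<And>x. \<bar>vd (vd f) x\<bar> \<le> D"
  shows "\<bar>vd f x\<bar> \<le> p * D"
proof -
  have "(f has_real_derivative vd f y) (at y)" for y
    using smooth_has_vd[OF f] by (simp add: has_real_derivative_iff_has_vector_derivative)
  then have "\<exists>z>x. z < x + p \<and> f (x + p) - f x = (x + p - x) * vd f z"
    using p(1) by (intro MVT2) auto
  then obtain z where z: "x < z" "z < x + p" "f (x + p) - f x = (x + p - x) * vd f z"
    by blast
  then have "vd f z = 0" using p by simp
  moreover have "norm (vd f x - vd f z) \<le> D * \<bar>x - z\<bar>"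
    using D by (intro vector_differentiable_bound_UNIV smooth_vd f) auto
  moreover have "D * \<bar>x - z\<bar> \<le> D * p"
    using z D[of x] by (intro mult_left_mono) auto
  ultimately show ?thesis by (simp add: mult.commute)
qed

text \<open>A vector-valued derivative of mean zero need not vanish anywhere, so the four components
  are treated separately; hence the factor 4.\<close>

lemma periodic_vd_bound:
  fixes f :: "real \<Rightarrow> quat"
  assumes f: "smooth f" and p: "0 < p" "\<And>x. f (x + p) = f x" and D: "\<And>x. norm (vd (vd f) x) \<le> D"
  shows "norm (vd f x) \<le> 4 * p * D"
proof -
  have *: "\<bar>T (vd f x)\<bar> \<le> p * D" if T: "bounded_linear T" "\<And>q. \<bar>T q\<bar> \<le> norm q" for T :: "quat \<Rightarrow> real"
  proof -
    have "\<bar>vd (vd (\<lambda>x. T (f x))) y\<bar> \<le> D" for y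
      unfolding vd_linear[OF T(1) f] fun_cong[OF vd_linear[OF T(1) smooth_vd[OF f]]]
      by (rule order_trans[OF T(2) D])
    then have "\<bar>vd (\<lambda>x. T (f x)) x\<bar> \<le> p * D"
      by (intro periodic_vd_bound_real smooth_linear[OF T(1) f] p(1)) (simp_all add: p(2))
    then show ?thesis unfolding fun_cong[OF vd_linear[OF T(1) f]] .
  qed
  show ?thesis
    using norm_le_sum_sel[of "vd f x"] *[OF bounded_linear_sel(1) abs_sel_le_norm(1)]
      *[OF bounded_linear_sel(2) abs_sel_le_norm(2)] *[OF bounded_linear_sel(3) abs_sel_le_norm(3)]
      *[OF bounded_linear_sel(4) abs_sel_le_norm(4)] by linarith
qed

lemma periodic_nth_derivative_bound:
  fixes f :: "real \<Rightarrow> quat"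
  assumes f: "smooth f" and p: "0 < p" "\<And>x. f (x + p) = f x" and k: "1 \<le> k"
    and D: "\<And>x. norm (nth_derivative (k + m) f x) \<le> D"
  shows "norm (nth_derivative k f x) \<le> (4 * p) ^ m * D"
  using D
proof (induction m arbitrary: D x)
  case (Suc m)
  obtain l where l: "k + m = Suc l" using k by (cases "k + m") auto
  have "norm (nth_derivative (k + m) f x) \<le> 4 * p * D" for x
    unfolding l nth_derivative_Suc'
  proof (rule periodic_vd_bound[OF smooth_nth_derivative[OF f] p(1)])
    show "nth_derivative l f (x + p) = nth_derivative l f x" for x
      by (rule periodic_nth_derivative[OF f p(2)])
    show "norm (vd (vd (nth_derivative l f)) x) \<le> D" for x
      using Suc.prems[of x] l by (simp add: nth_derivative_Suc')
  qed
  from Suc.IH[OF this] show ?case by (simp add: mult.assoc mult.left_commute)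
qed simp

lemma smooth_on_bounded_vd:
  fixes \<phi> :: "real \<Rightarrow> real"
  assumes "open T" "smooth_on T \<phi>" "{a..b} \<subseteq> T"
  obtains K where "0 \<le> K" "\<And>x. x \<in> {a..b} \<Longrightarrow> \<bar>\<phi> x\<bar> \<le> K" "\<And>x y. x \<in> {a..b} \<Longrightarrow> y \<in> {a..b} \<Longrightarrow> \<bar>\<phi> x - \<phi> y\<bar> \<le> K * \<bar>x - y\<bar>"
proof -
  have bdd: "\<exists>K. \<forall>x\<in>{a..b}. \<bar>f x\<bar> \<le> K" if "smooth_on T f" for f :: "real \<Rightarrow> real"
  proof -
    have "continuous_on {a..b} f"
      using smooth_on_continuous_on[OF that] assms(3) by (rule continuous_on_subset)
    then have "bounded (f ` {a..b})"
      by (intro compact_imp_bounded compact_continuous_image) auto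
    then obtain K where "\<forall>y\<in>f ` {a..b}. norm y \<le> K"
      unfolding bounded_iff by blast
    then show ?thesis by (intro exI[of _ K]) simp
  qed
  obtain K1 where K1: "\<And>x. x \<in> {a..b} \<Longrightarrow> \<bar>\<phi> x\<bar> \<le> K1"
    using bdd[OF assms(2)] by blast
  obtain K2 where K2: "\<And>x. x \<in> {a..b} \<Longrightarrow> \<bar>vd \<phi> x\<bar> \<le> K2"
    using bdd[OF smooth_on_vd[OF assms(2)]] by blast
  have lip: "\<bar>\<phi> x - \<phi> y\<bar> \<le> K2 * \<bar>x - y\<bar>" if "x \<in> {a..b}" "y \<in> {a..b}" for x y
  proof -
    have "(\<phi> has_vector_derivative vd \<phi> z) (at z within {a..b})" if "z \<in> {a..b}" for z
      using that assms(3) by (rule_tac has_vector_derivative_at_within[OF smooth_on_has_vd[OF assms(2)]]) auto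
    then have "norm (\<phi> x - \<phi> y) \<le> K2 * norm (x - y)"
      using K2 that by (intro vector_differentiable_bound[of "{a..b}" \<phi> "vd \<phi>"]) auto
    then show ?thesis by simp
  qed
  show thesis
  proof (rule that[of "max 0 (max K1 K2)"])
    fix x y assume xy: "x \<in> {a..b}" "y \<in> {a..b}"
    show "\<bar>\<phi> x\<bar> \<le> max 0 (max K1 K2)" using K1[OF xy(1)] by simp
    show "\<bar>\<phi> x - \<phi> y\<bar> \<le> max 0 (max K1 K2) * \<bar>x - y\<bar>"
      using lip[OF xy] by (rule order_trans) (intro mult_right_mono; simp)
  qed simp
qed

text \<open>Induction on r with \<phi> generalized replaces the formula of Faa di Bruno: the
  derivative of the composition is f' times the composition with the derivative of \<phi>. The point
  is that K is uniform in f, in the scale t and in x.\<close>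

lemma cn_compose:
  fixes \<phi> :: "real \<Rightarrow> real"
  assumes T: "open T" "{a..b} \<subseteq> T" and c: "c \<in> {a..b}" and \<phi>: "smooth_on T \<phi>"
  shows "\<exists>K\<ge>0. \<forall>f t x. smooth f \<longrightarrow> range f \<subseteq> {a..b} \<longrightarrow> 0 \<le> t \<longrightarrow> cn r t (\<lambda>x. f x - c) x \<le> B
    \<longrightarrow> cn r t (\<lambda>x. \<phi> (f x) - \<phi> c) x \<le> K * cn r t (\<lambda>x. f x - c) x"
  using \<phi>
proof (induction r arbitrary: \<phi>)
  case 0
  obtain K where "0 \<le> K" "\<And>x y. x \<in> {a..b} \<Longrightarrow> y \<in> {a..b} \<Longrightarrow> \<bar>\<phi> x - \<phi> y\<bar> \<le> K * \<bar>x - y\<bar>"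
    using smooth_on_bounded_vd[OF T(1) 0 T(2)] by metis
  then show ?case using c by (intro exI[of _ K]) (auto simp: image_subset_iff)
next
  case (Suc r)
  obtain K1 where K1: "0 \<le> K1" "\<And>f t x. \<lbrakk>smooth f; range f \<subseteq> {a..b}; 0 \<le> t; cn r t (\<lambda>x. f x - c) x \<le> B\<rbrakk>
      \<Longrightarrow> cn r t (\<lambda>x. \<phi> (f x) - \<phi> c) x \<le> K1 * cn r t (\<lambda>x. f x - c) x"
    using Suc.IH[OF Suc.prems] by blast
  obtain K2 where K2: "0 \<le> K2" "\<And>f t x. \<lbrakk>smooth f; range f \<subseteq> {a..b}; 0 \<le> t; cn r t (\<lambda>x. f x - c) x \<le> B\<rbrakk>
      \<Longrightarrow> cn r t (\<lambda>x. vd \<phi> (f x) - vd \<phi> c) x \<le> K2 * cn r t (\<lambda>x. f x - c) x"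
    using Suc.IH[OF smooth_on_vd[OF Suc.prems]] by blast
  define K where "K = K1 + (\<bar>vd \<phi> c\<bar> + K2 * \<bar>B\<bar>)"
  have "cn (Suc r) t (\<lambda>x. \<phi> (f x) - \<phi> c) x \<le> K * cn (Suc r) t (\<lambda>x. f x - c) x"
    if f: "smooth f" "range f \<subseteq> {a..b}" and t: "0 \<le> t" and B: "cn (Suc r) t (\<lambda>x. f x - c) x \<le> B" for f t x
  proof -
    let ?N = "cn (Suc r) t (\<lambda>x. f x - c) x"
    have fT: "f x \<in> T" for x using f(2) T(2) by auto
    have le: "cn r t (\<lambda>x. f x - c) x \<le> ?N" "0 \<le> ?N" by (rule cn_le_Suc[OF t], rule cn_nonneg[OF t])
    then have B': "cn r t (\<lambda>x. f x - c) x \<le> B" "?N \<le> \<bar>B\<bar>" using B by auto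
    have sm: "smooth (\<lambda>x. \<phi> (f x))" "smooth (\<lambda>x. vd \<phi> (f x))"
      using smooth_compose[OF Suc.prems T(1) f(1) fT] smooth_compose[OF smooth_on_vd[OF Suc.prems] T(1) f(1) fT] by auto
    have "((\<lambda>x. \<phi> (f x)) has_vector_derivative vd f y *\<^sub>R vd \<phi> (f y)) (at y)" for y
      using vector_diff_chain_at[OF smooth_has_vd[OF f(1)] smooth_on_has_vd[OF Suc.prems fT]]
      by (simp add: o_def)
    then have "vd (\<lambda>x. \<phi> (f x) - \<phi> c) = (\<lambda>y. vd f y * vd \<phi> (f y))"
      unfolding vd_diff_const[OF sm(1)] using vd_eqI by fastforce
    then have "t * cn r t (vd (\<lambda>x. \<phi> (f x) - \<phi> c)) x \<le> t * (cn r t (vd f) x * cn r t (\<lambda>y. vd \<phi> (f y)) x)"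
      using t f(1) sm by (simp only:) (intro mult_left_mono cn_mult smooth_vd)
    also have "\<dots> = (t * cn r t (vd f) x) * cn r t (\<lambda>y. vd \<phi> (f y)) x" by simp
    also have "\<dots> \<le> ?N * (\<bar>vd \<phi> c\<bar> + K2 * \<bar>B\<bar>)"
    proof (rule mult_mono)
      show "t * cn r t (vd f) x \<le> ?N"
        using cn_vd_le[OF t, of r "\<lambda>x. f x - c" x] by (simp add: vd_diff_const[OF f(1)])
      have "cn r t (\<lambda>y. vd \<phi> (f y)) x \<le> norm (vd \<phi> c) + cn r t (\<lambda>y. vd \<phi> (f y) - vd \<phi> c) x"
        by (rule cn_le_const_add[OF t sm(2)])
      also have "\<dots> \<le> norm (vd \<phi> c) + K2 * cn r t (\<lambda>x. f x - c) x"
        using K2(2)[OF f t B'(1)] by simp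
      also have "\<dots> \<le> norm (vd \<phi> c) + K2 * \<bar>B\<bar>"
        using K2(1) le B'(2) by (intro add_left_mono mult_left_mono) auto
      finally show "cn r t (\<lambda>y. vd \<phi> (f y)) x \<le> \<bar>vd \<phi> c\<bar> + K2 * \<bar>B\<bar>" by simp
    qed (use t le in auto)
    finally have "t * cn r t (vd (\<lambda>x. \<phi> (f x) - \<phi> c)) x \<le> (\<bar>vd \<phi> c\<bar> + K2 * \<bar>B\<bar>) * ?N"
      by (simp only: mult.commute)
    moreover have "cn r t (\<lambda>x. \<phi> (f x) - \<phi> c) x \<le> K1 * ?N"
      using K1(2)[OF f t B'(1)] le K1(1) by (meson mult_left_mono order_trans)
    ultimately show ?thesis unfolding K_def distrib_right cn.simps(2)[of r t "\<lambda>x. \<phi> (f x) - \<phi> c"] by linarith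
  qed
  moreover have "0 \<le> K" using K1 K2 by (simp add: K_def)
  ultimately show ?case by blast
qed

subsection \<open>A smooth step\<close>

text \<open>The powers in the denominator are included so that derivatives stay in the linear span
  of the family.\<close>

definition flat_exp :: "nat \<Rightarrow> real \<Rightarrow> real" where
  "flat_exp n x = (if x > 0 then exp (- 1 / x) / x ^ n else 0)"

lemma flat_exp_has_derivative:
  "(flat_exp n has_real_derivative flat_exp (n + 2) x - n * flat_exp (n + 1) x) (at x)"
proof -
  consider "x > 0" | "x < 0" | "x = 0" by linarith
  then show ?thesis
  proof cases
    case 1
    have "((\<lambda>x. exp (- 1 / x) / x ^ n) has_real_derivative flat_exp (n + 2) x - n * flat_exp (n + 1) x) (at x)"
      using 1 by (auto intro!: derivative_eq_intros simp: flat_exp_def field_simps power2_eq_square)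
        (cases n; simp add: field_simps)
    then show ?thesis
      by (rule DERIV_cong_ev[THEN iffD1, rotated 3])
        (use 1 eventually_nhds_in_open[of "{0<..}" x] in \<open>auto simp: flat_exp_def elim!: eventually_mono\<close>)
  next
    case 2
    have "((\<lambda>_. 0) has_real_derivative flat_exp (n + 2) x - n * flat_exp (n + 1) x) (at x)"
      using 2 by (simp add: flat_exp_def)
    then show ?thesis
      by (rule DERIV_cong_ev[THEN iffD1, rotated 3])
        (use 2 eventually_nhds_in_open[of "{..<0}" x] in \<open>auto simp: flat_exp_def elim!: eventually_mono\<close>)
  next
    case 3
    have "((\<lambda>y. flat_exp n y / y) \<longlongrightarrow> 0) (at 0)"
    proof (rule filterlim_split_at_real)
      have "((\<lambda>y::real. exp (- 1 / y) / y ^ n / y) \<longlongrightarrow> 0) (at_right 0)"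
        by real_asymp
      then show "((\<lambda>y. flat_exp n y / y) \<longlongrightarrow> 0) (at_right 0)"
        by (rule Lim_transform_eventually) (auto simp: eventually_at_filter flat_exp_def)
      show "((\<lambda>y. flat_exp n y / y) \<longlongrightarrow> 0) (at_left 0)"
        by (rule tendsto_eventually) (auto simp: eventually_at_filter flat_exp_def)
    qed
    then show ?thesis
      using 3 by (simp add: has_field_derivative_iff flat_exp_def)
  qed
qed

lemma smooth_flat_exp: "smooth (flat_exp n)"
proof -
  have "smooth_upto k UNIV (flat_exp n)" for k
  proof (induction k arbitrary: n)
    case (Suc k)
    show ?case
    proof (rule smooth_upto_SucI)
      show "(flat_exp n has_vector_derivative flat_exp (n + 2) x + (- real n) * flat_exp (n + 1) x) (at x)" for x
        using flat_exp_has_derivative[of n x] by (simp add: has_real_derivative_iff_has_vector_derivative)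
      show "smooth_upto k UNIV (\<lambda>x. flat_exp (n + 2) x + (- real n) * flat_exp (n + 1) x)"
        by (intro smooth_upto_add smooth_upto_bilinear[OF bounded_bilinear_mult] smooth_upto_const Suc) auto
    qed simp
  qed simp
  then show ?thesis by (simp add: smooth_iff_smooth_on smooth_on_def)
qed

definition smooth_step :: "real \<Rightarrow> real" where
  "smooth_step x = flat_exp 0 x / (flat_exp 0 x + flat_exp 0 (1 - x))"

lemma smooth_step_simps: "x \<le> 0 \<Longrightarrow> smooth_step x = 0" "1 \<le> x \<Longrightarrow> smooth_step x = 1"
  by (auto simp: smooth_step_def flat_exp_def)

lemma smooth_step_bounds: "0 \<le> smooth_step x" "smooth_step x \<le> 1"
  by (auto simp: smooth_step_def flat_exp_def add_nonneg_nonneg divide_le_eq_1 add_pos_nonneg)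

lemma smooth_smooth_step: "smooth smooth_step"
proof -
  have "smooth (\<lambda>x. flat_exp 0 ((-1) * x + 1))"
    by (rule smooth_affine[OF smooth_flat_exp])
  then have "smooth (\<lambda>x. flat_exp 0 x + flat_exp 0 (1 - x))"
    by (intro smooth_add smooth_flat_exp) simp
  moreover have "flat_exp 0 x + flat_exp 0 (1 - x) \<noteq> 0" for x
    by (auto simp: flat_exp_def add_pos_pos add_eq_0_iff_both_eq_0 intro!: less_imp_neq[THEN not_sym] add_nonneg_pos)
  ultimately have "smooth (\<lambda>x. flat_exp 0 x * inverse (flat_exp 0 x + flat_exp 0 (1 - x)))"
    by (intro smooth_mult smooth_flat_exp smooth_inverse)
  then show ?thesis by (simp add: smooth_step_def[abs_def] divide_inverse)
qed

lemma continuous_on_cn: "smooth f \<Longrightarrow> continuous_on S (cn r t f)"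
proof (induction r arbitrary: f)
  case (Suc r)
  show ?case
    unfolding cn.simps
    by (intro continuous_intros Suc.IH[OF Suc.prems] Suc.IH[OF smooth_vd[OF Suc.prems]])
qed (simp add: continuous_on_norm smooth_continuous)

lemma cn_smooth_step_bound: "\<exists>K\<ge>1. \<forall>x. cn r 1 smooth_step x \<le> K"
proof -
  have "bounded (cn r 1 smooth_step ` {0..1})"
    by (intro compact_imp_bounded compact_continuous_image continuous_on_cn smooth_smooth_step) auto
  then obtain K where K: "\<And>x. x \<in> {0..1} \<Longrightarrow> cn r 1 smooth_step x \<le> K"
    unfolding bounded_iff by (auto simp: image_iff) (metis abs_le_D1 atLeastAtMost_iff)
  have "cn r 1 smooth_step x \<le> max 1 K" for x
  proof -
    consider "x < 0" | "x > 1" | "x \<in> {0..1}" by fastforce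
    then show ?thesis
    proof cases
      case 1
      then have "cn r 1 smooth_step x = cn r 1 (\<lambda>_. 0::real) x"
        by (rule_tac cn_cong_open[where S = "{..<0}"]) (auto simp: smooth_step_simps)
      then show ?thesis by (simp del: cn_const add: cn_const[of r 1 "0::real" x])
    next
      case 2
      then have "cn r 1 smooth_step x = cn r 1 (\<lambda>_. 1::real) x"
        by (rule_tac cn_cong_open[where S = "{1<..}"]) (auto simp: smooth_step_simps)
      then show ?thesis by (simp del: cn_const add: cn_const[of r 1 "1::real" x])
    next
      case 3
      then show ?thesis using K[of x] by simp
    qed
  qed
  then show ?thesis by (intro exI[of _ "max 1 K"]) auto
qed

section \<open>Conjugating a cocycle close to a constant to that constant\<close>

lemma power_one_plus_le:
  fixes a :: real
  assumes "0 \<le> a" "real k * a \<le> 1"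
  shows "(1 + a) ^ k \<le> 1 + 2 * (real k * a)"
proof -
  have "(1 + a) ^ k \<le> exp a ^ k"
    using assms(1) by (intro power_mono exp_ge_add_one_self) auto
  also have "\<dots> = exp (real k * a)" by (simp add: exp_of_nat_mult)
  also have "\<dots> \<le> 1 + real k * a + (real k * a)\<^sup>2"
    using assms by (intro exp_bound) auto
  also have "(real k * a)\<^sup>2 \<le> real k * a"
    using assms by (simp add: power2_eq_square mult_left_le)
  finally show ?thesis by (simp add: mult.commute)
qed

lemma cn_reflect: "smooth f \<Longrightarrow> cn r t (\<lambda>x. f (c - x)) x = cn r t f (c - x)"
proof (induction r arbitrary: f)
  case (Suc r)
  have sm: "smooth (\<lambda>x. vd f (c - x))"
    using smooth_affine[OF smooth_vd[OF Suc.prems], of "-1" c] by simp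
  have "vd (\<lambda>x. f (c - x)) = (\<lambda>x. - vd f (c - x))"
    using vd_affine[OF Suc.prems, of "-1" c] by simp
  then show ?case
    by (simp only: cn.simps cn_minus[OF sm] Suc.IH[OF Suc.prems] Suc.IH[OF smooth_vd[OF Suc.prems]])
qed simp

lemma smooth_reflect: "smooth f \<Longrightarrow> smooth (\<lambda>x. f (c - x))"
  using smooth_affine[of f "-1" c] by simp

text \<open>For C equal to u on the left half-line, these are the iterations, starting from 1, for a
  solution h of h (x + s) * C x = u * h x. On each left half-line they become stationary after
  finitely many steps.\<close>

primrec transport :: "quat \<Rightarrow> real \<Rightarrow> (real \<Rightarrow> quat) \<Rightarrow> nat \<Rightarrow> real \<Rightarrow> quat" where
  "transport u s C 0 x = 1"
| "transport u s C (Suc k) x = u * transport u s C k (x - s) * inverse (C (x - s))"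

lemma smooth_transport:
  assumes "smooth C" "\<And>x. C x \<noteq> 0"
  shows "smooth (transport u s C k)"
proof (induction k)
  case 0
  then show ?case by (simp add: fun_eq_iff[symmetric] transport.simps(1)[abs_def])
next
  case (Suc k)
  have "smooth (\<lambda>x. u * transport u s C k (x + - s) * inverse (C (x + - s)))"
    by (intro smooth_mult smooth_const smooth_shift[OF Suc] smooth_inverse smooth_shift[OF assms(1)] assms(2))
  then show ?case by (simp add: transport.simps(2)[abs_def])
qed

lemma transport_nonzero: "u \<noteq> 0 \<Longrightarrow> (\<And>x. C x \<noteq> 0) \<Longrightarrow> transport u s C k x \<noteq> 0"
  by (induction k arbitrary: x) auto

lemma transport_one:
  assumes "u \<noteq> 0" "0 < s" "\<And>x. x \<le> 0 \<Longrightarrow> C x = u" "x \<le> s"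
  shows "transport u s C k x = 1"
  using assms(4)
proof (induction k arbitrary: x)
  case (Suc k)
  then have "transport u s C k (x - s) = 1" "C (x - s) = u"
    using assms by auto
  then show ?case using assms(1) by simp
qed simp

lemma transport_Suc_stable:
  assumes "u \<noteq> 0" "0 < s" "\<And>x. x \<le> 0 \<Longrightarrow> C x = u" "x \<le> real (Suc k) * s"
  shows "transport u s C (Suc k) x = transport u s C k x"
  using assms(4)
proof (induction k arbitrary: x)
  case 0
  then have "x \<le> s" by simp
  then show ?case by (simp only: transport_one[OF assms(1-3)])
next
  case (Suc k)
  have "x - s \<le> real (Suc k) * s"
    using Suc.prems by (simp add: algebra_simps)
  from Suc.IH[OF this] show ?case by (simp only: transport.simps(2))
qed

lemma transport_stable:
  assumes "u \<noteq> 0" "0 < s" "\<And>x. x \<le> 0 \<Longrightarrow> C x = u" "x \<le> real k * s" "k \<le> m"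
  shows "transport u s C m x = transport u s C k x"
  using assms(5)
proof (induction m rule: dec_induct)
  case (step m)
  have "real k * s \<le> real (Suc m) * s"
    using step assms(2) by (intro mult_right_mono) auto
  then have "x \<le> real (Suc m) * s"
    using assms(4) by linarith
  then have "transport u s C (Suc m) x = transport u s C m x"
    by (intro transport_Suc_stable assms(1-3))
  with step show ?case by (simp only:)
qed simp

lemma cn_transport:
  assumes C: "smooth C" "\<And>x. C x \<noteq> 0" and u: "norm u = 1" and t: "0 \<le> t" and s: "0 < s"
    and d: "\<And>y. y \<le> x \<Longrightarrow> cn r t (\<lambda>x. inverse (C x) - inverse u) y \<le> d"
  shows "cn r t (\<lambda>x. transport u s C k x - 1) x \<le> (1 + d) ^ k - 1"
  using d
proof (induction k arbitrary: x)
  case (Suc k)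
  \<comment> \<open>Inserting \<open>inverse u * u\<close> makes the next iterate a product of two
    factors near 1, to which \<open>cn_mult_near\<close> applies with both constants equal to
    1.\<close>
  define f where "f = (\<lambda>x. u * transport u s C k (x - s) * inverse u)"
  define g where "g = (\<lambda>x. u * inverse (C (x - s)))"
  have iu: "norm (inverse u) = 1" "u \<noteq> 0" using u by (auto simp: norm_inverse)
  have sm: "smooth (\<lambda>x. transport u s C k x - 1)" "smooth (\<lambda>x. inverse (C x) - inverse u)"
    by (intro smooth_diff smooth_inverse smooth_transport smooth_const C)+
  have sm': "smooth (\<lambda>x. transport u s C k (x + - s) - 1)" "smooth (\<lambda>x. inverse (C (x + - s)) - inverse u)"
    by (rule smooth_shift[OF sm(1)], rule smooth_shift[OF sm(2)])
  have f1: "f x - 1 = u * (transport u s C k (x + - s) - 1) * inverse u" for x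
    using iu by (simp add: f_def algebra_simps)
  have g1: "g x - 1 = u * (inverse (C (x + - s)) - inverse u)" for x
    using iu by (simp add: g_def algebra_simps)
  have f: "cn r t (\<lambda>x. f x - 1) x \<le> (1 + d) ^ k - 1"
  proof -
    have "cn r t (\<lambda>x. f x - 1) x = cn r t (\<lambda>x. transport u s C k x - 1) (x + - s)"
      unfolding f1 cn_unit_mult(2)[OF iu(1) smooth_mult[OF smooth_const sm'(1)]] cn_unit_mult(1)[OF u sm'(1)]
      by (rule cn_shift[OF sm(1)])
    also have "\<dots> \<le> (1 + d) ^ k - 1"
      using s by (intro Suc.IH Suc.prems) auto
    finally show ?thesis .
  qed
  have g: "cn r t (\<lambda>x. g x - 1) x \<le> d"
  proof -
    have "cn r t (\<lambda>x. g x - 1) x = cn r t (\<lambda>x. inverse (C x) - inverse u) (x + - s)"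
      unfolding g1 cn_unit_mult(1)[OF u sm'(2)] by (rule cn_shift[OF sm(2)])
    also have "\<dots> \<le> d" using s by (intro Suc.prems) auto
    finally show ?thesis .
  qed
  have "smooth f" "smooth g"
    unfolding f_def g_def using smooth_shift[OF smooth_transport[OF C, of u s k], of "- s"] smooth_shift[OF smooth_inverse[OF C], of "- s"]
    by (auto intro!: smooth_mult)
  then have "1 + cn r t (\<lambda>x. f x * g x - 1 * 1) x \<le> (1 + cn r t (\<lambda>x. f x - 1) x) * (1 + cn r t (\<lambda>x. g x - 1) x)"
    by (intro cn_mult_near t) auto
  also have "\<dots> \<le> (1 + ((1 + d) ^ k - 1)) * (1 + d)"
    using f g t order_trans[OF cn_nonneg[OF t] g] by (intro mult_mono add_left_mono) auto
  finally have *: "1 + cn r t (\<lambda>x. f x * g x - 1 * 1) x \<le> (1 + ((1 + d) ^ k - 1)) * (1 + d)" .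
  have "inverse u * (u * z) = z" for z
    using iu by (simp flip: mult.assoc)
  then have "f y * g y - 1 * 1 = transport u s C (Suc k) y - 1" for y
    by (simp add: f_def g_def mult.assoc)
  with * show ?case by (simp add: mult.commute del: transport.simps)
qed simp

text \<open>At x only about x / s steps contribute, since all earlier values of C are equal to u;
  this is the exponent in the bound. The number of iterations may vary with x because the iterates
  agree where they have become stationary.\<close>

lemma transport_right:
  fixes C :: "real \<Rightarrow> quat"
  assumes C: "smooth C" "\<And>x. C x \<noteq> 0" and u: "norm u = 1" and s: "0 < s"
    and C0: "\<And>x. x \<le> 0 \<Longrightarrow> C x = u"
  obtains g where "smooth g" "\<And>x. g x \<noteq> 0" "\<And>x. g (x + s) * C x = u * g x"
    "\<And>r t d x. 0 \<le> t \<Longrightarrow> (\<And>y. y \<le> x \<Longrightarrow> cn r t (\<lambda>x. inverse (C x) - inverse u) y \<le> d)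
      \<Longrightarrow> cn r t (\<lambda>x. g x - 1) x \<le> (1 + d) ^ (nat \<lceil>x / s\<rceil> + 1) - 1"
proof
  define g where "g x = transport u s C (nat \<lceil>x / s\<rceil>) x" for x
  have u0: "u \<noteq> 0" using u by auto
  have g: "g x = transport u s C k x" if "x \<le> real k * s" for k x
  proof -
    have "x / s \<le> real k" using that s by (simp add: field_simps)
    then have 1: "nat \<lceil>x / s\<rceil> \<le> k" by linarith
    have 2: "x \<le> real (nat \<lceil>x / s\<rceil>) * s"
      using s by (simp flip: pos_divide_le_eq add: real_nat_ceiling_ge)
    show ?thesis
      unfolding g_def by (rule transport_stable[OF u0 s C0 2 1, symmetric])
  qed
  have loc: "\<And>y. y \<in> {..<real k * s} \<Longrightarrow> g y = transport u s C k y" for k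
    using g by auto
  have mem: "x \<in> {..<real (nat \<lceil>x / s\<rceil> + 1) * s}" for x
  proof -
    have "x / s < real (nat \<lceil>x / s\<rceil> + 1)" by linarith
    then show ?thesis using s by (simp only: pos_divide_less_eq lessThan_iff)
  qed
  show "smooth g"
  proof (rule smooth_local)
    fix x
    show "\<exists>S h. open S \<and> x \<in> S \<and> smooth_on S h \<and> (\<forall>y\<in>S. g y = h y)"
    proof (intro exI conjI ballI)
      show "x \<in> {..<real (nat \<lceil>x / s\<rceil> + 1) * s}" by (rule mem)
      show "smooth_on {..<real (nat \<lceil>x / s\<rceil> + 1) * s} (transport u s C (nat \<lceil>x / s\<rceil> + 1))"
        using smooth_transport[OF C] by (simp only: smooth_iff_smooth_on smooth_on_subset[OF _ subset_UNIV])
    qed (simp_all only: loc open_lessThan)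
  qed
  show "g x \<noteq> 0" for x
    unfolding g_def using transport_nonzero u0 C(2) by blast
  show "g (x + s) * C x = u * g x" for x
  proof -
    have 1: "x \<le> real (nat \<lceil>x / s\<rceil>) * s"
      using s by (simp flip: pos_divide_le_eq add: real_nat_ceiling_ge)
    then have "x + s \<le> real (Suc (nat \<lceil>x / s\<rceil>)) * s" by (simp add: algebra_simps)
    from g[OF this] g[OF 1] show ?thesis
      using C(2)[of x] by (simp add: mult.assoc)
  qed
  show "cn r t (\<lambda>x. g x - 1) x \<le> (1 + d) ^ (nat \<lceil>x / s\<rceil> + 1) - 1"
    if "0 \<le> t" "\<And>y. y \<le> x \<Longrightarrow> cn r t (\<lambda>x. inverse (C x) - inverse u) y \<le> d" for r t d x
  proof -
    have "cn r t (\<lambda>x. g x - 1) x = cn r t (\<lambda>z. transport u s C (nat \<lceil>x / s\<rceil> + 1) z - 1) x"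
      by (rule cn_cong_open[OF _ mem]) (simp_all only: loc open_lessThan)
    also have "\<dots> \<le> (1 + d) ^ (nat \<lceil>x / s\<rceil> + 1) - 1"
      by (rule cn_transport[OF C u that(1) s that(2)])
    finally show ?thesis .
  qed
qed

text \<open>The reflection at L exchanges the two directions of the equation and replaces C by its
  inverse, so \<open>transport_right\<close> applies; its solution is read off at L + s - x.\<close>

lemma transport_left:
  fixes C :: "real \<Rightarrow> quat"
  assumes C: "smooth C" "\<And>x. C x \<noteq> 0" and u: "norm u = 1" and s: "0 < s"
    and CL: "\<And>x. L \<le> x \<Longrightarrow> C x = u"
  obtains g where "smooth g" "\<And>x. g x \<noteq> 0" "\<And>x. g (x + s) * C x = u * g x"
    "\<And>r t d x. 0 \<le> t \<Longrightarrow> (\<And>y. x - s \<le> y \<Longrightarrow> cn r t (\<lambda>x. C x - u) y \<le> d)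
      \<Longrightarrow> cn r t (\<lambda>x. g x - 1) x \<le> (1 + d) ^ (nat \<lceil>(L + s - x) / s\<rceil> + 1) - 1"
proof -
  have u0: "u \<noteq> 0" "norm (inverse u) = 1" using u by (auto simp: norm_inverse)
  define C' where "C' y = inverse (C (L - y))" for y
  have C': "smooth C'" "\<And>x. C' x \<noteq> 0" "\<And>x. x \<le> 0 \<Longrightarrow> C' x = inverse u"
    unfolding C'_def by (intro smooth_inverse smooth_reflect C) (auto simp: C CL)
  obtain h where h: "smooth h" "\<And>x. h x \<noteq> 0" "\<And>x. h (x + s) * C' x = inverse u * h x"
    "\<And>r t d x. 0 \<le> t \<Longrightarrow> (\<And>y. y \<le> x \<Longrightarrow> cn r t (\<lambda>x. inverse (C' x) - inverse (inverse u)) y \<le> d)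
      \<Longrightarrow> cn r t (\<lambda>x. h x - 1) x \<le> (1 + d) ^ (nat \<lceil>x / s\<rceil> + 1) - 1"
    using transport_right[OF C'(1,2) u0(2) s C'(3)] by metis
  have h1: "smooth (\<lambda>x. h x - 1)" by (intro smooth_diff h smooth_const)
  have C1: "smooth (\<lambda>x. C x - u)" by (intro smooth_diff C smooth_const)
  show thesis
  proof (rule that[of "\<lambda>x. h (L + s - x)"])
    show "smooth (\<lambda>x. h (L + s - x))" by (rule smooth_reflect[OF h(1)])
    show "h (L + s - x) \<noteq> 0" for x by (rule h)
    show "h (L + s - (x + s)) * C x = u * h (L + s - x)" for x
    proof -
      have "h (L - x + s) * inverse (C x) = inverse u * h (L - x)"
        using h(3)[of "L - x"] by (simp add: C'_def)
      then have "u * (h (L - x + s) * inverse (C x)) * C x = u * (inverse u * h (L - x)) * C x"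
        by simp
      then have "u * h (L - x + s) = h (L - x) * C x"
        using u0 C(2)[of x] by (simp add: mult.assoc) (simp flip: mult.assoc)
      then show ?thesis by (simp add: algebra_simps)
    qed
    show "cn r t (\<lambda>x. h (L + s - x) - 1) x \<le> (1 + d) ^ (nat \<lceil>(L + s - x) / s\<rceil> + 1) - 1"
      if "0 \<le> t" "\<And>y. x - s \<le> y \<Longrightarrow> cn r t (\<lambda>x. C x - u) y \<le> d" for r t d x
    proof -
      have "cn r t (\<lambda>x. inverse (C' x) - inverse (inverse u)) y \<le> d" if "y \<le> L + s - x" for y
      proof -
        have "cn r t (\<lambda>x. inverse (C' x) - inverse (inverse u)) y = cn r t (\<lambda>x. C x - u) (L - y)"
          using cn_reflect[OF C1, of r t L y] by (simp add: C'_def)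
        also have "\<dots> \<le> d" using that by (intro \<open>\<And>y. x - s \<le> y \<Longrightarrow> _\<close>) simp
        finally show ?thesis .
      qed
      then show ?thesis
        using h(4)[OF that(1)] by (simp only: cn_reflect[OF h1])
    qed
  qed
qed

text \<open>C is only near u, and only on a window, so neither transport applies to it directly. A
  cutoff at scale t replaces C by u on the left; transport from there makes the conjugated C equal
  to u beyond t, and the rest is transported from the other side. Each pass takes about t / s steps
  on the window, hence the square. The same h serves all r and d.\<close>

lemma straighten:
  obtains K :: "nat \<Rightarrow> real" where "\<And>r. 1 \<le> K r"
    "\<And>C u s t. \<lbrakk>smooth C; \<And>x. C x \<noteq> 0; norm u = 1; 0 < s; s \<le> t;
        \<And>x. 0 \<le> x \<Longrightarrow> x \<le> t \<Longrightarrow> norm (C x - u) < 1\<rbrakk>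
      \<Longrightarrow> \<exists>h::real \<Rightarrow> quat. smooth h \<and> (\<forall>x. h x \<noteq> 0) \<and> (\<forall>x. h (x + s) * C x = u * h x) \<and>
        (\<forall>r d. (\<forall>x\<in>{-3*t..3*t}. cn r t (\<lambda>x. C x - u) x \<le> d) \<longrightarrow> K r * d * (t / s)\<^sup>2 \<le> 1 \<longrightarrow>
          (\<forall>x\<in>{-2*t..3*t}. cn r t (\<lambda>x. h x - 1) x \<le> K r * d * (t / s)\<^sup>2))"
proof -
  obtain K0 where K0: "\<And>r. 1 \<le> K0 r" "\<And>r x. cn r 1 smooth_step x \<le> K0 r"
    using cn_smooth_step_bound by metis
  \<comment> \<open>15360 = 20 * 768: the first pass gives the 20 in \<open>d1\<close>, the second
    pass and the product of both conjugations give the 768 at the end.\<close>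
  define K where "K r = 15360 * K0 r" for r
  have main: "\<exists>h::real \<Rightarrow> quat. smooth h \<and> (\<forall>x. h x \<noteq> 0) \<and> (\<forall>x. h (x + s) * C x = u * h x) \<and>
        (\<forall>r d. (\<forall>x\<in>{-3*t..3*t}. cn r t (\<lambda>x. C x - u) x \<le> d) \<longrightarrow> K r * d * (t / s)\<^sup>2 \<le> 1 \<longrightarrow>
          (\<forall>x\<in>{-2*t..3*t}. cn r t (\<lambda>x. h x - 1) x \<le> K r * d * (t / s)\<^sup>2))"
    if C: "smooth C" "\<And>x. C x \<noteq> 0" and u: "norm u = 1" and s: "0 < s" "s \<le> t"
      and near: "\<And>x. 0 \<le> x \<Longrightarrow> x \<le> t \<Longrightarrow> norm (C x - u) < 1" for C u s t
  proof -
    have t: "0 < t" "0 \<le> t" using s by auto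
    have u0: "u \<noteq> 0" "norm (inverse u) = 1" using u by (auto simp: norm_inverse)
    \<comment> \<open>At scale t this cutoff has the norm that \<open>smooth_step\<close> has at
      scale 1, whatever t is.\<close>
    define cut where "cut x = smooth_step (x / t)" for x
    have cut: "smooth cut" "\<And>r x. cn r t cut x \<le> K0 r"
      using smooth_affine[OF smooth_smooth_step, of "1 / t" 0] cn_affine[OF smooth_smooth_step, of "1 / t" _ t 0] t K0(2)
      by (simp_all add: cut_def[abs_def])
    define Cp where "Cp x = u + cut x *\<^sub>R (C x - u)" for x
    have smCu: "smooth (\<lambda>x. C x - u)" by (intro smooth_diff C smooth_const)
    have Cp: "smooth Cp"
      unfolding Cp_def[abs_def] by (intro smooth_add smooth_const smooth_scaleR cut smCu)
    have Cp_left: "Cp x = u" if "x \<le> 0" for x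
      using that t by (simp add: Cp_def cut_def smooth_step_simps divide_nonpos_pos)
    have Cp_right: "Cp x = C x" if "t \<le> x" for x
      using that t by (simp add: Cp_def cut_def smooth_step_simps)
    have Cp0: "Cp x \<noteq> 0" for x
    proof -
      consider "x \<le> 0" | "0 \<le> x" "x \<le> t" | "t \<le> x" by linarith
      then show ?thesis
      proof cases
        case 2
        have "norm (cut x *\<^sub>R (C x - u)) \<le> 1 * norm (C x - u)"
          unfolding norm_scaleR using smooth_step_bounds by (intro mult_right_mono) (auto simp: cut_def)
        also have "\<dots> < 1" using near[OF 2] by simp
        finally have "norm (Cp x - u) < norm u" using u by (simp add: Cp_def)
        then show ?thesis by auto
      qed (use Cp_left Cp_right C u0 in auto)
    qed
    obtain gp where gp: "smooth gp" "\<And>x. gp x \<noteq> 0" "\<And>x. gp (x + s) * Cp x = u * gp x"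
      "\<And>r t d x. 0 \<le> t \<Longrightarrow> (\<And>y. y \<le> x \<Longrightarrow> cn r t (\<lambda>x. inverse (Cp x) - inverse u) y \<le> d)
        \<Longrightarrow> cn r t (\<lambda>x. gp x - 1) x \<le> (1 + d) ^ (nat \<lceil>x / s\<rceil> + 1) - 1"
      using transport_right[OF Cp Cp0 u s(1) Cp_left] by blast
    \<comment> \<open>This is C conjugated by \<open>gp\<close>, written with \<open>Cp\<close> so
      that the value u is visible wherever \<open>Cp\<close> and C agree.\<close>
    define C1 where "C1 x = u * gp x * inverse (Cp x) * C x * inverse (gp x)" for x
    have C1: "smooth C1" "\<And>x. C1 x \<noteq> 0"
      unfolding C1_def[abs_def] using u0 gp(2) C Cp0
      by (auto intro!: smooth_mult smooth_inverse gp(1) Cp)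
    have C1_right: "C1 x = u" if "t \<le> x" for x
      using Cp_right[OF that] C(2)[of x] gp(2)[of x] by (simp add: C1_def mult.assoc)
    have C1_eq: "C1 x * gp x = gp (x + s) * C x" for x
    proof -
      have "gp (x + s) = u * gp x * inverse (Cp x)"
        unfolding gp(3)[symmetric] using Cp0[of x] by (simp add: mult.assoc)
      then show ?thesis using gp(2)[of x] by (simp add: C1_def mult.assoc)
    qed
    obtain gm where gm: "smooth gm" "\<And>x. gm x \<noteq> 0" "\<And>x. gm (x + s) * C1 x = u * gm x"
      "\<And>r t1 d x. 0 \<le> t1 \<Longrightarrow> (\<And>y. x - s \<le> y \<Longrightarrow> cn r t1 (\<lambda>x. C1 x - u) y \<le> d)
        \<Longrightarrow> cn r t1 (\<lambda>x. gm x - 1) x \<le> (1 + d) ^ (nat \<lceil>(t + s - x) / s\<rceil> + 1) - 1"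
      using transport_left[OF C1 u s(1) C1_right] by blast
    have "cn r t (\<lambda>x. gm x * gp x - 1) x \<le> K r * d * (t / s)\<^sup>2"
      if d: "\<forall>x\<in>{-3*t..3*t}. cn r t (\<lambda>x. C x - u) x \<le> d" and small: "K r * d * (t / s)\<^sup>2 \<le> 1"
        and x: "-2*t \<le> x" "x \<le> 3*t" for r d x
    proof -
      define q where "q = t / s"
      have q: "1 \<le> q" using s by (simp add: q_def)
      have "0 \<in> {-3*t..3*t}" using t by simp
      then have d0: "0 \<le> d"
        using d cn_nonneg[OF t(2), of r "\<lambda>x. C x - u" 0] by (meson order_trans)
      define c where "c = K0 r * d"
      have c: "0 \<le> c" "d \<le> c" "15360 * (q * (q * c)) \<le> 1"
        using d0 K0(1)[of r] small mult_right_mono[OF K0(1) d0, of r]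
        by (auto simp: c_def K_def q_def power2_eq_square algebra_simps)
      have qc: "c \<le> q * c" "q * c \<le> q * (q * c)"
        using mult_right_mono[OF q c(1)] mult_left_mono[OF mult_right_mono[OF q c(1)], of q] q by auto
      have near_Cp: "cn r t (\<lambda>x. Cp x - u) y \<le> c" if "y \<le> 3*t" for y
      proof (cases "y < 0")
        case True
        then have "cn r t (\<lambda>x. Cp x - u) y = cn r t (\<lambda>_. 0::quat) y"
          by (rule_tac cn_cong_open[where S = "{..<0}"]) (auto simp: Cp_left)
        then show ?thesis using c(1) cn_const[of r t "0::quat"] by simp
      next
        case False
        have "cn r t (\<lambda>x. Cp x - u) y = cn r t (\<lambda>x. cut x *\<^sub>R (C x - u)) y"
          by (simp add: Cp_def)
        also have "\<dots> \<le> cn r t cut y * cn r t (\<lambda>x. C x - u) y"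
          by (rule cn_scaleR[OF t(2) cut(1) smCu])
        also have "\<dots> \<le> K0 r * d"
          using cut(2)[of r y] d that False K0(1)[of r] t
          by (intro mult_mono) auto
        finally show ?thesis by (simp add: c_def)
      qed
      have near_iCp: "cn r t (\<lambda>x. inverse (Cp x) - inverse u) y \<le> 2 * c" if "y \<le> 3*t" for y
      proof -
        have "cn r t (\<lambda>x. inverse (Cp x) - inverse u) y \<le> c / (1 - c)"
          using c qc by (intro cn_inverse_near t Cp Cp0 u near_Cp that) auto
        also have "\<dots> \<le> 2 * c"
        proof -
          have "c * 1 \<le> c * (2 * (1 - c))" using c qc by (intro mult_left_mono) auto
          then show ?thesis using c qc by (simp add: pos_divide_le_eq algebra_simps)
        qed
        finally show ?thesis .
      qed
      define d1 where "d1 = 20 * (q * c)"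
      have d1: "0 \<le> d1" "2 * c \<le> d1" "d \<le> d1" "768 * (q * d1) \<le> 1" "768 * d1 \<le> 1" "d1 \<le> q * d1"
      proof -
        have "q * d1 = 20 * (q * (q * c))" by (simp add: d1_def)
        then show "0 \<le> d1" "2 * c \<le> d1" "d \<le> d1" "768 * (q * d1) \<le> 1" "768 * d1 \<le> 1" "d1 \<le> q * d1"
          unfolding d1_def using c qc by linarith+
      qed
      have near_gp: "cn r t (\<lambda>x. gp x - 1) y \<le> d1" if "y \<le> 3*t" for y
      proof -
        let ?N = "nat \<lceil>y / s\<rceil> + 1"
        have "y / s \<le> 3 * q" using that s by (simp add: q_def divide_right_mono)
        then have N: "real ?N \<le> 5 * q" using q by linarith
        have N2: "real ?N * (2 * c) \<le> 10 * (q * c)"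
          using mult_right_mono[OF N, of "2 * c"] c by simp
        have "cn r t (\<lambda>x. gp x - 1) y \<le> (1 + 2 * c) ^ ?N - 1"
          using near_iCp that by (intro gp(4) t) auto
        also have "\<dots> \<le> 2 * (real ?N * (2 * c))"
        proof -
          have "0 \<le> 2 * c" "real ?N * (2 * c) \<le> 1" using N2 c qc by linarith+
          from power_one_plus_le[OF this] show ?thesis by linarith
        qed
        also have "\<dots> \<le> d1" using N2 by (simp add: d1_def)
        finally show ?thesis .
      qed
      have near_igp: "cn r t (\<lambda>x. inverse (gp x) - inverse 1) y \<le> 2 * d1" if "y \<le> 3*t" for y
      proof -
        have "cn r t (\<lambda>x. inverse (gp x) - inverse 1) y \<le> d1 / (1 - d1)"
          using d1 by (intro cn_inverse_near t gp near_gp that) auto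
        also have "\<dots> \<le> 2 * d1"
        proof -
          have "d1 * 1 \<le> d1 * (2 * (1 - d1))" using d1 by (intro mult_left_mono) auto
          then show ?thesis using d1 by (simp add: pos_divide_le_eq algebra_simps)
        qed
        finally show ?thesis .
      qed
      have near_C1: "cn r t (\<lambda>x. C1 x - u) y \<le> 16 * d1" if "x - s \<le> y" for y
      proof (cases "t < y")
        case True
        then have "cn r t (\<lambda>x. C1 x - u) y = cn r t (\<lambda>_. 0::quat) y"
          by (rule_tac cn_cong_open[where S = "{t<..}"]) (auto simp: C1_right)
        then show ?thesis using d1(1) cn_const[of r t "0::quat"] by simp
      next
        case False
        then have y: "- 3 * t \<le> y" "y \<le> t" "y \<le> 3 * t" using that x s by auto
        have sm: "smooth (\<lambda>x. u * gp x)" "smooth (\<lambda>x. u * gp x * inverse (Cp x))"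
          "smooth (\<lambda>x. u * gp x * inverse (Cp x) * C x)" "smooth (\<lambda>x. inverse (Cp x))" "smooth (\<lambda>x. inverse (gp x))"
          using gp(1,2) Cp Cp0 C by (auto intro!: smooth_mult smooth_inverse)
        have nu: "norm (u * 1) = 1" "norm (u * 1 * inverse u) = 1" "norm (u * 1 * inverse u * u) = 1" "norm (inverse (1::quat)) = 1" "norm (1::quat) = 1"
          using u by (simp_all add: norm_mult norm_inverse)
        have "1 + cn r t (\<lambda>x. u * gp x - u * 1) y \<le> (1 + cn r t (\<lambda>x. u - u) y) * (1 + cn r t (\<lambda>x. gp x - 1) y)"
          by (rule cn_mult_near[OF t(2) smooth_const gp(1) u nu(5)])
        also have "\<dots> \<le> (1 + 2 * d1)"
          using near_gp[OF y(3)] d1(1) cn_const[of r t "0::quat"] by simp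
        finally have 1: "1 + cn r t (\<lambda>x. u * gp x - u * 1) y \<le> 1 + 2 * d1" .
        have "1 + cn r t (\<lambda>x. u * gp x * inverse (Cp x) - u * 1 * inverse u) y
           \<le> (1 + cn r t (\<lambda>x. u * gp x - u * 1) y) * (1 + cn r t (\<lambda>x. inverse (Cp x) - inverse u) y)"
          by (rule cn_mult_near[OF t(2) sm(1,4) nu(1) u0(2)])
        also have "\<dots> \<le> (1 + 2 * d1) * (1 + 2 * d1)"
          using 1 near_iCp[OF y(3)] d1 t by (intro mult_mono) (auto intro: add_nonneg_nonneg)
        finally have 2: "1 + cn r t (\<lambda>x. u * gp x * inverse (Cp x) - u * 1 * inverse u) y \<le> (1 + 2 * d1) * (1 + 2 * d1)" .
        have "1 + cn r t (\<lambda>x. u * gp x * inverse (Cp x) * C x - u * 1 * inverse u * u) y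
           \<le> (1 + cn r t (\<lambda>x. u * gp x * inverse (Cp x) - u * 1 * inverse u) y) * (1 + cn r t (\<lambda>x. C x - u) y)"
          by (rule cn_mult_near[OF t(2) sm(2) C(1) nu(2) u])
        also have "\<dots> \<le> ((1 + 2 * d1) * (1 + 2 * d1)) * (1 + 2 * d1)"
          using 2 d y d1 t by (intro mult_mono) (auto intro: add_nonneg_nonneg order_trans[of _ d])
        finally have 3: "1 + cn r t (\<lambda>x. u * gp x * inverse (Cp x) * C x - u * 1 * inverse u * u) y
           \<le> ((1 + 2 * d1) * (1 + 2 * d1)) * (1 + 2 * d1)" .
        have "1 + cn r t (\<lambda>x. u * gp x * inverse (Cp x) * C x * inverse (gp x) - u * 1 * inverse u * u * inverse 1) y
           \<le> (1 + cn r t (\<lambda>x. u * gp x * inverse (Cp x) * C x - u * 1 * inverse u * u) y) * (1 + cn r t (\<lambda>x. inverse (gp x) - inverse 1) y)"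
          by (rule cn_mult_near[OF t(2) sm(3,5) nu(3,4)])
        also have "\<dots> \<le> (((1 + 2 * d1) * (1 + 2 * d1)) * (1 + 2 * d1)) * (1 + 2 * d1)"
          using 3 near_igp[OF y(3)] d1 t by (intro mult_mono) (auto intro: add_nonneg_nonneg)
        also have "\<dots> = (1 + 2 * d1) ^ 4" by (simp add: power4_eq_xxxx)
        also have "\<dots> \<le> 1 + 2 * (real 4 * (2 * d1))"
          using d1 by (intro power_one_plus_le) auto
        finally show ?thesis using u0 by (simp add: C1_def)
      qed
      have near_gm: "cn r t (\<lambda>x. gm x - 1) x \<le> 192 * (q * d1)"
      proof -
        let ?N = "nat \<lceil>(t + s - x) / s\<rceil> + 1"
        have "(t + s - x) / s \<le> (3 * t + s) / s" using x s by (intro divide_right_mono) auto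
        also have "\<dots> = 3 * q + 1" using s by (simp add: q_def field_simps)
        finally have N: "real ?N \<le> 6 * q" using q by linarith
        have N2: "real ?N * (16 * d1) \<le> 96 * (q * d1)"
          using mult_right_mono[OF N, of "16 * d1"] d1 by simp
        have "cn r t (\<lambda>x. gm x - 1) x \<le> (1 + 16 * d1) ^ ?N - 1"
          using near_C1 by (intro gm(4) t) auto
        also have "\<dots> \<le> 2 * (real ?N * (16 * d1))"
        proof -
          have "0 \<le> 16 * d1" "real ?N * (16 * d1) \<le> 1" using N2 d1 by linarith+
          from power_one_plus_le[OF this] show ?thesis by linarith
        qed
        finally show ?thesis using N2 by linarith
      qed
      have "1 + cn r t (\<lambda>x. gm x * gp x - 1 * 1) x
         \<le> (1 + cn r t (\<lambda>x. gm x - 1) x) * (1 + cn r t (\<lambda>x. gp x - 1) x)"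
        by (intro cn_mult_near t gm gp) auto
      also have "\<dots> \<le> (1 + 192 * (q * d1)) * (1 + 192 * (q * d1))"
        using near_gm near_gp[OF x(2)] d1 t by (intro mult_mono) (auto intro: add_nonneg_nonneg)
      also have "\<dots> = (1 + 192 * (q * d1)) ^ 2" by (simp add: power2_eq_square)
      also have "\<dots> \<le> 1 + 2 * (real 2 * (192 * (q * d1)))"
        using d1 by (intro power_one_plus_le) auto
      finally have "cn r t (\<lambda>x. gm x * gp x - 1) x \<le> 768 * (q * d1)" by simp
      also have "\<dots> = K r * d * (t / s)\<^sup>2"
        by (simp add: d1_def c_def K_def q_def power2_eq_square)
      finally show ?thesis .
    qed
    moreover have "gm (x + s) * gp (x + s) * C x = u * (gm x * gp x)" for x
    proof -
      have "gm (x + s) * gp (x + s) * C x = gm (x + s) * C1 x * gp x"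
        using C1_eq[of x] by (simp only: mult.assoc)
      then show ?thesis by (simp only: gm(3) mult.assoc)
    qed
    ultimately show ?thesis
      using gm(2) gp(2) by (intro exI[of _ "\<lambda>x. gm x * gp x"]) (auto intro!: smooth_mult gm gp)
  qed
  moreover have "1 \<le> K r" for r using K0(1)[of r] by (simp add: K_def)
  ultimately show thesis using that[of K] by blast
qed

section \<open>Renormalization in terms of quaternions\<close>

primrec qiter :: "real \<Rightarrow> (real \<Rightarrow> quat) \<Rightarrow> nat \<Rightarrow> real \<Rightarrow> quat" where
  "qiter s C 0 x = 1"
| "qiter s C (Suc k) x = C (x + real k * s) * qiter s C k x"

lemma smooth_qiter: "smooth C \<Longrightarrow> smooth (qiter s C k)"
proof (induction k)
  case 0
  then show ?case by (simp add: qiter.simps(1)[abs_def])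
next
  case (Suc k)
  then show ?case
    unfolding qiter.simps(2)[abs_def] by (intro smooth_mult smooth_shift) auto
qed

lemma qiter_nonzero: "(\<And>x. C x \<noteq> 0) \<Longrightarrow> qiter s C k x \<noteq> 0"
  by (induction k) auto

lemma qiter_conjugate:
  assumes "\<And>x. g x \<noteq> 0"
  shows "qiter s (\<lambda>x. g (x + s) * C x * inverse (g x)) k x = g (x + real k * s) * qiter s C k x * inverse (g x)"
proof (induction k)
  case (Suc k)
  have "inverse (g (x + real k * s)) * (g (x + real k * s) * z) = z" for z
    using assms by (simp flip: mult.assoc)
  moreover have "x + (1 + real k) * s = x + real k * s + s" by (simp add: algebra_simps)
  ultimately show ?case using Suc by (simp add: mult.assoc add.assoc)
qed (simp add: assms)

lemma cn_qiter:
  assumes C: "smooth C" and v: "norm v = 1" and t: "0 \<le> t"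
    and d: "\<And>x. cn r t (\<lambda>x. C x - v) x \<le> d"
  shows "cn r t (\<lambda>x. qiter s C k x - v ^ k) x \<le> (1 + d) ^ k - 1"
proof (induction k)
  case (Suc k)
  have "1 + cn r t (\<lambda>x. C (x + real k * s) * qiter s C k x - v * v ^ k) x
      \<le> (1 + cn r t (\<lambda>x. C (x + real k * s) - v) x) * (1 + cn r t (\<lambda>x. qiter s C k x - v ^ k) x)"
    by (intro cn_mult_near t smooth_shift smooth_qiter C) (simp_all add: norm_power v)
  also have "cn r t (\<lambda>x. C (x + real k * s) - v) x = cn r t (\<lambda>x. C x - v) (x + real k * s)"
    using cn_shift[of "\<lambda>x. C x - v" r t "real k * s" x] C by (simp add: smooth_diff)
  also have "(1 + cn r t (\<lambda>x. C x - v) (x + real k * s)) * (1 + cn r t (\<lambda>x. qiter s C k x - v ^ k) x)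
      \<le> (1 + d) * (1 + ((1 + d) ^ k - 1))"
    using Suc d t order_trans[OF cn_nonneg[OF t] d] by (intro mult_mono add_left_mono) (auto intro: add_nonneg_nonneg)
  finally show ?case by simp
qed simp

lemma cn_inverse_qiter:
  assumes C: "smooth C" "\<And>x. C x \<noteq> 0" and v: "norm v = 1" and t: "0 \<le> t"
    and d: "\<And>x. cn r t (\<lambda>x. inverse (C x) - inverse v) x \<le> d"
  shows "cn r t (\<lambda>x. inverse (qiter s C k x) - inverse (v ^ k)) x \<le> (1 + d) ^ k - 1"
proof (induction k)
  case (Suc k)
  have sm: "smooth (\<lambda>x. inverse (C x))" "smooth (\<lambda>x. inverse (qiter s C k x))"
    by (intro smooth_inverse C smooth_qiter qiter_nonzero)+
  have v0: "v \<noteq> 0" using v by auto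
  have "inverse (C (y + real k * s) * qiter s C k y) - inverse (v * v ^ k)
     = inverse (qiter s C k y) * inverse (C (y + real k * s)) - inverse (v ^ k) * inverse v" for y
    using C(2) v0 qiter_nonzero[OF C(2)] by (simp add: nonzero_inverse_mult_distrib)
  then have "1 + cn r t (\<lambda>x. inverse (qiter s C (Suc k) x) - inverse (v ^ Suc k)) x
      = 1 + cn r t (\<lambda>x. inverse (qiter s C k x) * inverse (C (x + real k * s)) - inverse (v ^ k) * inverse v) x"
    by simp
  also have "\<dots> \<le> (1 + cn r t (\<lambda>x. inverse (qiter s C k x) - inverse (v ^ k)) x) * (1 + cn r t (\<lambda>x. inverse (C (x + real k * s)) - inverse v) x)"
    by (intro cn_mult_near t smooth_shift[OF sm(1)] sm(2)) (simp_all add: norm_power v norm_inverse)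
  also have "cn r t (\<lambda>x. inverse (C (x + real k * s)) - inverse v) x = cn r t (\<lambda>x. inverse (C x) - inverse v) (x + real k * s)"
    using cn_shift[of "\<lambda>x. inverse (C x) - inverse v" r t "real k * s" x] sm by (simp add: smooth_diff)
  also have "(1 + cn r t (\<lambda>x. inverse (qiter s C k x) - inverse (v ^ k)) x) * (1 + cn r t (\<lambda>x. inverse (C x) - inverse v) (x + real k * s))
      \<le> (1 + ((1 + d) ^ k - 1)) * (1 + d)"
    using Suc d t order_trans[OF cn_nonneg[OF t] d] by (intro mult_mono add_left_mono) (auto intro: add_nonneg_nonneg)
  finally show ?case by (simp add: mult.commute)
qed simp

lemma anticommuting_units_sym: "anticommuting_units u v \<Longrightarrow> anticommuting_units v u"
  by (simp add: anticommuting_units_def)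

lemma anticommuting_units_minus: "anticommuting_units u v \<Longrightarrow> anticommuting_units u (- v)"
  by (simp add: anticommuting_units_def)

lemma anticommuting_units_power: "anticommuting_units u v \<Longrightarrow> anticommuting_units (u * v ^ k) v"
proof (induction k)
  case (Suc k)
  then have "anticommuting_units v ((u * v ^ k) * v)"
    by (intro anticommuting_units_mult(1)) auto
  then show ?case
    using anticommuting_units_sym by (metis mult.assoc power_Suc2)
qed simp

lemma anticommuting_units_inverse_power:
  assumes "anticommuting_units u v" shows "anticommuting_units (u * inverse (v ^ k)) v"
proof -
  have "inverse v = - v"
    using assms by (intro inverse_square_minus_one) (simp add: anticommuting_units_def)
  then have "inverse (v ^ k) = v ^ k \<or> inverse (v ^ k) = - (v ^ k)"
    by (metis power_inverse power_minus_even power_minus_odd)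
  then show ?thesis
    using anticommuting_units_power[OF assms, of k]
      anticommuting_units_minus[OF anticommuting_units_sym[OF anticommuting_units_power[OF assms, of k]]]
    by (auto intro: anticommuting_units_sym)
qed

lemma anticommuting_units_conjugate_unit:
  assumes "anticommuting_units u v"
  obtains q where "norm q = 1" "q * u = qi * q" "q * v = qj * q"
proof -
  obtain p where "p \<noteq> 0" "p * u = qi * p" "p * v = qj * p"
    using anticommuting_units_conjugate[OF assms anticommuting_units_ij] by blast
  then show thesis by (intro that[of "p /\<^sub>R norm p"]) auto
qed

lemma periodic_reduce:
  fixes f :: "real \<Rightarrow> 'a" and p :: real
  assumes "0 < p" "\<And>x. f (x + p) = f x"
  obtains y where "0 \<le> y" "y < p" "f y = f x"
proof
  define k where "k = \<lfloor>x / p\<rfloor>"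
  have nat: "f (y + real n * p) = f y" for n y
  proof (induction n)
    case (Suc n)
    have "y + real (Suc n) * p = y + real n * p + p" by (simp add: algebra_simps)
    then show ?case using Suc assms(2)[of "y + real n * p"] by (simp add: add.assoc)
  qed simp
  have "f (x - of_int k * p) = f x"
  proof (cases "k \<ge> 0")
    case True
    then show ?thesis using nat[of "x - of_int k * p" "nat k"] by simp
  next
    case False
    then show ?thesis using nat[of x "nat (- k)"] by simp
  qed
  then show "f (x - of_int k * p) = f x" .
  have "of_int k \<le> x / p" "x / p < of_int k + 1" by (simp_all add: k_def)
  then show "0 \<le> x - of_int k * p" "x - of_int k * p < p"
    using assms(1) by (simp_all add: field_simps)
qed

text \<open>The quaternions \<open>G n x\<close> lift the fibre maps over the translations by \<open>b n\<close>. The generators of an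
  action of \<open>\<int>\<^sup>2\<close> commute as rotations; that their lifts anticommute expresses that the cocycle is not
  homotopic to the identity.\<close>

locale renormalization =
  fixes b :: "nat \<Rightarrow> real" and a :: "nat \<Rightarrow> nat" and G :: "nat \<Rightarrow> real \<Rightarrow> quat"
  assumes b_pos: "0 < b n" and b_dec: "b (Suc n) < b n" and a_pos: "1 \<le> a n"
    and b_rec: "b n = b (Suc (Suc n)) + real (a n) * b (Suc n)"
    and G_smooth: "smooth (G n)" and G_norm: "norm (G n x) = 1"
    and G_rec: "G n x = G (Suc (Suc n)) (x + real (a n) * b (Suc n)) * qiter (b (Suc n)) (G (Suc n)) (a n) x"
    and G_anticommute: "G n (x + b (Suc n)) * G (Suc n) x = - (G (Suc n) (x + b n) * G n x)"
begin

lemma b_nonneg: "0 \<le> b n" using b_pos[of n] by simp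

lemma b_antimono: "n \<le> m \<Longrightarrow> b m \<le> b n"
  by (rule lift_Suc_antimono_le[of b]) (simp_all add: less_imp_le[OF b_dec])

lemma G_nonzero: "G n x \<noteq> 0" using G_norm[of n x] by auto

definition tw :: "(real \<Rightarrow> quat) \<Rightarrow> nat \<Rightarrow> real \<Rightarrow> quat" where
  "tw g n x = g (x + b n) * G n x * inverse (g x)"

text \<open>The first generator is normalized exactly, the second only up to e. Exactness is what
  yields the symmetry \<open>tw_Suc_shift\<close>, and later the periodicity of quotients of two
  gauges. Gauges need not have norm one.\<close>

definition gauge :: "nat \<Rightarrow> nat \<Rightarrow> real \<Rightarrow> (real \<Rightarrow> quat) \<Rightarrow> bool" where
  "gauge n r e g \<longleftrightarrow> smooth g \<and> (\<forall>x. g x \<noteq> 0) \<and> (\<forall>x. tw g n x = qi) \<and>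
     (\<forall>x. cn r (b n) (\<lambda>x. tw g (Suc n) x - qj) x \<le> e)"

lemma smooth_tw: "smooth g \<Longrightarrow> (\<And>x. g x \<noteq> 0) \<Longrightarrow> smooth (tw g n)"
  unfolding tw_def[abs_def] by (intro smooth_mult smooth_shift smooth_inverse G_smooth)

lemma tw_nonzero: "(\<And>x. g x \<noteq> 0) \<Longrightarrow> tw g n x \<noteq> 0"
  by (simp add: tw_def G_nonzero)

lemma tw_mult: "(\<And>x. h x \<noteq> 0) \<Longrightarrow> (\<And>x. g x \<noteq> 0) \<Longrightarrow>
    tw (\<lambda>x. h x * g x) n x = h (x + b n) * tw g n x * inverse (h x)"
  by (simp add: tw_def nonzero_inverse_mult_distrib mult.assoc)

lemma tw_rec:
  assumes "\<And>x. g x \<noteq> 0"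
  shows "tw g n x = tw g (Suc (Suc n)) (x + real (a n) * b (Suc n)) * qiter (b (Suc n)) (tw g (Suc n)) (a n) x"
proof -
  let ?y = "x + real (a n) * b (Suc n)"
  have "qiter (b (Suc n)) (tw g (Suc n)) (a n) x = g ?y * qiter (b (Suc n)) (G (Suc n)) (a n) x * inverse (g x)"
    using qiter_conjugate[of g, OF assms, of "b (Suc n)" "G (Suc n)" "a n" x] by (simp add: tw_def[abs_def])
  moreover have "x + b n = ?y + b (Suc (Suc n))" using b_rec[of n] by simp
  moreover have "inverse (g ?y) * (g ?y * z) = z" for z using assms by (simp flip: mult.assoc)
  ultimately show ?thesis
    by (simp add: tw_def G_rec[of n x] mult.assoc add.assoc)
qed

lemma tw_rec_inverse:
  assumes "\<And>x. g x \<noteq> 0"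
  shows "tw g (Suc (Suc n)) x = tw g n (x - real (a n) * b (Suc n))
    * inverse (qiter (b (Suc n)) (tw g (Suc n)) (a n) (x - real (a n) * b (Suc n)))"
  using tw_rec[of g, OF assms, of n "x - real (a n) * b (Suc n)"] qiter_nonzero[of "tw g (Suc n)", OF tw_nonzero[of g, OF assms]]
  by (simp add: mult.assoc)

lemma tw_anticommute:
  assumes "\<And>x. g x \<noteq> 0"
  shows "tw g n (x + b (Suc n)) * tw g (Suc n) x = - (tw g (Suc n) (x + b n) * tw g n x)"
proof -
  have i: "inverse (g y) * (g y * z) = z" for y z using assms by (simp flip: mult.assoc)
  have "tw g n (x + b (Suc n)) * tw g (Suc n) x
      = g (x + b (Suc n) + b n) * (G n (x + b (Suc n)) * G (Suc n) x) * inverse (g x)"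
    by (simp add: tw_def mult.assoc i)
  also have "\<dots> = - (g (x + b n + b (Suc n)) * (G (Suc n) (x + b n) * G n x) * inverse (g x))"
    by (simp add: G_anticommute add_ac)
  also have "\<dots> = - (tw g (Suc n) (x + b n) * tw g n x)"
    by (simp add: tw_def mult.assoc i)
  finally show ?thesis .
qed

text \<open>Anticommutation with a constant first generator, read as a twisted periodicity: bounds
  on the second generator over one period hold on the whole line.\<close>

lemma tw_Suc_shift:
  assumes "\<And>x. g x \<noteq> 0" "\<And>x. tw g n x = u" "u * u = -1"
  shows "tw g (Suc n) (x + b n) = u * tw g (Suc n) x * u"
proof -
  have "tw g (Suc n) (x + b n) * u = - (u * tw g (Suc n) x)"
    using tw_anticommute[of g, OF assms(1), of n x] by (simp add: assms(2))
  then have "tw g (Suc n) (x + b n) * u * u = - (u * tw g (Suc n) x) * u" by simp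
  then show ?thesis by (simp add: mult.assoc assms(3))
qed

lemma cn_tw_Suc_shift:
  assumes g: "smooth g" "\<And>x. g x \<noteq> 0" "\<And>x. tw g n x = u" and uv: "anticommuting_units u v"
  shows "cn r t (\<lambda>x. tw g (Suc n) x - v) (x + b n) = cn r t (\<lambda>x. tw g (Suc n) x - v) x"
proof -
  have u: "u * u = -1" "norm u = 1" "u * v * u = v"
    using uv anticommuting_units_norm[OF uv]
    by (auto simp: anticommuting_units_def mult.assoc)
  have sm: "smooth (\<lambda>x. tw g (Suc n) x - v)"
    by (intro smooth_diff smooth_tw g smooth_const)
  have "tw g (Suc n) (x + b n) - v = u * (tw g (Suc n) x - v) * u" for x
    using tw_Suc_shift[of g, OF g(2,3) u(1)] u(3) by (simp add: algebra_simps)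
  then have "cn r t (\<lambda>x. tw g (Suc n) (x + b n) - v) x = cn r t (\<lambda>x. tw g (Suc n) x - v) x"
    by (simp only: cn_unit_mult(2)[OF u(2) smooth_mult[OF smooth_const sm]] cn_unit_mult(1)[OF u(2) sm])
  then show ?thesis using cn_shift[OF sm] by simp
qed

lemma cn_tw_Suc_bound:
  assumes g: "smooth g" "\<And>x. g x \<noteq> 0" "\<And>x. tw g n x = u" and uv: "anticommuting_units u v"
    and d: "\<And>x. 0 \<le> x \<Longrightarrow> x \<le> b n \<Longrightarrow> cn r t (\<lambda>x. tw g (Suc n) x - v) x \<le> d"
  shows "cn r t (\<lambda>x. tw g (Suc n) x - v) x \<le> d"
proof -
  obtain y where "0 \<le> y" "y < b n" "cn r t (\<lambda>x. tw g (Suc n) x - v) y = cn r t (\<lambda>x. tw g (Suc n) x - v) x"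
    using periodic_reduce[OF b_pos[of n], of "cn r t (\<lambda>x. tw g (Suc n) x - v)" x] cn_tw_Suc_shift[OF g uv] by metis
  then show ?thesis using d[of y] by simp
qed

text \<open>A constant unit moves the model pair (u, v) to (i, j), and conjugation by it is an
  isometry for \<open>cn\<close>.\<close>

lemma gauge_standardize:
  assumes g: "smooth g" "\<And>x. g x \<noteq> 0" "\<And>x. tw g n x = u" and uv: "anticommuting_units u v"
    and q: "norm q = 1" "q * u = qi * q" "q * v = qj * q"
    and d: "\<And>x. cn r (b n) (\<lambda>x. tw g (Suc n) x - v) x \<le> d"
  shows "gauge n r d (\<lambda>x. q * g x)"
  unfolding gauge_def
proof (intro conjI allI)
  have q0: "q \<noteq> 0" "norm (inverse q) = 1" using q(1) by (auto simp: norm_inverse)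
  have conj: "tw (\<lambda>x. q * g x) m x = q * tw g m x * inverse q" for m x
    by (rule tw_mult) (use q0 g in auto)
  have sm: "smooth (\<lambda>x. tw g (Suc n) x - v)"
    by (intro smooth_diff smooth_tw g smooth_const)
  show "smooth (\<lambda>x. q * g x)" by (intro smooth_mult smooth_const g)
  show "q * g x \<noteq> 0" for x using q0 g by simp
  show "tw (\<lambda>x. q * g x) n x = qi" for x
    unfolding conj g(3) q(2) using q0 by (simp add: mult.assoc)
  have "tw (\<lambda>x. q * g x) (Suc n) x - qj = q * (tw g (Suc n) x - v) * inverse q" for x
    unfolding conj using q0 q(3) by (simp add: algebra_simps)
  then show "cn r (b n) (\<lambda>x. tw (\<lambda>x. q * g x) (Suc n) x - qj) x \<le> d" for x
    using d[of x] by (simp only: cn_unit_mult(2)[OF q0(2) smooth_mult[OF smooth_const sm]] cn_unit_mult(1)[OF q(1) sm])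
qed

end

lemma cn_twist:
  fixes h T :: "real \<Rightarrow> quat"
  assumes t: "0 \<le> t" and h: "smooth h" "\<And>x. h x \<noteq> 0" and T: "smooth T" and v: "norm v = 1"
    and D: "cn r t (\<lambda>x. h x - 1) (x + c) \<le> D" "cn r t (\<lambda>x. h x - 1) x \<le> D"
      "cn r t (\<lambda>x. T x - v) x \<le> D" "6 * D \<le> 1"
  shows "cn r t (\<lambda>x. h (x + c) * T x * inverse (h x) - v) x \<le> 12 * D"
proof -
  have D0: "0 \<le> D" using order_trans[OF cn_nonneg[OF t] D(2)] .
  have sm: "smooth (\<lambda>x. h (x + c))" "smooth (\<lambda>x. h (x + c) * T x)" "smooth (\<lambda>x. inverse (h x))"
    by (intro smooth_mult smooth_shift smooth_inverse h T)+
  have "smooth (\<lambda>x. h x - 1)" by (intro smooth_diff h smooth_const)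
  from cn_shift[OF this] have "cn r t (\<lambda>x. h (x + c) - 1) x \<le> D" using D(1) by simp
  moreover have "1 + cn r t (\<lambda>x. h (x + c) * T x - 1 * v) x
      \<le> (1 + cn r t (\<lambda>x. h (x + c) - 1) x) * (1 + cn r t (\<lambda>x. T x - v) x)"
    by (intro cn_mult_near t sm T v) simp
  moreover have "(1 + cn r t (\<lambda>x. h (x + c) - 1) x) * (1 + cn r t (\<lambda>x. T x - v) x) \<le> (1 + D) * (1 + D)"
    using calculation(1) D D0 t by (intro mult_mono) (auto intro: add_nonneg_nonneg)
  ultimately have 1: "1 + cn r t (\<lambda>x. h (x + c) * T x - 1 * v) x \<le> (1 + D) * (1 + D)" by linarith
  have "cn r t (\<lambda>x. inverse (h x) - inverse 1) x \<le> D / (1 - D)"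
    using D D0 by (intro cn_inverse_near t h) auto
  also have "\<dots> \<le> 2 * D"
  proof -
    have "D * 1 \<le> D * (2 * (1 - D))" using D0 D(4) by (intro mult_left_mono) auto
    then show ?thesis using D0 D(4) by (simp add: pos_divide_le_eq algebra_simps)
  qed
  finally have 2: "cn r t (\<lambda>x. inverse (h x) - inverse 1) x \<le> 2 * D" .
  have "1 + cn r t (\<lambda>x. h (x + c) * T x * inverse (h x) - 1 * v * inverse 1) x
      \<le> (1 + cn r t (\<lambda>x. h (x + c) * T x - 1 * v) x) * (1 + cn r t (\<lambda>x. inverse (h x) - inverse 1) x)"
    by (intro cn_mult_near t sm) (simp_all add: v)
  also have "\<dots> \<le> ((1 + D) * (1 + D)) * (1 + 2 * D)"
    using 1 2 D0 t by (intro mult_mono) (auto intro: add_nonneg_nonneg)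
  also have "\<dots> \<le> ((1 + 2 * D) * (1 + 2 * D)) * (1 + 2 * D)"
    using D0 by (intro mult_right_mono mult_mono) auto
  also have "\<dots> = (1 + 2 * D) ^ 3" by (simp add: power3_eq_cube)
  also have "\<dots> \<le> 1 + 2 * (real 3 * (2 * D))"
    using D0 D(4) by (intro power_one_plus_le) auto
  finally show ?thesis by simp
qed

section \<open>Gauges and their transfer between steps\<close>

context renormalization
begin

text \<open>Here \<open>straighten\<close> is used with s = t = \<open>b n\<close>, so no power of t
  / s is lost. Closeness is required on its window only; the bound for the second generator is
  obtained on one period and then spread by \<open>cn_tw_Suc_bound\<close>. That one g' serves all r
  and d lets the gauges of \<open>initial_gauges\<close> be good in all orders at once.\<close>

lemma gauge_of_near:
  obtains K :: "nat \<Rightarrow> real" where "\<And>r. 1 \<le> K r"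
    "\<And>n g u v. \<lbrakk>smooth g; \<And>x. g x \<noteq> 0; anticommuting_units u v;
        \<And>x. 0 \<le> x \<Longrightarrow> x \<le> b n \<Longrightarrow> norm (tw g n x - u) < 1\<rbrakk>
      \<Longrightarrow> \<exists>g'. \<forall>r d. (\<forall>x\<in>{-3 * b n..3 * b n}. cn r (b n) (\<lambda>x. tw g n x - u) x \<le> d
            \<and> cn r (b n) (\<lambda>x. tw g (Suc n) x - v) x \<le> d) \<longrightarrow> K r * d \<le> 1 \<longrightarrow> gauge n r (K r * d) g'"
proof -
  obtain K0 where K0: "\<And>r. 1 \<le> K0 r"
    "\<And>C u s t. \<lbrakk>smooth C; \<And>x. C x \<noteq> 0; norm u = 1; 0 < s; s \<le> t;
        \<And>x. 0 \<le> x \<Longrightarrow> x \<le> t \<Longrightarrow> norm (C x - u) < 1\<rbrakk>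
      \<Longrightarrow> \<exists>h::real \<Rightarrow> quat. smooth h \<and> (\<forall>x. h x \<noteq> 0) \<and> (\<forall>x. h (x + s) * C x = u * h x) \<and>
        (\<forall>r d. (\<forall>x\<in>{-3*t..3*t}. cn r t (\<lambda>x. C x - u) x \<le> d) \<longrightarrow> K0 r * d * (t / s)\<^sup>2 \<le> 1 \<longrightarrow>
          (\<forall>x\<in>{-2*t..3*t}. cn r t (\<lambda>x. h x - 1) x \<le> K0 r * d * (t / s)\<^sup>2))"
    using straighten by blast
  have main: "\<exists>g'. \<forall>r d. (\<forall>x\<in>{-3 * b n..3 * b n}. cn r (b n) (\<lambda>x. tw g n x - u) x \<le> d
            \<and> cn r (b n) (\<lambda>x. tw g (Suc n) x - v) x \<le> d) \<longrightarrow> 12 * K0 r * d \<le> 1 \<longrightarrow> gauge n r (12 * K0 r * d) g'"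
    if g: "smooth g" "\<And>x. g x \<noteq> 0" and uv: "anticommuting_units u v"
      and near: "\<And>x. 0 \<le> x \<Longrightarrow> x \<le> b n \<Longrightarrow> norm (tw g n x - u) < 1" for n g u v
  proof -
    have nu: "norm u = 1" "norm v = 1" using anticommuting_units_norm[OF uv] by auto
    obtain h where h: "smooth h" "\<And>x. h x \<noteq> 0" "\<And>x. h (x + b n) * tw g n x = u * h x"
      and h_near: "\<And>r d x. (\<forall>x\<in>{-3*b n..3*b n}. cn r (b n) (\<lambda>x. tw g n x - u) x \<le> d) \<Longrightarrow> K0 r * d \<le> 1 \<Longrightarrow>
          x\<in>{-2*b n..3*b n} \<Longrightarrow> cn r (b n) (\<lambda>x. h x - 1) x \<le> K0 r * d"
      using K0(2)[OF smooth_tw[OF g, of n] tw_nonzero[of g n, OF g(2)] nu(1) b_pos[of n] order_refl near] b_pos[of n]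
      by auto
    obtain q where q: "norm q = 1" "q * u = qi * q" "q * v = qj * q"
      using anticommuting_units_conjugate_unit[OF uv] by blast
    define g2 where "g2 = (\<lambda>x. h x * g x)"
    have g2: "smooth g2" "\<And>x. g2 x \<noteq> 0"
      unfolding g2_def by (intro smooth_mult h g) (simp add: h g)
    have tw2: "tw g2 m x = h (x + b m) * tw g m x * inverse (h x)" for m x
      unfolding g2_def by (rule tw_mult[of h g, OF h(2) g(2)])
    have g2u: "tw g2 n x = u" for x
      unfolding tw2 h(3) using h(2)[of x] by (simp add: mult.assoc)
    have "gauge n r (12 * K0 r * d) (\<lambda>x. q * g2 x)"
      if d: "\<forall>x\<in>{-3 * b n..3 * b n}. cn r (b n) (\<lambda>x. tw g n x - u) x \<le> d
            \<and> cn r (b n) (\<lambda>x. tw g (Suc n) x - v) x \<le> d" and small: "12 * K0 r * d \<le> 1" for r d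
    proof (rule gauge_standardize[OF g2 g2u uv q])
      fix x
      have "cn r (b n) (\<lambda>x. tw g2 (Suc n) x - v) y \<le> 12 * (K0 r * d)" if y: "0 \<le> y" "y \<le> b n" for y
        unfolding tw2
      proof (rule cn_twist[OF b_nonneg h(1,2) smooth_tw[OF g] nu(2)])
        have "cn r (b n) (\<lambda>x. tw g (Suc n) x - v) y \<le> d" "0 \<le> d"
          using d y order_trans[OF cn_nonneg[OF b_nonneg[of n]], of r "\<lambda>x. tw g n x - u" y d] b_pos[of n] by auto
        then show "cn r (b n) (\<lambda>x. tw g (Suc n) x - v) y \<le> K0 r * d"
          using mult_right_mono[OF K0(1)[of r], of d] by simp
        show "6 * (K0 r * d) \<le> 1"
          using \<open>0 \<le> d\<close> K0(1)[of r] small mult_nonneg_nonneg[of "K0 r" d] by simp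
        then have "K0 r * d \<le> 1" using \<open>0 \<le> d\<close> K0(1)[of r] mult_nonneg_nonneg[of "K0 r" d] by linarith
        then show "cn r (b n) (\<lambda>x. h x - 1) (y + b (Suc n)) \<le> K0 r * d" "cn r (b n) (\<lambda>x. h x - 1) y \<le> K0 r * d"
          using d y b_pos[of n] b_pos[of "Suc n"] b_dec[of n] by (auto intro!: h_near)
      qed
      then show "cn r (b n) (\<lambda>x. tw g2 (Suc n) x - v) x \<le> 12 * K0 r * d"
        using cn_tw_Suc_bound[OF g2 g2u uv] by (simp add: mult.assoc)
    qed
    then show ?thesis by blast
  qed
  have "1 \<le> 12 * K0 r" for r using K0(1)[of r] by linarith
  then show thesis using that[of "\<lambda>r. 12 * K0 r"] main by blast
qed

text \<open>The generators at step n + k are words of lengths L and L' in those at step n. The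
  lengths obey the recursion of the denominators of convergents, so the weighted sum with
  \<open>b\<close> is invariant; it gives \<open>L' * b (n + k)\<close> at most
  \<open>2 * b n\<close>. Inverses are carried along because passing to a later step divides by a
  power.\<close>

lemma near_words:
  fixes k :: nat
  assumes g: "smooth g" "\<And>x. g x \<noteq> 0" and uv: "anticommuting_units u v" and t: "0 \<le> t"
    and d: "\<And>x. cn r t (\<lambda>x. tw g n x - u) x \<le> d" "\<And>x. cn r t (\<lambda>x. inverse (tw g n x) - inverse u) x \<le> d"
      "\<And>x. cn r t (\<lambda>x. tw g (Suc n) x - v) x \<le> d" "\<And>x. cn r t (\<lambda>x. inverse (tw g (Suc n) x) - inverse v) x \<le> d"
  shows "\<exists>w w' L L'. anticommuting_units w w' \<and> L \<le> L' \<and>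
      real L' * b (n + k) + real L * b (Suc (n + k)) = b n + b (Suc n) \<and>
      (\<forall>x. cn r t (\<lambda>x. tw g (n + k) x - w) x \<le> (1 + d) ^ L - 1) \<and>
      (\<forall>x. cn r t (\<lambda>x. inverse (tw g (n + k) x) - inverse w) x \<le> (1 + d) ^ L - 1) \<and>
      (\<forall>x. cn r t (\<lambda>x. tw g (Suc (n + k)) x - w') x \<le> (1 + d) ^ L' - 1) \<and>
      (\<forall>x. cn r t (\<lambda>x. inverse (tw g (Suc (n + k)) x) - inverse w') x \<le> (1 + d) ^ L' - 1)"
proof (induction k)
  case 0
  show ?case
    by (rule exI[of _ u], rule exI[of _ v], rule exI[of _ "1::nat"], rule exI[of _ "1::nat"]) (use uv d in simp)
next
  case (Suc k)
  let ?m = "n + k"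
  obtain w w' L L' where w: "anticommuting_units w w'" and L: "L \<le> L'"
      "real L' * b ?m + real L * b (Suc ?m) = b n + b (Suc n)"
    and near: "\<And>x. cn r t (\<lambda>x. tw g ?m x - w) x \<le> (1 + d) ^ L - 1"
      "\<And>x. cn r t (\<lambda>x. inverse (tw g ?m x) - inverse w) x \<le> (1 + d) ^ L - 1"
      "\<And>x. cn r t (\<lambda>x. tw g (Suc ?m) x - w') x \<le> (1 + d) ^ L' - 1"
      "\<And>x. cn r t (\<lambda>x. inverse (tw g (Suc ?m) x) - inverse w') x \<le> (1 + d) ^ L' - 1"
    using Suc.IH by blast
  define c where "c = - (real (a ?m) * b (Suc ?m))"
  define Q where "Q = qiter (b (Suc ?m)) (tw g (Suc ?m)) (a ?m)"
  have d0: "0 \<le> d" by (rule order_trans[OF cn_nonneg[OF t] d(1)])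
  have nw: "norm w = 1" "norm w' = 1" using anticommuting_units_norm[OF w] by auto
  have T: "smooth (tw g m)" "\<And>x. tw g m x \<noteq> 0" for m
    by (rule smooth_tw[OF g], rule tw_nonzero[of g m, OF g(2)])
  have Q: "smooth Q" "\<And>x. Q x \<noteq> 0"
    unfolding Q_def by (rule smooth_qiter[OF T(1)], rule qiter_nonzero[of "tw g (Suc ?m)", OF T(2)])
  have Q_near: "cn r t (\<lambda>x. Q x - w' ^ a ?m) x \<le> (1 + ((1 + d) ^ L' - 1)) ^ a ?m - 1"
    "cn r t (\<lambda>x. inverse (Q x) - inverse (w' ^ a ?m)) x \<le> (1 + ((1 + d) ^ L' - 1)) ^ a ?m - 1" for x
    unfolding Q_def by (rule cn_qiter[OF T(1) nw(2) t near(3)], rule cn_inverse_qiter[OF T(1) T(2) nw(2) t near(4)])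
  have tw_eq: "tw g (Suc (Suc ?m)) x = tw g ?m (x + c) * inverse (Q (x + c))" for x
    unfolding c_def Q_def using tw_rec_inverse[of g, OF g(2), of ?m x] by simp
  define W where "W = w * inverse (w' ^ a ?m)"
  have sm: "smooth (\<lambda>x. tw g ?m x * inverse (Q x) - W)" "smooth (\<lambda>x. Q x * inverse (tw g ?m x) - inverse W)"
    by (intro smooth_diff smooth_mult smooth_inverse T Q smooth_const)+
  have pow: "(1 + ((1 + d) ^ L - 1)) * (1 + ((1 + ((1 + d) ^ L' - 1)) ^ a ?m - 1)) = (1 + d) ^ (L + a ?m * L')"
    by (simp add: power_add power_mult[symmetric] mult.commute)
  have nn: "0 \<le> (1 + d) ^ l - 1" for l using d0 by (simp add: one_le_power)
  have W_near1: "cn r t (\<lambda>x. tw g ?m x * inverse (Q x) - W) x \<le> (1 + d) ^ (L + a ?m * L') - 1" for x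
  proof -
    have "1 + cn r t (\<lambda>x. tw g ?m x * inverse (Q x) - W) x
      \<le> (1 + cn r t (\<lambda>x. tw g ?m x - w) x) * (1 + cn r t (\<lambda>x. inverse (Q x) - inverse (w' ^ a ?m)) x)"
      unfolding W_def by (intro cn_mult_near t T smooth_inverse Q nw) (simp add: norm_inverse norm_power nw)
    also have "\<dots> \<le> (1 + ((1 + d) ^ L - 1)) * (1 + ((1 + ((1 + d) ^ L' - 1)) ^ a ?m - 1))"
      using t nn d0 by (intro mult_mono add_left_mono near Q_near) (auto intro: add_nonneg_nonneg)
    finally show ?thesis unfolding pow by linarith
  qed
  have W_inv: "inverse W = w' ^ a ?m * inverse w"
    unfolding W_def using nw by (subst nonzero_inverse_mult_distrib) auto
  have W_near2: "cn r t (\<lambda>x. Q x * inverse (tw g ?m x) - inverse W) x \<le> (1 + d) ^ (L + a ?m * L') - 1" for x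
  proof -
    have "1 + cn r t (\<lambda>x. Q x * inverse (tw g ?m x) - inverse W) x
      \<le> (1 + cn r t (\<lambda>x. Q x - w' ^ a ?m) x) * (1 + cn r t (\<lambda>x. inverse (tw g ?m x) - inverse w) x)"
      unfolding W_inv by (intro cn_mult_near t T smooth_inverse Q nw) (simp_all add: norm_inverse norm_power nw)
    also have "\<dots> \<le> (1 + ((1 + ((1 + d) ^ L' - 1)) ^ a ?m - 1)) * (1 + ((1 + d) ^ L - 1))"
      using t nn d0 by (intro mult_mono add_left_mono near Q_near) (auto intro: add_nonneg_nonneg)
    also have "\<dots> = (1 + d) ^ (L + a ?m * L')" unfolding pow[symmetric] by (simp only: mult.commute)
    finally show ?thesis by linarith
  qed
  have inv_eq: "inverse (tw g (Suc (Suc ?m)) x) = Q (x + c) * inverse (tw g ?m (x + c))" for x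
    unfolding tw_eq using T(2) Q(2) by (subst nonzero_inverse_mult_distrib) auto
  show ?case
  proof (intro exI conjI allI)
    show "anticommuting_units w' W"
      unfolding W_def using anticommuting_units_sym[OF anticommuting_units_inverse_power[OF w]] .
    show "L' \<le> L + a ?m * L'" using a_pos[of ?m] by (metis le_add2 mult_le_mono1 mult_1 le_trans)
    show "real (L + a ?m * L') * b (n + Suc k) + real L' * b (Suc (n + Suc k)) = b n + b (Suc n)"
      using L(2) b_rec[of ?m] by (simp add: algebra_simps)
    show "cn r t (\<lambda>x. tw g (n + Suc k) x - w') x \<le> (1 + d) ^ L' - 1" for x using near(3) by simp
    show "cn r t (\<lambda>x. inverse (tw g (n + Suc k) x) - inverse w') x \<le> (1 + d) ^ L' - 1" for x using near(4) by simp
    show "cn r t (\<lambda>x. tw g (Suc (n + Suc k)) x - W) x \<le> (1 + d) ^ (L + a ?m * L') - 1" for x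
      using cn_shift[OF sm(1), of r t c x] W_near1[of "x + c"] by (simp add: tw_eq)
    show "cn r t (\<lambda>x. inverse (tw g (Suc (n + Suc k)) x) - inverse W) x \<le> (1 + d) ^ (L + a ?m * L') - 1" for x
      using cn_shift[OF sm(2), of r t c x] W_near2[of "x + c"] by (simp add: inv_eq)
  qed
qed

lemma near_words_down:
  assumes g: "smooth g" "\<And>x. g x \<noteq> 0" and uv: "anticommuting_units u v" and t: "0 \<le> t"
    and d: "\<And>x. cn r t (\<lambda>x. tw g m x - u) x \<le> d" "\<And>x. cn r t (\<lambda>x. tw g (Suc m) x - v) x \<le> d"
    and n: "n < m"
  shows "\<exists>w w' L L'. anticommuting_units w w' \<and> real L * b m \<le> 2 * b n \<and> real L' * b m \<le> 2 * b (Suc n) \<and>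
      (\<forall>x. cn r t (\<lambda>x. tw g n x - w) x \<le> (1 + d) ^ L - 1) \<and>
      (\<forall>x. cn r t (\<lambda>x. tw g (Suc n) x - w') x \<le> (1 + d) ^ L' - 1)"
proof -
  have d0: "0 \<le> d" by (rule order_trans[OF cn_nonneg[OF t] d(1)])
  have T: "smooth (tw g m)" "\<And>x. tw g m x \<noteq> 0" for m
    by (rule smooth_tw[OF g], rule tw_nonzero[of g m, OF g(2)])
  have step: "anticommuting_units (w' * w ^ a k) w \<and>
      (\<forall>x. cn r t (\<lambda>x. tw g k x - w' * w ^ a k) x \<le> (1 + d) ^ (L' + a k * L) - 1)"
    if w: "anticommuting_units w w'" and near: "\<forall>x. cn r t (\<lambda>x. tw g (Suc k) x - w) x \<le> (1 + d) ^ L - 1"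
      "\<forall>x. cn r t (\<lambda>x. tw g (Suc (Suc k)) x - w') x \<le> (1 + d) ^ L' - 1" for w w' k L L'
  proof
    have nw: "norm w = 1" "norm w' = 1" using anticommuting_units_norm[OF w] by auto
    show "anticommuting_units (w' * w ^ a k) w"
      by (rule anticommuting_units_power[OF anticommuting_units_sym[OF w]])
    define c where "c = real (a k) * b (Suc k)"
    define Q where "Q = qiter (b (Suc k)) (tw g (Suc k)) (a k)"
    have Q: "smooth Q" unfolding Q_def by (rule smooth_qiter[OF T(1)])
    have Q_near: "cn r t (\<lambda>x. Q x - w ^ a k) x \<le> (1 + ((1 + d) ^ L - 1)) ^ a k - 1" for x
      unfolding Q_def using near(1) by (intro cn_qiter[OF T(1) nw(1) t]) auto
    have sm: "smooth (\<lambda>x. tw g (Suc (Suc k)) x - w')" by (intro smooth_diff T smooth_const)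
    show "\<forall>x. cn r t (\<lambda>x. tw g k x - w' * w ^ a k) x \<le> (1 + d) ^ (L' + a k * L) - 1"
    proof
      fix x
      have "1 + cn r t (\<lambda>x. tw g k x - w' * w ^ a k) x
          = 1 + cn r t (\<lambda>x. tw g (Suc (Suc k)) (x + c) * Q x - w' * w ^ a k) x"
        unfolding tw_rec[of g, OF g(2), of k] c_def Q_def by simp
      also have "\<dots> \<le> (1 + cn r t (\<lambda>x. tw g (Suc (Suc k)) (x + c) - w') x) * (1 + cn r t (\<lambda>x. Q x - w ^ a k) x)"
        by (intro cn_mult_near t Q smooth_shift[OF T(1)] nw) (simp add: norm_power nw)
      also have "\<dots> \<le> (1 + ((1 + d) ^ L' - 1)) * (1 + ((1 + ((1 + d) ^ L - 1)) ^ a k - 1))"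
        using cn_shift[OF sm, of r t c x] near(2)[rule_format, of "x + c"] Q_near[of x] t d0
        by (intro mult_mono) (auto intro: add_nonneg_nonneg)
      also have "\<dots> = (1 + d) ^ (L' + a k * L)"
        by (simp add: power_add power_mult[symmetric] mult.commute)
      finally show "cn r t (\<lambda>x. tw g k x - w' * w ^ a k) x \<le> (1 + d) ^ (L' + a k * L) - 1" by linarith
    qed
  qed
  have "\<exists>w w' L L'. anticommuting_units w w' \<and> real L * b m \<le> 2 * b n \<and> real L' * b m \<le> 2 * b (Suc n) \<and>
      (\<forall>x. cn r t (\<lambda>x. tw g n x - w) x \<le> (1 + d) ^ L - 1) \<and>
      (\<forall>x. cn r t (\<lambda>x. tw g (Suc n) x - w') x \<le> (1 + d) ^ L' - 1)" if "n + Suc j = m" for n j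
    using that
  proof (induction j arbitrary: n)
    case 0
    then have m: "m = Suc n" by simp
    have 1: "\<forall>x. cn r t (\<lambda>x. tw g (Suc n) x - u) x \<le> (1 + d) ^ 1 - 1"
      "\<forall>x. cn r t (\<lambda>x. tw g (Suc (Suc n)) x - v) x \<le> (1 + d) ^ 1 - 1"
      using d by (simp_all add: m)
    have "1 * b (Suc n) \<le> real (a n) * b (Suc n)"
      using a_pos[of n] b_pos[of "Suc n"] by (intro mult_right_mono) auto
    then have "real (1 + a n * 1) * b m \<le> 2 * b n"
      using b_rec[of n] b_pos[of "Suc (Suc n)"] by (simp add: m algebra_simps)
    moreover have "real 1 * b m \<le> 2 * b (Suc n)" using b_pos[of m] by (simp add: m)
    ultimately show ?case using step[OF uv 1] 1(1) by blast
  next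
    case (Suc j)
    obtain w w' L L' where w: "anticommuting_units w w'"
      and L: "real L * b m \<le> 2 * b (Suc n)" "real L' * b m \<le> 2 * b (Suc (Suc n))"
      and near: "\<forall>x. cn r t (\<lambda>x. tw g (Suc n) x - w) x \<le> (1 + d) ^ L - 1"
      "\<forall>x. cn r t (\<lambda>x. tw g (Suc (Suc n)) x - w') x \<le> (1 + d) ^ L' - 1"
      using Suc.IH[of "Suc n"] Suc.prems by auto
    have "real (L' + a n * L) * b m = real L' * b m + real (a n) * (real L * b m)"
      by (simp add: algebra_simps)
    also have "\<dots> \<le> 2 * b (Suc (Suc n)) + real (a n) * (2 * b (Suc n))"
      using L by (intro add_mono mult_left_mono) auto
    also have "\<dots> = 2 * b n" using b_rec[of n] by simp
    finally show ?case using step[OF w near] near(1) L(1) by blast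
  qed
  from this[of n "m - Suc n"] show ?thesis using n by simp
qed

lemma gaugeD:
  assumes "gauge n r e g"
  shows "smooth g" "\<And>x. g x \<noteq> 0" "\<And>x. tw g n x = qi"
    "\<And>x. cn r (b n) (\<lambda>x. tw g (Suc n) x - qj) x \<le> e" "0 \<le> e"
proof -
  show *: "cn r (b n) (\<lambda>x. tw g (Suc n) x - qj) x \<le> e" for x
    using assms by (simp add: gauge_def)
  show "0 \<le> e" by (rule order_trans[OF cn_nonneg[OF b_nonneg] *])
qed (use assms in \<open>simp_all add: gauge_def\<close>)

text \<open>One factor \<open>b n / b m\<close> is the length of the words, and r more come from
  measuring at the coarser scale \<open>b n\<close>.\<close>

lemma gauge_pull_back:
  obtains K :: "nat \<Rightarrow> real" where "\<And>r. 1 \<le> K r"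
    "\<And>n m r e g. n < m \<Longrightarrow> gauge m r e g \<Longrightarrow> K r * e * (b n / b m) ^ (r + 1) \<le> 1
      \<Longrightarrow> \<exists>g'. gauge n r (K r * e * (b n / b m) ^ (r + 1)) g'"
proof -
  obtain K where K: "\<And>r. 1 \<le> K r"
    "\<And>n g u v. \<lbrakk>smooth g; \<And>x. g x \<noteq> 0; anticommuting_units u v;
        \<And>x. 0 \<le> x \<Longrightarrow> x \<le> b n \<Longrightarrow> norm (tw g n x - u) < 1\<rbrakk>
      \<Longrightarrow> \<exists>g'. \<forall>r d. (\<forall>x\<in>{-3 * b n..3 * b n}. cn r (b n) (\<lambda>x. tw g n x - u) x \<le> d
            \<and> cn r (b n) (\<lambda>x. tw g (Suc n) x - v) x \<le> d) \<longrightarrow> K r * d \<le> 1 \<longrightarrow> gauge n r (K r * d) g'"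
    using gauge_of_near by blast
  have main: "\<exists>g'. gauge n r (8 * K r * e * (b n / b m) ^ (r + 1)) g'"
    if n: "n < m" and g: "gauge m r e g" and small: "8 * K r * e * (b n / b m) ^ (r + 1) \<le> 1" for n m r e g
  proof -
    note g = gaugeD[OF g]
    define q where "q = b n / b m"
    have q: "1 \<le> q" using b_antimono[of n m] n b_pos[of m] by (simp add: q_def)
    have e: "cn r (b m) (\<lambda>x. tw g m x - qi) x \<le> e" for x
      using g(3,5) cn_const[of r "b m" "0::quat" x] by simp
    obtain w w' L L' where w: "anticommuting_units w w'"
      and L: "real L * b m \<le> 2 * b n" "real L' * b m \<le> 2 * b (Suc n)"
      and near: "\<And>x. cn r (b m) (\<lambda>x. tw g n x - w) x \<le> (1 + e) ^ L - 1"
        "\<And>x. cn r (b m) (\<lambda>x. tw g (Suc n) x - w') x \<le> (1 + e) ^ L' - 1"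
      using near_words_down[OF g(1,2) anticommuting_units_ij b_nonneg e g(4) n] by blast
    have q1: "1 \<le> q ^ r" "q \<le> q ^ (r + 1)" using q by (simp_all add: one_le_power mult_left_le)
    have eq: "e * q \<le> e * q ^ (r + 1)" using q1 g(5) by (intro mult_left_mono)
    have Keq: "e * q ^ (r + 1) \<le> K r * (e * q ^ (r + 1))"
      using K(1)[of r] g(5) q by (intro mult_right_mono[of 1 "K r", simplified]) auto
    have pow: "(1 + e) ^ l - 1 \<le> 4 * (e * q)" if "real l * b m \<le> 2 * b n" for l
    proof -
      have "real l \<le> 2 * q" using that b_pos[of m] by (simp add: q_def field_simps)
      then have "real l * e \<le> 2 * q * e" using g(5) by (intro mult_right_mono)
      moreover have "2 * (e * q) \<le> 1" using eq Keq small g(5) q by (simp add: q_def[symmetric] mult.assoc)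
      ultimately show ?thesis
        using power_one_plus_le[OF g(5), of l] by (simp add: mult.commute mult.left_commute)
    qed
    have L2: "real L' * b m \<le> 2 * b n" using L(2) b_dec[of n] by linarith
    define d where "d = 4 * (e * q ^ (r + 1))"
    have d: "cn r (b n) f x \<le> d" if "cn r (b m) f x \<le> 4 * (e * q)" for f :: "real \<Rightarrow> quat" and x
    proof -
      have "cn r (b n) f x \<le> q ^ r * cn r (b m) f x"
        unfolding q_def using b_antimono[of n m] n b_pos[of m] by (intro cn_change_scale) auto
      also have "\<dots> \<le> q ^ r * (4 * (e * q))" using that q by (intro mult_left_mono) auto
      finally show ?thesis by (simp add: d_def mult.commute mult.left_commute)
    qed
    have dw: "cn r (b n) (\<lambda>x. tw g n x - w) x \<le> d" "cn r (b n) (\<lambda>x. tw g (Suc n) x - w') x \<le> d" for x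
      using order_trans[OF near(1) pow[OF L(1)]] order_trans[OF near(2) pow[OF L2]] by (auto intro: d)
    have Kd: "2 * (K r * d) \<le> 1" using small by (simp add: d_def q_def[symmetric] mult.assoc)
    have "2 * d \<le> 1" using Kd Keq by (simp add: d_def)
    then have "norm (tw g n x - w) < 1" for x
      using norm_le_cn[OF b_nonneg, of "\<lambda>x. tw g n x - w" x r n] dw(1)[of x] by linarith
    from K(2)[OF g(1,2) w this] obtain g' where "\<And>r d. (\<forall>x\<in>{-3 * b n..3 * b n}. cn r (b n) (\<lambda>x. tw g n x - w) x \<le> d
            \<and> cn r (b n) (\<lambda>x. tw g (Suc n) x - w') x \<le> d) \<Longrightarrow> K r * d \<le> 1 \<Longrightarrow> gauge n r (K r * d) g'"
      by blast
    then have "gauge n r (K r * d) g'" using dw Kd g(5) q K(1)[of r] by (simp add: d_def)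
    then have "gauge n r (8 * K r * e * q ^ (r + 1)) g'"
      unfolding gauge_def d_def using g(5) q K(1)[of r]
      by (auto intro: order_trans mult_nonneg_nonneg)
    then show ?thesis unfolding q_def by blast
  qed
  have "1 \<le> 8 * K r" for r using K(1)[of r] by linarith
  then show thesis using that[of "\<lambda>r. 8 * K r"] main by blast
qed

end

lemma pure_square: "qRe M = 0 \<Longrightarrow> M * M = - ((norm M)\<^sup>2 *\<^sub>R 1)"
  by (simp add: quat_eq_iff norm_quat_sq) (simp add: power2_eq_square)

lemma anticommuting_units_normalize:
  assumes u: "u * u = -1" and M: "u * M = - (M * u)" "M \<noteq> 0"
  shows "anticommuting_units u (M /\<^sub>R norm M)"
proof -
  \<comment> \<open>The real part behaves like a trace, so the two products have the same one; they
    are M and - M.\<close>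
  have "qRe (u * (M * u)) = qRe ((M * u) * u)" by simp
  moreover have "u * (M * u) = M" "(M * u) * u = - M"
    using u M by (simp_all add: mult.assoc flip: mult.assoc[of u M u]) 
  ultimately have "qRe M = 0" by simp
  moreover have "inverse (norm M) * (inverse (norm M) * (norm M)\<^sup>2) = 1"
    using M(2) by (simp add: power2_eq_square field_simps)
  ultimately have "(M /\<^sub>R norm M) * (M /\<^sub>R norm M) = -1"
    using pure_square[of M] by simp
  then show ?thesis
    using u M by (simp add: anticommuting_units_def)
qed

lemma nth_derivative_diff_const: "smooth f \<Longrightarrow> 1 \<le> k \<Longrightarrow> nth_derivative k (\<lambda>x. f x - c) = nth_derivative k f"
  by (cases k) (simp_all add: nth_derivative_Suc vd_diff_const)

context renormalization
begin

text \<open>The norm of g has period \<open>b m\<close>, and the norm of the second generator is its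
  quotient over a shift: at most 1 at a maximum of the norm of g, at least 1 at a minimum. This
  keeps the mean M in \<open>gauge_improve\<close> near the unit sphere.\<close>

lemma tw_norm_crossing:
  assumes g: "smooth g" "\<And>x. g x \<noteq> 0" and u: "\<And>x. norm (tw g m x) = 1"
  obtains x y where "norm (tw g (Suc m) x) \<le> 1" "1 \<le> norm (tw g (Suc m) y)"
proof -
  define k where "k x = norm (g x)" for x
  have k_pos: "0 < k x" for x using g(2) by (simp add: k_def)
  have nt: "norm (tw g l x) = k (x + b l) / k x" for l x
    by (simp add: tw_def k_def norm_mult norm_inverse G_norm divide_inverse)
  have k_per: "k (x + b m) = k x" for x
    using u[of x] k_pos[of x] by (simp add: nt)
  have cont: "continuous_on {0..b m} k"
    unfolding k_def[abs_def] by (intro continuous_on_norm smooth_continuous g)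
  have ne: "{0..b m} \<noteq> {}" using b_pos[of m] by simp
  obtain x where x: "\<And>y. y \<in> {0..b m} \<Longrightarrow> k y \<le> k x"
    using continuous_attains_sup[OF compact_Icc ne cont] by blast
  obtain y where y: "\<And>z. z \<in> {0..b m} \<Longrightarrow> k y \<le> k z"
    using continuous_attains_inf[OF compact_Icc ne cont] by blast
  have all: "k z \<le> k x" "k y \<le> k z" for z
  proof -
    obtain z' where "0 \<le> z'" "z' < b m" "k z' = k z"
      using periodic_reduce[of "b m" k z, OF b_pos[of m] k_per] by blast
    then show "k z \<le> k x" "k y \<le> k z" using x[of z'] y[of z'] by auto
  qed
  show thesis
    by (rule that[of x y]) (use all k_pos in \<open>simp_all add: nt pos_divide_le_eq pos_le_divide_eq\<close>)
qed

text \<open>The cube is the loss: one factor for the length of the words, two for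
  \<open>straighten\<close> with t = \<open>b n\<close> and s = \<open>b m\<close>. The gain comes
  from the period \<open>2 * b m\<close> of the new second generator: each derivative of order at
  least one is controlled by the one of order r. What is left is a constant near an element that
  anticommutes with the first generator.\<close>

lemma gauge_improve:
  obtains K :: "nat \<Rightarrow> real" where "\<And>r. 1 \<le> K r"
    "\<And>n m r e g. n \<le> m \<Longrightarrow> 1 \<le> r \<Longrightarrow> gauge n r e g \<Longrightarrow> K r * e * (b n / b m) ^ 3 \<le> 1
      \<Longrightarrow> \<exists>g'. gauge m r (K r * e * (b n / b m) ^ 3 * (b m / b n) ^ r) g'"
proof -
  obtain K0 where K0: "\<And>r. 1 \<le> K0 r"
    "\<And>C u s t. \<lbrakk>smooth C; \<And>x. C x \<noteq> 0; norm u = 1; 0 < s; s \<le> t;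
        \<And>x. 0 \<le> x \<Longrightarrow> x \<le> t \<Longrightarrow> norm (C x - u) < 1\<rbrakk>
      \<Longrightarrow> \<exists>h::real \<Rightarrow> quat. smooth h \<and> (\<forall>x. h x \<noteq> 0) \<and> (\<forall>x. h (x + s) * C x = u * h x) \<and>
        (\<forall>r d. (\<forall>x\<in>{-3*t..3*t}. cn r t (\<lambda>x. C x - u) x \<le> d) \<longrightarrow> K0 r * d * (t / s)\<^sup>2 \<le> 1 \<longrightarrow>
          (\<forall>x\<in>{-2*t..3*t}. cn r t (\<lambda>x. h x - 1) x \<le> K0 r * d * (t / s)\<^sup>2))"
    using straighten by blast
  \<comment> \<open>16 ^ r is 2 ^ r for passing from single derivatives to \<open>cn\<close>, times
    8 ^ r for the factor 4 and the period \<open>2 * b m\<close> in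
    \<open>periodic_nth_derivative_bound\<close>. 576 = 6 * 12 * 8 collects the 6 of
    \<open>Fv\<close>, the 12 of \<open>cn_twist\<close> and the 8 in D.\<close>
  define K where "K r = 576 * 16 ^ r * K0 r" for r
  have main: "\<exists>g'. gauge m r (K r * e * (b n / b m) ^ 3 * (b m / b n) ^ r) g'"
    if nm: "n \<le> m" and r: "1 \<le> r" and g: "gauge n r e g" and small: "K r * e * (b n / b m) ^ 3 \<le> 1" for n m r e g
  proof -
    note g = gaugeD[OF g]
    define q where "q = b n / b m"
    have q: "1 \<le> q" using b_antimono[OF nm] b_pos[of m] by (simp add: q_def)
    have q3: "q \<le> q ^ 3" "q ^ 3 = q * q\<^sup>2"
      using q self_le_power[of q 3] by (simp_all add: power3_eq_cube power2_eq_square)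
    define E where "E = K0 r * e * q ^ 3"
    have E: "0 \<le> E" "576 * 16 ^ r * E \<le> 1"
      using small g(5) q K0(1)[of r] by (simp_all add: K_def E_def q_def[symmetric] mult.assoc)
    have "1 * E \<le> 16 ^ r * E" "8 ^ r * E \<le> 16 ^ r * E"
      using E(1) by (intro mult_right_mono power_mono; simp)+
    then have E2: "576 * E \<le> 1" "576 * (8 ^ r * E) \<le> 1" using E(2) by linarith+
    have "1 * (e * q) \<le> K0 r * (e * q ^ 3)"
      using g(5) q q3 K0(1)[of r] by (intro mult_mono) auto
    then have eqE: "e * q \<le> E" by (simp add: E_def mult.assoc)
    have "e * 1 \<le> e * q" using g(5) q by (intro mult_left_mono) auto
    then have e: "576 * e \<le> 1" "e \<le> E" using eqE E2 by linarith+
    have bn: "0 < b n" "0 \<le> b n" using b_pos[of n] by auto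
    have nj: "norm qj = 1" "norm qi = 1" by simp_all
    have ie: "cn r (b n) (\<lambda>x. inverse (tw g (Suc n) x) - inverse qj) x \<le> 2 * e" for x
    proof -
      have "cn r (b n) (\<lambda>x. inverse (tw g (Suc n) x) - inverse qj) x \<le> e / (1 - e)"
        using e by (intro cn_inverse_near bn(2) smooth_tw g tw_nonzero nj) auto
      also have "\<dots> \<le> 2 * e"
      proof -
        have "e * 1 \<le> e * (2 * (1 - e))" using g(5) e by (intro mult_left_mono) auto
        then show ?thesis using e by (simp add: pos_divide_le_eq algebra_simps)
      qed
      finally show ?thesis .
    qed
    have e2: "e \<le> 2 * e" using g(5) by simp
    obtain k where k: "m = n + k" using nm le_Suc_ex by blast
    have "\<exists>w w' L L'. anticommuting_units w w' \<and> L \<le> L' \<and>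
      real L' * b (n + k) + real L * b (Suc (n + k)) = b n + b (Suc n) \<and>
      (\<forall>x. cn r (b n) (\<lambda>x. tw g (n + k) x - w) x \<le> (1 + 2 * e) ^ L - 1) \<and>
      (\<forall>x. cn r (b n) (\<lambda>x. inverse (tw g (n + k) x) - inverse w) x \<le> (1 + 2 * e) ^ L - 1) \<and>
      (\<forall>x. cn r (b n) (\<lambda>x. tw g (Suc (n + k)) x - w') x \<le> (1 + 2 * e) ^ L' - 1) \<and>
      (\<forall>x. cn r (b n) (\<lambda>x. inverse (tw g (Suc (n + k)) x) - inverse w') x \<le> (1 + 2 * e) ^ L' - 1)"
      by (rule near_words[OF g(1,2) anticommuting_units_ij bn(2) _ _ order_trans[OF g(4) e2] ie])
        (use g(3,5) cn_const[of r "b n" "0::quat"] in simp_all)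
    then obtain w w' L L' where w: "anticommuting_units w w'" and L: "L \<le> L'"
      "real L' * b m + real L * b (Suc m) = b n + b (Suc n)"
      and near: "\<And>x. cn r (b n) (\<lambda>x. tw g m x - w) x \<le> (1 + 2 * e) ^ L - 1"
      "\<And>x. cn r (b n) (\<lambda>x. tw g (Suc m) x - w') x \<le> (1 + 2 * e) ^ L' - 1"
      unfolding k by blast
    have nw: "norm w = 1" "norm w' = 1" "w * w = -1"
      using anticommuting_units_norm[OF w] w by (auto simp: anticommuting_units_def)
    define d where "d = 8 * (e * q)"
    have pow: "(1 + 2 * e) ^ l - 1 \<le> d" if "l \<le> L'" for l
    proof -
      have "real L' * b m \<le> 2 * b n"
        using L(2) b_dec[of n] mult_nonneg_nonneg[OF _ b_nonneg, of "real L" "Suc m"] by linarith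
      then have "real L' \<le> 2 * q" using b_pos[of m] by (simp add: q_def field_simps)
      then have "real l \<le> 2 * q" using that by linarith
      then have "real l * (2 * e) \<le> 2 * q * (2 * e)" using g(5) by (intro mult_right_mono) auto
      then have "real l * (2 * e) \<le> 4 * (e * q)" by (simp add: mult.commute mult.left_commute)
      moreover have "4 * (e * q) \<le> 1" using eqE E2 by linarith
      moreover have "(1 + 2 * e) ^ l \<le> 1 + 2 * (real l * (2 * e))"
        using calculation g(5) by (intro power_one_plus_le) linarith+
      ultimately show ?thesis unfolding d_def by linarith
    qed
    have dw: "cn r (b n) (\<lambda>x. tw g m x - w) x \<le> d" "cn r (b n) (\<lambda>x. tw g (Suc m) x - w') x \<le> d" for x
      using order_trans[OF near(1) pow[OF L(1)]] order_trans[OF near(2) pow[OF order_refl]] by auto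
    have d0: "0 \<le> d" "d < 1" using g(5) q eqE E2 by (simp_all add: d_def)
    have lt1: "norm (tw g m x - w) < 1" for x
      using norm_le_cn[OF bn(2), of "\<lambda>x. tw g m x - w" x r] dw(1)[of x] d0 by linarith
    define D where "D = 8 * E"
    have KdD: "K0 r * d * (b n / b m)\<^sup>2 = D"
      by (simp add: D_def E_def d_def q3(2) q_def[symmetric])
    have D1: "D \<le> 1" using E2 by (simp add: D_def)
    obtain h where h: "smooth h" "\<And>x. h x \<noteq> 0" "\<And>x. h (x + b m) * tw g m x = w * h x"
      and h': "\<And>r d. (\<forall>x\<in>{-3*b n..3*b n}. cn r (b n) (\<lambda>x. tw g m x - w) x \<le> d) \<Longrightarrow> K0 r * d * (b n / b m)\<^sup>2 \<le> 1 \<Longrightarrow>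
          \<forall>x\<in>{-2*b n..3*b n}. cn r (b n) (\<lambda>x. h x - 1) x \<le> K0 r * d * (b n / b m)\<^sup>2"
      using K0(2)[OF smooth_tw[OF g(1,2), of m] tw_nonzero[of g m, OF g(2)] nw(1) b_pos[of m] b_antimono[OF nm] lt1]
      by blast
    have h_near: "cn r (b n) (\<lambda>x. h x - 1) x \<le> D" if "x \<in> {-2 * b n..3 * b n}" for x
      using h'[of r d] dw(1) that unfolding KdD by (simp add: D1)
    define g2 where "g2 = (\<lambda>x. h x * g x)"
    have g2: "smooth g2" "\<And>x. g2 x \<noteq> 0"
      unfolding g2_def by (intro smooth_mult h g) (simp add: h g)
    have tw2: "tw g2 l x = h (x + b l) * tw g l x * inverse (h x)" for l x
      unfolding g2_def by (rule tw_mult[of h g, OF h(2) g(2)])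
    have g2u: "tw g2 m x = w" for x
      unfolding tw2 h(3) using h(2)[of x] by (simp add: mult.assoc)
    have F_loc: "cn r (b n) (\<lambda>x. tw g2 (Suc m) x - w') y \<le> 12 * D" if y: "0 \<le> y" "y \<le> b m" for y
      unfolding tw2
    proof (rule cn_twist[OF bn(2) h(1,2) smooth_tw[OF g(1,2)] nw(2)])
      have bb: "b m \<le> b n" "b (Suc m) \<le> b n" "0 < b (Suc m)"
        using b_antimono[OF nm] b_antimono[of n "Suc m"] nm b_pos by auto
      then show "cn r (b n) (\<lambda>x. h x - 1) (y + b (Suc m)) \<le> D" "cn r (b n) (\<lambda>x. h x - 1) y \<le> D"
        using y by (auto intro!: h_near)
      have "d \<le> D" using eqE by (simp add: d_def D_def)
      then show "cn r (b n) (\<lambda>x. tw g (Suc m) x - w') y \<le> D" using dw(2)[of y] by linarith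
      show "6 * D \<le> 1" using E2 by (simp add: D_def)
    qed
    define F where "F = tw g2 (Suc m)"
    have F: "smooth F" unfolding F_def by (rule smooth_tw[OF g2])
    have F_near: "cn r (b n) (\<lambda>x. F x - w') x \<le> 12 * D" for x
      unfolding F_def by (rule cn_tw_Suc_bound[OF g2 g2u w F_loc])
    have F_shift: "F (x + b m) = w * F x * w" for x
      unfolding F_def by (rule tw_Suc_shift[of g2, OF g2(2) g2u nw(3)])
    have F_per: "F (x + 2 * b m) = F x" for x
    proof -
      have "F (x + 2 * b m) = w * (w * F x * w) * w"
        using F_shift[of "x + b m"] F_shift[of x] by (simp add: add.assoc)
      also have "\<dots> = (w * w) * F x * (w * w)" by (simp only: mult.assoc)
      finally show ?thesis by (simp add: nw(3))
    qed
    have bm: "0 < b m" "0 < 2 * b m" using b_pos[of m] by auto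
    define \<kappa> where "\<kappa> = 12 * 8 ^ r * D * (b m / b n) ^ r"
    have "96 * (8 ^ r * E) * (b m / b n) ^ r \<le> 96 * (8 ^ r * E) * 1"
      using b_antimono[OF nm] bm bn E(1) by (intro mult_left_mono power_le_one) auto
    moreover have \<kappa>_eq: "\<kappa> = 96 * (8 ^ r * E) * (b m / b n) ^ r"
      by (simp add: \<kappa>_def D_def)
    moreover have "0 \<le> \<kappa>" unfolding \<kappa>_eq using E(1) bm bn by simp
    ultimately have \<kappa>: "0 \<le> \<kappa>" "6 * \<kappa> \<le> 1"
      using E2 by linarith+
    have deriv: "b m ^ l * norm (nth_derivative l F x) \<le> \<kappa>" if l: "1 \<le> l" "l \<le> r" for l x
    proof -
      have "norm (nth_derivative (l + (r - l)) F y) \<le> 12 * D / b n ^ r" for y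
      proof -
        have "b n ^ r * norm (nth_derivative r (\<lambda>x. F x - w') y) \<le> 12 * D"
          by (rule order_trans[OF nth_derivative_le_cn[OF bn(2) order_refl] F_near])
        then show ?thesis
          using l r bn(1) by (simp add: nth_derivative_diff_const[OF F] field_simps)
      qed
      from periodic_nth_derivative_bound[OF F bm(2) F_per l(1) this]
      have "b m ^ l * norm (nth_derivative l F x) \<le> b m ^ l * ((4 * (2 * b m)) ^ (r - l) * (12 * D / b n ^ r))"
        using bm by (intro mult_left_mono) auto
      also have "\<dots> = 8 ^ (r - l) * (b m ^ (l + (r - l)) * (12 * D / b n ^ r))"
        by (simp add: power_mult_distrib power_add)
      also have "\<dots> \<le> 8 ^ r * (b m ^ (l + (r - l)) * (12 * D / b n ^ r))"
        using bm bn E(1) by (intro mult_right_mono power_increasing) (auto simp: D_def)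
      also have "\<dots> = \<kappa>" using l by (simp add: \<kappa>_def power_divide)
      finally show ?thesis .
    qed
    have vdF: "norm (vd F x) \<le> \<kappa> / b m" for x
      using deriv[of 1 x] r bm(1) by (simp add: nth_derivative_Suc field_simps)
    have F_osc: "norm (F x - F 0) \<le> 2 * \<kappa>" for x
    proof -
      obtain y where y: "0 \<le> y" "y < 2 * b m" "F y = F x"
        using periodic_reduce[of "2 * b m" F x, OF bm(2) F_per] by blast
      have "norm (F y - F 0) \<le> \<kappa> / b m * \<bar>y - 0\<bar>"
        by (rule vector_differentiable_bound_UNIV[OF F vdF])
      also have "\<dots> \<le> \<kappa> / b m * (2 * b m)"
        using y \<kappa> bm by (intro mult_left_mono) auto
      finally show ?thesis using y(3) bm by simp
    qed
    \<comment> \<open>The map sending z to w z w is an involution whose fixed points are exactly the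
      quaternions anticommuting with w; M is the projection of \<open>F 0\<close> to them, and F at
      \<open>b m\<close> is the image of \<open>F 0\<close>.\<close>
    define M where "M = (1/2) *\<^sub>R (F 0 + w * F 0 * w)"
    have "F 0 - M = (1/2) *\<^sub>R (F 0 - F (b m))"
      using F_shift[of 0] by (simp add: M_def algebra_simps) (simp flip: scaleR_add_left)
    then have FM: "norm (F 0 - M) \<le> \<kappa>"
      using F_osc[of "b m"] by (simp add: norm_minus_commute)
    have FM2: "norm (F x - M) \<le> 3 * \<kappa>" for x
      using norm_triangle_ineq[of "F x - F 0" "F 0 - M"] F_osc[of x] FM by simp
    have nM: "\<bar>norm M - 1\<bar> \<le> 3 * \<kappa>"
    proof -
      have "norm (tw g2 m x) = 1" for x using g2u nw by simp
      from tw_norm_crossing[OF g2 this] obtain x y where "norm (F x) \<le> 1" "1 \<le> norm (F y)"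
        unfolding F_def by blast
      then show ?thesis
        using FM2[of x] FM2[of y] norm_triangle_ineq3[of "F x" M] norm_triangle_ineq3[of "F y" M] by linarith
    qed
    then have M0: "M \<noteq> 0" using \<kappa> by auto
    have wM: "w * M = - (M * w)"
    proof -
      have "w * (F 0 + w * F 0 * w) = w * F 0 + (w * w) * F 0 * w" by (simp only: distrib_left mult.assoc)
      moreover have "(F 0 + w * F 0 * w) * w = F 0 * w + w * F 0 * (w * w)" by (simp only: distrib_right mult.assoc)
      ultimately have "w * (F 0 + w * F 0 * w) = - ((F 0 + w * F 0 * w) * w)" by (simp add: nw(3))
      then show ?thesis by (simp add: M_def)
    qed
    define v where "v = M /\<^sub>R norm M"
    have wv: "anticommuting_units w v"
      unfolding v_def by (rule anticommuting_units_normalize[OF nw(3) wM M0])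
    have "M - v = (norm M - 1) *\<^sub>R v" using M0 by (simp add: v_def algebra_simps)
    then have "norm (M - v) \<le> 3 * \<kappa>"
      using nM anticommuting_units_norm[OF wv] by simp
    then have Fv: "norm (F x - v) \<le> 6 * \<kappa>" for x
      using FM2[of x] norm_triangle_ineq[of "F x - M" "M - v"] by simp
    have "cn r (b m) (\<lambda>x. F x - v) x \<le> 2 ^ r * (6 * \<kappa>)" for x
    proof (rule cn_le_nth_derivative)
      fix l assume "l \<le> r"
      then show "b m ^ l * norm (nth_derivative l (\<lambda>x. F x - v) x) \<le> 6 * \<kappa>"
        using Fv[of x] deriv[of l x] \<kappa>(1) by (cases "l = 0") (auto simp: nth_derivative_diff_const[OF F])
    qed (use bm in simp)
    moreover have "2 ^ r * (6 * \<kappa>) = K r * e * (b n / b m) ^ 3 * (b m / b n) ^ r"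
    proof -
      have "(16::real) ^ r = 2 ^ r * 8 ^ r" by (simp flip: power_mult_distrib)
      then show ?thesis by (simp add: \<kappa>_def D_def E_def K_def q_def[symmetric])
    qed
    ultimately have Fn: "cn r (b m) (\<lambda>x. tw g2 (Suc m) x - v) x \<le> K r * e * (b n / b m) ^ 3 * (b m / b n) ^ r" for x
      unfolding F_def by simp
    obtain p where p: "norm p = 1" "p * w = qi * p" "p * v = qj * p"
      using anticommuting_units_conjugate_unit[OF wv] by blast
    show ?thesis
      using gauge_standardize[OF g2 g2u wv p Fn] by blast
  qed
  have "1 \<le> K r" for r
  proof -
    have "1 \<le> 576 * (16::real) ^ r" using one_le_power[of "16::real" r] by linarith
    then have "1 * 1 \<le> (576 * 16 ^ r) * K0 r" using K0(1)[of r] by (intro mult_mono) auto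
    then show ?thesis by (simp add: K_def)
  qed
  then show thesis using that[of K] main by blast
qed

end

text \<open>A small anticommutator forces small real parts: if p is half the anticommutator of units
  c and a, with real parts c0 and a0, then c0^2 + a0^2 = |Im p|^2 + 2 c0 a0 Re p. So c is nearly
  imaginary and normalizing its imaginary part gives u; the component of a anticommuting with u
  gives v.\<close>

lemma almost_anticommuting_units:
  assumes c: "norm c = 1" and a: "norm a = 1" and \<eta>: "norm (c * a + a * c) \<le> \<eta>" "\<eta> \<le> 1 / 10"
  obtains u v where "anticommuting_units u v" "norm (c - u) \<le> 2 * \<eta>" "norm (a - v) \<le> 5 * \<eta>"
proof -
  have \<eta>0: "0 \<le> \<eta>" using order_trans[OF norm_ge_zero \<eta>(1)] .
  define p where "p = (1/2) *\<^sub>R (c * a + a * c)"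
  have p: "norm p \<le> \<eta> / 2" using \<eta> by (simp add: p_def)
  have c2: "(qRe c)\<^sup>2 + (qIm1 c)\<^sup>2 + (qIm2 c)\<^sup>2 + (qIm3 c)\<^sup>2 = 1"
    and a2: "(qRe a)\<^sup>2 + (qIm1 a)\<^sup>2 + (qIm2 a)\<^sup>2 + (qIm3 a)\<^sup>2 = 1"
    using norm_quat_sq[of c] norm_quat_sq[of a] c a by simp_all
  have "(qIm1 p)\<^sup>2 + (qIm2 p)\<^sup>2 + (qIm3 p)\<^sup>2
      = (qRe c)\<^sup>2 * ((qRe a)\<^sup>2 + (qIm1 a)\<^sup>2 + (qIm2 a)\<^sup>2 + (qIm3 a)\<^sup>2)
      + (qRe a)\<^sup>2 * ((qRe c)\<^sup>2 + (qIm1 c)\<^sup>2 + (qIm2 c)\<^sup>2 + (qIm3 c)\<^sup>2) - 2 * (qRe c * qRe a) * qRe p"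
    by (simp add: p_def) algebra
  then have "(qRe c)\<^sup>2 + (qRe a)\<^sup>2 = (qIm1 p)\<^sup>2 + (qIm2 p)\<^sup>2 + (qIm3 p)\<^sup>2 + 2 * (qRe c * qRe a) * qRe p"
    by (simp add: c2 a2)
  also have "\<dots> \<le> (\<eta> / 2)\<^sup>2 + ((qRe c)\<^sup>2 + (qRe a)\<^sup>2) * (\<eta> / 2)"
  proof (rule add_mono)
    have "(qIm1 p)\<^sup>2 + (qIm2 p)\<^sup>2 + (qIm3 p)\<^sup>2 \<le> (norm p)\<^sup>2" by (simp add: norm_quat_sq)
    also have "\<dots> \<le> (\<eta> / 2)\<^sup>2" using p by (intro power_mono) auto
    finally show "(qIm1 p)\<^sup>2 + (qIm2 p)\<^sup>2 + (qIm3 p)\<^sup>2 \<le> (\<eta> / 2)\<^sup>2" .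
    have "2 * (qRe c * qRe a) * qRe p \<le> \<bar>2 * (qRe c * qRe a)\<bar> * \<bar>qRe p\<bar>"
      by (metis abs_ge_self abs_mult)
    also have "\<dots> \<le> ((qRe c)\<^sup>2 + (qRe a)\<^sup>2) * (\<eta> / 2)"
    proof (rule mult_mono)
      show "\<bar>2 * (qRe c * qRe a)\<bar> \<le> (qRe c)\<^sup>2 + (qRe a)\<^sup>2"
        using sum_squares_bound[of "\<bar>qRe c\<bar>" "\<bar>qRe a\<bar>"] by (simp add: abs_mult)
      show "\<bar>qRe p\<bar> \<le> \<eta> / 2" using abs_sel_le_norm(1)[of p] p by linarith
    qed auto
    finally show "2 * (qRe c * qRe a) * qRe p \<le> ((qRe c)\<^sup>2 + (qRe a)\<^sup>2) * (\<eta> / 2)" .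
  qed
  also have "((qRe c)\<^sup>2 + (qRe a)\<^sup>2) * (\<eta> / 2) \<le> ((qRe c)\<^sup>2 + (qRe a)\<^sup>2) * (1 / 2)"
    using \<eta>(2) by (intro mult_left_mono) auto
  finally have "(qRe c)\<^sup>2 + (qRe a)\<^sup>2 \<le> (\<eta> / 2)\<^sup>2 + ((qRe c)\<^sup>2 + (qRe a)\<^sup>2) * (1 / 2)"
    by simp
  moreover have "(\<eta> / 2)\<^sup>2 = \<eta>\<^sup>2 / 4" by (simp add: power_divide)
  ultimately have "(qRe c)\<^sup>2 \<le> \<eta>\<^sup>2" using zero_le_power2[of "qRe a"] zero_le_power2[of "\<eta>"] by argo
  then have c0: "\<bar>qRe c\<bar> \<le> \<eta>" using \<eta>0 by (simp add: abs_le_square_iff[of "qRe c" \<eta>, symmetric])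
  define c' where "c' = c - of_real (qRe c)"
  have cc': "norm (c - c') \<le> \<eta>" using c0 by (simp add: c'_def)
  have nc': "\<bar>norm c' - 1\<bar> \<le> \<eta>" using norm_triangle_ineq3[of c c'] cc' c by linarith
  then have c'0: "c' \<noteq> 0" using \<eta>(2) by auto
  define u where "u = c' /\<^sub>R norm c'"
  have u: "u * u = -1"
  proof -
    have "c' * c' = - ((norm c')\<^sup>2 *\<^sub>R 1)" by (rule pure_square) (simp add: c'_def)
    moreover have "inverse (norm c') * (inverse (norm c') * (norm c')\<^sup>2) = 1"
      using c'0 by (simp add: power2_eq_square field_simps)
    ultimately show ?thesis by (simp add: u_def)
  qed
  have "c' - u = (norm c' - 1) *\<^sub>R u" using c'0 by (simp add: u_def algebra_simps)
  then have "norm (c' - u) \<le> \<eta>" using nc' norm_square_minus_one[OF u] by simp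
  then have cu: "norm (c - u) \<le> 2 * \<eta>" using norm_triangle_ineq[of "c - c'" "c' - u"] cc' by simp
  define M where "M = (1/2) *\<^sub>R (a + u * a * u)"
  have "u * (a - u * a * u) = u * a - (u * u) * a * u" by (simp only: right_diff_distrib mult.assoc)
  then have "norm (a - u * a * u) = norm (u * a + a * u)"
    using norm_square_minus_one[OF u] norm_mult[of u "a - u * a * u"] by (simp add: u)
  also have "u * a + a * u = (c * a + a * c) - ((c - u) * a + a * (c - u))" by (simp add: algebra_simps)
  also have "norm \<dots> \<le> \<eta> + (2 * \<eta> + 2 * \<eta>)"
  proof -
    have "norm ((c - u) * a) \<le> 2 * \<eta>" "norm (a * (c - u)) \<le> 2 * \<eta>" using cu a by (simp_all add: norm_mult)
    then show ?thesis
      using norm_triangle_ineq4[of "c * a + a * c" "(c - u) * a + a * (c - u)"]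
        norm_triangle_ineq[of "(c - u) * a" "a * (c - u)"] \<eta>(1) by linarith
  qed
  finally have "norm (a - u * a * u) \<le> 5 * \<eta>" by simp
  moreover have "a - M = (1/2) *\<^sub>R (a - u * a * u)"
    by (simp add: M_def algebra_simps) (simp flip: scaleR_add_left)
  ultimately have aM: "norm (a - M) \<le> 5 / 2 * \<eta>" by simp
  have nM: "\<bar>norm M - 1\<bar> \<le> 5 / 2 * \<eta>" using norm_triangle_ineq3[of a M] aM a by linarith
  then have M0: "M \<noteq> 0" using \<eta>(2) by auto
  have uM: "u * M = - (M * u)"
  proof -
    have "u * (a + u * a * u) = u * a + (u * u) * a * u" by (simp only: distrib_left mult.assoc)
    moreover have "(a + u * a * u) * u = a * u + u * a * (u * u)" by (simp only: distrib_right mult.assoc)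
    ultimately have "u * (a + u * a * u) = - ((a + u * a * u) * u)" by (simp add: u)
    then show ?thesis by (simp add: M_def)
  qed
  have uv: "anticommuting_units u (M /\<^sub>R norm M)"
    by (rule anticommuting_units_normalize[OF u uM M0])
  have "M - M /\<^sub>R norm M = (norm M - 1) *\<^sub>R (M /\<^sub>R norm M)" using M0 by (simp add: algebra_simps)
  moreover have "norm (M /\<^sub>R norm M) = 1" using M0 by simp
  ultimately have "norm (M - M /\<^sub>R norm M) \<le> 5 / 2 * \<eta>" using nM by (simp only: norm_scaleR mult_1_right)
  then have "norm (a - M /\<^sub>R norm M) \<le> 5 * \<eta>"
    using norm_triangle_ineq[of "a - M" "M - M /\<^sub>R norm M"] aM by simp
  with uv cu show thesis using that by blast
qed

lemma (in renormalization) gauge_mono: "gauge n r e g \<Longrightarrow> e \<le> e' \<Longrightarrow> gauge n r e' g"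
  unfolding gauge_def by (auto intro: order_trans)

text \<open>Degree zero in scale-invariant form: measured at scale \<open>b n\<close>, the
  derivatives of both lifts tend to zero in every order r, uniformly in x.\<close>

locale flat_renormalization = renormalization +
  assumes flat: "0 < \<epsilon> \<Longrightarrow> \<forall>\<^sub>F n in sequentially. \<forall>x. b n * cn r (b n) (vd (G n)) x \<le> \<epsilon>
    \<and> b n * cn r (b n) (vd (G (Suc n))) x \<le> \<epsilon>"
begin

text \<open>Flatness makes both lifts nearly constant over a period, so the anticommutation relation
  passes to their values at 0. A single sequence \<gamma> has to work for all r and \<epsilon>,
  because the filter estimates below need one object that is good in all orders.\<close>

lemma initial_gauges:
  obtains \<gamma> where "\<And>r \<epsilon>. 0 < \<epsilon> \<Longrightarrow> \<forall>\<^sub>F n in sequentially. gauge n r \<epsilon> (\<gamma> n)"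
proof -
  obtain K where K: "\<And>r. 1 \<le> K r"
    "\<And>n g u v. \<lbrakk>smooth g; \<And>x. g x \<noteq> 0; anticommuting_units u v;
        \<And>x. 0 \<le> x \<Longrightarrow> x \<le> b n \<Longrightarrow> norm (tw g n x - u) < 1\<rbrakk>
      \<Longrightarrow> \<exists>g'. \<forall>r d. (\<forall>x\<in>{-3 * b n..3 * b n}. cn r (b n) (\<lambda>x. tw g n x - u) x \<le> d
            \<and> cn r (b n) (\<lambda>x. tw g (Suc n) x - v) x \<le> d) \<longrightarrow> K r * d \<le> 1 \<longrightarrow> gauge n r (K r * d) g'"
    using gauge_of_near by blast
  define ok where "ok n r \<epsilon> \<longleftrightarrow> (\<forall>x. b n * cn r (b n) (vd (G n)) x \<le> \<epsilon> \<and> b n * cn r (b n) (vd (G (Suc n))) x \<le> \<epsilon>)" for n r \<epsilon>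
  have osc: "norm (G m x - G m 0) \<le> 3 * \<epsilon>" if "ok n 0 \<epsilon>" "m = n \<or> m = Suc n" "\<bar>x\<bar> \<le> 3 * b n" for n m x \<epsilon>
  proof -
    have "norm (vd (G m) y) \<le> \<epsilon> / b n" for y
      using that(1,2) b_pos[of n] by (auto simp: ok_def field_simps)
    then have "norm (G m x - G m 0) \<le> \<epsilon> / b n * \<bar>x - 0\<bar>"
      by (rule vector_differentiable_bound_UNIV[OF G_smooth])
    also have "\<dots> \<le> \<epsilon> / b n * (3 * b n)"
    proof (intro mult_left_mono)
      have "0 \<le> b n * norm (vd (G n) 0)" using b_nonneg by simp
      also have "\<dots> \<le> \<epsilon>" using that(1) unfolding ok_def by simp
      finally show "0 \<le> \<epsilon> / b n" using b_nonneg[of n] by simp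
    qed (use that(3) in simp)
    finally show ?thesis using b_pos[of n] by simp
  qed
  have ex: "\<exists>g'. \<forall>r \<epsilon> \<epsilon>0. ok n r \<epsilon> \<and> ok n 0 \<epsilon>0 \<and> \<epsilon>0 \<le> 1/200 \<longrightarrow> K r * (80 * \<epsilon>0 + r * \<epsilon>) \<le> 1 \<longrightarrow> gauge n r (K r * (80 * \<epsilon>0 + r * \<epsilon>)) g'" for n
  proof (cases "ok n 0 (1/200)")
    case False
    have "\<not> (ok n 0 \<epsilon>0 \<and> \<epsilon>0 \<le> 1/200)" for \<epsilon>0
      using False unfolding ok_def by (meson order_trans)
    then show ?thesis by blast
  next
    case True
    \<comment> \<open>Within a factor 2 this is the least admissible tolerance of order zero, and it
      depends on n only. So the model pair and the conjugation can be fixed before r and the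
      tolerances are.\<close>
    define e where "e = (SUP x. b n * norm (vd (G n) x)) + (SUP x. b n * norm (vd (G (Suc n)) x))"
    have bdd: "bdd_above (range (\<lambda>x. b n * norm (vd (G n) x)))" "bdd_above (range (\<lambda>x. b n * norm (vd (G (Suc n)) x)))"
      using True unfolding ok_def by (auto intro!: bdd_aboveI2[where M = "1/200"])
    have ge: "b n * norm (vd (G n) x) \<le> (SUP x. b n * norm (vd (G n) x))" "b n * norm (vd (G (Suc n)) x) \<le> (SUP x. b n * norm (vd (G (Suc n)) x))" for x
      using cSUP_upper[OF _ bdd(1), of x] cSUP_upper[OF _ bdd(2), of x] by auto
    have ge0: "0 \<le> (SUP x. b n * norm (vd (G n) x))" "0 \<le> (SUP x. b n * norm (vd (G (Suc n)) x))"
      using order_trans[OF _ ge(1)[of 0]] order_trans[OF _ ge(2)[of 0]] b_nonneg[of n] by auto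
    have ok_e: "ok n 0 e"
      unfolding ok_def e_def using ge ge0 by (auto intro: order_trans add_increasing add_increasing2)
    have e_le: "e \<le> 2 * \<epsilon>0" if "ok n 0 \<epsilon>0" for \<epsilon>0
    proof -
      have "(SUP x. b n * norm (vd (G n) x)) \<le> \<epsilon>0" "(SUP x. b n * norm (vd (G (Suc n)) x)) \<le> \<epsilon>0"
        using that unfolding ok_def by (auto intro!: cSUP_least)
      then show ?thesis by (simp add: e_def)
    qed
    have e100: "e \<le> 1/100" using e_le[OF True] by simp
    have "norm (G n 0 * G (Suc n) 0 + G (Suc n) 0 * G n 0) \<le> 2 * (3 * e)"
    proof -
      have "G n 0 * G (Suc n) 0 + G (Suc n) 0 * G n 0
         = - ((G n (b (Suc n)) - G n 0) * G (Suc n) 0 + (G (Suc n) (b n) - G (Suc n) 0) * G n 0)"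
        using G_anticommute[of n 0] by (simp add: algebra_simps)
      also have "norm \<dots> \<le> norm (G n (b (Suc n)) - G n 0) + norm (G (Suc n) (b n) - G (Suc n) 0)"
        unfolding norm_minus_cancel
        using norm_triangle_ineq[of "(G n (b (Suc n)) - G n 0) * G (Suc n) 0" "(G (Suc n) (b n) - G (Suc n) 0) * G n 0"]
        by (simp add: norm_mult G_norm)
      also have "\<dots> \<le> 3 * e + 3 * e"
        using b_pos[of n] b_pos[of "Suc n"] b_dec[of n] by (intro add_mono osc[OF ok_e]) auto
      finally show ?thesis by simp
    qed
    moreover have "2 * (3 * e) \<le> 1 / 10" using e100 by simp
    ultimately obtain u v where uv: "anticommuting_units u v" "norm (G n 0 - u) \<le> 2 * (2 * (3 * e))"
        "norm (G (Suc n) 0 - v) \<le> 5 * (2 * (3 * e))"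
      using almost_anticommuting_units[OF G_norm[of n 0] G_norm[of "Suc n" 0]] by blast
    have tw1: "tw (\<lambda>_. 1) m = G m" for m by (simp add: tw_def[abs_def])
    have near0: "norm (G n x - u) < 1" if "\<bar>x\<bar> \<le> 3 * b n" for x
      using osc[OF ok_e _ that, of n] uv(2) e100 norm_triangle_ineq[of "G n x - G n 0" "G n 0 - u"] by simp
    obtain g' where g': "\<And>r d. (\<forall>x\<in>{-3 * b n..3 * b n}. cn r (b n) (\<lambda>x. G n x - u) x \<le> d
            \<and> cn r (b n) (\<lambda>x. G (Suc n) x - v) x \<le> d) \<Longrightarrow> K r * d \<le> 1 \<Longrightarrow> gauge n r (K r * d) g'"
      using K(2)[OF _ _ uv(1), of "\<lambda>_. 1" n] near0 b_pos[of n] by (auto simp: tw1)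
    have "gauge n r (K r * (80 * \<epsilon>0 + r * \<epsilon>)) g'" if ok: "ok n r \<epsilon>" "ok n 0 \<epsilon>0" and sm: "K r * (80 * \<epsilon>0 + r * \<epsilon>) \<le> 1" for r \<epsilon> \<epsilon>0
    proof (rule g'[OF ballI sm])
      fix x assume "x \<in> {-3 * b n..3 * b n}"
      then have x: "\<bar>x\<bar> \<le> 3 * b n" by auto
      \<comment> \<open>At most 3 e from the oscillation and 30 e from the model pair; as e is at
        most 2 \<epsilon>0, this is at most 66 \<epsilon>0, rounded up to 80 \<epsilon>0.\<close>
      have "norm (G n x - u) \<le> 80 * \<epsilon>0" "norm (G (Suc n) x - v) \<le> 80 * \<epsilon>0"
        using osc[OF ok_e _ x, of n] osc[OF ok_e _ x, of "Suc n"] uv(2,3) e_le[OF ok(2)] order_trans[OF norm_ge_zero uv(2)]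
          norm_triangle_ineq[of "G n x - G n 0" "G n 0 - u"] norm_triangle_ineq[of "G (Suc n) x - G (Suc n) 0" "G (Suc n) 0 - v"] by simp_all
      moreover have "real r * (b n * cn r (b n) (vd (G n)) x) \<le> r * \<epsilon>" "real r * (b n * cn r (b n) (vd (G (Suc n))) x) \<le> r * \<epsilon>"
        using ok(1) unfolding ok_def by (auto intro!: mult_left_mono)
      ultimately show "cn r (b n) (\<lambda>x. G n x - u) x \<le> 80 * \<epsilon>0 + r * \<epsilon> \<and> cn r (b n) (\<lambda>x. G (Suc n) x - v) x \<le> 80 * \<epsilon>0 + r * \<epsilon>"
        using cn_diff_const_le[OF b_nonneg[of n] G_smooth[of n], of r u x]
          cn_diff_const_le[OF b_nonneg[of n] G_smooth[of "Suc n"], of r v x] by linarith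
    qed
    then show ?thesis by blast
  qed
  then obtain \<gamma> where \<gamma>: "\<And>n r \<epsilon> \<epsilon>0. ok n r \<epsilon> \<Longrightarrow> ok n 0 \<epsilon>0 \<Longrightarrow> \<epsilon>0 \<le> 1/200 \<Longrightarrow> K r * (80 * \<epsilon>0 + r * \<epsilon>) \<le> 1
      \<Longrightarrow> gauge n r (K r * (80 * \<epsilon>0 + r * \<epsilon>)) (\<gamma> n)"
    by metis
  have "\<forall>\<^sub>F n in sequentially. gauge n r \<epsilon> (\<gamma> n)" if \<epsilon>: "0 < \<epsilon>" for r \<epsilon>
  proof -
    define \<delta> where "\<delta> = min (1/200) (min 1 \<epsilon> / (K r * (80 + r)))"
    have Kp: "0 < K r * (80 + r)" using K(1)[of r] by simp
    have \<delta>: "0 < \<delta>" "\<delta> \<le> 1/200"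
      unfolding \<delta>_def using Kp \<epsilon> by (simp_all only: min.cobounded1) simp
    have "\<delta> \<le> min 1 \<epsilon> / (K r * (80 + r))" by (simp add: \<delta>_def)
    then have "K r * (80 * \<delta> + r * \<delta>) \<le> min 1 \<epsilon>" using Kp by (simp add: pos_le_divide_eq algebra_simps)
    then have K\<delta>: "K r * (80 * \<delta> + r * \<delta>) \<le> 1" "K r * (80 * \<delta> + r * \<delta>) \<le> \<epsilon>" by auto
    have "\<forall>\<^sub>F n in sequentially. ok n r \<delta>" "\<forall>\<^sub>F n in sequentially. ok n 0 \<delta>"
      unfolding ok_def by (rule flat[OF \<delta>(1)])+
    then show ?thesis
    proof eventually_elim
      case (elim n)
      from \<gamma>[OF elim \<delta>(2) K\<delta>(1)] K\<delta>(2) show ?case by (rule gauge_mono)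
    qed
  qed
  then show thesis by (rule that)
qed

end

section \<open>Adiabatic steps\<close>

context renormalization
begin

definition ratio :: "nat \<Rightarrow> real" where
  "ratio n = b (Suc n) / b n"

text \<open>Estimates along this filter are uniform over all sufficiently late levels with a
  sufficiently small ratio, that is, over the steps at which \<open>\<alpha>\<close> is of Liouville type.\<close>

definition slow :: "nat filter" where
  "slow = inf sequentially (filtercomap ratio (nhds 0))"

lemma ratio_bounds: "0 < ratio n" "ratio n < 1"
  using b_pos b_dec by (simp_all add: ratio_def)

lemma slow_sequentially: "eventually P sequentially \<Longrightarrow> eventually P slow"
  unfolding slow_def by (rule filter_leD[OF inf_le1])

lemma slow_ratio: "0 < \<delta> \<Longrightarrow> \<forall>\<^sub>F n in slow. ratio n < \<delta>"
proof -
  assume "0 < \<delta>"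
  then have "\<forall>\<^sub>F x in nhds 0. x < \<delta>"
    by (intro order_tendstoD(2)[OF filterlim_ident]) 
  then have "\<forall>\<^sub>F n in filtercomap ratio (nhds 0). ratio n < \<delta>"
    by (auto simp: eventually_filtercomap)
  then show ?thesis
    unfolding slow_def by (rule filter_leD[OF inf_le2])
qed

text \<open>This turns estimates along the filter back into thresholds. If the ratios stay away from
  zero, the filter is trivial and the estimates hold vacuously, so no case distinction is
  made.\<close>

lemma slowD:
  assumes "eventually P slow"
  obtains N \<delta> where "0 < \<delta>" "\<And>n. N \<le> n \<Longrightarrow> ratio n < \<delta> \<Longrightarrow> P n"
proof -
  obtain Q R where Q: "eventually Q sequentially" and R: "eventually R (filtercomap ratio (nhds 0))"
    and P: "\<And>n. Q n \<Longrightarrow> R n \<Longrightarrow> P n"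
    using assms unfolding slow_def eventually_inf by blast
  obtain N where N: "\<And>n. N \<le> n \<Longrightarrow> Q n" using Q unfolding eventually_sequentially by blast
  obtain S where S: "eventually S (nhds 0)" "\<And>n. S (ratio n) \<Longrightarrow> R n"
    using R unfolding eventually_filtercomap by blast
  obtain \<delta> where "0 < \<delta>" "\<And>x. dist x 0 < \<delta> \<Longrightarrow> S x"
    using S(1) unfolding eventually_nhds_metric by blast
  then show thesis
    using that[of \<delta> N] N P S(2) ratio_bounds(1) by (auto simp: dist_real_def less_imp_le)
qed

definition ev_smooth :: "(nat \<Rightarrow> real \<Rightarrow> 'a::real_normed_vector) \<Rightarrow> bool" where
  "ev_smooth f \<longleftrightarrow> (\<forall>\<^sub>F n in slow. smooth (f n))"

text \<open>All orders r are covered at once, with constants depending on r. An operation may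
  therefore consume derivatives without the class being left.\<close>

definition bigO :: "nat \<Rightarrow> (nat \<Rightarrow> real \<Rightarrow> 'a::real_normed_vector) \<Rightarrow> bool" where
  "bigO p f \<longleftrightarrow> ev_smooth f \<and> (\<forall>r. \<exists>K. \<forall>\<^sub>F n in slow. \<forall>x. cn r (b n) (f n) x \<le> K * ratio n ^ p)"

definition tiny :: "(nat \<Rightarrow> real \<Rightarrow> 'a::real_normed_vector) \<Rightarrow> bool" where
  "tiny f \<longleftrightarrow> ev_smooth f \<and> (\<forall>r \<epsilon>. 0 < \<epsilon> \<longrightarrow> (\<forall>\<^sub>F n in slow. \<forall>x. cn r (b n) (f n) x \<le> \<epsilon>))"

lemma bigO_smooth: "bigO p f \<Longrightarrow> ev_smooth f" and tiny_smooth: "tiny f \<Longrightarrow> ev_smooth f"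
  by (simp_all add: bigO_def tiny_def)

lemma bigOE:
  assumes "bigO p f"
  obtains K where "0 \<le> K" "\<forall>\<^sub>F n in slow. \<forall>x. cn r (b n) (f n) x \<le> K * ratio n ^ p"
proof -
  obtain K where K: "\<forall>\<^sub>F n in slow. \<forall>x. cn r (b n) (f n) x \<le> K * ratio n ^ p"
    using assms unfolding bigO_def by blast
  have "\<forall>\<^sub>F n in slow. \<forall>x. cn r (b n) (f n) x \<le> \<bar>K\<bar> * ratio n ^ p"
    using K
  proof (rule eventually_mono)
    fix n assume *: "\<forall>x. cn r (b n) (f n) x \<le> K * ratio n ^ p"
    have "K * ratio n ^ p \<le> \<bar>K\<bar> * ratio n ^ p"
      using ratio_bounds[of n] by (intro mult_right_mono) auto
    then show "\<forall>x. cn r (b n) (f n) x \<le> \<bar>K\<bar> * ratio n ^ p" using * order_trans by blast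
  qed
  then show thesis using that[of "\<bar>K\<bar>"] by simp
qed

lemma tinyD: "tiny f \<Longrightarrow> 0 < \<epsilon> \<Longrightarrow> \<forall>\<^sub>F n in slow. \<forall>x. cn r (b n) (f n) x \<le> \<epsilon>"
  by (simp add: tiny_def)

lemma bigO_cong:
  assumes "bigO p f" "\<forall>\<^sub>F n in slow. f n = g n" shows "bigO p g"
  unfolding bigO_def ev_smooth_def
proof (intro conjI allI)
  show "\<forall>\<^sub>F n in slow. smooth (g n)"
    using bigO_smooth[OF assms(1), unfolded ev_smooth_def] assms(2) by eventually_elim simp
  fix r
  obtain K where "\<forall>\<^sub>F n in slow. \<forall>x. cn r (b n) (f n) x \<le> K * ratio n ^ p"
    using bigOE[OF assms(1)] by blast
  then have "\<forall>\<^sub>F n in slow. \<forall>x. cn r (b n) (g n) x \<le> K * ratio n ^ p"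
    using assms(2) by eventually_elim simp
  then show "\<exists>K. \<forall>\<^sub>F n in slow. \<forall>x. cn r (b n) (g n) x \<le> K * ratio n ^ p" by blast
qed

lemma tiny_imp_bigO: "tiny f \<Longrightarrow> bigO 0 f"
  unfolding tiny_def bigO_def by (auto intro: exI[of _ 1])

lemma bigO_le: "bigO p f \<Longrightarrow> q \<le> p \<Longrightarrow> bigO q f"
proof -
  assume f: "bigO p f" and q: "q \<le> p"
  have "\<exists>K. \<forall>\<^sub>F n in slow. \<forall>x. cn r (b n) (f n) x \<le> K * ratio n ^ q" for r
  proof -
    obtain K where K: "0 \<le> K" "\<forall>\<^sub>F n in slow. \<forall>x. cn r (b n) (f n) x \<le> K * ratio n ^ p"
      using bigOE[OF f] by blast
    have le: "K * ratio n ^ p \<le> K * ratio n ^ q" for n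
      using ratio_bounds[of n] K(1) q by (intro mult_left_mono power_decreasing) auto
    show ?thesis
      using K(2) by (intro exI[of _ K]) (auto elim!: eventually_mono intro: order_trans[OF _ le])
  qed
  then show "bigO q f" using f by (simp add: bigO_def)
qed

lemma bigO_imp_tiny: "bigO (Suc p) f \<Longrightarrow> tiny f"
proof -
  assume f: "bigO (Suc p) f"
  have "\<forall>\<^sub>F n in slow. \<forall>x. cn r (b n) (f n) x \<le> \<epsilon>" if "0 < \<epsilon>" for r \<epsilon>
  proof -
    obtain K where K: "0 \<le> K" "\<forall>\<^sub>F n in slow. \<forall>x. cn r (b n) (f n) x \<le> K * ratio n ^ 1"
      using bigOE[OF bigO_le[OF f, of 1]] by auto
    have "\<forall>\<^sub>F n in slow. ratio n < \<epsilon> / (K + 1)" using that K(1) by (intro slow_ratio) auto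
    with K(2) show ?thesis
    proof eventually_elim
      case (elim n)
      have "K * ratio n \<le> (K + 1) * (\<epsilon> / (K + 1))"
        using elim(2) K(1) ratio_bounds[of n] by (intro mult_mono) auto
      then show ?case using elim(1) K(1) by (auto intro: order_trans)
    qed
  qed
  then show "tiny f" using f by (simp add: tiny_def bigO_def)
qed

lemma ev_smooth_bilinear:
  "bounded_bilinear pr \<Longrightarrow> ev_smooth f \<Longrightarrow> ev_smooth g \<Longrightarrow> ev_smooth (\<lambda>n x. pr (f n x) (g n x))"
  unfolding ev_smooth_def
proof -
  assume pr: "bounded_bilinear pr" and "\<forall>\<^sub>F n in slow. smooth (f n)" "\<forall>\<^sub>F n in slow. smooth (g n)"
  from this(2,3) show "\<forall>\<^sub>F n in slow. smooth (\<lambda>x. pr (f n x) (g n x))"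
    by eventually_elim (rule smooth_bilinear[OF pr])
qed

lemma ev_smooth_add: "ev_smooth f \<Longrightarrow> ev_smooth g \<Longrightarrow> ev_smooth (\<lambda>n x. f n x + g n x)"
  unfolding ev_smooth_def
proof -
  assume "\<forall>\<^sub>F n in slow. smooth (f n)" "\<forall>\<^sub>F n in slow. smooth (g n)"
  then show "\<forall>\<^sub>F n in slow. smooth (\<lambda>x. f n x + g n x)"
    by eventually_elim (rule smooth_add)
qed

lemma ev_smooth_linear: "bounded_linear T \<Longrightarrow> ev_smooth f \<Longrightarrow> ev_smooth (\<lambda>n x. T (f n x))"
  unfolding ev_smooth_def by (auto elim!: eventually_mono simp: smooth_linear)

lemma ev_smooth_const: "ev_smooth (\<lambda>n x. c)"
  by (simp add: ev_smooth_def)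

lemma bigO_const: "bigO 0 (\<lambda>n x. c)"
  unfolding bigO_def by (auto simp: ev_smooth_const intro!: exI[of _ "norm c"])

lemma bigO_bilinear:
  assumes pr: "bounded_bilinear pr" "\<And>u v. norm (pr u v) \<le> norm u * norm v"
    and f: "bigO p f" and g: "bigO q g"
  shows "bigO (p + q) (\<lambda>n x. pr (f n x) (g n x))"
  unfolding bigO_def
proof (intro conjI allI)
  show "ev_smooth (\<lambda>n x. pr (f n x) (g n x))"
    by (rule ev_smooth_bilinear[OF pr(1) bigO_smooth[OF f] bigO_smooth[OF g]])
  fix r
  obtain K where K: "0 \<le> K" "\<forall>\<^sub>F n in slow. \<forall>x. cn r (b n) (f n) x \<le> K * ratio n ^ p"
    using bigOE[OF f] by blast
  obtain L where L: "0 \<le> L" "\<forall>\<^sub>F n in slow. \<forall>x. cn r (b n) (g n) x \<le> L * ratio n ^ q"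
    using bigOE[OF g] by blast
  have "\<forall>\<^sub>F n in slow. \<forall>x. cn r (b n) (\<lambda>x. pr (f n x) (g n x)) x \<le> (K * L) * ratio n ^ (p + q)"
    using K(2) L(2) bigO_smooth[OF f, unfolded ev_smooth_def] bigO_smooth[OF g, unfolded ev_smooth_def]
  proof eventually_elim
    case (elim n)
    show ?case
    proof
      fix x
      have "cn r (b n) (\<lambda>x. pr (f n x) (g n x)) x \<le> cn r (b n) (f n) x * cn r (b n) (g n) x"
        by (rule cn_bilinear[OF pr b_nonneg elim(3,4)])
      also have "\<dots> \<le> (K * ratio n ^ p) * (L * ratio n ^ q)"
        using elim(1,2) K(1) L(1) ratio_bounds[of n] b_nonneg by (intro mult_mono) auto
      finally show "cn r (b n) (\<lambda>x. pr (f n x) (g n x)) x \<le> (K * L) * ratio n ^ (p + q)"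
        by (simp add: power_add mult_ac)
    qed
  qed
  then show "\<exists>K. \<forall>\<^sub>F n in slow. \<forall>x. cn r (b n) (\<lambda>x. pr (f n x) (g n x)) x \<le> K * ratio n ^ (p + q)" by blast
qed

lemma tiny_bilinear:
  assumes pr: "bounded_bilinear pr" "\<And>u v. norm (pr u v) \<le> norm u * norm v"
    and f: "tiny f" and g: "bigO 0 g"
  shows "tiny (\<lambda>n x. pr (f n x) (g n x))"
  unfolding tiny_def
proof (intro conjI allI impI)
  show "ev_smooth (\<lambda>n x. pr (f n x) (g n x))"
    by (rule ev_smooth_bilinear[OF pr(1) tiny_smooth[OF f] bigO_smooth[OF g]])
  fix r and \<epsilon> :: real assume \<epsilon>: "0 < \<epsilon>"
  obtain L where L: "0 \<le> L" "\<forall>\<^sub>F n in slow. \<forall>x. cn r (b n) (g n) x \<le> L * ratio n ^ 0"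
    using bigOE[OF g] by blast
  have "\<forall>\<^sub>F n in slow. \<forall>x. cn r (b n) (f n) x \<le> \<epsilon> / (L + 1)"
    using \<epsilon> L(1) by (intro tinyD[OF f]) auto
  then show "\<forall>\<^sub>F n in slow. \<forall>x. cn r (b n) (\<lambda>x. pr (f n x) (g n x)) x \<le> \<epsilon>"
    using L(2) tiny_smooth[OF f, unfolded ev_smooth_def] bigO_smooth[OF g, unfolded ev_smooth_def]
  proof eventually_elim
    case (elim n)
    show ?case
    proof
      fix x
      have "cn r (b n) (\<lambda>x. pr (f n x) (g n x)) x \<le> cn r (b n) (f n) x * cn r (b n) (g n) x"
        by (rule cn_bilinear[OF pr b_nonneg elim(3,4)])
      also have "\<dots> \<le> (\<epsilon> / (L + 1)) * (L + 1)"
      proof (rule mult_mono)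
        show "cn r (b n) (g n) x \<le> L + 1" using elim(2)[rule_format, of x] by simp
      qed (use elim(1) \<epsilon> L(1) b_nonneg in auto)
      finally show "cn r (b n) (\<lambda>x. pr (f n x) (g n x)) x \<le> \<epsilon>" using L(1) by simp
    qed
  qed
qed

lemma bigO_linear:
  assumes T: "bounded_linear T" "\<And>u. norm (T u) \<le> norm u" and f: "bigO p f"
  shows "bigO p (\<lambda>n x. T (f n x))"
proof -
  have "\<exists>K. \<forall>\<^sub>F n in slow. \<forall>x. cn r (b n) (\<lambda>x. T (f n x)) x \<le> K * ratio n ^ p" for r
  proof -
    obtain K where K: "\<forall>\<^sub>F n in slow. \<forall>x. cn r (b n) (f n) x \<le> K * ratio n ^ p"
      using bigOE[OF f] by blast
    have "\<forall>\<^sub>F n in slow. \<forall>x. cn r (b n) (\<lambda>x. T (f n x)) x \<le> K * ratio n ^ p"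
      using K bigO_smooth[OF f, unfolded ev_smooth_def]
    proof eventually_elim
      case (elim n)
      then show ?case
        using cn_linear[OF T(1), of 1 "b n" "f n" r] T(2) b_nonneg by (auto intro: order_trans)
    qed
    then show ?thesis by blast
  qed
  then show ?thesis using ev_smooth_linear[OF T(1) bigO_smooth[OF f]] by (simp add: bigO_def)
qed

lemma tiny_linear:
  assumes T: "bounded_linear T" "\<And>u. norm (T u) \<le> norm u" and f: "tiny f"
  shows "tiny (\<lambda>n x. T (f n x))"
  unfolding tiny_def
proof (intro conjI allI impI)
  show "ev_smooth (\<lambda>n x. T (f n x))" by (rule ev_smooth_linear[OF T(1) tiny_smooth[OF f]])
  fix r and \<epsilon> :: real assume "0 < \<epsilon>"
  then have "\<forall>\<^sub>F n in slow. \<forall>x. cn r (b n) (f n) x \<le> \<epsilon>" by (rule tinyD[OF f])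
  then show "\<forall>\<^sub>F n in slow. \<forall>x. cn r (b n) (\<lambda>x. T (f n x)) x \<le> \<epsilon>"
    using tiny_smooth[OF f, unfolded ev_smooth_def]
  proof eventually_elim
    case (elim n)
    then show ?case
      using cn_linear[OF T(1), of 1 "b n" "f n" r] T(2) b_nonneg by (auto intro: order_trans)
  qed
qed

lemma tiny_add:
  assumes f: "tiny f" and g: "tiny g"
  shows "tiny (\<lambda>n x. f n x + g n x)"
  unfolding tiny_def
proof (intro conjI allI impI)
  show "ev_smooth (\<lambda>n x. f n x + g n x)"
    by (rule ev_smooth_add[OF tiny_smooth[OF f] tiny_smooth[OF g]])
  fix r and \<epsilon> :: real assume "0 < \<epsilon>"
  then have "\<forall>\<^sub>F n in slow. \<forall>x. cn r (b n) (f n) x \<le> \<epsilon> / 2" "\<forall>\<^sub>F n in slow. \<forall>x. cn r (b n) (g n) x \<le> \<epsilon> / 2"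
    by (intro tinyD[OF f] tinyD[OF g]; simp)+
  then show "\<forall>\<^sub>F n in slow. \<forall>x. cn r (b n) (\<lambda>x. f n x + g n x) x \<le> \<epsilon>"
    using tiny_smooth[OF f, unfolded ev_smooth_def] tiny_smooth[OF g, unfolded ev_smooth_def]
  proof eventually_elim
    case (elim n)
    show ?case
    proof
      fix x
      show "cn r (b n) (\<lambda>x. f n x + g n x) x \<le> \<epsilon>"
        using cn_add[OF b_nonneg[of n] elim(3,4), of r x] elim(1,2)[rule_format, of x] by simp
    qed
  qed
qed

lemma bigO_add:
  assumes f: "bigO p f" and g: "bigO p g"
  shows "bigO p (\<lambda>n x. f n x + g n x)"
  unfolding bigO_def
proof (intro conjI allI)
  show "ev_smooth (\<lambda>n x. f n x + g n x)"
    by (rule ev_smooth_add[OF bigO_smooth[OF f] bigO_smooth[OF g]])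
  fix r
  obtain K where K: "\<forall>\<^sub>F n in slow. \<forall>x. cn r (b n) (f n) x \<le> K * ratio n ^ p"
    using bigOE[OF f] by blast
  obtain L where L: "\<forall>\<^sub>F n in slow. \<forall>x. cn r (b n) (g n) x \<le> L * ratio n ^ p"
    using bigOE[OF g] by blast
  have "\<forall>\<^sub>F n in slow. \<forall>x. cn r (b n) (\<lambda>x. f n x + g n x) x \<le> (K + L) * ratio n ^ p"
    using K L bigO_smooth[OF f, unfolded ev_smooth_def] bigO_smooth[OF g, unfolded ev_smooth_def]
  proof eventually_elim
    case (elim n)
    show ?case
    proof
      fix x
      show "cn r (b n) (\<lambda>x. f n x + g n x) x \<le> (K + L) * ratio n ^ p"
        using cn_add[OF b_nonneg[of n] elim(3,4), of r x] elim(1,2)[rule_format, of x]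
        by (simp add: distrib_right)
    qed
  qed
  then show "\<exists>K. \<forall>\<^sub>F n in slow. \<forall>x. cn r (b n) (\<lambda>x. f n x + g n x) x \<le> K * ratio n ^ p" by blast
qed

lemma bigO_minus: "bigO p f \<Longrightarrow> bigO p (\<lambda>n x. - f n x)"
  by (rule bigO_linear[OF bounded_linear_minus[OF bounded_linear_ident]]) auto

lemma bigO_diff: "bigO p f \<Longrightarrow> bigO p g \<Longrightarrow> bigO p (\<lambda>n x. f n x - g n x)"
  using bigO_add[of p f "\<lambda>n x. - g n x"] bigO_minus[of p g] by simp

lemma bigO_bounded: "tiny (\<lambda>n x. f n x - c) \<Longrightarrow> bigO 0 f"
  using bigO_add[OF tiny_imp_bigO bigO_const[of c], of "\<lambda>n x. f n x - c"] by simp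

text \<open>A shift by \<open>b (Suc n)\<close> has length \<open>ratio n\<close> in units of the
  scale \<open>b n\<close>: the difference costs one derivative and gains one power of the
  ratio.\<close>

lemma bigO_difference:
  assumes f: "bigO p f"
  shows "bigO (Suc p) (\<lambda>n x. f n (x + b (Suc n)) - f n x)"
  unfolding bigO_def
proof (intro conjI allI)
  show "ev_smooth (\<lambda>n x. f n (x + b (Suc n)) - f n x)"
    using bigO_smooth[OF f] unfolding ev_smooth_def
    by (auto elim!: eventually_mono intro!: smooth_diff smooth_shift)
  fix r
  obtain K where K: "0 \<le> K" "\<forall>\<^sub>F n in slow. \<forall>x. cn (Suc r) (b n) (f n) x \<le> K * ratio n ^ p"
    using bigOE[OF f] by blast
  have "\<forall>\<^sub>F n in slow. \<forall>x. cn r (b n) (\<lambda>x. f n (x + b (Suc n)) - f n x) x \<le> (2 ^ r * K) * ratio n ^ Suc p"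
    using K(2) bigO_smooth[OF f, unfolded ev_smooth_def]
  proof eventually_elim
    case (elim n)
    have "cn r (b n) (vd (f n)) y \<le> K * ratio n ^ p / b n" for y
    proof -
      have "b n * cn r (b n) (vd (f n)) y \<le> K * ratio n ^ p"
        using cn_vd_le[OF b_nonneg[of n], of r "f n" y] elim(1)[rule_format, of y] by linarith
      then show ?thesis using b_pos[of n] by (simp add: field_simps)
    qed
    from cn_difference[OF b_nonneg elim(2) this, of "b (Suc n)"]
    have "cn r (b n) (\<lambda>x. f n (x + b (Suc n)) - f n x) x \<le> 2 ^ r * (b (Suc n) * (K * ratio n ^ p / b n))" for x
      using b_nonneg[of "Suc n"] by simp
    also have "2 ^ r * (b (Suc n) * (K * ratio n ^ p / b n)) = (2 ^ r * K) * ratio n ^ Suc p"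
      by (simp add: ratio_def)
    finally show ?case by blast
  qed
  then show "\<exists>K. \<forall>\<^sub>F n in slow. \<forall>x. cn r (b n) (\<lambda>x. f n (x + b (Suc n)) - f n x) x \<le> K * ratio n ^ Suc p" by blast
qed

lemma compose_near:
  fixes \<phi> :: "real \<Rightarrow> real"
  assumes T: "open T" "smooth_on T \<phi>" "c \<in> T" and f: "tiny (\<lambda>n x. f n x - c)"
  shows "tiny (\<lambda>n x. \<phi> (f n x) - \<phi> c)"
    "bigO p (\<lambda>n x. f n x - c) \<Longrightarrow> bigO p (\<lambda>n x. \<phi> (f n x) - \<phi> c)"
    "\<forall>\<^sub>F n in slow. \<forall>x. f n x \<in> T"
proof -
  obtain \<delta> where \<delta>: "0 < \<delta>" "cball c \<delta> \<subseteq> T"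
    using T open_contains_cball by blast
  then have ab: "{c - \<delta>..c + \<delta>} \<subseteq> T" "c \<in> {c - \<delta>..c + \<delta>}"
    by (auto simp: cball_eq_atLeastAtMost)
  have sm: "\<forall>\<^sub>F n in slow. smooth (f n)"
    using tiny_smooth[OF f] unfolding ev_smooth_def
    by (elim eventually_mono) (drule smooth_add[OF _ smooth_const[of c]], simp)
  have ran: "\<forall>\<^sub>F n in slow. range (f n) \<subseteq> {c - \<delta>..c + \<delta>}"
    using tinyD[OF f \<delta>(1), of 0] by (elim eventually_mono) (auto simp: abs_le_iff algebra_simps)
  then show in_T: "\<forall>\<^sub>F n in slow. \<forall>x. f n x \<in> T"
    by (elim eventually_mono) (use ab(1) in blast)
  have key: "\<exists>K\<ge>0. \<forall>\<^sub>F n in slow. \<forall>x. cn r (b n) (\<lambda>x. \<phi> (f n x) - \<phi> c) x \<le> K * cn r (b n) (\<lambda>x. f n x - c) x" for r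
  proof -
    obtain K where K: "0 \<le> K" "\<And>f t x. smooth f \<Longrightarrow> range f \<subseteq> {c - \<delta>..c + \<delta>} \<Longrightarrow> 0 \<le> t \<Longrightarrow> cn r t (\<lambda>x. f x - c) x \<le> 1
    \<Longrightarrow> cn r t (\<lambda>x. \<phi> (f x) - \<phi> c) x \<le> K * cn r t (\<lambda>x. f x - c) x"
      using cn_compose[OF T(1) ab T(2), of r 1] by blast
    have "\<forall>\<^sub>F n in slow. \<forall>x. cn r (b n) (\<lambda>x. \<phi> (f n x) - \<phi> c) x \<le> K * cn r (b n) (\<lambda>x. f n x - c) x"
      using sm ran tinyD[OF f zero_less_one, of r]
    proof eventually_elim
      case (elim n)
      then show ?case using K(2)[OF elim(1,2) b_nonneg[of n]] by blast
    qed
    then show ?thesis using K(1) by blast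
  qed
  have smo: "ev_smooth (\<lambda>n x. \<phi> (f n x) - \<phi> c)"
    unfolding ev_smooth_def using sm in_T
    by eventually_elim (intro smooth_diff smooth_const smooth_compose[OF T(2,1)]; blast)
  show "tiny (\<lambda>n x. \<phi> (f n x) - \<phi> c)"
    unfolding tiny_def
  proof (intro conjI allI impI smo)
    fix r and \<epsilon> :: real assume \<epsilon>: "0 < \<epsilon>"
    obtain K where K: "0 \<le> K" "\<forall>\<^sub>F n in slow. \<forall>x. cn r (b n) (\<lambda>x. \<phi> (f n x) - \<phi> c) x \<le> K * cn r (b n) (\<lambda>x. f n x - c) x"
      using key by blast
    have "\<forall>\<^sub>F n in slow. \<forall>x. cn r (b n) (\<lambda>x. f n x - c) x \<le> \<epsilon> / (K + 1)"
      using \<epsilon> K(1) by (intro tinyD[OF f]) auto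
    with K(2) show "\<forall>\<^sub>F n in slow. \<forall>x. cn r (b n) (\<lambda>x. \<phi> (f n x) - \<phi> c) x \<le> \<epsilon>"
    proof eventually_elim
      case (elim n)
      show ?case
      proof
        fix x
        have "K * cn r (b n) (\<lambda>x. f n x - c) x \<le> (K + 1) * (\<epsilon> / (K + 1))"
          using elim(2) K(1) b_nonneg by (intro mult_mono) auto
        then show "cn r (b n) (\<lambda>x. \<phi> (f n x) - \<phi> c) x \<le> \<epsilon>"
          using elim(1)[rule_format, of x] K(1) by simp
      qed
    qed
  qed
  show "bigO p (\<lambda>n x. \<phi> (f n x) - \<phi> c)" if O: "bigO p (\<lambda>n x. f n x - c)"
    unfolding bigO_def
  proof (intro conjI allI smo)
    fix r
    obtain K where K: "0 \<le> K" "\<forall>\<^sub>F n in slow. \<forall>x. cn r (b n) (\<lambda>x. \<phi> (f n x) - \<phi> c) x \<le> K * cn r (b n) (\<lambda>x. f n x - c) x"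
      using key by blast
    obtain L where L: "\<forall>\<^sub>F n in slow. \<forall>x. cn r (b n) (\<lambda>x. f n x - c) x \<le> L * ratio n ^ p"
      using bigOE[OF O] by blast
    have "\<forall>\<^sub>F n in slow. \<forall>x. cn r (b n) (\<lambda>x. \<phi> (f n x) - \<phi> c) x \<le> (K * L) * ratio n ^ p"
      using K(2) L
    proof eventually_elim
      case (elim n)
      show ?case
      proof
        fix x
        have "K * cn r (b n) (\<lambda>x. f n x - c) x \<le> K * (L * ratio n ^ p)"
          using elim(2) K(1) by (intro mult_left_mono) auto
        then show "cn r (b n) (\<lambda>x. \<phi> (f n x) - \<phi> c) x \<le> (K * L) * ratio n ^ p"
          using elim(1)[rule_format, of x] by simp
      qed
    qed
    then show "\<exists>K. \<forall>\<^sub>F n in slow. \<forall>x. cn r (b n) (\<lambda>x. \<phi> (f n x) - \<phi> c) x \<le> K * ratio n ^ p" by blast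
  qed
qed

end

section \<open>Aligning the axis of the second generator with j\<close>

definition offdiag :: "quat \<Rightarrow> quat" where "offdiag q = Quat 0 (qIm1 q) 0 (qIm3 q)"
definition imag :: "quat \<Rightarrow> quat" where "imag q = Quat 0 (qIm1 q) (qIm2 q) (qIm3 q)"

lemma sel_offdiag [simp]: "qRe (offdiag q) = 0" "qIm1 (offdiag q) = qIm1 q" "qIm2 (offdiag q) = 0" "qIm3 (offdiag q) = qIm3 q"
  by (simp_all add: offdiag_def)

lemma sel_imag [simp]: "qRe (imag q) = 0" "qIm1 (imag q) = qIm1 q" "qIm2 (imag q) = qIm2 q" "qIm3 (imag q) = qIm3 q"
  by (simp_all add: imag_def)

lemma norm_offdiag: "norm (offdiag q) \<le> norm q" and norm_imag: "norm (imag q) \<le> norm q"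
  by (rule power2_le_imp_le; simp add: norm_quat_sq)+

lemma bounded_linear_offdiag: "bounded_linear offdiag" and bounded_linear_imag: "bounded_linear imag"
  by (rule bounded_linear_intro[where K = 1]; simp add: quat_eq_iff norm_offdiag norm_imag)+

lemma offdiag_simps: "offdiag (p - q) = offdiag p - offdiag q" "offdiag (p + q) = offdiag p + offdiag q" "offdiag qj = 0"
    "imag (p - q) = imag p - imag q" "imag qj = qj"
  by (simp_all add: quat_eq_iff)

text \<open>A rotation taking the axis of \<open>q\<close> to \<open>qj\<close>: with \<open>n = norm (imag q)\<close> it is proportional to
  \<open>n - qj * imag q\<close>, and dividing by the real number \<open>n + qIm2 q\<close> makes it as close to \<open>1\<close> as \<open>offdiag q\<close> is to \<open>0\<close>.\<close>

definition axis_sum :: "quat \<Rightarrow> real" where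
  "axis_sum q = (inner (imag q) (imag q)) powr (1/2) + qIm2 q"

definition align :: "quat \<Rightarrow> quat" where
  "align q = 1 - (axis_sum q powr (-1)) *\<^sub>R (qj * offdiag q)"

text \<open>Let s be \<open>axis_sum q\<close> and S = s - \<open>qj * offdiag q\<close>, a real
  multiple of \<open>align q\<close>. Then S q = (\<open>qRe q\<close> + n qj) S, which spells out
  that n is the norm of the imaginary part; so the conjugate of q lies in the plane of 1 and
  qj.\<close>

lemma offdiag_align:
  assumes "0 < axis_sum q" "align q \<noteq> 0"
  shows "offdiag (align q * q * inverse (align q)) = 0"
proof -
  define n where "n = (inner (imag q) (imag q)) powr (1/2)"
  define s where "s = axis_sum q"
  have n: "n * n = (qIm1 q)\<^sup>2 + (qIm2 q)\<^sup>2 + (qIm3 q)\<^sup>2"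
  proof -
    have "n * n = inner (imag q) (imag q)"
      by (simp add: n_def flip: powr_add)
    then show ?thesis by (simp add: inner_quat_def power2_eq_square)
  qed
  have s: "s = n + qIm2 q" "0 < s" using assms(1) by (simp_all add: s_def n_def axis_sum_def)
  define P where "P = qRe q *\<^sub>R 1 + n *\<^sub>R qj"
  define S where "S = s *\<^sub>R 1 - qj * offdiag q"
  have "S * q = P * S"
    unfolding quat_eq_iff S_def P_def using n by (simp add: s power2_eq_square algebra_simps)
  moreover have "align q = (1 / s) *\<^sub>R S"
    using s(2) by (simp add: align_def S_def s_def[symmetric] powr_minus_divide algebra_simps)
  ultimately have "align q * q = P * align q" by simp
  then have "align q * q * inverse (align q) = P" using assms(2) by (simp add: mult.assoc)
  then show ?thesis by (simp add: P_def quat_eq_iff)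
qed

text \<open>Aligning is equivariant under the symmetry of the second generator over
  \<open>b n\<close>; therefore it does not disturb the normalization of the first generator to
  qi.\<close>

lemma align_flip: "align (qi * q * qi) * qi = qi * align q"
proof -
  have "axis_sum (qi * q * qi) = axis_sum q"
    by (simp add: axis_sum_def inner_quat_def)
  then show ?thesis
    by (simp add: align_def quat_eq_iff)
qed

context renormalization
begin

text \<open>\<open>offdiag\<close> collects the components anticommuting with qj. Only these are of
  order p and improve with the iteration; the angle inside the plane of 1 and qj is merely tiny and
  is left to \<open>averaging\<close>.\<close>

definition adiabatic :: "nat \<Rightarrow> (nat \<Rightarrow> real \<Rightarrow> quat) \<Rightarrow> bool" where
  "adiabatic p \<gamma> \<longleftrightarrow> (\<forall>\<^sub>F n in slow. smooth (\<gamma> n) \<and> (\<forall>x. \<gamma> n x \<noteq> 0) \<and> (\<forall>x. tw (\<gamma> n) n x = qi)) \<and>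
     tiny (\<lambda>n x. tw (\<gamma> n) (Suc n) x - qj) \<and> bigO p (\<lambda>n x. offdiag (tw (\<gamma> n) (Suc n) x))"

lemma adiabaticD:
  assumes "adiabatic p \<gamma>"
  shows "\<forall>\<^sub>F n in slow. smooth (\<gamma> n)" "\<forall>\<^sub>F n in slow. \<forall>x. \<gamma> n x \<noteq> 0" "\<forall>\<^sub>F n in slow. \<forall>x. tw (\<gamma> n) n x = qi"
    "tiny (\<lambda>n x. tw (\<gamma> n) (Suc n) x - qj)" "bigO p (\<lambda>n x. offdiag (tw (\<gamma> n) (Suc n) x))"
  using assms by (auto simp: adiabatic_def elim: eventually_mono)

lemma tiny_offdiag: "tiny (\<lambda>n x. f n x - qj) \<Longrightarrow> tiny (\<lambda>n x. offdiag (f n x))"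
  using tiny_linear[OF bounded_linear_offdiag norm_offdiag, of "\<lambda>n x. f n x - qj"]
  by (simp add: offdiag_simps)

lemma tiny_axis_sum:
  assumes F: "tiny (\<lambda>n x. F n x - qj)"
  shows "tiny (\<lambda>n x. axis_sum (F n x) - 2)"
proof -
  have im: "tiny (\<lambda>n x. imag (F n x) - qj)"
    using tiny_linear[OF bounded_linear_imag norm_imag F]
    by (simp add: offdiag_simps)
  have bl: "bounded_bilinear (inner :: quat \<Rightarrow> quat \<Rightarrow> real)" "\<And>u v :: quat. norm (inner u v) \<le> norm u * norm v"
    by (rule bounded_bilinear_inner, simp add: Cauchy_Schwarz_ineq2)
  have "tiny (\<lambda>n x. inner (imag (F n x) - qj) (imag (F n x)) + inner (imag (F n x) - qj) qj)"
    by (intro tiny_add tiny_bilinear[OF bl im] bigO_bounded[OF im] bigO_const)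
  moreover have "inner (imag (F n x) - qj) (imag (F n x)) + inner (imag (F n x) - qj) qj = inner (imag (F n x)) (imag (F n x)) - 1" for n x
    by (simp add: inner_quat_def algebra_simps)
  ultimately have "tiny (\<lambda>n x. inner (imag (F n x)) (imag (F n x)) - 1)" by simp
  from compose_near(1)[OF _ smooth_on_powr[of "1/2"] _ this]
  have 1: "tiny (\<lambda>n x. (inner (imag (F n x)) (imag (F n x))) powr (1/2) - 1)" by simp
  have 2: "tiny (\<lambda>n x. qIm2 (F n x - qj))"
    by (rule tiny_linear[OF bounded_linear_sel(3) _ F]) (simp add: abs_sel_le_norm)
  show ?thesis using tiny_add[OF 1 2] by (simp add: axis_sum_def)
qed

lemma align_bigO:
  assumes F: "tiny (\<lambda>n x. F n x - qj)" and W: "bigO p (\<lambda>n x. offdiag (F n x))"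
  shows "bigO p (\<lambda>n x. align (F n x) - 1)" "tiny (\<lambda>n x. align (F n x) - 1)" "\<forall>\<^sub>F n in slow. \<forall>x. 0 < axis_sum (F n x)"
proof -
  note c = compose_near[OF _ smooth_on_powr[of "-1"] _ tiny_axis_sum[OF F]]
  have inv: "bigO 0 (\<lambda>n x. axis_sum (F n x) powr (-1))"
    by (rule bigO_bounded[OF c(1)]) auto
  show "\<forall>\<^sub>F n in slow. \<forall>x. 0 < axis_sum (F n x)" using c(3) by simp
  have jW: "bigO p (\<lambda>n x. qj * offdiag (F n x))"
    by (rule bigO_linear[OF bounded_linear_mult_right _ W]) (simp add: norm_mult)
  have jW': "tiny (\<lambda>n x. qj * offdiag (F n x))"
    by (rule tiny_linear[OF bounded_linear_mult_right _ tiny_offdiag[OF F]]) (simp add: norm_mult)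
  have bl: "bounded_bilinear (\<lambda>(q::quat) r. r *\<^sub>R q)" "\<And>(q::quat) r. norm (r *\<^sub>R q) \<le> norm q * norm r"
    by (rule bounded_bilinear.flip[OF bounded_bilinear_scaleR], simp add: mult.commute)
  have "bigO (p + 0) (\<lambda>n x. axis_sum (F n x) powr (-1) *\<^sub>R (qj * offdiag (F n x)))"
    by (rule bigO_bilinear[OF bl jW inv])
  from bigO_minus[OF this] show "bigO p (\<lambda>n x. align (F n x) - 1)" by (simp add: align_def)
  have "tiny (\<lambda>n x. axis_sum (F n x) powr (-1) *\<^sub>R (qj * offdiag (F n x)))"
    by (rule tiny_bilinear[OF bl jW' inv])
  then have "tiny (\<lambda>n x. - (axis_sum (F n x) powr (-1) *\<^sub>R (qj * offdiag (F n x))))"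
    by (rule tiny_linear[OF bounded_linear_minus[OF bounded_linear_ident], rotated]) simp
  then show "tiny (\<lambda>n x. align (F n x) - 1)" by (simp add: align_def)
qed

lemma tiny_inverse:
  fixes g :: "nat \<Rightarrow> real \<Rightarrow> quat"
  assumes g: "tiny (\<lambda>n x. g n x - 1)"
  shows "\<forall>\<^sub>F n in slow. \<forall>x. g n x \<noteq> 0" "tiny (\<lambda>n x. inverse (g n x) - 1)" "\<forall>\<^sub>F n in slow. smooth (g n)"
proof -
  show nz: "\<forall>\<^sub>F n in slow. \<forall>x. g n x \<noteq> 0"
  proof (rule eventually_mono)
    show "\<forall>\<^sub>F n in slow. \<forall>x. cn 0 (b n) (\<lambda>x. g n x - 1) x \<le> 1/2" by (rule tinyD[OF g]) simp
    fix n assume *: "\<forall>x. cn 0 (b n) (\<lambda>x. g n x - 1) x \<le> 1/2"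
    show "\<forall>x. g n x \<noteq> 0"
    proof
      fix x show "g n x \<noteq> 0" using *[rule_format, of x] by auto
    qed
  qed
  show sm: "\<forall>\<^sub>F n in slow. smooth (g n)"
    using tiny_smooth[OF g] unfolding ev_smooth_def
    by (elim eventually_mono) (drule smooth_add[OF _ smooth_const[of 1]], simp)
  show "tiny (\<lambda>n x. inverse (g n x) - 1)"
    unfolding tiny_def ev_smooth_def
  proof (intro conjI allI impI)
    show "\<forall>\<^sub>F n in slow. smooth (\<lambda>x. inverse (g n x) - 1)"
      using nz sm by eventually_elim (intro smooth_diff smooth_inverse smooth_const; blast)
    fix r and \<epsilon> :: real assume \<epsilon>: "0 < \<epsilon>"
    define d where "d = min (1/2) (\<epsilon> / 2)"
    have d: "0 < d" "d < 1" "d \<le> \<epsilon> / 2" "d \<le> 1/2" using \<epsilon> by (auto simp: d_def)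
    have "d / (1 - d) \<le> 2 * d"
    proof -
      have "d * 1 \<le> d * (2 * (1 - d))" using d by (intro mult_left_mono) auto
      then show ?thesis using d by (simp add: pos_divide_le_eq algebra_simps)
    qed
    then have dd: "d / (1 - d) \<le> \<epsilon>" using d by linarith
    show "\<forall>\<^sub>F n in slow. \<forall>x. cn r (b n) (\<lambda>x. inverse (g n x) - 1) x \<le> \<epsilon>"
      using nz sm tinyD[OF g d(1), of r]
    proof eventually_elim
      case (elim n)
      have "cn r (b n) (\<lambda>x. inverse (g n x) - inverse 1) x \<le> d / (1 - d)" for x
        using elim d by (intro cn_inverse_near b_nonneg) auto
      then show ?case using dd by (auto intro: order_trans)
    qed
  qed
qed

text \<open>If the aligning conjugation g took the same value at both ends of the shift, no
  \<open>offdiag\<close> part would remain. The new error is thus the difference of g over one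
  shift; g - 1 is of order p, so by \<open>bigO_difference\<close> its difference is one order
  smaller.\<close>

lemma adiabatic_step:
  assumes ad: "adiabatic p \<gamma>"
  obtains \<gamma>' where "adiabatic (Suc p) \<gamma>'"
proof
  define F where "F n = tw (\<gamma> n) (Suc n)" for n
  define g where "g n x = align (F n x)" for n x
  define \<gamma>' where "\<gamma>' n x = g n x * \<gamma> n x" for n x
  note ad' = adiabaticD[OF ad, folded F_def]
  note g1 = align_bigO[OF ad'(4,5), folded g_def]
  note gi = tiny_inverse[OF g1(2)]
  have F0: "bigO 0 F" by (rule bigO_bounded[OF ad'(4)])
  have gi0: "bigO 0 (\<lambda>n x. inverse (g n x))" by (rule bigO_bounded[OF gi(2)])
  have tw': "\<forall>\<^sub>F n in slow. \<forall>m x. tw (\<gamma>' n) m x = g n (x + b m) * tw (\<gamma> n) m x * inverse (g n x)"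
    using gi(1) ad'(2)
  proof eventually_elim
    case (elim n)
    show ?case unfolding \<gamma>'_def using tw_mult[of "g n" "\<gamma> n"] elim by blast
  qed
  have bil: "bounded_bilinear ((*) :: quat \<Rightarrow> quat \<Rightarrow> quat)" "\<And>u v :: quat. norm (u * v) \<le> norm u * norm v"
    by (rule bounded_bilinear_mult, simp add: norm_mult)
  show "adiabatic (Suc p) \<gamma>'"
    unfolding adiabatic_def
  proof (intro conjI)
    show "\<forall>\<^sub>F n in slow. smooth (\<gamma>' n) \<and> (\<forall>x. \<gamma>' n x \<noteq> 0) \<and> (\<forall>x. tw (\<gamma>' n) n x = qi)"
      using ad'(1-3) gi(1,3) tw'
    proof eventually_elim
      case (elim n)
      have "F n (x + b n) = qi * F n x * qi" for x
        unfolding F_def using elim(2,3) by (intro tw_Suc_shift) (auto simp: units_mult)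
      then have "g n (x + b n) * qi = qi * g n x" for x by (simp add: g_def align_flip)
      then have "tw (\<gamma>' n) n x = qi * g n x * inverse (g n x)" for x using elim(3,6) by simp
      then have "tw (\<gamma>' n) n x = qi" for x using elim(4) by (simp add: mult.assoc)
      moreover have "smooth (\<gamma>' n)" unfolding \<gamma>'_def[abs_def] by (intro smooth_mult elim)
      ultimately show ?case using elim(2,4) by (simp add: \<gamma>'_def)
    qed
    have smF: "\<forall>\<^sub>F n in slow. smooth (F n)"
      using ad'(1,2) unfolding F_def by eventually_elim (rule smooth_tw; blast)
    show "tiny (\<lambda>n x. tw (\<gamma>' n) (Suc n) x - qj)"
      unfolding tiny_def ev_smooth_def
    proof (intro conjI allI impI)
      show "\<forall>\<^sub>F n in slow. smooth (\<lambda>x. tw (\<gamma>' n) (Suc n) x - qj)"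
        using smF gi(1,3) tw'
      proof eventually_elim
        case (elim n)
        have sm: "smooth (F n)" "smooth (g n)" "\<And>x. g n x \<noteq> 0" using elim by blast+
        have "tw (\<gamma>' n) (Suc n) x = g n (x + b (Suc n)) * F n x * inverse (g n x)" for x
          using elim(4) by (simp add: F_def)
        then show ?case
          by (simp only:) (rule smooth_diff[OF smooth_mult[OF smooth_mult[OF smooth_shift[OF sm(2)] sm(1)] smooth_inverse[OF sm(2,3)]] smooth_const])
      qed
      fix r and \<epsilon> :: real assume "0 < \<epsilon>"
      define D where "D = min (1/12) (\<epsilon> / 12)"
      have D: "0 < D" "6 * D \<le> 1" "12 * D \<le> \<epsilon>" using \<open>0 < \<epsilon>\<close> by (auto simp: D_def min_def)
      show "\<forall>\<^sub>F n in slow. \<forall>x. cn r (b n) (\<lambda>x. tw (\<gamma>' n) (Suc n) x - qj) x \<le> \<epsilon>"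
        using smF gi(1,3) tw' tinyD[OF g1(2) D(1), of r] tinyD[OF ad'(4) D(1), of r]
      proof eventually_elim
        case (elim n)
        have "cn r (b n) (\<lambda>x. g n (x + b (Suc n)) * F n x * inverse (g n x) - qj) x \<le> 12 * D" for x
          using elim by (intro cn_twist b_nonneg D(2)) auto
        then show ?case using elim(4) D(3) by (auto simp: F_def intro: order_trans)
      qed
    qed
    have "bigO (Suc p) (\<lambda>n x. (g n (x + b (Suc n)) - 1) - (g n x - 1))"
      by (rule bigO_difference[OF g1(1)])
    then have 1: "bigO (Suc p) (\<lambda>n x. g n (x + b (Suc n)) - g n x)" by simp
    have "bigO (Suc p + 0 + 0) (\<lambda>n x. (g n (x + b (Suc n)) - g n x) * F n x * inverse (g n x))"
      by (intro bigO_bilinear[OF bil] 1 F0 gi0)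
    then have "bigO (Suc p) (\<lambda>n x. offdiag ((g n (x + b (Suc n)) - g n x) * F n x * inverse (g n x)))"
      by (intro bigO_linear[OF bounded_linear_offdiag norm_offdiag]) simp
    then show "bigO (Suc p) (\<lambda>n x. offdiag (tw (\<gamma>' n) (Suc n) x))"
    proof (rule bigO_cong)
      show "\<forall>\<^sub>F n in slow. (\<lambda>x. offdiag ((g n (x + b (Suc n)) - g n x) * F n x * inverse (g n x))) = (\<lambda>x. offdiag (tw (\<gamma>' n) (Suc n) x))"
        using tw' gi(1) g1(3)
      proof eventually_elim
        case (elim n)
        show ?case
        proof
          fix x
          have "offdiag (g n x * F n x * inverse (g n x)) = 0"
            using elim unfolding g_def by (intro offdiag_align) auto
          moreover have "tw (\<gamma>' n) (Suc n) x = (g n (x + b (Suc n)) - g n x) * F n x * inverse (g n x) + g n x * F n x * inverse (g n x)"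
            using elim(1) by (simp add: F_def algebra_simps)
          ultimately show "offdiag ((g n (x + b (Suc n)) - g n x) * F n x * inverse (g n x)) = offdiag (tw (\<gamma>' n) (Suc n) x)"
            by (simp add: offdiag_simps)
        qed
      qed
    qed
  qed
qed

end

context flat_renormalization
begin

lemma adiabatic_exists: "\<exists>\<gamma>. adiabatic p \<gamma>"
proof (induction p)
  case 0
  obtain \<gamma> where \<gamma>: "\<And>r \<epsilon>. 0 < \<epsilon> \<Longrightarrow> \<forall>\<^sub>F n in sequentially. gauge n r \<epsilon> (\<gamma> n)"
    using initial_gauges by blast
  have G: "\<forall>\<^sub>F n in slow. gauge n r \<epsilon> (\<gamma> n)" if "0 < \<epsilon>" for r \<epsilon>
    by (rule slow_sequentially[OF \<gamma>[OF that]])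
  have sm: "\<forall>\<^sub>F n in slow. smooth (\<gamma> n) \<and> (\<forall>x. \<gamma> n x \<noteq> 0) \<and> (\<forall>x. tw (\<gamma> n) n x = qi)"
    using G[OF zero_less_one, of 0] by (elim eventually_mono) (auto simp: gauge_def)
  have tiny: "tiny (\<lambda>n x. tw (\<gamma> n) (Suc n) x - qj)"
    unfolding tiny_def ev_smooth_def
  proof (intro conjI allI impI)
    show "\<forall>\<^sub>F n in slow. smooth (\<lambda>x. tw (\<gamma> n) (Suc n) x - qj)"
      using sm by (elim eventually_mono) (intro smooth_diff smooth_tw smooth_const; blast)
    fix r and \<epsilon> :: real assume "0 < \<epsilon>"
    from G[OF this, of r] show "\<forall>\<^sub>F n in slow. \<forall>x. cn r (b n) (\<lambda>x. tw (\<gamma> n) (Suc n) x - qj) x \<le> \<epsilon>"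
      by (elim eventually_mono) (auto simp: gauge_def)
  qed
  then show ?case
    using sm tiny_imp_bigO[OF tiny_offdiag[OF tiny]] by (auto simp: adiabatic_def)
next
  case (Suc p)
  then show ?case using adiabatic_step by blast
qed

end

section \<open>The abelian part: angles, averaging and the resulting gauge\<close>

lemma smooth_of_vd: "smooth f \<Longrightarrow> (\<And>x. (B has_vector_derivative f x) (at x)) \<Longrightarrow> smooth B"
  unfolding smooth_iff_smooth_on smooth_on_def
proof
  fix n
  assume "\<forall>n. smooth_upto n UNIV f" "\<And>x. (B has_vector_derivative f x) (at x)"
  then have "smooth_upto (Suc n) UNIV B" by (intro smooth_upto_SucI[where f' = f]) auto
  then show "smooth_upto n UNIV B" by (rule smooth_upto_le) simp
qed

text \<open>For any primitive the sum of its values at x and x + p is constant, and subtracting half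
  of this constant makes it antiperiodic. Antiperiodicity of f plays the part of a mean-zero
  condition.\<close>

lemma antiperiodic_antiderivative:
  fixes f :: "real \<Rightarrow> real"
  assumes f: "smooth f" and p: "\<And>x. f (x + p) = - f x"
  obtains B where "smooth B" "\<And>x. vd B x = f x" "\<And>x. B (x + p) = - B x"
proof -
  define B0 where "B0 x = (LBINT y=ereal 0..ereal x. f y)" for x
  have B0: "(B0 has_vector_derivative f x) (at x)" for x
  proof -
    define l u where "l = min 0 x - 1" and "u = max 0 x + 1"
    have lu: "l \<le> 0" "0 \<le> u" "l \<le> x" "x \<le> u" by (auto simp: l_def u_def)
    have "((\<lambda>u. LBINT y=ereal 0..ereal u. f y) has_vector_derivative f x) (at x within {l..u})"
      by (rule interval_integral_FTC2[OF lu(1,2) smooth_continuous[OF f] lu(3,4)])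
    moreover have "at x within {l..u} = at x" by (rule at_within_Icc_at) (auto simp: l_def u_def)
    ultimately show ?thesis by (simp add: B0_def[abs_def])
  qed
  have sB0: "smooth B0" by (rule smooth_of_vd[OF f B0])
  have "vd (\<lambda>x. B0 (x + p) + B0 x) y = 0" for y
    using fun_cong[OF vd_add[OF smooth_shift[OF sB0] sB0], of p y] fun_cong[OF vd_shift[OF sB0, of p], of y]
      vd_eqI[OF B0] p[of y] by simp
  then have const: "B0 (x + p) + B0 x = B0 (0 + p) + B0 0" for x
    using vector_differentiable_bound_UNIV[OF smooth_add[OF smooth_shift[OF sB0] sB0], of p 0 x 0] by simp
  define C where "C = B0 (0 + p) + B0 0"
  show thesis
  proof (rule that[of "\<lambda>x. B0 x - C / 2"])
    show "smooth (\<lambda>x. B0 x - C / 2)" by (intro smooth_diff sB0 smooth_const)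
    show "vd (\<lambda>x. B0 x - C / 2) x = f x" for x
      using fun_cong[OF vd_diff_const[OF sB0]] vd_eqI[OF B0] by simp
    show "B0 (x + p) - C / 2 = - (B0 x - C / 2)" for x
    proof -
      have "C = B0 (x + p) + B0 x" using const[of x] by (simp add: C_def)
      then show ?thesis by (simp add: field_simps)
    qed
  qed
qed

text \<open>The one-parameter group exp (t qj), the unit circle in the plane of 1 and qj.\<close>

definition rotj :: "real \<Rightarrow> quat" where "rotj t = Quat (cos t) 0 (sin t) 0"

lemma sel_rotj [simp]: "qRe (rotj t) = cos t" "qIm1 (rotj t) = 0" "qIm2 (rotj t) = sin t" "qIm3 (rotj t) = 0"
  by (simp_all add: rotj_def)

lemma norm_rotj: "norm (rotj t) = 1"
proof -
  have "(norm (rotj t))\<^sup>2 = 1" by (simp add: norm_quat_sq)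
  then show ?thesis using norm_ge_zero[of "rotj t"] by (simp add: power2_eq_1_iff)
qed

lemma rotj_add: "rotj s * rotj t = rotj (s + t)"
  by (simp add: quat_eq_iff cos_add sin_add algebra_simps)

lemma rotj_inverse: "inverse (rotj t) = rotj (- t)"
  by (simp add: inverse_unit[OF norm_rotj] quat_eq_iff)

lemma rotj_commute: "rotj t * qj = qj * rotj t"
  by (simp add: quat_eq_iff)

lemma rotj_eq: "rotj t = cos t *\<^sub>R 1 + sin t *\<^sub>R qj"
  by (simp add: quat_eq_iff)

lemma smooth_rotj: assumes "smooth \<beta>" shows "smooth (\<lambda>x. rotj (\<beta> x))"
proof -
  have "smooth (\<lambda>x. cos (\<beta> x))" "smooth (\<lambda>x. sin (\<beta> x))"
    using smooth_compose[of UNIV cos \<beta>] smooth_compose[of UNIV sin \<beta>] smooth_cos smooth_sin assms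
    by (simp_all add: smooth_iff_smooth_on)
  then show ?thesis
    unfolding rotj_eq by (intro smooth_add smooth_scaleR smooth_const)
qed

lemma vd_rotj:
  assumes "smooth \<beta>" shows "vd (\<lambda>x. rotj (\<beta> x)) = (\<lambda>x. vd \<beta> x *\<^sub>R (qj * rotj (\<beta> x)))"
proof
  fix x
  have d: "(\<beta> has_real_derivative vd \<beta> x) (at x)"
    using smooth_has_vd[OF assms] by (simp add: has_real_derivative_iff_has_vector_derivative)
  have "((\<lambda>x. cos (\<beta> x)) has_vector_derivative - sin (\<beta> x) * vd \<beta> x) (at x)"
    "((\<lambda>x. sin (\<beta> x)) has_vector_derivative cos (\<beta> x) * vd \<beta> x) (at x)"
    unfolding has_real_derivative_iff_has_vector_derivative[symmetric] by (auto intro!: derivative_eq_intros d)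
  then have "((\<lambda>x. cos (\<beta> x) *\<^sub>R 1 + sin (\<beta> x) *\<^sub>R qj) has_vector_derivative
      (- sin (\<beta> x) * vd \<beta> x) *\<^sub>R 1 + (cos (\<beta> x) * vd \<beta> x) *\<^sub>R qj) (at x)"
    by (intro has_vector_derivative_add bounded_linear.has_vector_derivative[OF bounded_linear_scaleR_left])
  then have "vd (\<lambda>x. rotj (\<beta> x)) x = (- sin (\<beta> x) * vd \<beta> x) *\<^sub>R 1 + (cos (\<beta> x) * vd \<beta> x) *\<^sub>R qj"
    unfolding rotj_eq by (rule vd_eqI)
  then show "vd (\<lambda>x. rotj (\<beta> x)) x = vd \<beta> x *\<^sub>R (qj * rotj (\<beta> x))"
    by (simp add: quat_eq_iff)
qed

text \<open>Only the derivative of \<beta> at scale t enters. This matters in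
  \<open>adiabatic_gauge\<close>, where the angle itself may be as large as the inverse of the
  ratio.\<close>

lemma cn_rotj:
  assumes "smooth \<beta>" "0 \<le> t" "t * cn r t (vd \<beta>) x \<le> K"
  shows "cn r t (\<lambda>x. rotj (\<beta> x)) x \<le> (1 + K) ^ r"
  using assms(3)
proof (induction r)
  case (Suc r)
  have le: "t * cn r t (vd \<beta>) x \<le> K"
    using Suc.prems mult_left_mono[OF cn_le_Suc[OF assms(2), of r "vd \<beta>" x] assms(2)] by linarith
  then have K: "0 \<le> K" using order_trans[OF mult_nonneg_nonneg[OF assms(2) cn_nonneg[OF assms(2)]]] by blast
  note IH = Suc.IH[OF le]
  have sm: "smooth (\<lambda>x. rotj (\<beta> x))" by (rule smooth_rotj[OF assms(1)])
  have "t * cn r t (\<lambda>x. vd \<beta> x *\<^sub>R (qj * rotj (\<beta> x))) x \<le> t * (cn r t (vd \<beta>) x * cn r t (\<lambda>x. qj * rotj (\<beta> x)) x)"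
    using assms sm by (intro mult_left_mono cn_scaleR smooth_vd smooth_mult smooth_const)
  also have "\<dots> = (t * cn r t (vd \<beta>) x) * cn r t (\<lambda>x. rotj (\<beta> x)) x"
    by (simp add: cn_unit_mult(1)[OF norm_units(2) sm])
  also have "\<dots> \<le> K * (1 + K) ^ r"
    using le IH K assms(2) by (intro mult_mono) auto
  finally show ?case
    using IH by (simp add: vd_rotj[OF assms(1)] distrib_right)
qed (simp add: norm_rotj)

lemma smooth_on_arctan: "smooth_on UNIV (arctan :: real \<Rightarrow> real)"
proof (rule smooth_onI)
  fix n
  have "smooth_upto (Suc n) UNIV (arctan :: real \<Rightarrow> real)"
  proof (rule smooth_upto_SucI)
    show "(arctan has_vector_derivative inverse (1 + x * x)) (at x)" for x :: real
      using DERIV_arctan[of x] by (simp add: has_real_derivative_iff_has_vector_derivative power2_eq_square)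
    have "1 + x * x \<noteq> 0" for x :: real using zero_le_square[of x] by linarith
    then have "smooth (\<lambda>x::real. inverse (1 + x * x))"
      by (intro smooth_inverse smooth_add smooth_mult smooth_const smooth_id)
    then show "smooth_upto n UNIV (\<lambda>x::real. inverse (1 + x * x))"
      by (simp add: smooth_iff_smooth_on smooth_on_def)
  qed simp
  then show "smooth_upto n UNIV (arctan :: real \<Rightarrow> real)" by (rule smooth_upto_le) simp
qed

context renormalization
begin

text \<open>Averaging for the abelian part. As \<open>\<theta>\<close> is antiperiodic, so is a suitable primitive of it;
  hence the normal form of the generator at scale \<open>b n\<close> is preserved exactly.\<close>

lemma averaging:
  fixes \<theta> :: "nat \<Rightarrow> real \<Rightarrow> real"
  assumes \<theta>: "bigO 0 \<theta>" "\<forall>\<^sub>F n in slow. \<forall>x. \<theta> n (x + b n) = - \<theta> n x"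
  shows "\<exists>\<beta>. (\<forall>\<^sub>F n in slow. smooth (\<beta> n)) \<and> (\<forall>\<^sub>F n in slow. \<forall>x. \<beta> n (x + b n) = - \<beta> n x) \<and>
    bigO p (\<lambda>n x. \<theta> n x + \<beta> n (x + b (Suc n)) - \<beta> n x) \<and> bigO 0 (\<lambda>n x. b (Suc n) *\<^sub>R vd (\<beta> n) x)"
proof (induction p)
  case 0
  show ?case
    using \<theta>(1) bigO_const[of 0] by (intro exI[of _ "\<lambda>n x. 0"]) simp
next
  case (Suc p)
  obtain \<beta> where \<beta>: "\<forall>\<^sub>F n in slow. smooth (\<beta> n)" "\<forall>\<^sub>F n in slow. \<forall>x. \<beta> n (x + b n) = - \<beta> n x"
    "bigO p (\<lambda>n x. \<theta> n x + \<beta> n (x + b (Suc n)) - \<beta> n x)" "bigO 0 (\<lambda>n x. b (Suc n) *\<^sub>R vd (\<beta> n) x)"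
    using Suc by blast
  define \<rho> where "\<rho> n x = \<theta> n x + \<beta> n (x + b (Suc n)) - \<beta> n x" for n x
  note \<rho> = \<beta>(3)[folded \<rho>_def]
  have \<rho>s: "\<forall>\<^sub>F n in slow. smooth (\<rho> n)" using bigO_smooth[OF \<rho>] by (simp add: ev_smooth_def)
  have \<rho>a: "\<forall>\<^sub>F n in slow. \<forall>x. \<rho> n (x + b n) = - \<rho> n x"
    using \<theta>(2) \<beta>(2)
  proof eventually_elim
    case (elim n)
    have "\<beta> n (x + b n + b (Suc n)) = - \<beta> n (x + b (Suc n))" for x
      using elim(2)[rule_format, of "x + b (Suc n)"] by (simp add: add_ac)
    then show ?case using elim by (simp add: \<rho>_def)
  qed
  \<comment> \<open>B solves the equation with the difference over \<open>b (Suc n)\<close> replaced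
    by \<open>b (Suc n)\<close> times the derivative. The Taylor remainder has the factor
    \<open>ratio n ^ 2\<close>, of which the division by \<open>b (Suc n)\<close> takes one power
    back; one power is gained.\<close>
  have "\<forall>n. \<exists>B. smooth (\<rho> n) \<and> (\<forall>x. \<rho> n (x + b n) = - \<rho> n x) \<longrightarrow>
    smooth B \<and> (\<forall>x. vd B x = - (1 / b (Suc n)) *\<^sub>R \<rho> n x) \<and> (\<forall>x. B (x + b n) = - B x)"
  proof
    fix n
    show "\<exists>B. smooth (\<rho> n) \<and> (\<forall>x. \<rho> n (x + b n) = - \<rho> n x) \<longrightarrow>
      smooth B \<and> (\<forall>x. vd B x = - (1 / b (Suc n)) *\<^sub>R \<rho> n x) \<and> (\<forall>x. B (x + b n) = - B x)"
    proof (cases "smooth (\<rho> n) \<and> (\<forall>x. \<rho> n (x + b n) = - \<rho> n x)")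
      case True
      then have "smooth (\<lambda>x. - (1 / b (Suc n)) *\<^sub>R \<rho> n x)" by (intro smooth_scaleR smooth_const) auto
      then obtain B where "smooth B" "\<And>x. vd B x = - (1 / b (Suc n)) *\<^sub>R \<rho> n x" "\<And>x. B (x + b n) = - B x"
        using antiperiodic_antiderivative[of "\<lambda>x. - (1 / b (Suc n)) *\<^sub>R \<rho> n x" "b n"] True by auto
      then show ?thesis by blast
    qed blast
  qed
  then obtain B where B: "\<And>n. smooth (\<rho> n) \<Longrightarrow> \<forall>x. \<rho> n (x + b n) = - \<rho> n x \<Longrightarrow>
    smooth (B n) \<and> (\<forall>x. vd (B n) x = - (1 / b (Suc n)) *\<^sub>R \<rho> n x) \<and> (\<forall>x. B n (x + b n) = - B n x)"
    by metis
  have B': "\<forall>\<^sub>F n in slow. smooth (B n)" "\<forall>\<^sub>F n in slow. \<forall>x. vd (B n) x = - (1 / b (Suc n)) *\<^sub>R \<rho> n x"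
     "\<forall>\<^sub>F n in slow. \<forall>x. B n (x + b n) = - B n x"
  proof -
    have "\<forall>\<^sub>F n in slow. smooth (B n) \<and> (\<forall>x. vd (B n) x = - (1 / b (Suc n)) *\<^sub>R \<rho> n x) \<and> (\<forall>x. B n (x + b n) = - B n x)"
      using \<rho>s \<rho>a by eventually_elim (rule B)
    then show "\<forall>\<^sub>F n in slow. smooth (B n)" "\<forall>\<^sub>F n in slow. \<forall>x. vd (B n) x = - (1 / b (Suc n)) *\<^sub>R \<rho> n x"
     "\<forall>\<^sub>F n in slow. \<forall>x. B n (x + b n) = - B n x"
      by (simp_all only: eventually_conj_iff)
  qed
  have new: "\<forall>\<^sub>F n in slow. (\<lambda>x. B n (x + b (Suc n)) - B n x - b (Suc n) *\<^sub>R vd (B n) x)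
      = (\<lambda>x. \<theta> n x + (\<beta> n (x + b (Suc n)) + B n (x + b (Suc n))) - (\<beta> n x + B n x))"
    using B'(2)
  proof eventually_elim
    case (elim n)
    then have "b (Suc n) *\<^sub>R vd (B n) x = - \<rho> n x" for x using b_pos[of "Suc n"] by simp
    then show ?case by (auto simp: \<rho>_def)
  qed
  have O: "bigO (Suc p) (\<lambda>n x. B n (x + b (Suc n)) - B n x - b (Suc n) *\<^sub>R vd (B n) x)"
    unfolding bigO_def ev_smooth_def
  proof (intro conjI allI)
    show "\<forall>\<^sub>F n in slow. smooth (\<lambda>x. B n (x + b (Suc n)) - B n x - b (Suc n) *\<^sub>R vd (B n) x)"
      using B'(1)
    proof eventually_elim
      case (elim n)
      show ?case
        by (rule smooth_diff[OF smooth_diff[OF smooth_shift[OF elim] elim] smooth_scaleR[OF smooth_const smooth_vd[OF elim]]])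
    qed
    fix r
    obtain K where K: "0 \<le> K" "\<forall>\<^sub>F n in slow. \<forall>x. cn (Suc r) (b n) (\<rho> n) x \<le> K * ratio n ^ p"
      using bigOE[OF \<rho>] by blast
    have "\<forall>\<^sub>F n in slow. \<forall>x. cn r (b n) (\<lambda>x. B n (x + b (Suc n)) - B n x - b (Suc n) *\<^sub>R vd (B n) x) x \<le> (2 ^ r * K) * ratio n ^ Suc p"
      using K(2) B'(1,2) \<rho>s
    proof eventually_elim
      case (elim n)
      let ?s = "b (Suc n)"
      have vdB: "vd (B n) = (\<lambda>x. - (1 / ?s) *\<^sub>R \<rho> n x)" using elim(3) by auto
      have vdvd: "vd (vd (B n)) = (\<lambda>x. - (1 / ?s) *\<^sub>R vd (\<rho> n) x)"
        unfolding vdB by (rule vd_linear[OF bounded_linear_scaleR_right elim(4)])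
      have "cn r (b n) (vd (vd (B n))) y \<le> K * ratio n ^ p / (?s * b n)" for y
      proof -
        have "b n * cn r (b n) (vd (\<rho> n)) y \<le> K * ratio n ^ p"
          using cn_vd_le[OF b_nonneg[of n], of r "\<rho> n" y] elim(1)[rule_format, of y] by linarith
        then have "cn r (b n) (vd (\<rho> n)) y \<le> K * ratio n ^ p / b n" using b_pos[of n] by (simp add: field_simps)
        then have "1 / ?s * cn r (b n) (vd (\<rho> n)) y \<le> 1 / ?s * (K * ratio n ^ p / b n)"
          using b_nonneg[of "Suc n"] by (intro mult_left_mono) auto
        moreover have "cn r (b n) (vd (vd (B n))) y = 1 / ?s * cn r (b n) (vd (\<rho> n)) y"
          unfolding vdvd cn_scaleR_const[OF smooth_vd[OF elim(4)]] using b_pos[of "Suc n"] by simp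
        ultimately show ?thesis by simp
      qed
      from cn_taylor[OF b_nonneg elim(2) this, of ?s]
      have "cn r (b n) (\<lambda>x. B n (x + ?s) - B n x - ?s *\<^sub>R vd (B n) x) x \<le> 2 ^ r * (?s\<^sup>2 * (K * ratio n ^ p / (?s * b n)))" for x .
      also have "2 ^ r * (?s\<^sup>2 * (K * ratio n ^ p / (?s * b n))) = (2 ^ r * K) * ratio n ^ Suc p"
        using b_pos[of "Suc n"] by (simp add: ratio_def power2_eq_square)
      finally show ?case by blast
    qed
    then show "\<exists>K. \<forall>\<^sub>F n in slow. \<forall>x. cn r (b n) (\<lambda>x. B n (x + b (Suc n)) - B n x - b (Suc n) *\<^sub>R vd (B n) x) x \<le> K * ratio n ^ Suc p"
      by blast
  qed
  have vdO: "bigO 0 (\<lambda>n x. b (Suc n) *\<^sub>R vd (\<beta> n) x + - \<rho> n x)"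
    by (rule bigO_add[OF \<beta>(4) bigO_minus[OF bigO_le[OF \<rho>]]]) simp
  show ?case
  proof (intro exI[of _ "\<lambda>n x. \<beta> n x + B n x"] conjI)
    show "\<forall>\<^sub>F n in slow. smooth (\<lambda>x. \<beta> n x + B n x)" using \<beta>(1) B'(1) by eventually_elim (rule smooth_add)
    show "\<forall>\<^sub>F n in slow. \<forall>x. \<beta> n (x + b n) + B n (x + b n) = - (\<beta> n x + B n x)"
      using \<beta>(2) B'(3) by eventually_elim simp
    show "bigO (Suc p) (\<lambda>n x. \<theta> n x + (\<beta> n (x + b (Suc n)) + B n (x + b (Suc n))) - (\<beta> n x + B n x))"
      by (rule bigO_cong[OF O new])
    show "bigO 0 (\<lambda>n x. b (Suc n) *\<^sub>R vd (\<lambda>x. \<beta> n x + B n x) x)"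
    proof (rule bigO_cong[OF vdO])
      show "\<forall>\<^sub>F n in slow. (\<lambda>x. b (Suc n) *\<^sub>R vd (\<beta> n) x + - \<rho> n x) = (\<lambda>x. b (Suc n) *\<^sub>R vd (\<lambda>x. \<beta> n x + B n x) x)"
        using \<beta>(1) B'(1,2)
      proof eventually_elim
        case (elim n)
        show ?case
        proof
          fix x
          have "b (Suc n) *\<^sub>R vd (B n) x = - \<rho> n x" using elim(3) b_pos[of "Suc n"] by simp
          then show "b (Suc n) *\<^sub>R vd (\<beta> n) x + - \<rho> n x = b (Suc n) *\<^sub>R vd (\<lambda>x. \<beta> n x + B n x) x"
            unfolding fun_cong[OF vd_add[OF elim(1,2)]] by (simp add: algebra_simps)
        qed
      qed
    qed
  qed
qed

lemma tw_normalize: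
  assumes "\<And>x. g x \<noteq> 0"
  shows "tw (\<lambda>x. norm (g x) powr (-1) *\<^sub>R g x) m x = tw g m x /\<^sub>R norm (tw g m x)"
proof -
  have "norm (tw g m x) = norm (g (x + b m)) / norm (g x)"
    by (simp add: tw_def norm_mult norm_inverse G_norm divide_inverse)
  then show ?thesis
    using assms by (simp add: tw_def powr_minus_divide divide_inverse inverse_scaleR_distrib mult.commute)
qed

end

lemma sqrt_rotation:
  assumes "0 < f2"
  shows "cos (arctan (- (f0 / f2))) = f2 / sqrt (f0\<^sup>2 + f2\<^sup>2)" "sin (arctan (- (f0 / f2))) = - f0 / sqrt (f0\<^sup>2 + f2\<^sup>2)"
proof -
  have "1 + (- (f0 / f2))\<^sup>2 = (f0\<^sup>2 + f2\<^sup>2) / f2\<^sup>2" using assms by (simp add: field_simps)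
  then have "sqrt (1 + (- (f0 / f2))\<^sup>2) = sqrt (f0\<^sup>2 + f2\<^sup>2) / f2"
    using assms by (simp add: real_sqrt_divide)
  then show "cos (arctan (- (f0 / f2))) = f2 / sqrt (f0\<^sup>2 + f2\<^sup>2)" "sin (arctan (- (f0 / f2))) = - f0 / sqrt (f0\<^sup>2 + f2\<^sup>2)"
    unfolding cos_arctan sin_arctan using assms by simp_all
qed

context renormalization
begin

lemma tiny_diff_const_inner:
  fixes F :: "nat \<Rightarrow> real \<Rightarrow> quat"
  assumes F: "tiny (\<lambda>n x. F n x - qj)"
  shows "tiny (\<lambda>n x. inner (F n x) (F n x) - 1)"
proof -
  have bl: "bounded_bilinear (inner :: quat \<Rightarrow> quat \<Rightarrow> real)" "\<And>u v :: quat. norm (inner u v) \<le> norm u * norm v"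
    by (rule bounded_bilinear_inner, simp add: Cauchy_Schwarz_ineq2)
  have "tiny (\<lambda>n x. inner (F n x - qj) (F n x) + inner (F n x - qj) qj)"
    by (intro tiny_add tiny_bilinear[OF bl F] bigO_bounded[OF F] bigO_const)
  moreover have "inner (F n x - qj) (F n x) + inner (F n x - qj) qj = inner (F n x) (F n x) - 1" for n x
    by (simp add: inner_quat_def algebra_simps)
  ultimately show ?thesis by simp
qed

text \<open>\<theta> is the angle of the projection of F to the plane of 1 and qj. As F has norm
  one, the radius of this projection differs from 1 only quadratically in the \<open>offdiag\<close>
  part, so renormalizing it costs nothing in the order. The symmetry of F makes the angle
  antiperiodic.\<close>

lemma abelian_part:
  assumes F: "tiny (\<lambda>n x. F n x - qj)" and W: "bigO (Suc p) (\<lambda>n x. offdiag (F n x))"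
    and unit: "\<forall>\<^sub>F n in slow. \<forall>x. norm (F n x) = 1"
    and flip: "\<forall>\<^sub>F n in slow. \<forall>x. F n (x + b n) = qi * F n x * qi"
  obtains \<theta> where "tiny \<theta>" "\<forall>\<^sub>F n in slow. \<forall>x. \<theta> n (x + b n) = - \<theta> n x"
    "bigO (Suc p) (\<lambda>n x. F n x - qj * rotj (\<theta> n x))"
proof
  define \<theta> where "\<theta> n x = arctan (- (qRe (F n x) / qIm2 (F n x)))" for n x
  have f0: "tiny (\<lambda>n x. qRe (F n x))"
    using tiny_linear[OF bounded_linear_sel(1) _ F] by (simp add: abs_sel_le_norm)
  have f2: "tiny (\<lambda>n x. qIm2 (F n x) - 1)"
    using tiny_linear[OF bounded_linear_sel(3) _ F] by (simp add: abs_sel_le_norm)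
  note c = compose_near[OF _ smooth_on_powr[of "-1"] _ f2]
  have pos: "\<forall>\<^sub>F n in slow. \<forall>x. 0 < qIm2 (F n x)" using c(3) by simp
  have inv: "bigO 0 (\<lambda>n x. qIm2 (F n x) powr (-1))" by (rule bigO_bounded[OF c(1)]) auto
  have bl: "bounded_bilinear ((*) :: real \<Rightarrow> real \<Rightarrow> real)" "\<And>u v :: real. norm (u * v) \<le> norm u * norm v"
    by (rule bounded_bilinear_mult, simp add: abs_mult)
  have "tiny (\<lambda>n x. qRe (F n x) * qIm2 (F n x) powr (-1))"
    by (rule tiny_bilinear[OF bl f0 inv])
  then have "tiny (\<lambda>n x. - (qRe (F n x) * qIm2 (F n x) powr (-1)) - 0)"
    using tiny_linear[OF bounded_linear_minus[OF bounded_linear_ident], of "\<lambda>n x. qRe (F n x) * qIm2 (F n x) powr (-1)"] by simp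
  from compose_near(1)[OF open_UNIV smooth_on_arctan UNIV_I this]
  have t: "tiny (\<lambda>n x. arctan (- (qRe (F n x) * qIm2 (F n x) powr (-1))))" by simp
  have teq: "\<forall>\<^sub>F n in slow. (\<lambda>x. arctan (- (qRe (F n x) * qIm2 (F n x) powr (-1)))) = \<theta> n"
    using pos
  proof eventually_elim
    case (elim n)
    have "qIm2 (F n x) powr (-1) = 1 / qIm2 (F n x)" for x
      using elim[rule_format, of x] by (simp add: powr_minus_divide abs_of_pos)
    then show ?case by (simp add: \<theta>_def fun_eq_iff)
  qed
  show "tiny \<theta>"
    unfolding tiny_def ev_smooth_def
  proof (intro conjI allI impI)
    show "\<forall>\<^sub>F n in slow. smooth (\<theta> n)"
      using tiny_smooth[OF t, unfolded ev_smooth_def] teq by eventually_elim simp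
    fix r and \<epsilon> :: real assume "0 < \<epsilon>"
    from tinyD[OF t this, of r] teq show "\<forall>\<^sub>F n in slow. \<forall>x. cn r (b n) (\<theta> n) x \<le> \<epsilon>"
      by eventually_elim simp
  qed
  show "\<forall>\<^sub>F n in slow. \<forall>x. \<theta> n (x + b n) = - \<theta> n x"
    using flip
  proof eventually_elim
    case (elim n)
    show ?case
    proof
      fix x
      have "qRe (F n (x + b n)) = - qRe (F n x)" "qIm2 (F n (x + b n)) = qIm2 (F n x)"
        using elim by simp_all
      then show "\<theta> n (x + b n) = - \<theta> n x" unfolding \<theta>_def arctan_minus[symmetric] by simp
    qed
  qed
  define N where "N n x = - inner (offdiag (F n x)) (offdiag (F n x))" for n x
  have il: "bounded_bilinear (inner :: quat \<Rightarrow> quat \<Rightarrow> real)" "\<And>u v :: quat. norm (inner u v) \<le> norm u * norm v"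
    by (rule bounded_bilinear_inner, simp add: Cauchy_Schwarz_ineq2)
  have N: "bigO (Suc p) N"
    unfolding N_def[abs_def] using bigO_le[OF bigO_minus[OF bigO_bilinear[OF il W W]]] by simp
  have N1: "tiny (\<lambda>n x. (1 + N n x) - 1)" "bigO (Suc p) (\<lambda>n x. (1 + N n x) - 1)"
    using N bigO_imp_tiny[OF N] by simp_all
  have "bigO (Suc p) (\<lambda>n x. (1 + N n x) powr (-1/2) - 1 powr (-1/2))"
    by (rule compose_near(2)[OF _ smooth_on_powr _ N1]) auto
  then have P: "bigO (Suc p) (\<lambda>n x. (1 + N n x) powr (-1/2) - 1)" by simp
  have Np: "\<forall>\<^sub>F n in slow. \<forall>x. 1 + N n x \<in> {0<..}"
    by (rule compose_near(3)[OF _ smooth_on_powr[of 1] _ N1(1)]) auto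
  have sl: "bounded_bilinear ((*\<^sub>R) :: real \<Rightarrow> quat \<Rightarrow> quat)" "\<And>u (v :: quat). norm (u *\<^sub>R v) \<le> norm u * norm v"
    by (rule bounded_bilinear_scaleR, simp)
  have D0: "bigO 0 (\<lambda>n x. F n x - offdiag (F n x))"
    by (intro bigO_diff bigO_bounded[OF F] bigO_le[OF W]) simp
  have V: "bigO (Suc p) (\<lambda>n x. offdiag (F n x) - ((1 + N n x) powr (-1/2) - 1) *\<^sub>R (F n x - offdiag (F n x)))"
    using bigO_diff[OF W, of "\<lambda>n x. ((1 + N n x) powr (-1/2) - 1) *\<^sub>R (F n x - offdiag (F n x))"] bigO_bilinear[OF sl P D0] by simp
  show "bigO (Suc p) (\<lambda>n x. F n x - qj * rotj (\<theta> n x))"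
  proof (rule bigO_cong[OF V])
    show "\<forall>\<^sub>F n in slow. (\<lambda>x. offdiag (F n x) - ((1 + N n x) powr (-1/2) - 1) *\<^sub>R (F n x - offdiag (F n x))) = (\<lambda>x. F n x - qj * rotj (\<theta> n x))"
      using pos unit Np
    proof eventually_elim
      case (elim n)
      show ?case
      proof
        fix x
        define s where "s = (qRe (F n x))\<^sup>2 + (qIm2 (F n x))\<^sup>2"
        have "s = 1 + N n x"
          using norm_quat_sq[of "F n x"] elim(2)[rule_format, of x] by (simp add: s_def N_def inner_quat_def power2_eq_square)
        then have s: "1 + N n x = s" "0 < s" using elim(3) by simp_all
        have "s powr (-1/2) = 1 / sqrt s"
          using s(2) by (simp add: powr_minus_divide powr_half_sqrt)
        moreover have "cos (\<theta> n x) = qIm2 (F n x) / sqrt s" "sin (\<theta> n x) = - qRe (F n x) / sqrt s"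
          unfolding \<theta>_def s_def using sqrt_rotation elim(1) by blast+
        ultimately show "offdiag (F n x) - ((1 + N n x) powr (-1/2) - 1) *\<^sub>R (F n x - offdiag (F n x)) = F n x - qj * rotj (\<theta> n x)"
          unfolding s(1) by (simp add: quat_eq_iff algebra_simps)
      qed
    qed
  qed
qed

text \<open>After division by norms the angle is removed by a rotation \<open>rotj\<close> with the
  \<beta> of \<open>averaging\<close>. Since \<beta> may be large, the result is measured at the
  finer scale \<open>b (Suc n)\<close>, where this rotation is bounded in every order.\<close>

lemma adiabatic_gauge:
  assumes ad: "adiabatic (Suc p) \<gamma>"
  obtains g where "\<forall>\<^sub>F n in slow. smooth (g n) \<and> (\<forall>x. g n x \<noteq> 0) \<and> (\<forall>x. tw (g n) n x = qi)"
    "\<And>r. \<exists>K. \<forall>\<^sub>F n in slow. \<forall>x. cn r (b (Suc n)) (\<lambda>x. tw (g n) (Suc n) x - qj) x \<le> K * ratio n ^ Suc p"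
proof -
  note ad' = adiabaticD[OF ad]
  define \<gamma>1 where "\<gamma>1 n x = norm (\<gamma> n x) powr (-1) *\<^sub>R \<gamma> n x" for n x
  define F where "F n x = tw (\<gamma> n) (Suc n) x" for n x
  define F1 where "F1 n x = tw (\<gamma>1 n) (Suc n) x" for n x
  have tw1: "\<forall>\<^sub>F n in slow. \<forall>m x. tw (\<gamma>1 n) m x = tw (\<gamma> n) m x /\<^sub>R norm (tw (\<gamma> n) m x)"
    using ad'(2)
  proof eventually_elim
    case (elim n)
    then show ?case unfolding \<gamma>1_def[abs_def] using tw_normalize[of "\<gamma> n"] by blast
  qed
  have \<gamma>1: "\<forall>\<^sub>F n in slow. smooth (\<gamma>1 n)" "\<forall>\<^sub>F n in slow. \<forall>x. \<gamma>1 n x \<noteq> 0" "\<forall>\<^sub>F n in slow. \<forall>x. tw (\<gamma>1 n) n x = qi"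
  proof -
    show "\<forall>\<^sub>F n in slow. smooth (\<gamma>1 n)"
      using ad'(1,2) unfolding \<gamma>1_def[abs_def] by eventually_elim (rule smooth_scaleR[OF smooth_norm]; blast)
    show "\<forall>\<^sub>F n in slow. \<forall>x. \<gamma>1 n x \<noteq> 0"
      using ad'(2) unfolding \<gamma>1_def by eventually_elim simp
    show "\<forall>\<^sub>F n in slow. \<forall>x. tw (\<gamma>1 n) n x = qi"
      using ad'(3) tw1 by eventually_elim simp
  qed
  note Ft = ad'(4)[folded F_def]
  note c = compose_near[OF _ smooth_on_powr[of "-1/2"] _ tiny_diff_const_inner[OF Ft]]
  define \<iota> where "\<iota> n x = (inner (F n x) (F n x)) powr (-1/2)" for n x
  have \<iota>: "tiny (\<lambda>n x. \<iota> n x - 1)" unfolding \<iota>_def using c(1) by simp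
  have F1eq: "\<forall>\<^sub>F n in slow. \<forall>x. F1 n x = \<iota> n x *\<^sub>R F n x"
    using tw1 ad'(2)
  proof eventually_elim
    case (elim n)
    show ?case
    proof
      fix x
      have "F n x \<noteq> 0" unfolding F_def using tw_nonzero[of "\<gamma> n"] elim(2) by blast
      then have "\<iota> n x = 1 / norm (F n x)"
        by (simp add: \<iota>_def norm_eq_sqrt_inner powr_minus_divide powr_half_sqrt)
      then show "F1 n x = \<iota> n x *\<^sub>R F n x" using elim(1) by (simp add: F1_def F_def divide_inverse)
    qed
  qed
  have sl: "bounded_bilinear ((*\<^sub>R) :: real \<Rightarrow> quat \<Rightarrow> quat)" "\<And>u (v :: quat). norm (u *\<^sub>R v) \<le> norm u * norm v"
    by (rule bounded_bilinear_scaleR, simp)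
  have "tiny (\<lambda>n x. (\<iota> n x - 1) *\<^sub>R F n x + (F n x - qj))"
    by (intro tiny_add tiny_bilinear[OF sl \<iota>] bigO_bounded[OF Ft] Ft)
  then have t: "tiny (\<lambda>n x. \<iota> n x *\<^sub>R F n x - qj)" by (simp add: algebra_simps)
  have O: "bigO (Suc p) (\<lambda>n x. offdiag (\<iota> n x *\<^sub>R F n x))"
  proof -
    have "offdiag (\<iota> n x *\<^sub>R F n x) = \<iota> n x *\<^sub>R offdiag (F n x)" for n x by (simp add: quat_eq_iff)
    then show ?thesis using bigO_bilinear[OF sl bigO_bounded[OF \<iota>] ad'(5)] by (simp add: F_def)
  qed
  have F1n: "\<forall>\<^sub>F n in slow. \<forall>x. norm (\<iota> n x *\<^sub>R F n x) = 1"
    using tw1 ad'(2) F1eq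
  proof eventually_elim
    case (elim n)
    show ?case
    proof
      fix x
      have "F n x \<noteq> 0" unfolding F_def using tw_nonzero[of "\<gamma> n"] elim(2) by blast
      then have "norm (F1 n x) = 1" using elim(1) by (simp add: F1_def F_def)
      then show "norm (\<iota> n x *\<^sub>R F n x) = 1" using elim(3) by simp
    qed
  qed
  have F1f: "\<forall>\<^sub>F n in slow. \<forall>x. \<iota> n (x + b n) *\<^sub>R F n (x + b n) = qi * (\<iota> n x *\<^sub>R F n x) * qi"
    using \<gamma>1(2,3) F1eq
  proof eventually_elim
    case (elim n)
    have "F1 n (x + b n) = qi * F1 n x * qi" for x
      unfolding F1_def using elim(1,2) by (intro tw_Suc_shift) (auto simp: units_mult)
    then show ?case using elim(3) by simp
  qed
  obtain \<theta> where \<theta>: "tiny \<theta>" "\<forall>\<^sub>F n in slow. \<forall>x. \<theta> n (x + b n) = - \<theta> n x"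
    and V: "bigO (Suc p) (\<lambda>n x. \<iota> n x *\<^sub>R F n x - qj * rotj (\<theta> n x))"
    using abelian_part[OF t O F1n F1f] by blast
  obtain \<beta> where \<beta>: "\<forall>\<^sub>F n in slow. smooth (\<beta> n)" "\<forall>\<^sub>F n in slow. \<forall>x. \<beta> n (x + b n) = - \<beta> n x"
    and \<beta>O: "bigO (Suc p) (\<lambda>n x. \<theta> n x + \<beta> n (x + b (Suc n)) - \<beta> n x)" "bigO 0 (\<lambda>n x. b (Suc n) *\<^sub>R vd (\<beta> n) x)"
    using averaging[OF tiny_imp_bigO[OF \<theta>(1)] \<theta>(2), of "Suc p"] by blast
  define g where "g n x = rotj (\<beta> n x) * \<gamma>1 n x" for n x
  have rn: "rotj z \<noteq> 0" for z using norm_rotj[of z] by auto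
  have twg: "\<forall>\<^sub>F n in slow. \<forall>m x. tw (g n) m x = rotj (\<beta> n (x + b m)) * tw (\<gamma>1 n) m x * rotj (- \<beta> n x)"
    using \<gamma>1(2)
  proof eventually_elim
    case (elim n)
    show ?case
      unfolding g_def[abs_def] using tw_mult[of "\<lambda>x. rotj (\<beta> n x)" "\<gamma>1 n"] elim rn
      by (simp add: rotj_inverse)
  qed
  show thesis
  proof (rule that[of g])
    show "\<forall>\<^sub>F n in slow. smooth (g n) \<and> (\<forall>x. g n x \<noteq> 0) \<and> (\<forall>x. tw (g n) n x = qi)"
      using \<gamma>1 \<beta> twg
    proof eventually_elim
      case (elim n)
      have "tw (g n) n x = rotj (- \<beta> n x) * qi * rotj (- \<beta> n x)" for x using elim(3,5,6) by simp
      \<comment> \<open>Conjugation by qi inverts the circle \<open>rotj\<close>, so the sign change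
        of \<beta> over \<open>b n\<close> keeps the first generator equal to qi.\<close>
      moreover have "rotj (- z) * qi * rotj (- z) = qi" for z
        using sin_cos_squared_add[of z] by (simp add: quat_eq_iff power2_eq_square algebra_simps)
      moreover have "smooth (g n)" unfolding g_def[abs_def] by (intro smooth_mult smooth_rotj elim)
      ultimately show ?case using elim(2) rn by (simp add: g_def)
    qed
    show "\<exists>K. \<forall>\<^sub>F n in slow. \<forall>x. cn r (b (Suc n)) (\<lambda>x. tw (g n) (Suc n) x - qj) x \<le> K * ratio n ^ Suc p" for r
    proof -
      define \<psi> where "\<psi> n x = \<theta> n x + \<beta> n (x + b (Suc n)) - \<beta> n x" for n x
      note \<psi>O = \<beta>O(1)[folded \<psi>_def]
      have \<psi>t: "tiny (\<lambda>n x. \<psi> n x - 0)" "bigO (Suc p) (\<lambda>n x. \<psi> n x - 0)" using bigO_imp_tiny[OF \<psi>O] \<psi>O by simp_all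
      have uu: "open (UNIV :: real set)" "smooth_on UNIV (cos :: real \<Rightarrow> real)" "smooth_on UNIV (sin :: real \<Rightarrow> real)" "(0::real) \<in> UNIV"
        using smooth_cos smooth_sin by (simp_all add: smooth_iff_smooth_on)
      have cs: "bigO (Suc p) (\<lambda>n x. cos (\<psi> n x) - 1)" "bigO (Suc p) (\<lambda>n x. sin (\<psi> n x))"
        using compose_near(2)[OF uu(1,2,4) \<psi>t] compose_near(2)[OF uu(1,3,4) \<psi>t] by simp_all
      have "bigO (Suc p) (\<lambda>n x. (cos (\<psi> n x) - 1) *\<^sub>R qj + - (sin (\<psi> n x) *\<^sub>R 1))"
        by (intro bigO_add bigO_minus bigO_linear[OF bounded_linear_scaleR_left _ cs(1)] bigO_linear[OF bounded_linear_scaleR_left _ cs(2)]) simp_all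
      moreover have "(cos z - 1) *\<^sub>R qj + - (sin z *\<^sub>R 1) = qj * rotj z - qj" for z by (simp add: quat_eq_iff)
      ultimately have Z: "bigO (Suc p) (\<lambda>n x. qj * rotj (\<psi> n x) - qj)" by simp
      obtain K1 where K1: "0 \<le> K1" "\<forall>\<^sub>F n in slow. \<forall>x. cn r (b n) (\<lambda>x. qj * rotj (\<psi> n x) - qj) x \<le> K1 * ratio n ^ Suc p"
        using bigOE[OF Z] by blast
      obtain K2 where K2: "0 \<le> K2" "\<forall>\<^sub>F n in slow. \<forall>x. cn r (b n) (\<lambda>x. \<iota> n x *\<^sub>R F n x - qj * rotj (\<theta> n x)) x \<le> K2 * ratio n ^ Suc p"
        using bigOE[OF V] by blast
      obtain K3 where K3: "0 \<le> K3" "\<forall>\<^sub>F n in slow. \<forall>x. cn r (b n) (\<lambda>x. b (Suc n) *\<^sub>R vd (\<beta> n) x) x \<le> K3 * ratio n ^ 0"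
        using bigOE[OF \<beta>O(2)] by blast
      define K where "K = K1 + (1 + K3) ^ r * K2 * (1 + K3) ^ r"
      have "\<forall>\<^sub>F n in slow. \<forall>x. cn r (b (Suc n)) (\<lambda>x. tw (g n) (Suc n) x - qj) x \<le> K * ratio n ^ Suc p"
        using K1(2) K2(2) K3(2) \<beta>(1) twg F1eq bigO_smooth[OF V, unfolded ev_smooth_def] bigO_smooth[OF Z, unfolded ev_smooth_def]
      proof eventually_elim
        case (elim n)
        let ?s = "b (Suc n)"
        have s: "0 \<le> ?s" "?s \<le> b n" using b_nonneg[of "Suc n"] b_dec[of n] by auto
        define U where "U x = \<iota> n x *\<^sub>R F n x - qj * rotj (\<theta> n x)" for x
        have sU: "smooth U" unfolding U_def[abs_def] by (rule elim(7))
        have vb: "?s * cn r ?s (vd (\<beta> n)) x \<le> K3" for x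
        proof -
          have "?s * cn r ?s (vd (\<beta> n)) x \<le> ?s * cn r (b n) (vd (\<beta> n)) x"
            using s by (intro mult_left_mono cn_mono_scale)
          also have "\<dots> = cn r (b n) (\<lambda>x. ?s *\<^sub>R vd (\<beta> n) x) x"
            using s by (simp add: cn_scaleR_const[OF smooth_vd[OF elim(4)]] del: real_scaleR_def)
          also have "\<dots> \<le> K3" using elim(3) by simp
          finally show ?thesis .
        qed
        have sr: "smooth (\<lambda>x. rotj (\<beta> n x))" "smooth (\<lambda>x. rotj (- \<beta> n x))"
          by (rule smooth_rotj[OF elim(4)], rule smooth_rotj[OF smooth_minus[OF elim(4)]])
        have r1: "cn r ?s (\<lambda>x. rotj (\<beta> n x)) x \<le> (1 + K3) ^ r" for x
          by (rule cn_rotj[OF elim(4) s(1) vb])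
        have r2: "cn r ?s (\<lambda>x. rotj (- \<beta> n x)) x \<le> (1 + K3) ^ r" for x
          using vb by (intro cn_rotj smooth_minus elim s) (simp add: vd_minus[OF elim(4)] cn_minus[OF smooth_vd[OF elim(4)]])
        show ?case
        proof
          fix x
          have eq: "tw (g n) (Suc n) y - qj = (qj * rotj (\<psi> n y) - qj) + rotj (\<beta> n (y + ?s)) * U y * rotj (- \<beta> n y)" for y
          proof -
            have "tw (g n) (Suc n) y = rotj (\<beta> n (y + ?s)) * (qj * rotj (\<theta> n y) + U y) * rotj (- \<beta> n y)"
              using elim(5,6) by (simp add: U_def F1_def[symmetric])
            also have "\<dots> = rotj (\<beta> n (y + ?s)) * (qj * rotj (\<theta> n y)) * rotj (- \<beta> n y) + rotj (\<beta> n (y + ?s)) * U y * rotj (- \<beta> n y)"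
              by (simp add: algebra_simps)
            also have "rotj (\<beta> n (y + ?s)) * (qj * rotj (\<theta> n y)) * rotj (- \<beta> n y) = qj * (rotj (\<beta> n (y + ?s)) * rotj (\<theta> n y) * rotj (- \<beta> n y))"
              by (simp add: mult.assoc[symmetric] rotj_commute)
            also have "rotj (\<beta> n (y + ?s)) * rotj (\<theta> n y) * rotj (- \<beta> n y) = rotj (\<psi> n y)"
              by (simp add: rotj_add \<psi>_def algebra_simps)
            finally show ?thesis by simp
          qed
          have sm: "smooth (\<lambda>x. rotj (\<beta> n (x + ?s)) * U x)" "smooth (\<lambda>x. rotj (\<beta> n (x + ?s)) * U x * rotj (- \<beta> n x))"
            by (rule smooth_mult[OF smooth_shift[OF sr(1)] sU], rule smooth_mult[OF smooth_mult[OF smooth_shift[OF sr(1)] sU] sr(2)])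
          have "cn r ?s (\<lambda>x. rotj (\<beta> n (x + ?s)) * U x * rotj (- \<beta> n x)) x
              \<le> cn r ?s (\<lambda>x. rotj (\<beta> n (x + ?s)) * U x) x * cn r ?s (\<lambda>x. rotj (- \<beta> n x)) x"
            by (rule cn_mult[OF s(1) sm(1) sr(2)])
          also have "\<dots> \<le> (cn r ?s (\<lambda>x. rotj (\<beta> n (x + ?s))) x * cn r ?s U x) * cn r ?s (\<lambda>x. rotj (- \<beta> n x)) x"
            by (intro mult_right_mono cn_mult s smooth_shift[OF sr(1)] sU cn_nonneg)
          also have "\<dots> \<le> ((1 + K3) ^ r * (K2 * ratio n ^ Suc p)) * (1 + K3) ^ r"
          proof (intro mult_mono r2)
            show "cn r ?s (\<lambda>x. rotj (\<beta> n (x + ?s))) x \<le> (1 + K3) ^ r"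
              using r1[of "x + ?s"] cn_shift[OF sr(1), of r ?s ?s x] by simp
            show "cn r ?s U x \<le> K2 * ratio n ^ Suc p"
              using cn_mono_scale[OF s, of r U x] elim(2)[rule_format, of x] unfolding U_def by linarith
          qed (use K2(1) K3(1) s ratio_bounds[of n] in auto)
          finally have A: "cn r ?s (\<lambda>x. rotj (\<beta> n (x + ?s)) * U x * rotj (- \<beta> n x)) x \<le> ((1 + K3) ^ r * K2 * (1 + K3) ^ r) * ratio n ^ Suc p"
            by (simp add: mult_ac)
          have B: "cn r ?s (\<lambda>x. qj * rotj (\<psi> n x) - qj) x \<le> K1 * ratio n ^ Suc p"
            using cn_mono_scale[OF s, of r "\<lambda>x. qj * rotj (\<psi> n x) - qj" x] elim(1)[rule_format, of x] by linarith
          have "cn r ?s (\<lambda>x. tw (g n) (Suc n) x - qj) x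
            \<le> cn r ?s (\<lambda>x. qj * rotj (\<psi> n x) - qj) x + cn r ?s (\<lambda>x. rotj (\<beta> n (x + ?s)) * U x * rotj (- \<beta> n x)) x"
            unfolding eq by (rule cn_add[OF s(1) elim(8) sm(2)])
          then show "cn r ?s (\<lambda>x. tw (g n) (Suc n) x - qj) x \<le> K * ratio n ^ Suc p"
            using A B unfolding K_def distrib_right by linarith
        qed
      qed
      then show ?thesis by blast
    qed
  qed
qed

end

section \<open>Gauges of arbitrary precision at every step\<close>

context flat_renormalization
begin

text \<open>The estimate of \<open>adiabatic_gauge\<close> still normalizes the generator at step n;
  one application of the recursion moves it to step n + 1, whose scale is already the one in that
  estimate.\<close>

lemma slow_gauge:
  obtains K \<delta> :: real and N :: nat where "0 < \<delta>" "0 \<le> K"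
    "\<And>n. N \<le> n \<Longrightarrow> ratio n < \<delta> \<Longrightarrow> \<exists>g. gauge (Suc n) r (K * ratio n ^ R) g"
proof -
  obtain K0 where K0: "\<And>r. 1 \<le> K0 r"
    "\<And>n g u v. \<lbrakk>smooth g; \<And>x. g x \<noteq> 0; anticommuting_units u v;
        \<And>x. 0 \<le> x \<Longrightarrow> x \<le> b n \<Longrightarrow> norm (tw g n x - u) < 1\<rbrakk>
      \<Longrightarrow> \<exists>g'. \<forall>r d. (\<forall>x\<in>{-3 * b n..3 * b n}. cn r (b n) (\<lambda>x. tw g n x - u) x \<le> d
            \<and> cn r (b n) (\<lambda>x. tw g (Suc n) x - v) x \<le> d) \<longrightarrow> K0 r * d \<le> 1 \<longrightarrow> gauge n r (K0 r * d) g'"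
    using gauge_of_near by blast
  \<comment> \<open>Two extra orders: one pays for the words of length about the inverse of the
    ratio, the other makes the error small enough for \<open>gauge_of_near\<close> when the ratio is
    small, even for R = 0.\<close>
  obtain \<gamma> where ad: "adiabatic (Suc (Suc R)) \<gamma>" using adiabatic_exists by blast
  obtain g where g: "\<forall>\<^sub>F n in slow. smooth (g n) \<and> (\<forall>x. g n x \<noteq> 0) \<and> (\<forall>x. tw (g n) n x = qi)"
    and ex: "\<And>r. \<exists>K. \<forall>\<^sub>F n in slow. \<forall>x. cn r (b (Suc n)) (\<lambda>x. tw (g n) (Suc n) x - qj) x \<le> K * ratio n ^ Suc (Suc R)"
    using adiabatic_gauge[OF ad] by blast
  obtain K1 where K1: "\<forall>\<^sub>F n in slow. \<forall>x. cn r (b (Suc n)) (\<lambda>x. tw (g n) (Suc n) x - qj) x \<le> K1 * ratio n ^ Suc (Suc R)"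
    using ex by blast
  define K where "K = max 1 K1"
  have K: "1 \<le> K" "K1 \<le> K" by (auto simp: K_def)
  have "0 < 1 / (16 * K0 r * K)" using K0(1)[of r] K(1) by simp
  from slow_ratio[OF this]
  have "\<forall>\<^sub>F n in slow. \<exists>g. gauge (Suc n) r (8 * K0 r * K * ratio n ^ R) g"
    using K1 g
  proof eventually_elim
    case (elim n)
    let ?s = "b (Suc n)" and ?g = "g n"
    note rb = ratio_bounds[of n]
    have g: "smooth ?g" "\<And>x. ?g x \<noteq> 0" "\<And>x. tw ?g n x = qi" using elim(3) by auto
    define e where "e = K * ratio n ^ Suc (Suc R)"
    have ratio1: "16 * K0 r * K * ratio n \<le> 1" using elim(1) K0(1)[of r] K(1) by (simp add: field_simps)
    have e0: "0 \<le> e" using K(1) rb by (simp add: e_def)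
    have eN: "cn r ?s (\<lambda>x. tw ?g (Suc n) x - qj) x \<le> e" for x
    proof -
      have "K1 * ratio n ^ Suc (Suc R) \<le> e" unfolding e_def using K(2) rb by (intro mult_right_mono) auto
      then show ?thesis using elim(2) order_trans by blast
    qed
    define d where "d = 8 * K * ratio n ^ Suc R"
    have Kr: "K * ratio n ^ Suc R \<le> K * ratio n"
      using K(1) rb power_decreasing[of 1 "Suc R" "ratio n"] by (intro mult_left_mono) auto
    have K0e: "1 * (K * ratio n) \<le> K0 r * (K * ratio n)" using K0(1)[of r] K(1) rb by (intro mult_right_mono) auto
    have "K0 r * (K * ratio n ^ Suc R) \<le> K0 r * (K * ratio n)" using K0(1)[of r] by (intro mult_left_mono[OF Kr]) simp
    moreover have "K * ratio n ^ Suc (Suc R) \<le> K * ratio n ^ Suc R"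
      using K(1) rb by (intro mult_left_mono power_decreasing) auto
    moreover have "0 \<le> K * ratio n ^ Suc R" using K(1) rb by simp
    ultimately have d: "2 * (K0 r * d) \<le> 1" "2 * d \<le> 1" "0 \<le> d" "e \<le> 1 / 2"
      using ratio1 K0e Kr unfolding d_def e_def
      by (simp_all only: mult.assoc mult.left_commute[of "K0 r" "8"])
    have ie: "cn r ?s (\<lambda>x. inverse (tw ?g (Suc n) x) - inverse qj) x \<le> 2 * e" for x
    proof -
      have "cn r ?s (\<lambda>x. inverse (tw ?g (Suc n) x) - inverse qj) x \<le> e / (1 - e)"
        using d(4) eN by (intro cn_inverse_near b_nonneg smooth_tw g tw_nonzero) auto
      also have "\<dots> \<le> 2 * e"
      proof -
        have "e * 1 \<le> e * (2 * (1 - e))" using e0 d(4) by (intro mult_left_mono) auto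
        then show ?thesis using d(4) by (simp add: pos_divide_le_eq algebra_simps)
      qed
      finally show ?thesis .
    qed
    have e2: "e \<le> 2 * e" using e0 by simp
    have "\<exists>w w' L L'. anticommuting_units w w' \<and> L \<le> L' \<and>
      real L' * b (n + 1) + real L * b (Suc (n + 1)) = b n + b (Suc n) \<and>
      (\<forall>x. cn r ?s (\<lambda>x. tw ?g (n + 1) x - w) x \<le> (1 + 2 * e) ^ L - 1) \<and>
      (\<forall>x. cn r ?s (\<lambda>x. inverse (tw ?g (n + 1) x) - inverse w) x \<le> (1 + 2 * e) ^ L - 1) \<and>
      (\<forall>x. cn r ?s (\<lambda>x. tw ?g (Suc (n + 1)) x - w') x \<le> (1 + 2 * e) ^ L' - 1) \<and>
      (\<forall>x. cn r ?s (\<lambda>x. inverse (tw ?g (Suc (n + 1)) x) - inverse w') x \<le> (1 + 2 * e) ^ L' - 1)"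
      by (rule near_words[OF g(1,2) anticommuting_units_ij b_nonneg _ _ order_trans[OF eN e2] ie])
        (use g(3) e0 cn_const[of r ?s "0::quat"] in simp_all)
    then obtain w w' L L' where w: "anticommuting_units w w'" and L: "L \<le> L'"
      "real L' * ?s + real L * b (Suc (Suc n)) = b n + ?s"
      and near: "\<And>x. cn r ?s (\<lambda>x. tw ?g (Suc n) x - w) x \<le> (1 + 2 * e) ^ L - 1"
      "\<And>x. cn r ?s (\<lambda>x. tw ?g (Suc (Suc n)) x - w') x \<le> (1 + 2 * e) ^ L' - 1"
      by auto
    have pow: "(1 + 2 * e) ^ l - 1 \<le> d" if "l \<le> L'" for l
    proof -
      have "real L' * ?s \<le> 2 * b n"
        using L(2) b_dec[of n] mult_nonneg_nonneg[OF _ b_nonneg, of "real L" "Suc (Suc n)"] by linarith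
      then have "real L' * ratio n \<le> 2" using b_pos[of n] by (simp add: ratio_def field_simps)
      moreover have "real l * ratio n \<le> real L' * ratio n" using that rb by (intro mult_right_mono) auto
      ultimately have "real l * ratio n \<le> 2" by linarith
      then have "(real l * ratio n) * (2 * (K * ratio n ^ Suc R)) \<le> 2 * (2 * (K * ratio n ^ Suc R))"
        using K(1) rb by (intro mult_right_mono) auto
      then have "real l * (2 * e) \<le> d / 2" by (simp add: e_def d_def mult_ac)
      then show ?thesis
        using power_one_plus_le[of "2 * e" l] e0 d(2,3) by linarith
    qed
    have dw: "cn r ?s (\<lambda>x. tw ?g (Suc n) x - w) x \<le> d" "cn r ?s (\<lambda>x. tw ?g (Suc (Suc n)) x - w') x \<le> d" for x
      using order_trans[OF near(1) pow[OF L(1)]] order_trans[OF near(2) pow[OF order_refl]] by auto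
    have "norm (tw ?g (Suc n) x - w) < 1" for x
      using norm_le_cn[OF b_nonneg, of "\<lambda>x. tw ?g (Suc n) x - w" x r "Suc n"] dw(1)[of x] d by linarith
    from K0(2)[OF g(1,2) w this] obtain g' where "\<And>r d. (\<forall>x\<in>{-3 * ?s..3 * ?s}. cn r ?s (\<lambda>x. tw ?g (Suc n) x - w) x \<le> d
            \<and> cn r ?s (\<lambda>x. tw ?g (Suc (Suc n)) x - w') x \<le> d) \<Longrightarrow> K0 r * d \<le> 1 \<Longrightarrow> gauge (Suc n) r (K0 r * d) g'"
      by blast
    then have "gauge (Suc n) r (K0 r * d) g'" using dw d(1) d(3) K0(1)[of r] mult_nonneg_nonneg[of "K0 r" d] by simp
    moreover have "K0 r * d \<le> 8 * K0 r * K * ratio n ^ R"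
    proof -
      have "ratio n ^ Suc R \<le> ratio n ^ R" using rb by (intro power_decreasing) auto
      then have "8 * K0 r * K * ratio n ^ Suc R \<le> 8 * K0 r * K * ratio n ^ R"
        using K0(1)[of r] K(1) by (intro mult_left_mono) auto
      then show ?thesis by (simp add: d_def mult_ac)
    qed
    ultimately show ?case using gauge_mono by blast
  qed
  then obtain N \<delta> where "0 < \<delta>" "\<And>n. N \<le> n \<Longrightarrow> ratio n < \<delta> \<Longrightarrow> \<exists>g. gauge (Suc n) r (8 * K0 r * K * ratio n ^ R) g"
    using slowD by blast
  moreover have "0 \<le> 8 * K0 r * K" using K0(1)[of r] K(1) by simp
  ultimately show thesis using that by blast
qed

end

context renormalization
begin

text \<open>Two consecutive steps at least halve the scale, since \<open>b n\<close> is at least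
  \<open>b (Suc n) + b (Suc (Suc n))\<close>.\<close>

lemma b_small:
  assumes "0 < \<epsilon>"
  obtains N where "\<And>n. N \<le> n \<Longrightarrow> b n < \<epsilon>"
proof -
  have half: "b (Suc (Suc n)) \<le> b n / 2" for n
  proof -
    have "1 * b (Suc n) \<le> real (a n) * b (Suc n)" using a_pos[of n] b_nonneg by (intro mult_right_mono) auto
    then show ?thesis using b_rec[of n] b_dec[of "Suc n"] by linarith
  qed
  have "b (2 * k) \<le> b 0 * (1 / 2) ^ k" for k
    by (induction k) (use half[of "2 * _"] in \<open>auto intro: order_trans\<close>)
  moreover obtain k where "(1 / 2) ^ k < \<epsilon> / b 0"
    using real_arch_pow_inv[of "\<epsilon> / b 0" "1 / 2"] assms b_pos[of 0] by auto
  then have "b 0 * (1 / 2) ^ k < \<epsilon>" using b_pos[of 0] by (simp add: field_simps)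
  ultimately have "b (2 * k) < \<epsilon>" using order_le_less_trans by blast
  then have "b n < \<epsilon>" if "2 * k \<le> n" for n
    using b_antimono[OF that] by linarith
  then show thesis by (rule that)
qed

lemma gauge_mono_order: "gauge n s e g \<Longrightarrow> r \<le> s \<Longrightarrow> gauge n r e g"
  unfolding gauge_def using cn_mono[OF b_nonneg] order_trans by blast

end

context flat_renormalization
begin

text \<open>Along a subsequence the errors decay faster than a prescribed power of \<open>b\<close>: a scale at which
  \<open>gauge_improve\<close> does not apply is reached by a single step of small \<open>ratio\<close>.\<close>

lemma fast_gauges:
  obtains j0 \<epsilon>0 where "0 < \<epsilon>0" "\<And>M. \<exists>m\<ge>M. \<exists>g. gauge m (R + 4) (\<epsilon>0 * (b m / b j0) ^ R) g"
proof -
  \<comment> \<open>Three orders pay for the cube in \<open>gauge_improve\<close>, R orders carry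
    the decay along, and the last one leaves a factor \<kappa> that absorbs the constant K.\<close>
  define \<rho> where "\<rho> = R + 4"
  define P where "P j e \<longleftrightarrow> (\<exists>g. gauge j \<rho> e g)" for j e
  have P_mono: "P j e' \<Longrightarrow> e' \<le> e \<Longrightarrow> P j e" for j e e'
    unfolding P_def using gauge_mono by blast
  have P_nonneg: "P j e \<Longrightarrow> 0 \<le> e" for j e unfolding P_def using gaugeD(5) by blast
  obtain K where K: "1 \<le> K" and I: "\<And>n m e. n \<le> m \<Longrightarrow> P n e \<Longrightarrow> K * e * (b n / b m) ^ 3 \<le> 1
      \<Longrightarrow> P m (K * e * (b n / b m) ^ 3 * (b m / b n) ^ \<rho>)"
  proof -
    obtain K where K: "\<And>r. 1 \<le> K r"
      "\<And>n m r e g. n \<le> m \<Longrightarrow> 1 \<le> r \<Longrightarrow> gauge n r e g \<Longrightarrow> K r * e * (b n / b m) ^ 3 \<le> 1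
        \<Longrightarrow> \<exists>g'. gauge m r (K r * e * (b n / b m) ^ 3 * (b m / b n) ^ r) g'"
      using gauge_improve by blast
    show thesis
    proof (rule that[OF K(1)[of \<rho>]])
      show "P m (K \<rho> * e * (b n / b m) ^ 3 * (b m / b n) ^ \<rho>)"
        if "n \<le> m" "P n e" "K \<rho> * e * (b n / b m) ^ 3 \<le> 1" for n m e
        using that K(2)[OF that(1) _ _ that(3)] unfolding P_def by (auto simp: \<rho>_def)
    qed
  qed
  obtain K2 \<delta> N where S: "0 < \<delta>" "0 \<le> K2" "\<And>n. N \<le> n \<Longrightarrow> ratio n < \<delta> \<Longrightarrow> P (Suc n) (K2 * ratio n ^ \<rho>)"
  proof -
    obtain K2 \<delta> N where h: "0 < \<delta>" "0 \<le> K2"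
      "\<And>n. N \<le> n \<Longrightarrow> ratio n < \<delta> \<Longrightarrow> \<exists>g. gauge (Suc n) \<rho> (K2 * ratio n ^ \<rho>) g"
      by (rule slow_gauge[where r = \<rho> and R = \<rho>]) (rule that)
    show thesis by (rule that[OF h(1,2)]) (unfold P_def, rule h(3))
  qed
  \<comment> \<open>The scale has to drop by at least the factor l, so that K \<kappa> is at most 1
    and the bound \<open>e j\<close> is reproduced without a growing constant.\<close>
  define l where "l = 1 / (K + 1)"
  have l: "0 < l" "l < 1" "K * l \<le> 1" using K by (auto simp: l_def field_simps)
  \<comment> \<open>The two demands of the case of a fast drop: the ratio of the last step must be
    below \<delta>, and the bound of \<open>slow_gauge\<close> must be below
    \<open>e j'\<close>.\<close>
  define \<mu> where "\<mu> = min (l * \<delta>) (l ^ \<rho> / (K * (K2 + 1)))"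
  have \<mu>: "0 < \<mu>" "\<mu> \<le> l * \<delta>" "\<mu> \<le> l ^ \<rho> / (K * (K2 + 1))" using S l K by (auto simp: \<mu>_def)
  \<comment> \<open>With this choice K \<open>e j\<close> never exceeds \<mu> ^ 3, so that failure
    of the condition of \<open>gauge_improve\<close> forces \<kappa> below \<mu>.\<close>
  define \<epsilon>0 where "\<epsilon>0 = \<mu> ^ 3 / K"
  have \<epsilon>0: "0 < \<epsilon>0" "K * \<epsilon>0 = \<mu> ^ 3" using \<mu> K by (auto simp: \<epsilon>0_def)
  obtain \<gamma> where "\<And>r \<epsilon>. 0 < \<epsilon> \<Longrightarrow> \<forall>\<^sub>F n in sequentially. gauge n r \<epsilon> (\<gamma> n)"
    using initial_gauges by blast
  then obtain j0 where j0: "N \<le> j0" "P j0 \<epsilon>0"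
    using \<epsilon>0(1) unfolding P_def eventually_sequentially by (metis nat_le_linear)
  define e where "e j = \<epsilon>0 * (b j / b j0) ^ R" for j
  have e_pos: "0 < e j" for j using \<epsilon>0 b_pos by (simp add: e_def)
  have step: "\<exists>j'>j. P j' (e j')" if j: "j0 \<le> j" "P j (e j)" for j
  proof -
    obtain M where M: "\<And>n. M \<le> n \<Longrightarrow> b n < l * b j" using b_small[of "l * b j"] l b_pos by auto
    \<comment> \<open>The first step at which the scale has dropped by the factor l. At its
      predecessor i it has not, so the whole drop \<kappa> is shared by the last step up to the
      factor l: \<open>ratio i\<close> is at most \<kappa> / l.\<close>
    define j' where "j' = (LEAST n. b n \<le> l * b j)"
    have j'l: "b j' \<le> l * b j" unfolding j'_def by (rule LeastI[of _ M]) (use M[of M] in simp)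
    have lbj: "l * b j < b j" using l b_pos[of j] by simp
    have jj: "j < j'"
      using j'l lbj b_antimono[of j' j] by (meson not_le order_le_less_trans order_less_irrefl)
    then obtain i where i: "j' = Suc i" "j \<le> i" by (cases j') auto
    have il: "l * b j < b i" using not_less_Least[of i "\<lambda>n. b n \<le> l * b j"] i(1) by (simp add: j'_def[symmetric])
    define \<kappa> where "\<kappa> = b j' / b j"
    have \<kappa>: "0 < \<kappa>" "\<kappa> \<le> l" using j'l b_pos by (auto simp: \<kappa>_def field_simps)
    have inv: "b j / b j' = 1 / \<kappa>" by (simp add: \<kappa>_def)
    have ej': "e j' = e j * \<kappa> ^ R" using b_pos[of j] by (simp add: e_def \<kappa>_def power_divide)
    have ele: "e j \<le> \<epsilon>0"
      using \<epsilon>0(1) b_antimono[OF j(1)] b_pos[of j] b_pos[of j0] mult_left_mono[of "(b j / b j0) ^ R" 1 \<epsilon>0]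
      by (simp add: e_def power_le_one)
    show ?thesis
    proof (cases "K * e j \<le> \<kappa> ^ 3")
      case True
      have "P j' (K * e j * (b j / b j') ^ 3 * (b j' / b j) ^ \<rho>)"
        using jj True \<kappa> by (intro I j) (auto simp: inv power_divide)
      moreover have "K * e j * (b j / b j') ^ 3 * (b j' / b j) ^ \<rho> = (K * \<kappa>) * (e j * \<kappa> ^ R)"
        using \<kappa>(1) unfolding inv \<kappa>_def[symmetric] \<rho>_def by (simp add: power_add power_divide eval_nat_numeral field_simps)
      moreover have "(K * \<kappa>) * (e j * \<kappa> ^ R) \<le> 1 * (e j * \<kappa> ^ R)"
      proof (rule mult_right_mono)
        show "K * \<kappa> \<le> 1" using mult_left_mono[OF \<kappa>(2), of K] K l(3) by linarith
        show "0 \<le> e j * \<kappa> ^ R" using \<kappa>(1) e_pos[of j] by simp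
      qed
      ultimately have "P j' (e j')" using P_mono ej' by simp
      then show ?thesis using jj by blast
    next
      case False
      have "K * e j \<le> \<mu> ^ 3" using ele K mult_left_mono[of "e j" \<epsilon>0 K] \<epsilon>0(2) by simp
      then have "\<kappa> ^ 3 < \<mu> ^ 3" using False by linarith
      then have lm: "\<kappa> < \<mu>" using power_less_imp_less_base \<mu>(1) by (metis less_imp_le)
      have rl: "ratio i * l \<le> \<kappa>"
      proof -
        have "b j' * (l * b j) \<le> b j' * b i" using il b_nonneg by (intro mult_left_mono) auto
        then show ?thesis using b_pos[of i] b_pos[of j] by (simp add: ratio_def \<kappa>_def i(1) field_simps)
      qed
      have "ratio i * l < \<delta> * l" using rl lm \<mu>(2) by (simp add: mult.commute)
      then have "ratio i < \<delta>" using l by simp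
      then have "P j' (K2 * ratio i ^ \<rho>)" using S(3)[of i] i j(1) j0(1) by simp
      moreover have "K2 * ratio i ^ \<rho> \<le> e j'"
      proof -
        have "(ratio i * l) ^ \<rho> \<le> \<kappa> ^ \<rho>" using rl ratio_bounds[of i] l by (intro power_mono) auto
        then have A: "ratio i ^ \<rho> * l ^ \<rho> \<le> \<kappa> * \<kappa> ^ 3 * \<kappa> ^ R"
          by (simp add: power_mult_distrib \<rho>_def power_add eval_nat_numeral mult_ac)
        have "\<kappa> * (\<kappa> ^ 3 * \<kappa> ^ R) \<le> \<mu> * (K * e j * \<kappa> ^ R)"
          using lm False \<kappa> \<mu> K e_pos[of j] by (intro mult_mono mult_right_mono) auto
        also have "\<dots> \<le> (l ^ \<rho> / (K * (K2 + 1))) * (K * e j * \<kappa> ^ R)"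
          using \<mu> K e_pos[of j] \<kappa> by (intro mult_right_mono) auto
        also have "\<dots> = l ^ \<rho> * e j' / (K2 + 1)" using K by (simp add: ej')
        finally have "ratio i ^ \<rho> * l ^ \<rho> \<le> (e j' / (K2 + 1)) * l ^ \<rho>" using A by (simp add: mult_ac)
        then have "ratio i ^ \<rho> \<le> e j' / (K2 + 1)" by (rule mult_right_le_imp_le) (use l in simp)
        then have "(K2 + 1) * ratio i ^ \<rho> \<le> e j'" using S(2) by (simp add: field_simps)
        then show ?thesis using ratio_bounds[of i] by (simp add: distrib_right) (smt (verit) zero_le_power)
      qed
      ultimately have "P j' (e j')" by (rule P_mono)
      then show ?thesis using jj by blast
    qed
  qed
  have "\<exists>m\<ge>M. j0 \<le> m \<and> P m (e m)" for M
  proof (induction M)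
    case 0
    have "P j0 (e j0)" using j0(2) b_pos[of j0] by (simp add: e_def)
    then show ?case by auto
  next
    case (Suc M)
    then obtain m where m: "M \<le> m" "j0 \<le> m" "P m (e m)" by blast
    from step[OF this(2,3)] obtain j' where "m < j'" "P j' (e j')" by blast
    then show ?case using m by (intro exI[of _ j']) auto
  qed
  then show thesis
    by (intro that[of \<epsilon>0 j0, OF \<epsilon>0(1)]) (unfold P_def e_def \<rho>_def, blast)
qed

text \<open>Pulling back from step m costs the power r + 1 of \<open>b n / b m\<close>. Errors
  decaying like the power r + 2 of \<open>b m\<close> leave one factor \<open>b m\<close>, which
  tends to zero.\<close>

lemma gauges_exist:
  assumes "0 < \<delta>"
  shows "\<exists>g. gauge n r \<delta> g"
proof -
  obtain j0 \<epsilon>0 where \<epsilon>0: "0 < \<epsilon>0"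
    and fast: "\<And>M. \<exists>m\<ge>M. \<exists>g. gauge m (r + 2 + 4) (\<epsilon>0 * (b m / b j0) ^ (r + 2)) g"
    by (rule fast_gauges[where R = "r + 2"]) (rule that)
  obtain K where K: "\<And>r. 1 \<le> K r"
    and pull: "\<And>n m r e g. n < m \<Longrightarrow> gauge m r e g \<Longrightarrow> K r * e * (b n / b m) ^ (r + 1) \<le> 1
      \<Longrightarrow> \<exists>g'. gauge n r (K r * e * (b n / b m) ^ (r + 1)) g'"
    by (rule gauge_pull_back) (rule that)
  define C where "C = K r * \<epsilon>0 * b n ^ (r + 1) / b j0 ^ (r + 2)"
  have C: "0 < C" using K[of r] \<epsilon>0 b_pos by (simp add: C_def)
  define d where "d = min \<delta> 1"
  have d: "0 < d" "d \<le> \<delta>" "d \<le> 1" using assms by (auto simp: d_def)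
  obtain N where N: "\<And>m. N \<le> m \<Longrightarrow> b m < d / C" using b_small[of "d / C"] C d by auto
  obtain m g where m: "max (Suc n) N \<le> m" and g0: "gauge m (r + 2 + 4) (\<epsilon>0 * (b m / b j0) ^ (r + 2)) g"
    using fast[of "max (Suc n) N"] by blast
  have g: "gauge m r (\<epsilon>0 * (b m / b j0) ^ (r + 2)) g" by (rule gauge_mono_order[OF g0]) simp
  have eq: "K r * (\<epsilon>0 * (b m / b j0) ^ (r + 2)) * (b n / b m) ^ (r + 1) = C * b m"
    using b_pos[of m] b_pos[of j0] by (simp add: C_def power_divide field_simps)
  have "C * b m \<le> d" using N[of m] m C by (simp add: field_simps)
  then have "C * b m \<le> 1" "C * b m \<le> \<delta>" using d by auto
  then have "\<exists>g'. gauge n r (C * b m) g'" using pull[OF _ g, of n] m unfolding eq by auto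
  then show ?thesis using gauge_mono \<open>C * b m \<le> \<delta>\<close> by blast
qed

end

section \<open>Quaternions and rotations\<close>

definition hq :: "real^3 \<Rightarrow> quat" where "hq v = Quat 0 (v $ 1) (v $ 2) (v $ 3)"
definition qv :: "quat \<Rightarrow> real^3" where "qv q = vector [qIm1 q, qIm2 q, qIm3 q]"

lemma hq_sel [simp]: "qRe (hq v) = 0" "qIm1 (hq v) = v $ 1" "qIm2 (hq v) = v $ 2" "qIm3 (hq v) = v $ 3"
  by (simp_all add: hq_def)

lemma qv_nth [simp]: "qv q $ 1 = qIm1 q" "qv q $ 2 = qIm2 q" "qv q $ 3 = qIm3 q"
  by (simp_all add: qv_def vector_3)

lemma hq_qv: "qRe q = 0 \<Longrightarrow> hq (qv q) = q" and qv_hq [simp]: "qv (hq v) = v"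
  by (simp_all add: quat_eq_iff vec_eq_iff forall_3)

lemma bounded_linear_hq: "bounded_linear hq" and bounded_linear_qv: "bounded_linear qv"
  by (simp_all add: linear_conv_bounded_linear[symmetric] linear_iff quat_eq_iff vec_eq_iff forall_3)

lemma hq_minus: "hq (- v) = - hq v" and hq_0: "hq 0 = 0"
  by (simp_all add: quat_eq_iff)

lemma inner_hq: "inner (hq v) (hq w) = inner v w"
  by (simp add: inner_quat_def inner_vec_def sum_3)

lemma norm_hq [simp]: "norm (hq v) = norm v"
  by (simp add: norm_eq_sqrt_inner inner_hq)

lemma hq_axis: "hq (axis 1 1) = qi" "hq (axis 2 1) = qj" "hq (axis 3 1) = qk"
  by (simp_all add: quat_eq_iff axis_def)

lemma hq_mult: "hq v * hq w = of_real (- inner v w) + hq (cross3 v w)"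
  by (simp add: quat_eq_iff cross_components inner_vec_def sum_3)

text \<open>The matrix of multiplication by p on the left and q on the right, restricted to
  imaginary quaternions and followed by the imaginary part. Keeping p and q apart makes it bilinear,
  so smoothness and derivatives of \<open>rot\<close> follow from the general rules.\<close>

definition conj_mat :: "quat \<Rightarrow> quat \<Rightarrow> real^3^3" where
  "conj_mat p q = (\<chi> i j. qv (p * hq (axis j 1) * q) $ i)"

lemma conj_mat_mult_vec: "conj_mat p q *v v = qv (p * hq v * q)"
  by (simp add: conj_mat_def vec_eq_iff forall_3 matrix_vector_mult_def sum_3 axis_def algebra_simps)

lemma bounded_bilinear_conj_mat: "bounded_bilinear conj_mat"
  unfolding bilinear_conv_bounded_bilinear[symmetric] bilinear_def
  by (simp add: linear_iff conj_mat_def vec_eq_iff forall_3 algebra_simps)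

definition rot :: "quat \<Rightarrow> real^3^3" where "rot q = conj_mat q (inverse q)"

lemma qRe_conjugate:
  assumes "q \<noteq> 0"
  shows "qRe (q * p * inverse q) = qRe p"
proof -
  have "qRe (x * y) = qRe (y * x)" for x y by simp
  then have "qRe (q * p * inverse q) = qRe (inverse q * (q * p))" .
  then show ?thesis using assms by (simp add: mult.assoc[symmetric])
qed

lemma hq_rot: "q \<noteq> 0 \<Longrightarrow> hq (rot q *v v) = q * hq v * inverse q"
  unfolding rot_def conj_mat_mult_vec by (rule hq_qv) (simp add: qRe_conjugate del: quat_sel_ring)

lemma hq_eq_iff: "hq v = hq w \<longleftrightarrow> v = w"
  by (metis qv_hq)

lemma mat_eqI: "(\<And>v. M *v v = N *v v) \<Longrightarrow> M = N" for M N :: "real^3^3"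
  using matrix_eq by blast

lemma rot_mult:
  assumes "p \<noteq> 0" "q \<noteq> 0"
  shows "rot (p * q) = rot p ** rot q"
proof (rule mat_eqI)
  fix v
  have "hq (rot (p * q) *v v) = hq (rot p *v (rot q *v v))"
    using assms by (simp add: hq_rot nonzero_inverse_mult_distrib mult.assoc)
  then show "rot (p * q) *v v = (rot p ** rot q) *v v"
    by (simp add: hq_eq_iff matrix_vector_mul_assoc)
qed

lemma rot_one [simp]: "rot 1 = mat 1"
  by (rule mat_eqI) (simp add: hq_eq_iff[symmetric] hq_rot)

lemma rot_scaleR: "c \<noteq> 0 \<Longrightarrow> rot (c *\<^sub>R q) = rot q"
  by (rule mat_eqI) (simp add: rot_def conj_mat_mult_vec inverse_scaleR_distrib)

lemma rot_minus [simp]: "rot (- q) = rot q"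
  using rot_scaleR[of "-1" q] by simp

lemma norm_rot_mult_vec: "q \<noteq> 0 \<Longrightarrow> norm (rot q *v v) = norm v"
  using arg_cong[OF hq_rot[of q v], of norm] by (simp add: norm_mult norm_inverse)

lemma rot_SO3:
  assumes "q \<noteq> 0"
  shows "rot q \<in> SO3"
proof -
  have ortho: "orthogonal_matrix (rot p)" if "p \<noteq> 0" for p
  proof -
    have "orthogonal_transformation ((*v) (rot p))"
      using norm_rot_mult_vec[OF that] by (simp add: orthogonal_transformation)
    then show ?thesis
      using orthogonal_transformation_matrix[of "(*v) (rot p)"] by (simp add: matrix_of_matrix_vector_mul)
  qed
  \<comment> \<open>Up to a real factor every nonzero quaternion is a square, by (q + |q|)^2 = 2 (Re
    q + |q|) q unless q is real. So \<open>rot q\<close> is the square of an orthogonal matrix and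
    has determinant 1.\<close>
  have "\<exists>c p. c \<noteq> 0 \<and> p \<noteq> 0 \<and> c *\<^sub>R q = p * p"
  proof (cases "qIm1 q = 0 \<and> qIm2 q = 0 \<and> qIm3 q = 0")
    case True
    then have q: "q = qRe q *\<^sub>R 1" by (simp add: quat_eq_iff)
    then have "inverse (qRe q) *\<^sub>R q = 1 * 1" using assms by (metis mult_1 scaleR_scaleR scaleR_eq_0_iff left_inverse scaleR_one)
    moreover have "inverse (qRe q) \<noteq> 0" using q assms by auto
    ultimately show ?thesis by (metis one_neq_zero)
  next
    case False
    define p where "p = q + of_real (norm q)"
    have p: "p \<noteq> 0" using False by (auto simp: p_def quat_eq_iff)
    have n: "(norm q)\<^sup>2 = (qRe q)\<^sup>2 + (qIm1 q)\<^sup>2 + (qIm2 q)\<^sup>2 + (qIm3 q)\<^sup>2" by (rule norm_quat_sq)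
    have "p * p = (2 * (qRe q + norm q)) *\<^sub>R q"
      unfolding p_def using n by (simp add: quat_eq_iff algebra_simps power2_eq_square)
    then show ?thesis using p mult_eq_0_iff by (metis scaleR_zero_left)
  qed
  then obtain c p where cp: "c \<noteq> 0" "p \<noteq> 0" "c *\<^sub>R q = p * p" by blast
  then have rp: "rot q = rot p ** rot p" using rot_scaleR rot_mult by metis
  have "det (rot p) = 1 \<or> det (rot p) = -1" by (rule det_orthogonal_matrix[OF ortho[OF cp(2)]])
  then have "det (rot q) = 1" by (auto simp: rp det_mul)
  then show ?thesis using ortho[OF assms] by (simp add: SO3_def rotation_matrix_def)
qed

lemma matrix_inv_unique:
  fixes M :: "real^3^3"
  assumes "M ** N = mat 1" "N ** M = mat 1"
  shows "matrix_inv M = N"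
proof -
  have "M ** matrix_inv M = mat 1 \<and> matrix_inv M ** M = mat 1"
    unfolding matrix_inv_def by (rule someI[of _ N]) (use assms in simp)
  then show ?thesis by (metis assms(1) matrix_mul_assoc matrix_mul_lid matrix_mul_rid)
qed

lemma SO3_inverse:
  assumes "M \<in> SO3"
  shows "matrix_inv M = transpose M" "M ** transpose M = mat 1" "transpose M ** M = mat 1" "transpose M \<in> SO3"
proof -
  show *: "M ** transpose M = mat 1" "transpose M ** M = mat 1"
    using assms by (auto simp: SO3_def rotation_matrix_def orthogonal_matrix_def)
  show "matrix_inv M = transpose M" using * by (rule matrix_inv_unique)
  show "transpose M \<in> SO3" using assms by (simp add: SO3_def rotation_matrix_def orthogonal_matrix_transpose)
qed

lemma SO3_mult: "M \<in> SO3 \<Longrightarrow> N \<in> SO3 \<Longrightarrow> M ** N \<in> SO3"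
  by (simp add: SO3_def rotation_matrix_def orthogonal_matrix_mul det_mul)

lemma SO3_mult_inverse:
  assumes "M \<in> SO3"
  shows "(N ** matrix_inv M) ** M = N" "(N ** M) ** matrix_inv M = N"
  by (simp_all add: SO3_inverse[OF assms] matrix_mul_assoc[symmetric])

lemma rot_inverse: "q \<noteq> 0 \<Longrightarrow> rot (inverse q) = matrix_inv (rot q)"
proof -
  assume q: "q \<noteq> 0"
  then have "rot q ** rot (inverse q) = mat 1" "rot (inverse q) ** rot q = mat 1"
    using rot_mult[of q "inverse q"] rot_mult[of "inverse q" q] by auto
  then show ?thesis by (metis matrix_inv_unique)
qed

lemma rot_eqI:
  assumes M: "M \<in> SO3" and q: "q \<noteq> 0" "q * qi = hq (M *v axis 1 1) * q" "q * qj = hq (M *v axis 2 1) * q"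
  shows "rot q = M"
proof -
  have e: "rot q *v axis 1 1 = M *v axis 1 1" "rot q *v axis 2 1 = M *v axis 2 1"
    using q by (simp_all add: hq_eq_iff[symmetric] hq_rot hq_axis mult.assoc)
  have "rot q *v axis 3 1 = M *v axis 3 1"
    using M rot_SO3[OF q(1)] e by (metis (no_types) SO3_def mem_Collect_eq cross_rotation_matrix cross_basis(1))
  with e show ?thesis
    unfolding matrix_vector_mult_basis by (simp add: column_def vec_eq_iff forall_3)
qed

lemma SO3_units:
  assumes "M \<in> SO3"
  shows "anticommuting_units (hq (M *v axis 1 1)) (hq (M *v axis 2 1))"
proof -
  have "orthogonal_transformation ((*v) M)"
    using assms orthogonal_transformation_matrix[of "(*v) M"]
    by (simp add: SO3_def rotation_matrix_def matrix_of_matrix_vector_mul)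
  then have "inner (M *v x) (M *v y) = inner x y" for x y by (simp add: orthogonal_transformation_def)
  then show ?thesis
    unfolding anticommuting_units_def hq_mult
    by (simp add: inner_axis_axis cross_refl cross_skew[of "M *v axis 1 1"] hq_minus hq_0)
qed

text \<open>The images of the first two basis vectors are anticommuting units, hence conjugates of
  qi and qj by a common quaternion; the third column of a rotation is determined by the other
  two.\<close>

lemma rot_surj:
  assumes "M \<in> SO3"
  obtains q where "norm q = 1" "rot q = M"
proof -
  obtain q where q: "q \<noteq> 0" "q * qi = hq (M *v axis 1 1) * q" "q * qj = hq (M *v axis 2 1) * q"
    using anticommuting_units_conjugate[OF anticommuting_units_ij SO3_units[OF assms]] by metis
  then have "rot q = M" by (rule rot_eqI[OF assms])
  then show thesis using q(1) by (intro that[of "(1 / norm q) *\<^sub>R q"]) (auto simp: rot_scaleR)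
qed

lemma rot_eq_iff:
  assumes "norm p = 1" "norm q = 1"
  shows "rot p = rot q \<longleftrightarrow> p = q \<or> p = - q"
proof
  assume eq: "rot p = rot q"
  have nz: "p \<noteq> 0" "q \<noteq> 0" using assms by auto
  define u where "u = inverse q * p"
  have u: "u \<noteq> 0" "norm u = 1" using nz assms by (auto simp: u_def norm_mult norm_inverse)
  have "rot u = mat 1"
    using nz eq rot_mult[of "inverse q" p] rot_mult[of "inverse q" q] by (simp add: u_def)
  then have "u * hq v * inverse u = hq v" for v using hq_rot[OF u(1), of v] by simp
  then have "u * hq v = hq v * u" for v using u(1) by (metis mult.assoc left_inverse mult_1_right)
  from this[of "axis 1 1"] this[of "axis 2 1"] have "qIm1 u = 0" "qIm2 u = 0" "qIm3 u = 0"
    by (simp_all add: hq_axis quat_eq_iff)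
  then have "u = 1 \<or> u = -1"
    using norm_quat_sq[of u] u(2) by (simp add: quat_eq_iff power2_eq_1_iff)
  moreover have "p = q * u" using nz by (simp add: u_def mult.assoc[symmetric])
  ultimately show "p = q \<or> p = - q" by auto
qed auto

text \<open>A section of \<^const>\<open>rot\<close> near the identity, up to a positive factor: the average
  \<open>\<Sum> u\<^sub>e e\<^sup>-\<^sup>1\<close> over \<open>e = 1, i, j, k\<close>, where \<open>u\<^sub>e\<close> is the image of \<open>e\<close>.\<close>

definition rot_section :: "real^3^3 \<Rightarrow> quat" where
  "rot_section M = 1 - hq (M *v axis 1 1) * qi - hq (M *v axis 2 1) * qj
     - hq (M *v axis 1 1) * hq (M *v axis 2 1) * qk"

lemma rot_rot_section:
  assumes "M \<in> SO3" "rot_section M \<noteq> 0"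
  shows "rot (rot_section M) = M"
proof (rule rot_eqI[OF assms])
  define u v where "u = hq (M *v axis 1 1)" and "v = hq (M *v axis 2 1)"
  have uv: "u * u = -1" "v * v = -1" "v * u = - (u * v)"
    using SO3_units[OF assms(1)] by (auto simp: anticommuting_units_def u_def v_def)
  have uuv: "u * (u * v) = - v" "v * (u * v) = u"
    using uv by (simp_all add: mult.assoc[symmetric]) (simp add: mult.assoc)
  have uvv: "u * v * v = - u" using uv(2) by (simp add: mult.assoc)
  have s: "rot_section M = 1 - u * qi - v * qj - u * v * qk" by (simp add: rot_section_def u_def v_def)
  show "rot_section M * qi = hq (M *v axis 1 1) * rot_section M"
    unfolding s u_def[symmetric] by (simp add: algebra_simps units_mult mult.assoc[of _ qi] mult.assoc[of _ qj] mult.assoc[of _ qk])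
      (simp add: mult.assoc[symmetric] uv uvv)
  show "rot_section M * qj = hq (M *v axis 2 1) * rot_section M"
    unfolding s v_def[symmetric] by (simp add: algebra_simps units_mult mult.assoc[of _ qi] mult.assoc[of _ qj] mult.assoc[of _ qk])
      (simp add: mult.assoc[symmetric] uv uvv)
qed

lemma rot_section_one: "rot_section (mat 1) = 4"
  by (simp add: rot_section_def hq_axis units_mult)

lemma smooth_on_rot_section:
  assumes "open S" "smooth_on S A"
  shows "smooth_on S (\<lambda>x. rot_section (A x))"
proof -
  have h: "bounded_linear (\<lambda>M. hq (M *v v))" for v :: "real^3"
    by (intro bounded_linear_compose[OF bounded_linear_hq] linear_conv_bounded_linear[THEN iffD1])
      (simp add: linear_iff matrix_vector_mult_add_rdistrib scaleR_matrix_vector_assoc)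
  show ?thesis
    unfolding rot_section_def
    by (intro smooth_on_diff smooth_on_mult smooth_on_const assms smooth_on_linear[OF h])
qed

lemma smooth_on_rot:
  assumes "open S" "\<And>x. x \<in> S \<Longrightarrow> f x \<noteq> 0" "smooth_on S f"
  shows "smooth_on S (\<lambda>x. rot (f x))"
  unfolding rot_def
  by (rule smooth_on_bilinear[OF bounded_bilinear_conj_mat assms(1,3) smooth_on_inverse[OF assms]])

lemma smooth_rot: "smooth f \<Longrightarrow> (\<And>x. f x \<noteq> 0) \<Longrightarrow> smooth (\<lambda>x. rot (f x))"
  unfolding smooth_iff_smooth_on by (rule smooth_on_rot) auto

lemma bounded_bilinear_matrix_mult: "bounded_bilinear ((**) :: real^3^3 \<Rightarrow> real^3^3 \<Rightarrow> real^3^3)"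
  unfolding bilinear_conv_bounded_bilinear[symmetric] bilinear_def
  by (simp add: linear_iff vec_eq_iff matrix_matrix_mult_def sum.distrib sum_distrib_left algebra_simps)

lemma bounded_linear_transpose: "bounded_linear (transpose :: real^3^3 \<Rightarrow> real^3^3)"
  by (simp add: linear_conv_bounded_linear[symmetric] linear_iff transpose_def vec_eq_iff)

section \<open>Lifting maps into SO(3) to unit quaternions\<close>

lemma rot_lift_unique:
  assumes S: "connected S" and f: "continuous_on S f" "\<And>x. x \<in> S \<Longrightarrow> norm (f x) = 1"
    and g: "continuous_on S g" "\<And>x. x \<in> S \<Longrightarrow> norm (g x) = 1"
    and eq: "\<And>x. x \<in> S \<Longrightarrow> rot (f x) = rot (g x)"
  shows "(\<forall>x\<in>S. f x = g x) \<or> (\<forall>x\<in>S. f x = - g x)"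
proof -
  define h where "h x = inner (f x) (g x)" for x
  have *: "f x = g x \<and> h x = 1 \<or> f x = - g x \<and> h x = -1" if "x \<in> S" for x
    using rot_eq_iff[OF f(2) g(2), OF that that] eq[OF that] g(2)[OF that]
    by (auto simp: h_def dot_square_norm)
  then have "h ` S \<subseteq> {1, -1}" by auto
  then have "finite (h ` S)" by (rule finite_subset) simp
  moreover have "connected (h ` S)"
    unfolding h_def by (intro connected_continuous_image continuous_on_inner S f g)
  ultimately have "h ` S = {} \<or> (\<exists>c. h ` S = {c})" using connected_finite_iff_sing by blast
  then obtain c where "\<And>x. x \<in> S \<Longrightarrow> h x = c" by auto
  with * show ?thesis by (cases "c = 1") (force, metis)
qed

lemma rot_lift_unique_base:
  assumes "connected S" "continuous_on S f" "continuous_on S g" "z \<in> S" "f z = g z" "x \<in> S"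
    "\<And>x. x \<in> S \<Longrightarrow> norm (f x) = 1 \<and> norm (g x) = 1 \<and> rot (f x) = rot (g x)"
  shows "f x = g x"
proof -
  have "f z \<noteq> - g z"
  proof
    assume "f z = - g z"
    then have "f z + f z = 0" using assms(5) by (metis add.left_inverse)
    then have "2 *\<^sub>R f z = 0" by (simp add: scaleR_2)
    then show False using assms(7)[OF assms(4)] by auto
  qed
  then show ?thesis using rot_lift_unique[OF assms(1,2) _ assms(3)] assms(4,6,7) by blast
qed

text \<open>The rotation from \<open>A 0\<close> to \<open>A x\<close> is a product of N increments
  between consecutive points k x / N. By uniform continuity all of them are so close to the identity
  that \<open>rot_section\<close> does not vanish. Each factor is smooth in x on the whole interval,
  so no pieces have to be glued.\<close>

lemma rot_lift_interval:
  assumes A: "smooth A" "range A \<subseteq> SO3" and w: "norm w = 1" "rot w = A 0"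
  obtains Q where "smooth_on {-L<..<L} Q" "\<And>x. x \<in> {-L<..<L} \<Longrightarrow> norm (Q x) = 1 \<and> rot (Q x) = A x" "Q 0 = w"
proof -
  let ?I = "{-L<..<L::real}"
  define M where "M x y = A y ** transpose (A x)" for x y
  have AS: "A x \<in> SO3" for x using A(2) by auto
  have MS: "M x y \<in> SO3" for x y unfolding M_def by (intro SO3_mult AS SO3_inverse(4))
  have "continuous_on UNIV rot_section"
  proof -
    have h: "bounded_linear (\<lambda>M. hq (M *v v))" for v :: "real^3"
      by (intro bounded_linear_compose[OF bounded_linear_hq] linear_conv_bounded_linear[THEN iffD1])
        (simp add: linear_iff matrix_vector_mult_add_rdistrib scaleR_matrix_vector_assoc)
    show ?thesis unfolding rot_section_def
      by (intro continuous_intros bounded_linear.continuous_on[OF h])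
  qed
  moreover have "continuous_on ({-L..L} \<times> {-L..L}) (\<lambda>z. M (fst z) (snd z))"
    unfolding M_def
    by (intro bounded_bilinear.continuous_on[OF bounded_bilinear_matrix_mult]
        bounded_linear.continuous_on[OF bounded_linear_transpose]
        continuous_on_compose2[OF smooth_continuous[OF A(1), of UNIV]] continuous_intros) auto
  ultimately have "continuous_on ({-L..L} \<times> {-L..L}) (\<lambda>z. rot_section (M (fst z) (snd z)))"
    by (rule continuous_on_compose2) simp
  then have "uniformly_continuous_on ({-L..L} \<times> {-L..L}) (\<lambda>z. rot_section (M (fst z) (snd z)))"
    by (intro compact_uniformly_continuous compact_Times) auto
  then obtain \<delta> where \<delta>: "0 < \<delta>" and near: "\<And>z z'. z \<in> {-L..L} \<times> {-L..L} \<Longrightarrow> z' \<in> {-L..L} \<times> {-L..L} \<Longrightarrow> dist z' z < \<delta>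
      \<Longrightarrow> dist (rot_section (M (fst z') (snd z'))) (rot_section (M (fst z) (snd z))) < 4"
    unfolding uniformly_continuous_on_def by (metis zero_less_numeral)
  \<comment> \<open>The value of \<open>rot_section\<close> at the identity is 4, so a distance
    below 4 keeps it away from zero.\<close>
  have nz: "rot_section (M x y) \<noteq> 0" if "\<bar>x\<bar> \<le> L" "\<bar>y\<bar> \<le> L" "\<bar>y - x\<bar> < \<delta>" for x y
  proof -
    have "dist (rot_section (M x y)) (rot_section (M x x)) < 4"
      using near[of "(x, x)" "(x, y)"] that by (auto simp: dist_Pair_Pair dist_real_def abs_le_iff)
    moreover have "rot_section (M x x) = 4" by (simp add: M_def SO3_inverse(2)[OF AS] rot_section_one)
    ultimately show ?thesis by (auto simp: dist_norm)
  qed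
  obtain N :: nat where N: "0 < N" "L / N < \<delta>"
  proof -
    obtain n where "L / \<delta> < real n" using reals_Archimedean2 by blast
    then have "L / \<delta> < real (Suc n)" by simp
    then show thesis using \<delta> by (intro that[of "Suc n"]) (auto simp: field_simps)
  qed
  have "\<exists>P. smooth_on ?I P \<and> (\<forall>x\<in>?I. P x \<noteq> 0 \<and> rot (P x) = M 0 (real k / N * x)) \<and> (\<exists>c>0. P 0 = of_real c)" if "k \<le> N" for k
    using that
  proof (induction k)
    case 0
    then show ?case
      by (intro exI[of _ "\<lambda>_. 1"]) (auto simp: M_def SO3_inverse[OF AS] smooth_on_const intro!: exI[of _ "1::real"])
  next
    case (Suc k)
    then obtain P c where P: "smooth_on ?I P" "\<And>x. x \<in> ?I \<Longrightarrow> P x \<noteq> 0 \<and> rot (P x) = M 0 (real k / N * x)"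
      "0 < c" "P 0 = of_real c" by auto
    define s where "s x = rot_section (M (real k / N * x) (real (Suc k) / N * x))" for x
    have s: "s x \<noteq> 0" "rot (s x) = M (real k / N * x) (real (Suc k) / N * x)" if x: "x \<in> ?I" for x
    proof -
      have nb: "\<bar>real l / N * x\<bar> \<le> L" if "l \<le> N" for l
      proof -
        have "real l / N * \<bar>x\<bar> \<le> 1 * \<bar>x\<bar>" using that N(1) by (intro mult_right_mono) auto
        then show ?thesis using x by (auto simp: abs_mult)
      qed
      have "real (Suc k) / N * x - real k / N * x = x / N"
        by (simp add: add_divide_distrib distrib_right)
      then have "\<bar>real (Suc k) / N * x - real k / N * x\<bar> = \<bar>x\<bar> / N" by simp
      moreover have "\<bar>x\<bar> / N \<le> L / N" using x by (intro divide_right_mono) auto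
      ultimately show "s x \<noteq> 0" unfolding s_def using Suc.prems N(2) by (intro nz nb) linarith+
      then show "rot (s x) = M (real k / N * x) (real (Suc k) / N * x)"
        unfolding s_def by (rule rot_rot_section[OF MS])
    qed
    have sA: "smooth_on ?I (\<lambda>x. A (d * x))" for d
      using smooth_affine[OF A(1), of d 0] smooth_on_subset[of UNIV] by (simp add: smooth_iff_smooth_on)
    have "smooth_on ?I (\<lambda>x. s x * P x)"
      unfolding s_def M_def
      by (intro smooth_on_mult P(1) smooth_on_rot_section smooth_on_bilinear[OF bounded_bilinear_matrix_mult]
          smooth_on_linear[OF bounded_linear_transpose] sA) auto
    moreover have "s x * P x \<noteq> 0 \<and> rot (s x * P x) = M 0 (real (Suc k) / N * x)" if "x \<in> ?I" for x
    proof -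
      have "M x y ** M z x = M z y" for x y z
        unfolding M_def by (metis SO3_inverse(3)[OF AS] matrix_mul_assoc matrix_mul_lid)
      then show ?thesis using s[OF that] P(2)[OF that] by (simp add: rot_mult)
    qed
    moreover have "s 0 * P 0 = of_real (4 * c)"
      by (simp add: s_def M_def SO3_inverse(2)[OF AS] rot_section_one P(4))
    ultimately show ?case using P(3) by (intro exI[of _ "\<lambda>x. s x * P x"]) (auto intro!: exI[of _ "4 * c"])
  qed
  from this[of N] obtain P c where P: "smooth_on ?I P" "\<And>x. x \<in> ?I \<Longrightarrow> P x \<noteq> 0 \<and> rot (P x) = M 0 x"
    "0 < c" "P 0 = of_real c" using N(1) by auto
  define i where "i x = (inner (P x) (P x)) powr (-1/2)" for x
  have i: "i x = 1 / norm (P x)" if "P x \<noteq> 0" for x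
    using that by (simp add: i_def norm_eq_sqrt_inner powr_minus_divide powr_half_sqrt)
  have wn: "w \<noteq> 0" using w by auto
  show thesis
  proof (rule that[of "\<lambda>x. (i x *\<^sub>R P x) * w"])
    have "smooth_on ?I (\<lambda>x. inner (P x) (P x))"
      by (rule smooth_on_bilinear[OF bounded_bilinear_inner _ P(1) P(1)]) auto
    then have "smooth_on ?I i"
      unfolding i_def[abs_def] using P(2)
      by (intro smooth_on_compose[OF _ _ _ smooth_on_powr]) auto
    then show "smooth_on ?I (\<lambda>x. (i x *\<^sub>R P x) * w)"
      by (intro smooth_on_mult smooth_on_scaleR P(1) smooth_on_const) auto
    show "norm ((i x *\<^sub>R P x) * w) = 1 \<and> rot ((i x *\<^sub>R P x) * w) = A x" if "x \<in> ?I" for x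
    proof -
      have "rot ((i x *\<^sub>R P x) * w) = M 0 x ** A 0"
        using P(2)[OF that] i wn w(2) by (simp add: rot_mult rot_scaleR)
      also have "\<dots> = A x" unfolding M_def by (simp add: matrix_mul_assoc[symmetric] SO3_inverse(3)[OF AS])
      finally show ?thesis using P(2)[OF that] i w(1) by (simp add: norm_mult)
    qed
    have "i 0 *\<^sub>R P 0 = 1"
      using P(3,4) i[of 0] by (simp add: scaleR_conv_of_real of_real_mult[symmetric] del: of_real_mult of_real_divide)
    then show "(i 0 *\<^sub>R P 0) * w = w" by simp
  qed
qed

lemma rot_lift:
  assumes A: "smooth A" "range A \<subseteq> SO3"
  obtains Q where "smooth Q" "\<And>x. norm (Q x) = 1" "\<And>x. rot (Q x) = A x"
proof -
  have "A 0 \<in> SO3" using A(2) by auto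
  then obtain w where w: "norm w = 1" "rot w = A 0" by (rule rot_surj)
  have "\<exists>F. smooth_on {-L<..<L} F \<and> (\<forall>x\<in>{-L<..<L}. norm (F x) = 1 \<and> rot (F x) = A x) \<and> F 0 = w" for L
    using rot_lift_interval[OF A w, of L] by metis
  then obtain F where F: "\<And>L. smooth_on {-L<..<L} (F L)" "\<And>L x. \<bar>x\<bar> < L \<Longrightarrow> norm (F L x) = 1 \<and> rot (F L x) = A x"
    "\<And>L. F L 0 = w" by (metis abs_less_iff greaterThanLessThan_iff minus_less_iff)
  define Q where "Q x = F (\<bar>x\<bar> + 1) x" for x
  have eq: "Q x = F L x" if "\<bar>x\<bar> < L" for x L
  proof -
    define m where "m = min L (\<bar>x\<bar> + 1)"
    have m: "\<bar>x\<bar> < m" "m \<le> L" "m \<le> \<bar>x\<bar> + 1" using that by (auto simp: m_def)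
    show ?thesis unfolding Q_def
    proof (rule rot_lift_unique_base[of "{-m<..<m}" "F (\<bar>x\<bar> + 1)" "F L" 0])
      show "continuous_on {-m<..<m} (F (\<bar>x\<bar> + 1))" "continuous_on {-m<..<m} (F L)"
        using m by (auto intro!: smooth_on_continuous_on smooth_on_subset[OF F(1)])
    qed (use m F in auto)
  qed
  show thesis
  proof (rule that[of Q])
    show "smooth Q"
    proof (rule smooth_local)
      fix x :: real
      define L where "L = \<bar>x\<bar> + 1"
      show "\<exists>S h. open S \<and> x \<in> S \<and> smooth_on S h \<and> (\<forall>y\<in>S. Q y = h y)"
        using F(1)[of L] eq[of _ L] by (intro exI[of _ "{-L<..<L}"] exI[of _ "F L"]) (auto simp: L_def)
    qed
  qed (use F(2) in \<open>auto simp: Q_def\<close>)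
qed

lemma continuous_on_rot: "continuous_on (- {0}) rot"
  unfolding rot_def
  by (intro bounded_bilinear.continuous_on[OF bounded_bilinear_conj_mat] continuous_intros) auto

lemma periodic1_of_int:
  assumes "periodic1 f"
  shows "f (x + of_int n) = f x"
proof (induction n rule: int_induct[of _ 0])
  case (step1 i)
  then show ?case using assms[unfolded periodic1_def, rule_format, of "x + of_int i"] by (simp add: add_ac)
next
  case (step2 i)
  then show ?case using assms[unfolded periodic1_def, rule_format, of "x + of_int (i - 1)"] by (simp add: add_ac)
qed simp

text \<open>Loops in the simply connected three-sphere are contractible.\<close>

lemma periodic_lift_imp_homotopic:
  assumes Q: "continuous_on UNIV Q" "periodic1 Q" "\<And>x. norm (Q x) = 1" and A: "\<And>x. rot (Q x) = A x"
  shows "homotopic_torus_SO3 A (\<lambda>_. mat 1)"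
proof -
  have "simply_connected (sphere (0::quat) 1)" by (rule simply_connected_sphere) (simp add: DIM_quat)
  moreover have "path Q" "path_image Q \<subseteq> sphere 0 1" "pathfinish Q = pathstart Q" "1 \<in> sphere (0::quat) 1"
    using Q(3) Q(2)[unfolded periodic1_def, rule_format, of 0]
    by (auto simp: path_def path_image_def pathfinish_def pathstart_def intro: continuous_on_subset[OF Q(1)])
  ultimately have "homotopic_loops (sphere 0 1) Q (linepath 1 1)"
    using simply_connected_eq_contractible_loop_any by blast
  from homotopic_loops_imp_homotopic_circlemaps[OF this]
  have "homotopic_with_canon (\<lambda>h. True) (sphere 0 1) (sphere 0 1) (Q \<circ> (\<lambda>z. Arg2pi z / (2 * pi))) (\<lambda>_. 1)"
    by (simp add: linepath_def o_def)
  then have "homotopic_with_canon (\<lambda>h. True) (sphere 0 1) SO3 (rot \<circ> (Q \<circ> (\<lambda>z. Arg2pi z / (2 * pi)))) (rot \<circ> (\<lambda>_. 1))"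
    by (intro homotopic_with_compose_continuous_left)
      (auto intro!: continuous_on_subset[OF continuous_on_rot] rot_SO3 simp: Pi_iff)
  \<comment> \<open>The homotopy lives on the circle in the complex plane. The predicate saying that
    the pull-back to the line is periodic holds for every map on the circle, and carrying it along
    turns the homotopy into one through periodic maps.\<close>
  then have "homotopic_with_canon (\<lambda>f. periodic1 (f \<circ> (\<lambda>x. cis (2 * pi * x)))) (sphere 0 1) SO3 (rot \<circ> (Q \<circ> (\<lambda>z. Arg2pi z / (2 * pi)))) (rot \<circ> (\<lambda>_. 1))"
    by (rule homotopic_with_mono) (simp add: periodic1_def distrib_left cis_mult[symmetric])
  then have "homotopic_with_canon periodic1 UNIV SO3 ((rot \<circ> (Q \<circ> (\<lambda>z. Arg2pi z / (2 * pi)))) \<circ> (\<lambda>x. cis (2 * pi * x))) ((rot \<circ> (\<lambda>_. 1)) \<circ> (\<lambda>x. cis (2 * pi * x)))"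
    by (rule homotopic_with_compose_continuous_right) (auto intro!: continuous_intros)
  moreover have "((rot \<circ> (Q \<circ> (\<lambda>z. Arg2pi z / (2 * pi)))) \<circ> (\<lambda>x. cis (2 * pi * x))) = A"
  proof
    fix x :: real
    have "Q (frac x + of_int n) = Q (frac x)" for n
      using Q(2) by (rule periodic1_of_int)
    then have "Q (frac x) = Q x" by (metis frac_def diff_add_cancel)
    moreover have "Arg2pi (cis (2 * pi * x)) = 2 * pi * frac x"
    proof (rule Arg2pi_unique[of 1])
      have "cis (2 * pi * x) = cis (2 * pi * frac x) * cis (2 * pi * of_int \<lfloor>x\<rfloor>)"
        by (simp add: cis_mult frac_def algebra_simps)
      also have "cis (2 * pi * of_int \<lfloor>x\<rfloor>) = 1" by (simp add: cis_conv_exp exp_eq_1)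
      finally show "of_real 1 * exp (\<i> * of_real (2 * pi * frac x)) = cis (2 * pi * x)" by (simp add: cis_conv_exp)
    qed (use frac_lt_1[of x] in auto)
    ultimately show "((rot \<circ> (Q \<circ> (\<lambda>z. Arg2pi z / (2 * pi)))) \<circ> (\<lambda>x. cis (2 * pi * x))) x = A x" by (simp add: A)
  qed
  ultimately show ?thesis by (simp add: homotopic_torus_SO3_def o_def)
qed

text \<open>A lift and its translate by a period lift the same map, so they agree up to one global
  sign; a periodic lift would make A contractible.\<close>

lemma antiperiodic_lift:
  assumes A: "A \<in> smooth_torus SO3" and nh: "\<not> homotopic_torus_SO3 A (\<lambda>_. mat 1)"
  obtains Q where "smooth Q" "\<And>x. norm (Q x) = 1" "\<And>x. rot (Q x) = A x" "\<And>x. Q (x + 1) = - Q x"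
proof -
  have A': "smooth A" "range A \<subseteq> SO3" "\<And>x. A (x + 1) = A x" using A by (auto simp: smooth_torus_def periodic1_def)
  obtain Q where Q: "smooth Q" "\<And>x. norm (Q x) = 1" "\<And>x. rot (Q x) = A x" using rot_lift[OF A'(1,2)] by blast
  have "(\<forall>x\<in>UNIV. Q (x + 1) = Q x) \<or> (\<forall>x\<in>UNIV. Q (x + 1) = - Q x)"
    by (rule rot_lift_unique) (auto simp: Q A' smooth_continuous[OF Q(1)] smooth_continuous[OF smooth_shift[OF Q(1)]])
  moreover have "\<not> (\<forall>x\<in>UNIV. Q (x + 1) = Q x)"
    using periodic_lift_imp_homotopic[OF smooth_continuous[OF Q(1)] _ Q(2,3)] nh by (auto simp: periodic1_def)
  ultimately show thesis using that[OF Q] by blast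
qed

section \<open>The renormalizations of a lifted cocycle\<close>

lemma gauss_iter_bounds:
  assumes "0 < \<alpha>" "\<alpha> < 1" "\<alpha> \<notin> \<rat>"
  shows "0 < gauss_iter \<alpha> n" "gauss_iter \<alpha> n < 1" "gauss_iter \<alpha> n \<notin> \<rat>"
proof -
  have "0 < gauss_iter \<alpha> n \<and> gauss_iter \<alpha> n < 1 \<and> gauss_iter \<alpha> n \<notin> \<rat>"
  proof (induction n)
    case (Suc n)
    let ?g = "gauss_iter \<alpha> n"
    have eq: "gauss_iter \<alpha> (Suc n) = frac (1 / ?g)" by (simp add: gauss_iter_def gauss_map_def)
    have "frac (1 / ?g) \<notin> \<rat>"
    proof
      assume "frac (1 / ?g) \<in> \<rat>"
      then have "frac (1 / ?g) + of_int \<lfloor>1 / ?g\<rfloor> \<in> \<rat>" by (intro Rats_add Rats_of_int)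
      then have "1 / ?g \<in> \<rat>" by (simp add: frac_def)
      then have "inverse (1 / ?g) \<in> \<rat>" by (rule Rats_inverse)
      then show False using Suc by simp
    qed
    moreover from this have "frac (1 / ?g) \<noteq> 0" by (metis Rats_0)
    ultimately show ?case using frac_ge_0[of "1 / ?g"] frac_lt_1[of "1 / ?g"] by (auto simp: eq less_le)
  qed (simp add: gauss_iter_def assms)
  then show "0 < gauss_iter \<alpha> n" "gauss_iter \<alpha> n < 1" "gauss_iter \<alpha> n \<notin> \<rat>" by auto
qed

lemma qiter_Suc_right: "qiter s C (Suc k) x = qiter s C k (x + s) * C x"
proof (induction k)
  case (Suc k)
  have "qiter s C (Suc (Suc k)) x = C (x + real (Suc k) * s) * (qiter s C k (x + s) * C x)"
    using Suc by simp
  also have "x + real (Suc k) * s = (x + s) + real k * s" by (simp add: algebra_simps)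
  finally show ?case by (simp add: mult.assoc)
qed simp

lemma norm_qiter: "(\<And>x. norm (C x) = 1) \<Longrightarrow> norm (qiter s C k x) = 1"
  by (induction k) (simp_all add: norm_mult)

definition partial_quotient :: "real \<Rightarrow> nat \<Rightarrow> nat" where
  "partial_quotient \<alpha> n = nat \<lfloor>1 / gauss_iter \<alpha> n\<rfloor>"

locale irrational_rotation =
  fixes \<alpha> :: real
  assumes \<alpha>: "0 < \<alpha>" "\<alpha> < 1" "\<alpha> \<notin> \<rat>"
begin

abbreviation "b \<equiv> conv_beta \<alpha>"
abbreviation "a \<equiv> partial_quotient \<alpha>"
abbreviation "q \<equiv> conv_den \<alpha>"

lemma partial_quotient_pos: "1 \<le> a n" and of_nat_partial_quotient: "int (a n) = \<lfloor>1 / gauss_iter \<alpha> n\<rfloor>"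
proof -
  have "1 \<le> 1 / gauss_iter \<alpha> n" using gauss_iter_bounds[OF \<alpha>, of n] by simp
  then have "1 \<le> \<lfloor>1 / gauss_iter \<alpha> n\<rfloor>" by simp
  then show "1 \<le> a n" "int (a n) = \<lfloor>1 / gauss_iter \<alpha> n\<rfloor>" unfolding partial_quotient_def by linarith+
qed

lemma conv_beta_rec: "b n = b (Suc (Suc n)) + real (a n) * b (Suc n)"
  using of_nat_partial_quotient[of n, symmetric] by (simp add: conv_beta_def algebra_simps)

lemma conv_beta_Suc: "b (Suc n) = gauss_iter \<alpha> n * b n"
proof (induction n)
  case (Suc n)
  have "real (a n) = of_int \<lfloor>1 / gauss_iter \<alpha> n\<rfloor>" using of_nat_partial_quotient[of n] by (metis of_int_of_nat_eq)
  moreover have "b (Suc (Suc n)) = b n - real (a n) * b (Suc n)" using conv_beta_rec[of n] by simp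
  moreover have "b n = (1 / gauss_iter \<alpha> n) * b (Suc n)" using Suc gauss_iter_bounds(1)[OF \<alpha>, of n] by simp
  moreover have "gauss_iter \<alpha> (Suc n) = 1 / gauss_iter \<alpha> n - of_int \<lfloor>1 / gauss_iter \<alpha> n\<rfloor>"
    by (simp add: gauss_iter_def gauss_map_def frac_def)
  ultimately have "b (Suc (Suc n)) = gauss_iter \<alpha> (Suc n) * b (Suc n)"
    by (simp only: left_diff_distrib)
  then show ?case .
qed (simp add: conv_beta_def gauss_iter_def)

lemma conv_beta_pos: "0 < b n"
proof (induction n)
  case (Suc n)
  then show ?case using gauss_iter_bounds(1)[OF \<alpha>, of n] by (simp add: conv_beta_Suc)
qed (simp add: conv_beta_def)

lemma conv_den_ge: "0 \<le> q n" "1 \<le> q (Suc n)" "int n \<le> q (Suc n)"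
proof -
  have rec: "0 \<le> q n \<Longrightarrow> 1 \<le> q (Suc n) \<Longrightarrow> q (Suc n) + q n \<le> q (Suc (Suc n))" for n
    using partial_quotient_pos[of n] mult_right_mono[of 1 "int (a n)" "q (Suc n)"]
    by (simp flip: of_nat_partial_quotient)
  have *: "0 \<le> q n \<and> 1 \<le> q (Suc n)" for n
    by (induction n) (use rec in \<open>force simp del: conv_den.simps(3)\<close>)+
  then show "0 \<le> q n" "1 \<le> q (Suc n)" by auto
  show "int n \<le> q (Suc n)"
  proof (induction n)
    case (Suc n)
    have "n = 0 \<or> 1 \<le> q n" using * by (cases n) auto
    then show ?case using rec[of n] *[of n] *[of "Suc n"] Suc by (auto simp del: conv_den.simps(3))
  qed simp
qed

text \<open>The determinant identity for convergents. It bounds the scale \<open>b n\<close> by the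
  inverse of the next return time, which is how bounds for iterates become bounds for
  renormalizations.\<close>

lemma conv_beta_conv_den: "b n * q (Suc n) + b (Suc n) * q n = 1"
proof (induction n)
  case (Suc n)
  have "real_of_int (q (Suc (Suc n))) = real (a n) * q (Suc n) + q n" by (simp flip: of_nat_partial_quotient)
  then have "b (Suc n) * q (Suc (Suc n)) + b (Suc (Suc n)) * q (Suc n)
    = b (Suc n) * q n + q (Suc n) * (b (Suc (Suc n)) + real (a n) * b (Suc n))"
    by (simp add: algebra_simps del: conv_den.simps)
  then show ?case using Suc unfolding conv_beta_rec[of n, symmetric] by (simp add: algebra_simps del: conv_den.simps)
qed (simp add: conv_beta_def)

lemma conv_beta_le: "b n * q (Suc n) \<le> 1"
  using conv_beta_conv_den[of n] mult_nonneg_nonneg[OF less_imp_le[OF conv_beta_pos[of "Suc n"]], of "q n"] conv_den_ge(1)[of n]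
  by simp

text \<open>The signed number of iterates whose translation is \<open>b n\<close> modulo 1.\<close>

abbreviation "rtime n \<equiv> (-1) ^ (n + 1) * q n"

lemma conv_beta_mod_1: "b n = rtime n * \<alpha> + of_int ((-1) ^ n * conv_num \<alpha> n)"
  by (simp add: conv_beta_def algebra_simps)

lemma rtime_Suc_Suc: "rtime (Suc (Suc n)) = rtime n - int (a n) * rtime (Suc n)"
  by (simp add: of_nat_partial_quotient algebra_simps)

end

locale lifted_cocycle = irrational_rotation +
  fixes A :: "real \<Rightarrow> real^3^3" and Q :: "real \<Rightarrow> quat"
  assumes Q_smooth: "smooth Q" and Q_norm: "norm (Q x) = 1" and rot_Q: "rot (Q x) = A x"
    and Q_antiperiodic: "Q (x + 1) = - Q x"
begin

lemma Q_nonzero: "Q x \<noteq> 0" using Q_norm[of x] by auto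

definition lift_iter :: "int \<Rightarrow> real \<Rightarrow> quat" where
  "lift_iter m x = (if 0 \<le> m then qiter \<alpha> Q (nat m) x else inverse (qiter \<alpha> Q (nat (- m)) (x + m * \<alpha>)))"

lemma norm_lift_iter: "norm (lift_iter m x) = 1"
  by (simp add: lift_iter_def norm_inverse norm_qiter[OF Q_norm])

lemma lift_iter_nonzero: "lift_iter m x \<noteq> 0" using norm_lift_iter[of m x] by auto

lemma smooth_lift_iter: "smooth (lift_iter m)"
proof (cases "0 \<le> m")
  case False
  have "smooth (\<lambda>x. inverse (qiter \<alpha> Q (nat (- m)) (x + m * \<alpha>)))"
    by (rule smooth_inverse[OF smooth_shift[OF smooth_qiter[OF Q_smooth]] qiter_nonzero[OF Q_nonzero]])
  with False show ?thesis by (simp add: lift_iter_def[abs_def])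
qed (simp add: lift_iter_def[abs_def] smooth_qiter[OF Q_smooth])

lemma rot_lift_iter: "rot (lift_iter m x) = cocycle_iter \<alpha> A m x"
proof -
  have "rot (qiter \<alpha> Q k x) = cocycle_iter_nat \<alpha> A k x" for k x
    by (induction k) (simp_all add: rot_mult Q_nonzero qiter_nonzero rot_Q)
  then show ?thesis
    by (simp add: lift_iter_def cocycle_iter_def rot_inverse qiter_nonzero Q_nonzero)
qed

lemma lift_iter_step: "lift_iter (m + 1) x = Q (x + m * \<alpha>) * lift_iter m x"
proof (cases "0 \<le> m")
  case True
  then show ?thesis by (simp add: lift_iter_def nat_add_distrib)
next
  case False
  define k where "k = nat (- m - 1)"
  have m: "nat (- m) = Suc k" "m + 1 = - int k" using False by (auto simp: k_def)
  have "qiter \<alpha> Q (Suc k) (x + m * \<alpha>) = qiter \<alpha> Q k (x + (m + 1) * \<alpha>) * Q (x + m * \<alpha>)"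
    unfolding qiter_Suc_right by (simp add: algebra_simps)
  then have "lift_iter m x = inverse (Q (x + m * \<alpha>)) * inverse (qiter \<alpha> Q k (x + (m + 1) * \<alpha>))"
    using False by (simp add: lift_iter_def m(1) nonzero_inverse_mult_distrib qiter_nonzero Q_nonzero del: qiter.simps)
  moreover have "lift_iter (m + 1) x = inverse (qiter \<alpha> Q k (x + (m + 1) * \<alpha>))"
  proof -
    have r: "real_of_int m + 1 = - real k" using m(2) by linarith
    show ?thesis by (cases "k = 0") (simp_all add: lift_iter_def m(2) r del: qiter.simps(2))
  qed
  ultimately show ?thesis by (simp add: Q_nonzero mult.assoc[symmetric])
qed

lemma lift_iter_add: "lift_iter (m + l) x = lift_iter m (x + l * \<alpha>) * lift_iter l x"
proof (induction m rule: int_induct[of _ 0])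
  case base
  then show ?case by (simp add: lift_iter_def)
next
  case (step1 i)
  then show ?case
    using lift_iter_step[of i "x + l * \<alpha>"] lift_iter_step[of "i + l" x] by (simp add: algebra_simps)
next
  case (step2 i)
  have "Q (x + (i - 1 + l) * \<alpha>) * lift_iter (i - 1 + l) x
      = Q (x + (i - 1 + l) * \<alpha>) * (lift_iter (i - 1) (x + l * \<alpha>) * lift_iter l x)"
    using step2(2) lift_iter_step[of "i - 1" "x + l * \<alpha>"] lift_iter_step[of "i - 1 + l" x]
    by (simp add: algebra_simps) auto
  then show ?case using mult_left_cancel[OF Q_nonzero] by blast
qed

abbreviation "cocycle \<equiv> cocycle_iter \<alpha> A"

lemma cocycle_add: "cocycle (m + l) x = cocycle m (x + l * \<alpha>) ** cocycle l x"
  by (simp add: rot_lift_iter[symmetric] lift_iter_add rot_mult lift_iter_nonzero)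

text \<open>Over a period the lift of an iterate is multiplied by 1 or -1, which \<open>rot\<close>
  does not see.\<close>

lemma cocycle_of_int: "cocycle m (x + of_int k) = cocycle m x"
proof (rule periodic1_of_int)
  have "qiter \<alpha> Q k (x + 1) = (-1) ^ k * qiter \<alpha> Q k x" for k x
  proof (induction k)
    case (Suc k)
    then show ?case using Q_antiperiodic[of "x + k * \<alpha>"] by (cases "even k") (simp_all add: add_ac)
  qed simp
  then have qp: "qiter \<alpha> Q k (x + 1) = qiter \<alpha> Q k x \<or> qiter \<alpha> Q k (x + 1) = - qiter \<alpha> Q k x" for k x
    by (cases "even k") simp_all
  have "lift_iter m (x + 1) = lift_iter m x \<or> lift_iter m (x + 1) = - lift_iter m x" for x
    unfolding lift_iter_def using qp[of "nat m" x] qp[of "nat (- m)" "x + m * \<alpha>"]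
    by (auto simp: add_ac)
  then show "periodic1 (cocycle m)"
    unfolding periodic1_def rot_lift_iter[symmetric] by (metis rot_minus)
qed

text \<open>The recursion of the locale solved for the later step, starting from the lifts of the
  generators over 1 and \<alpha>. The lifted iterates \<open>lift_iter\<close> agree with it in
  general only up to sign, because Q changes sign over a period; the recursion makes a consistent
  choice.\<close>

fun G :: "nat \<Rightarrow> real \<Rightarrow> quat" where
  "G 0 x = 1"
| "G (Suc 0) x = Q x"
| "G (Suc (Suc n)) x = G n (x - real (a n) * b (Suc n)) * inverse (qiter (b (Suc n)) (G (Suc n)) (a n) (x - real (a n) * b (Suc n)))"

lemma norm_G: "norm (G n x) = 1"
  by (induction n x rule: G.induct) (simp_all add: Q_norm norm_mult norm_inverse norm_qiter)

lemma G_nonzero: "G n x \<noteq> 0" using norm_G[of n x] by auto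

lemma smooth_G: "smooth (G n)"
proof -
  have "smooth (G n) \<and> smooth (G (Suc n))"
  proof (induction n)
    case 0
    then show ?case by (simp add: G.simps(1,2)[abs_def] Q_smooth)
  next
    case (Suc n)
    have "smooth (\<lambda>x. G n (x + - (real (a n) * b (Suc n))) * inverse (qiter (b (Suc n)) (G (Suc n)) (a n) (x + - (real (a n) * b (Suc n)))))"
      by (rule smooth_mult[OF smooth_shift smooth_inverse[OF smooth_shift[OF smooth_qiter] qiter_nonzero[OF G_nonzero]]]) (use Suc in auto)
    then show ?case using Suc by (simp add: G.simps(3)[abs_def])
  qed
  then show ?thesis ..
qed

lemma rot_G: "rot (G n x) = cocycle (rtime n) x"
proof (induction n x rule: G.induct)
  case (1 x)
  then show ?case by (simp add: rot_lift_iter[symmetric] lift_iter_def)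
next
  case (2 x)
  then show ?case by (simp add: rot_lift_iter[symmetric] lift_iter_def)
next
  case (3 n x)
  let ?y = "x - real (a n) * b (Suc n)"
  define m where "m = rtime (Suc n)"
  have b: "b (Suc n) = m * \<alpha> + of_int ((-1) ^ Suc n * conv_num \<alpha> (Suc n))"
    unfolding m_def by (rule conv_beta_mod_1)
  have shift: "cocycle l (z + real k * b (Suc n)) = cocycle l (z + of_int (int k * m) * \<alpha>)" for l z k
  proof -
    have "z + real k * b (Suc n) = (z + of_int (int k * m) * \<alpha>) + of_int (int k * ((-1) ^ Suc n * conv_num \<alpha> (Suc n)))"
      unfolding b by (simp add: algebra_simps)
    then show ?thesis by (metis cocycle_of_int)
  qed
  have it: "rot (qiter (b (Suc n)) (G (Suc n)) k z) = cocycle (int k * m) z" for k z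
  proof (induction k)
    case 0
    then show ?case by (simp add: rot_lift_iter[symmetric] lift_iter_def)
  next
    case (Suc k)
    have "int (Suc k) * m = m + int k * m" by (simp add: algebra_simps)
    then show ?case
      using Suc 3(2) by (simp only: qiter.simps rot_mult[OF G_nonzero qiter_nonzero[OF G_nonzero]] shift cocycle_add m_def)
  qed
  have "rot (G (Suc (Suc n)) x) = cocycle (rtime n) ?y ** matrix_inv (cocycle (int (a n) * m) ?y)"
    using 3(1) it by (simp add: rot_mult rot_inverse G_nonzero qiter_nonzero[OF G_nonzero])
  also have "cocycle (rtime n) ?y = cocycle (rtime (Suc (Suc n)) + int (a n) * m) ?y"
    unfolding rtime_Suc_Suc m_def by simp
  also have "\<dots> = cocycle (rtime (Suc (Suc n))) (?y + real (a n) * b (Suc n)) ** cocycle (int (a n) * m) ?y"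
    unfolding cocycle_add shift ..
  finally show ?case
    using SO3_mult_inverse(2)[OF rot_SO3[OF lift_iter_nonzero]] by (simp add: rot_lift_iter del: conv_den.simps G.simps)
qed

lemma G_rec': "G n x = G (Suc (Suc n)) (x + real (a n) * b (Suc n)) * qiter (b (Suc n)) (G (Suc n)) (a n) x"
  by (simp add: mult.assoc qiter_nonzero[OF G_nonzero])

text \<open>The base case is the sign change of Q over a period. In the step the new generator
  differs from the old one by a power of the middle generator, which commutes with the middle
  generator as a cocycle; so the sign is passed on.\<close>

lemma G_anti: "G n (x + b (Suc n)) * G (Suc n) x = - (G (Suc n) (x + b n) * G n x)"
proof (induction n arbitrary: x)
  case 0
  then show ?case using Q_antiperiodic[of x] by (simp add: conv_beta_def)
next
  case (Suc n)
  let ?b = "b (Suc n)" and ?W = "qiter (b (Suc n)) (G (Suc n)) (a n)"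
  define y where "y = x - real (a n) * ?b"
  have W: "?W z \<noteq> 0" for z by (rule qiter_nonzero[OF G_nonzero])
  have 1: "G (Suc n) (y + real (a n) * ?b) * ?W y = ?W (y + ?b) * G (Suc n) y"
    using qiter_Suc_right[of ?b "G (Suc n)" "a n" y] by simp
  have 2: "G (Suc n) (y + b n) * G n y = - (G n (y + ?b) * G (Suc n) y)" using Suc[of y] by simp
  have "G (Suc n) (x + b (Suc (Suc n))) * G (Suc (Suc n)) x = (G (Suc n) (y + b n) * G n y) * inverse (?W y)"
    using conv_beta_rec[of n] by (simp add: y_def mult.assoc)
  also have "\<dots> = - (G n (y + ?b) * (G (Suc n) y * inverse (?W y)))"
    unfolding 2 by (simp add: mult.assoc)
  also have "G (Suc n) y * inverse (?W y) = inverse (?W (y + ?b)) * G (Suc n) (y + real (a n) * ?b)"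
  proof -
    have "G (Suc n) y * inverse (?W y) = inverse (?W (y + ?b)) * (?W (y + ?b) * G (Suc n) y) * inverse (?W y)"
      using W[of "y + ?b"] by (simp add: mult.assoc[symmetric])
    also have "\<dots> = inverse (?W (y + ?b)) * G (Suc n) (y + real (a n) * ?b)"
      unfolding 1[symmetric] using W[of y] by (simp add: mult.assoc)
    finally show ?thesis .
  qed
  also have "G n (y + ?b) * (inverse (?W (y + ?b)) * G (Suc n) (y + real (a n) * ?b)) = G (Suc (Suc n)) (x + ?b) * G (Suc n) x"
    by (simp add: y_def algebra_simps)
  finally show ?case .
qed

sublocale renormalization "conv_beta \<alpha>" "partial_quotient \<alpha>" G
proof
  fix n x
  show "b (Suc n) < b n"
    using conv_beta_Suc[of n] gauss_iter_bounds(2)[OF \<alpha>, of n] conv_beta_pos[of n] by simp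
qed (fact conv_beta_pos partial_quotient_pos conv_beta_rec smooth_G norm_G G_rec' G_anti)+

end

section \<open>Cocycles of degree zero have flat renormalizations\<close>

lemma integral_periodic_shift:
  fixes f :: "real \<Rightarrow> real"
  assumes f: "continuous_on UNIV f" "periodic1 f"
  shows "integral {0..1} (\<lambda>x. f (x + c)) = integral {0..1} f"
proof -
  define r where "r = frac c"
  have r: "0 \<le> r" "r \<le> 1" using frac_lt_1[of c] by (auto simp: r_def)
  have io: "f integrable_on {u..v}" for u v
    by (intro integrable_continuous_interval continuous_on_subset[OF f(1)]) simp
  have "f (x + c) = f (x + r)" for x
    using periodic1_of_int[OF f(2), of "x + r" "\<lfloor>c\<rfloor>"] by (simp add: r_def frac_def)
  then have "integral {0..1} (\<lambda>x. f (x + c)) = integral {r..1 + r} f"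
    using integral_shift_real_ivl[where a = r and c = r and b = "1 + r" and f = f] by simp
  also have "\<dots> = integral {r..1} f + integral {1..1 + r} f"
    using Henstock_Kurzweil_Integration.integral_combine[where a = r and c = 1 and b = "1 + r" and f = f] r io by simp
  also have "integral {1..1 + r} f = integral {0..r} f"
    using integral_shift_real_ivl[where a = 1 and c = 1 and b = "1 + r" and f = f] f(2) by (simp add: periodic1_def)
  also have "integral {r..1} f + integral {0..r} f = integral {0..1} f"
    using Henstock_Kurzweil_Integration.integral_combine[where a = 0 and c = r and b = 1 and f = f] r io by simp
  finally show ?thesis .
qed

text \<open>Kronecker's theorem with a waiting time uniform in the target x: it is applied to the
  finitely many points i / M only.\<close>

lemma rotation_orbit_dense:
  fixes \<beta> :: real
  assumes "\<beta> \<notin> \<rat>" "0 < \<delta>"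
  obtains K where "\<And>x. \<exists>k\<le>K. \<exists>n::int. \<bar>real k * \<beta> - x - of_int n\<bar> < \<delta>"
proof -
  obtain M :: nat where M: "0 < M" "1 / M < \<delta> / 2"
    using assms(2) by (metis half_gt_zero inverse_eq_divide real_arch_inverse gr0I)
  have "\<exists>k. \<bar>frac (real k * \<beta>) - real i / M\<bar> < \<delta> / 2" if "i \<le> M" for i
    using Kronecker_approx_1_explicit[OF assms(1), of "real i / M" "\<delta> / 2"] that M(1) assms(2) by auto
  then obtain k where k: "\<And>i. i \<le> M \<Longrightarrow> \<bar>frac (real (k i) * \<beta>) - real i / M\<bar> < \<delta> / 2" by metis
  show thesis
  proof (rule that[of "\<Sum>i\<le>M. k i"])
    fix x :: real
    define i where "i = nat \<lfloor>real M * frac x\<rfloor>"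
    have "0 \<le> real M * frac x" by simp
    then have i: "real i \<le> real M * frac x" "real M * frac x < real i + 1" unfolding i_def by linarith+
    have "real M * frac x \<le> real M * 1" by (intro mult_left_mono) (simp_all add: less_imp_le[OF frac_lt_1])
    then have iM: "i \<le> M" using i(1) by linarith
    have "\<bar>real i / M - frac x\<bar> \<le> 1 / M"
    proof -
      have "real i / M - frac x = (real i - real M * frac x) / M" using M(1) by (simp add: diff_divide_distrib)
      then have "\<bar>real i / M - frac x\<bar> = \<bar>real i - real M * frac x\<bar> / M" by simp
      also have "\<dots> \<le> 1 / M" using i by (intro divide_right_mono) auto
      finally show ?thesis .
    qed
    then have "\<bar>frac (real (k i) * \<beta>) - frac x\<bar> < \<delta>" using k[OF iM] M(2) by linarith
    moreover have "frac (real (k i) * \<beta>) - frac x = real (k i) * \<beta> - x - of_int (\<lfloor>real (k i) * \<beta>\<rfloor> - \<lfloor>x\<rfloor>)"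
      by (simp add: frac_def)
    moreover have "k i \<le> (\<Sum>i\<le>M. k i)" using iM by (intro member_le_sum) auto
    ultimately show "\<exists>k'\<le>\<Sum>i\<le>M. k i. \<exists>n::int. \<bar>real k' * \<beta> - x - of_int n\<bar> < \<delta>"
      by metis
  qed
qed

text \<open>Unique ergodicity made quantitative. Any two starting points are joined, modulo 1, by at
  most K rotations and a shift below \<delta>, so their Birkhoff sums of length N differ by at most
  K B + N e / 2; averaging over the starting point gives N times the integral.\<close>

lemma birkhoff_sum_le:
  fixes f :: "real \<Rightarrow> real"
  assumes f: "periodic1 f" "\<And>x y. \<bar>f x - f y\<bar> \<le> C * \<bar>x - y\<bar>" "\<And>x. 0 \<le> f x" "\<And>x. f x \<le> B"
    and \<beta>: "\<beta> \<notin> \<rat>" and e: "0 < e"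
  obtains N0 where "\<And>N y. N0 \<le> N \<Longrightarrow> (\<Sum>j<N. f (y + real j * \<beta>)) \<le> N * (integral {0..1} f + e)"
proof -
  have C: "0 \<le> C" using f(2)[of 0 1] by auto
  have B: "0 \<le> B" using f(3,4) order_trans by blast
  define \<delta> where "\<delta> = e / (2 * (C + 1))"
  have \<delta>: "0 < \<delta>" "C * \<delta> \<le> e / 2" using C e by (auto simp: \<delta>_def field_simps)
  obtain K where K: "\<And>x. \<exists>k\<le>K. \<exists>n::int. \<bar>real k * \<beta> - x - of_int n\<bar> < \<delta>"
    using rotation_orbit_dense[OF \<beta> \<delta>(1)] by blast
  have cont: "continuous_on UNIV f"
    using C f(2) by (intro lipschitz_on_continuous_on[of C] lipschitz_onI) (auto simp: dist_real_def)
  define S where "S N y = (\<Sum>j<N. f (y + real j * \<beta>))" for N y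
  have S_shift: "S N (y + real k * \<beta>) \<le> S N y + k * B" for N y k
  proof (induction k)
    case (Suc k)
    have "S N (z + \<beta>) + f z = S N z + f (z + N * \<beta>)" for z
      using sum.lessThan_Suc_shift[of "\<lambda>j. f (z + real j * \<beta>)" N] by (simp add: S_def algebra_simps)
    from this[of "y + real k * \<beta>"] have "S N (y + real k * \<beta> + \<beta>) \<le> S N (y + real k * \<beta>) + B"
      using f(3,4) by (smt (verit))
    moreover have "y + real k * \<beta> + \<beta> = y + real (Suc k) * \<beta>" by (simp add: algebra_simps)
    ultimately show ?case using Suc by (simp add: algebra_simps)
  qed simp
  have S_lip: "S N z - S N w \<le> N * (C * \<bar>z - w\<bar>)" for N z w
  proof -
    have "S N z - S N w = (\<Sum>j<N. f (z + real j * \<beta>) - f (w + real j * \<beta>))" by (simp add: S_def sum_subtractf)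
    also have "\<dots> \<le> (\<Sum>j<N. C * \<bar>z - w\<bar>)"
    proof (rule sum_mono)
      show "f (z + real j * \<beta>) - f (w + real j * \<beta>) \<le> C * \<bar>z - w\<bar>" for j
        using f(2)[of "z + real j * \<beta>" "w + real j * \<beta>"] by simp
    qed
    finally show ?thesis by simp
  qed
  have S_per: "S N (z + of_int n) = S N z" for N z n
    using periodic1_of_int[OF f(1), of "z + real _ * \<beta>" n] by (simp add: S_def add_ac)
  have S_le: "S N z \<le> S N y + (K * B + N * (e / 2))" for N z y
  proof -
    obtain k n where k: "k \<le> K" "\<bar>real k * \<beta> - (z - y) - of_int n\<bar> < \<delta>" using K by blast
    have "S N z = S N (z + of_int n)" by (simp add: S_per)
    also have "\<dots> \<le> S N (y + real k * \<beta>) + N * (C * \<bar>(z + of_int n) - (y + real k * \<beta>)\<bar>)"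
      using S_lip[of N "z + of_int n" "y + real k * \<beta>"] by simp
    also have "real N * (C * \<bar>(z + of_int n) - (y + real k * \<beta>)\<bar>) \<le> N * (C * \<delta>)"
      using k(2) C by (intro mult_left_mono) auto
    also have "real N * (C * \<delta>) \<le> N * (e / 2)" using \<delta>(2) by (intro mult_left_mono) auto
    also have "S N (y + real k * \<beta>) \<le> S N y + k * B" by (rule S_shift)
    also have "k * B \<le> K * B" using k(1) B by (intro mult_right_mono) auto
    finally show ?thesis by simp
  qed
  have Sc: "continuous_on UNIV (S N)" for N
    unfolding S_def by (intro continuous_intros continuous_on_compose2[OF cont]) auto
  have fi: "(\<lambda>x. f (x + c)) integrable_on {0..1}" for c
    by (intro integrable_continuous_interval continuous_on_compose2[OF cont] continuous_intros) auto
  have S_int: "integral {0..1} (S N) = N * integral {0..1} f" for N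
    unfolding S_def using integral_periodic_shift[OF cont f(1)] fi by (simp add: integral_sum)
  have S_avg: "S N z \<le> N * integral {0..1} f + (K * B + N * (e / 2))" for N z
  proof -
    have "integral {0..1} (\<lambda>y::real. S N z) \<le> integral {0..1} (\<lambda>y. S N y + (K * B + N * (e / 2)))"
      by (rule Henstock_Kurzweil_Integration.integral_le)
        (simp_all only: S_le integrable_continuous_interval continuous_on_add continuous_on_const continuous_on_subset[OF Sc] subset_UNIV)
    also have "\<dots> = integral {0..1} (S N) + (K * B + N * (e / 2))"
      using Henstock_Kurzweil_Integration.integral_add[of "S N" "{0..1}" "\<lambda>y. K * B + N * (e / 2)"]
      by (simp add: integrable_continuous_interval continuous_on_subset[OF Sc])
    finally show ?thesis by (simp add: S_int)
  qed
  obtain N0 :: nat where N0: "2 * (K * B) / e \<le> N0" using real_arch_simple by blast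
  show thesis
  proof (rule that[of N0])
    fix N y assume "N0 \<le> N"
    then have "2 * (K * B) / e \<le> N" using N0 by linarith
    then have "K * B \<le> N * (e / 2)" using e by (simp add: field_simps)
    then show "(\<Sum>j<N. f (y + real j * \<beta>)) \<le> N * (integral {0..1} f + e)"
      using S_avg[of N y] unfolding S_def[symmetric] by (simp add: algebra_simps)
  qed
qed

lemma conj_mat_mult_rot: "u \<noteq> 0 \<Longrightarrow> conj_mat p q ** rot u = conj_mat (p * u) (inverse u * q)"
  by (rule mat_eqI) (simp add: matrix_vector_mul_assoc[symmetric] conj_mat_mult_vec hq_rot mult.assoc)

text \<open>The logarithmic derivative w of a path of unit quaternions is imaginary, and the
  differential of \<open>rot\<close> sends it to the commutator with w. The entries of that matrix
  off the diagonal are twice the components of w up to sign, which bounds the derivative of the lift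
  by that of the rotation.\<close>

lemma rot_log_derivative:
  assumes f: "smooth f" "\<And>x. norm (f x) = 1"
  defines "w x \<equiv> vd f x * inverse (f x)"
  shows "vd (\<lambda>x. rot (f x)) x ** matrix_inv (rot (f x)) = conj_mat (w x) 1 - conj_mat 1 (w x)"
    and "norm (vd f x) \<le> 2 * norm (conj_mat (w x) 1 - conj_mat 1 (w x))"
proof -
  have nz: "f x \<noteq> 0" for x using f(2)[of x] by auto
  interpret c: bounded_bilinear conj_mat by (rule bounded_bilinear_conj_mat)
  have "((\<lambda>x. rot (f x)) has_vector_derivative
      conj_mat (f x) (- (inverse (f x) * vd f x * inverse (f x))) + conj_mat (vd f x) (inverse (f x))) (at x)"
    unfolding rot_def
    by (rule c.has_vector_derivative[OF smooth_has_vd[OF f(1)] has_vector_derivative_inverse[OF smooth_has_vd[OF f(1)] nz]])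
  then have "vd (\<lambda>x. rot (f x)) x = conj_mat (vd f x) (inverse (f x)) - conj_mat (f x) (inverse (f x) * vd f x * inverse (f x))"
    by (simp add: vd_eqI c.minus_right)
  moreover have "(X - Y) ** Z = X ** Z - Y ** Z" for X Y Z :: "real^3^3"
    using bounded_bilinear.diff_left[OF bounded_bilinear_matrix_mult] .
  ultimately show "vd (\<lambda>x. rot (f x)) x ** matrix_inv (rot (f x)) = conj_mat (w x) 1 - conj_mat 1 (w x)"
    using nz by (simp add: rot_inverse[symmetric] conj_mat_mult_rot w_def mult.assoc[symmetric])
  have "inner (f x) (f x) = 1" for x using f(2)[of x] by (simp add: dot_square_norm)
  then have "(\<lambda>x. inner (f x) (f x)) = (\<lambda>_. 1)" by auto
  then have "((\<lambda>x. inner (f x) (f x)) has_vector_derivative 0) (at x)" by simp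
  moreover have "((\<lambda>x. inner (f x) (f x)) has_vector_derivative inner (f x) (vd f x) + inner (vd f x) (f x)) (at x)"
    by (rule bounded_bilinear.has_vector_derivative[OF bounded_bilinear_inner smooth_has_vd[OF f(1)] smooth_has_vd[OF f(1)]])
  ultimately have "inner (f x) (vd f x) + inner (vd f x) (f x) = 0" by (metis vd_eqI)
  then have "inner (vd f x) (f x) = 0" by (simp add: inner_commute)
  then have Re: "qRe (w x) = 0"
    unfolding w_def inverse_unit[OF f(2)] by (simp add: inner_quat_def)
  define M where "M = conj_mat (w x) 1 - conj_mat 1 (w x)"
  have entry: "\<bar>M $ i $ j\<bar> \<le> norm M" for i j
    using component_le_norm_cart[of "M $ i" j] Finite_Cartesian_Product.norm_nth_le[of M i] by linarith
  have M: "M $ 2 $ 1 = 2 * qIm3 (w x)" "M $ 3 $ 1 = - 2 * qIm2 (w x)" "M $ 3 $ 2 = 2 * qIm1 (w x)"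
    by (simp_all add: M_def conj_mat_def axis_def)
  have "norm (vd f x) = norm (w x)" by (simp add: w_def norm_mult norm_inverse f(2))
  then show "norm (vd f x) \<le> 2 * norm (conj_mat (w x) 1 - conj_mat 1 (w x))"
    using norm_le_sum_sel[of "w x"] Re entry[of 2 1] entry[of 3 1] entry[of 3 2] unfolding M M_def[symmetric] by linarith
qed

lemma qiter_add: "qiter s C (m + l) x = qiter s C m (x + real l * s) * qiter s C l x"
  by (induction m) (simp_all add: mult.assoc algebra_simps)

context lifted_cocycle
begin

abbreviation "F \<equiv> qiter \<alpha> Q"

lemma smooth_F: "smooth (F m)" by (rule smooth_qiter[OF Q_smooth])

lemma norm_F: "norm (F m x) = 1" by (rule norm_qiter[OF Q_norm])

lemma norm_vd_F_add: "norm (vd (F (m + l)) x) \<le> norm (vd (F m) (x + real l * \<alpha>)) + norm (vd (F l) x)"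
proof -
  have "vd (F (m + l)) = (\<lambda>x. F m (x + real l * \<alpha>) * vd (F l) x + vd (F m) (x + real l * \<alpha>) * F l x)"
    unfolding qiter_add[abs_def] vd_bilinear[OF bounded_bilinear_mult smooth_shift[OF smooth_F] smooth_F] fun_cong[OF vd_shift[OF smooth_F]] ..
  from fun_cong[OF this, of x] show ?thesis
    using norm_triangle_ineq[of "F m (x + real l * \<alpha>) * vd (F l) x" "vd (F m) (x + real l * \<alpha>) * F l x"]
    by (simp add: norm_mult norm_F add.commute)
qed

lemma F_plus_1: "F k (x + 1) = (-1) ^ k * F k x"
proof (induction k)
  case (Suc k)
  then show ?case using Q_antiperiodic[of "x + k * \<alpha>"] by (cases "even k") (simp_all add: add_ac)
qed simp

lemma norm_nth_derivative_F_periodic: "periodic1 (\<lambda>x. norm (nth_derivative k (F m) x))"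
  unfolding periodic1_def
proof
  fix x
  have "(\<lambda>x. F m (x + 1)) = F m \<or> (\<lambda>x. F m (x + 1)) = (\<lambda>x. - F m x)"
    unfolding F_plus_1[abs_def] by (cases "even m") auto
  moreover have "nth_derivative k (\<lambda>x. F m (x + 1)) x = nth_derivative k (F m) (x + 1)"
    using nth_derivative_vd_shift[OF smooth_F, of k m 1] by metis
  moreover have "nth_derivative k (\<lambda>x. - f x) = (\<lambda>x. - nth_derivative k f x)" if "smooth f" for f :: "real \<Rightarrow> quat"
    using that
  proof (induction k arbitrary: f)
    case (Suc k)
    then show ?case unfolding nth_derivative_Suc vd_minus[OF Suc.prems] by (simp add: smooth_vd)
  qed simp
  ultimately show "norm (nth_derivative k (F m) (x + 1)) = norm (nth_derivative k (F m) x)"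
    using smooth_F by (metis norm_minus_cancel)
qed

lemma nth_derivative_F_bounded:
  obtains B where "0 \<le> B" "\<And>x. norm (nth_derivative k (F m) x) \<le> B"
proof -
  have "compact ((\<lambda>x. norm (nth_derivative k (F m) x)) ` {0..1})"
    by (intro compact_continuous_image continuous_on_norm smooth_continuous smooth_nth_derivative smooth_F) auto
  then have "bounded ((\<lambda>x. norm (nth_derivative k (F m) x)) ` {0..1})" by (rule compact_imp_bounded)
  then obtain B where "\<forall>y\<in>(\<lambda>x. norm (nth_derivative k (F m) x)) ` {0..1}. norm y \<le> B"
    unfolding bounded_iff by blast
  then have B: "0 \<le> x \<Longrightarrow> x \<le> 1 \<Longrightarrow> norm (nth_derivative k (F m) x) \<le> B" for x by auto
  have "norm (nth_derivative k (F m) x) \<le> B" for x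
  proof -
    obtain y where "0 \<le> y" "y < 1" "norm (nth_derivative k (F m) y) = norm (nth_derivative k (F m) x)"
      using periodic_reduce[of 1 "\<lambda>x. norm (nth_derivative k (F m) x)" x] norm_nth_derivative_F_periodic[of k m]
      unfolding periodic1_def by auto
    then show ?thesis using B[of y] by simp
  qed
  moreover from this[of 0] have "0 \<le> B" using norm_ge_zero order_trans by blast
  ultimately show thesis using that by blast
qed

lemma F_1: "F 1 = Q"
  by (rule ext) simp

lemma vd_F_linear_growth:
  obtains L where "0 \<le> L" "\<And>m x. norm (vd (F m) x) \<le> L * real m"
proof -
  obtain L where L: "0 \<le> L" "\<And>x. norm (nth_derivative 1 (F 1) x) \<le> L" using nth_derivative_F_bounded by blast
  then have L': "norm (vd Q x) \<le> L" for x unfolding F_1 using nth_derivative_Suc[of 0 Q] by (metis One_nat_def nth_derivative_0)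
  have "norm (vd (F m) x) \<le> L * m" for m x
  proof (induction m arbitrary: x)
    case 0
    then show ?case by (simp add: qiter.simps(1)[abs_def])
  next
    case (Suc m)
    show ?case using norm_vd_F_add[of 1 m x] L'[of "x + real m * \<alpha>"] Suc[of x] unfolding F_1 by (simp add: algebra_simps del: qiter.simps(2))
  qed
  then show thesis using that L(1) by blast
qed

lemma degree_zero_mean:
  fixes \<eta> :: real
  assumes "degree_zero \<alpha> A" "0 < \<eta>"
  obtains n where "1 \<le> n" "integral {0..1} (\<lambda>x. norm (vd (F n) x)) \<le> \<eta> * n"
proof -
  define W where "W n x = conj_mat (vd (F n) x * inverse (F n x)) 1 - conj_mat 1 (vd (F n) x * inverse (F n x))" for n x
  have Fr: "cocycle_iter \<alpha> A (int n) = (\<lambda>x. rot (F n x))" for n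
    using rot_lift_iter[of "int n"] by (simp add: lift_iter_def fun_eq_iff)
  have "degree_zero \<alpha> A \<longleftrightarrow> (\<lambda>n. L2_norm_torus (\<lambda>x. (1 / real n) *\<^sub>R W n x)) \<longlonglongrightarrow> 0"
    unfolding degree_zero_def Fr rot_log_derivative(1)[OF smooth_F norm_F] W_def ..
  then have "\<forall>\<^sub>F n in sequentially. L2_norm_torus (\<lambda>x. (1 / real n) *\<^sub>R W n x) < \<eta> / 2"
    using assms by (intro order_tendstoD(2)) auto
  then obtain n where n: "1 \<le> n" "L2_norm_torus (\<lambda>x. (1 / real n) *\<^sub>R W n x) < \<eta> / 2"
    by (metis (no_types, lifting) eventually_sequentially nat_le_linear)
  define f where "f x = norm (vd (F n) x)" for x
  have Fc: "continuous_on S (F n)" "continuous_on S (vd (F n))" for S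
    by (intro smooth_continuous smooth_vd smooth_F)+
  have Wc: "continuous_on {0..1} (W n)"
    unfolding W_def
    by (intro continuous_intros bounded_bilinear.continuous_on[OF bounded_bilinear_conj_mat] Fc)
      (simp_all add: qiter_nonzero[OF Q_nonzero])
  have fc: "continuous_on {0..1} f" unfolding f_def by (intro continuous_on_norm Fc)
  define I where "I = integral {0..1} (\<lambda>x. (norm ((1 / real n) *\<^sub>R W n x))\<^sup>2)"
  have "0 \<le> I" unfolding I_def by (intro Henstock_Kurzweil_Integration.integral_nonneg integrable_continuous_interval continuous_intros Wc) auto
  moreover have "sqrt I < \<eta> / 2" using n(2) by (simp add: L2_norm_torus_def I_def)
  ultimately have I: "I \<le> (\<eta> / 2)\<^sup>2" by (metis less_imp_le real_sqrt_le_iff real_sqrt_pow2 power_mono real_sqrt_ge_zero)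
  have nn: "0 < \<eta> * n" using n(1) assms(2) by simp
  have "f x \<le> 2 * n / \<eta> * (norm ((1 / real n) *\<^sub>R W n x))\<^sup>2 + \<eta> * n / 2" for x
  proof -
    have "f x \<le> 2 * norm (W n x)" unfolding f_def W_def by (rule rot_log_derivative(2)[OF smooth_F norm_F])
    also have "norm (W n x) = n * norm ((1 / real n) *\<^sub>R W n x)" using n(1) by simp
    finally have *: "f x \<le> 2 * (n * norm ((1 / real n) *\<^sub>R W n x))" .
    \<comment> \<open>Completing the square replaces the inequality of Cauchy and Schwarz in passing
      from the quadratic mean to the mean.\<close>
    have "2 * (n * y) \<le> 2 * n / \<eta> * y\<^sup>2 + \<eta> * n / 2" for y :: real
    proof -
      have "0 \<le> (2 * n / \<eta>) * (y - \<eta> / 2)\<^sup>2" using assms(2) by simp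
      also have "\<dots> = 2 * n / \<eta> * y\<^sup>2 + \<eta> * n / 2 - 2 * (n * y)"
        using assms(2) by (simp add: power2_eq_square field_simps)
      finally show ?thesis by simp
    qed
    from order_trans[OF * this] show ?thesis .
  qed
  then have "integral {0..1} f \<le> integral {0..1} (\<lambda>x. 2 * n / \<eta> * (norm ((1 / real n) *\<^sub>R W n x))\<^sup>2 + \<eta> * n / 2)"
    using n(1) assms(2)
    by (intro Henstock_Kurzweil_Integration.integral_le integrable_continuous_interval continuous_intros Wc fc) auto
  also have "\<dots> = 2 * n / \<eta> * I + \<eta> * n / 2"
    unfolding I_def by (subst Henstock_Kurzweil_Integration.integral_add) (use n(1) assms(2) in \<open>auto intro!: integrable_continuous_interval continuous_intros Wc\<close>)
  also have "\<dots> \<le> 2 * n / \<eta> * (\<eta> / 2)\<^sup>2 + \<eta> * n / 2" using I assms(2) by (intro add_right_mono mult_left_mono) auto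
  also have "\<dots> = \<eta> * n" using assms(2) by (simp add: power2_eq_square)
  finally show thesis using n(1) that unfolding f_def by blast
qed

text \<open>For a given \<epsilon> a single n with small mean derivative is taken from the degree
  hypothesis. Subadditivity along the orbit of n \<alpha>, which is again irrational, together with
  \<open>birkhoff_sum_le\<close> turns it into a bound uniform in x for all long iterates.\<close>

lemma vd_F_sublinear:
  fixes \<epsilon> :: real
  assumes deg: "degree_zero \<alpha> A" and \<epsilon>: "0 < \<epsilon>"
  obtains M where "\<And>m x. M \<le> m \<Longrightarrow> norm (vd (F m) x) \<le> \<epsilon> * m"
proof -
  obtain L where L: "0 \<le> L" "\<And>m x. norm (vd (F m) x) \<le> L * real m" using vd_F_linear_growth by blast
  obtain n where n: "1 \<le> n" "integral {0..1} (\<lambda>x. norm (vd (F n) x)) \<le> \<epsilon> / 4 * n"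
    using degree_zero_mean[OF deg, of "\<epsilon> / 4"] \<epsilon> by auto
  define f where "f x = norm (vd (F n) x)" for x
  obtain C where C: "0 \<le> C" "\<And>x. norm (nth_derivative 2 (F n) x) \<le> C" using nth_derivative_F_bounded by blast
  have nd: "nth_derivative 2 (F n) = vd (vd (F n))" "nth_derivative 1 (F n) = vd (F n)"
    using nth_derivative_Suc[of 1 "F n"] nth_derivative_Suc[of 0 "F n"] nth_derivative_Suc[of 0 "vd (F n)"] by (simp_all add: eval_nat_numeral)
  have lip: "\<bar>f x - f y\<bar> \<le> C * \<bar>x - y\<bar>" for x y
  proof -
    have "\<bar>f x - f y\<bar> \<le> norm (vd (F n) x - vd (F n) y)" unfolding f_def by (rule norm_triangle_ineq3)
    also have "\<dots> \<le> C * \<bar>x - y\<bar>"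
      using C(2) unfolding nd by (rule vector_differentiable_bound_UNIV[OF smooth_vd[OF smooth_F]])
    finally show ?thesis .
  qed
  have per: "periodic1 f" using norm_nth_derivative_F_periodic[of 1 n] unfolding nd f_def[abs_def] .
  have irr: "real n * \<alpha> \<notin> \<rat>"
  proof
    assume "real n * \<alpha> \<in> \<rat>"
    then have "real n * \<alpha> / real n \<in> \<rat>" by (rule Rats_divide) simp
    then show False using n(1) \<alpha>(3) by simp
  qed
  have f: "0 \<le> f x" "f x \<le> L * n" "0 < \<epsilon> / 4 * n" for x using L(2) \<epsilon> n(1) by (simp_all add: f_def)
  obtain N0 where N0: "\<And>N y. N0 \<le> N \<Longrightarrow> (\<Sum>j<N. f (y + real j * (real n * \<alpha>))) \<le> N * (integral {0..1} f + \<epsilon> / 4 * n)"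
    by (rule birkhoff_sum_le[OF per lip f(1,2) irr f(3)]) (rule that)
  have sub: "norm (vd (F (N * n)) y) \<le> (\<Sum>j<N. f (y + real j * (real n * \<alpha>)))" for N y
  proof (induction N)
    case 0
    then show ?case by (simp add: qiter.simps(1)[abs_def])
  next
    case (Suc N)
    then show ?case using norm_vd_F_add[of n "N * n" y] by (simp add: f_def algebra_simps)
  qed
  obtain M0 :: nat where M0: "2 * (L * n) / \<epsilon> \<le> M0" using real_arch_simple by blast
  show thesis
  proof (rule that[of "max M0 (N0 * n)"])
    fix m x assume m: "max M0 (N0 * n) \<le> m"
    define N t where "N = m div n" and "t = m mod n"
    have mN: "m = N * n + t" "t \<le> n" using n(1) by (simp_all add: N_def t_def less_imp_le)
    have "N0 \<le> N" using m n(1) by (simp add: N_def less_eq_div_iff_mult_less_eq)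
    have "norm (vd (F m) x) \<le> norm (vd (F (N * n)) (x + real t * \<alpha>)) + norm (vd (F t) x)"
      unfolding mN(1) by (rule norm_vd_F_add)
    also have "\<dots> \<le> N * (integral {0..1} f + \<epsilon> / 4 * n) + L * t"
      using order_trans[OF sub N0[OF \<open>N0 \<le> N\<close>]] L(2) by (intro add_mono)
    also have "\<dots> \<le> N * (\<epsilon> / 4 * n + \<epsilon> / 4 * n) + L * n"
      using n(2) mN(2) L(1) \<epsilon> unfolding f_def by (intro add_mono mult_left_mono) auto
    also have "N * (\<epsilon> / 4 * n + \<epsilon> / 4 * n) = \<epsilon> / 2 * (N * n)" by simp
    also have "\<epsilon> / 2 * (N * n) \<le> \<epsilon> / 2 * m" using \<epsilon> mN(1) by (intro mult_left_mono) auto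
    also have "L * n \<le> \<epsilon> / 2 * m"
    proof -
      have "2 * (L * n) / \<epsilon> \<le> m" using M0 m by linarith
      then show ?thesis using \<epsilon> by (simp add: field_simps)
    qed
    finally show "norm (vd (F m) x) \<le> \<epsilon> * m" by simp
  qed
qed

text \<open>At scale 1 / m one factor has norm at most 1 + C / m, so m factors stay below exp C.
  This is the natural growth m ^ k of the k-th derivative and holds for any degree.\<close>

lemma cn_F_bounded:
  obtains B where "1 \<le> B" "\<And>m x. 1 \<le> m \<Longrightarrow> cn r (1 / real m) (F m) x \<le> B"
proof -
  have "\<exists>C\<ge>0. \<forall>x. \<forall>m\<ge>1. cn r (1 / real m) Q x \<le> 1 + C / m" for r
  proof (induction r)
    case 0
    then show ?case using Q_norm by (intro exI[of _ 0]) auto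
  next
    case (Suc r)
    then obtain C where C: "0 \<le> C" "\<And>x m. 1 \<le> m \<Longrightarrow> cn r (1 / real m) Q x \<le> 1 + C / m" by blast
    have "\<exists>D\<ge>0. \<forall>x. cn r 1 (vd Q) x \<le> D"
    proof -
      have "\<exists>D. 0 \<le> D \<and> (\<forall>x. norm (nth_derivative k (vd Q) x) \<le> D)" for k
        using nth_derivative_F_bounded[of "Suc k" 1] unfolding F_1 nth_derivative_Suc by metis
      then obtain D where D: "\<And>k. 0 \<le> D k" "\<And>k x. norm (nth_derivative k (vd Q) x) \<le> D k" by metis
      have "cn r 1 (vd Q) x \<le> 2 ^ r * (\<Sum>k\<le>r. D k)" for x
      proof (rule cn_le_nth_derivative)
        fix k assume "k \<le> r"
        then have "D k \<le> (\<Sum>k\<le>r. D k)" using D(1) by (intro member_le_sum) auto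
        then show "1 ^ k * norm (nth_derivative k (vd Q) x) \<le> (\<Sum>k\<le>r. D k)" using D(2)[of k x] by simp
      qed simp
      moreover have "0 \<le> 2 ^ r * (\<Sum>k\<le>r. D k)" using D(1) by (simp add: sum_nonneg)
      ultimately show ?thesis by blast
    qed
    then obtain D where D: "0 \<le> D" "\<And>x. cn r 1 (vd Q) x \<le> D" by blast
    have "cn (Suc r) (1 / real m) Q x \<le> 1 + (C + D) / m" if "1 \<le> m" for x m
    proof -
      have "cn r (1 / real m) (vd Q) x \<le> D"
        using that order_trans[OF cn_mono_scale[of "1 / real m" 1 r "vd Q" x] D(2)] by simp
      then have "1 / real m * cn r (1 / real m) (vd Q) x \<le> 1 / real m * D" by (intro mult_left_mono) auto
      then show ?thesis using C(2)[OF that, of x] by (simp add: add_divide_distrib)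
    qed
    then show ?case using C(1) D(1) by (intro exI[of _ "C + D"]) auto
  qed
  then obtain C where C: "0 \<le> C" "\<And>x m. 1 \<le> m \<Longrightarrow> cn r (1 / real m) Q x \<le> 1 + C / m" by blast
  have it: "cn r (1 / real m) (F k) x \<le> (1 + C / m) ^ k" if "1 \<le> m" for m k x
  proof (induction k)
    case 0
    then show ?case by (simp add: qiter.simps(1)[abs_def])
  next
    case (Suc k)
    have "cn r (1 / real m) (F (Suc k)) x \<le> cn r (1 / real m) (\<lambda>x. Q (x + real k * \<alpha>)) x * cn r (1 / real m) (F k) x"
      unfolding qiter.simps(2)[abs_def] by (intro cn_mult smooth_shift[OF Q_smooth] smooth_F) simp
    also have "\<dots> \<le> (1 + C / m) * (1 + C / m) ^ k"
      unfolding cn_shift[OF Q_smooth] using C(1) by (intro mult_mono C(2)[OF that] Suc) auto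
    finally show ?case by (simp del: qiter.simps(2))
  qed
  show thesis
  proof (rule that[of "exp C"])
    fix m x assume m: "1 \<le> (m::nat)"
    have "(1 + C / m) ^ m \<le> exp (C / m) ^ m" using C(1) by (intro power_mono) (auto simp: exp_ge_add_one_self add.commute)
    also have "\<dots> = exp C" using m by (simp flip: exp_of_nat_mult)
    finally show "cn r (1 / real m) (F m) x \<le> exp C" using it[OF m, of m x] by linarith
  qed (use C(1) in simp)
qed

text \<open>Landau's interpolation between \<open>f\<close> and \<open>f''\<close> transfers the smallness of the first
  derivative to all others.\<close>

lemma nth_derivative_F_sublinear:
  fixes \<epsilon> :: real
  assumes deg: "degree_zero \<alpha> A" and \<epsilon>: "0 < \<epsilon>"
  shows "\<exists>M. \<forall>m\<ge>M. \<forall>x. norm (nth_derivative (Suc k) (F m) x) \<le> \<epsilon> * real m ^ Suc k"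
  using \<epsilon>
proof (induction k arbitrary: \<epsilon>)
  case 0
  then show ?case using vd_F_sublinear[OF deg 0] by (metis nth_derivative_Suc nth_derivative_0 power_one_right One_nat_def)
next
  case (Suc k)
  obtain B where B: "1 \<le> B" "\<And>m x. 1 \<le> m \<Longrightarrow> cn (k + 3) (1 / real m) (F m) x \<le> B" using cn_F_bounded by blast
  \<comment> \<open>\<delta> / m is the step of the difference quotient. The Taylor remainder then
    contributes \<delta> B = \<epsilon> / 2, and the tolerance \<epsilon> \<delta> / 4 at both ends
    contributes the other half.\<close>
  define \<delta> where "\<delta> = \<epsilon> / (2 * B)"
  have \<delta>: "0 < \<delta>" "\<delta> * B = \<epsilon> / 2" using Suc.prems B by (auto simp: \<delta>_def)
  obtain M where M: "\<And>m x. M \<le> m \<Longrightarrow> norm (nth_derivative (Suc k) (F m) x) \<le> \<epsilon> * \<delta> / 4 * real m ^ Suc k"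
    using Suc.IH[of "\<epsilon> * \<delta> / 4"] \<delta>(1) Suc.prems by auto
  have "norm (nth_derivative (Suc (Suc k)) (F m) x) \<le> \<epsilon> * real m ^ Suc (Suc k)" if m: "max 1 M \<le> m" for m x
  proof -
    define u where "u = nth_derivative (Suc k) (F m)"
    define X where "X = real m ^ Suc k"
    have m1: "1 \<le> m" using m by simp
    have su: "smooth u" unfolding u_def by (intro smooth_nth_derivative smooth_F)
    have "norm (vd (vd u) y) \<le> B * real m ^ (k + 3)" for y
    proof -
      have "vd (vd u) y = nth_derivative (k + 3) (F m) y"
        by (simp add: u_def numeral_3_eq_3 nth_derivative_Suc'[abs_def])
      moreover have "(1 / real m) ^ (k + 3) * norm (nth_derivative (k + 3) (F m) y) \<le> B"
        using nth_derivative_le_cn[of "1 / real m" "k + 3" "k + 3" "F m" y] B(2)[OF m1, of y] by simp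
      ultimately show ?thesis using m1 by (simp add: power_divide field_simps)
    qed
    then have "norm (u (x + \<delta> / m) - u x - (\<delta> / m) *\<^sub>R vd u x) \<le> (\<delta> / m)\<^sup>2 * (B * real m ^ (k + 3))"
      using cn_taylor[of 0 u 0 "B * real m ^ (k + 3)" "\<delta> / m" x] su by simp
    also have "\<dots> = (\<delta> / m) * (\<delta> * B * (m * X))"
      using m1 by (simp add: X_def power_add eval_nat_numeral field_simps)
    finally have "norm ((\<delta> / m) *\<^sub>R vd u x) \<le> (\<delta> / m) * (\<delta> * B * (m * X)) + (norm (u (x + \<delta> / m)) + norm (u x))"
      using norm_triangle_ineq4[of "u (x + \<delta> / m) - u x" "u (x + \<delta> / m) - u x - (\<delta> / m) *\<^sub>R vd u x"]
        norm_triangle_ineq4[of "u (x + \<delta> / m)" "u x"] by (simp add: norm_minus_commute)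
    also have "\<dots> \<le> (\<delta> / m) * (\<epsilon> / 2 * (m * X)) + (\<epsilon> * \<delta> / 4 * X + \<epsilon> * \<delta> / 4 * X)"
      unfolding \<delta>(2) using M[of m] m by (intro add_mono order_refl) (auto simp: u_def X_def)
    also have "\<dots> = (\<delta> / m) * (\<epsilon> * (m * X))" using m1 by (simp add: field_simps)
    finally have "(\<delta> / m) * norm (vd u x) \<le> (\<delta> / m) * (\<epsilon> * (m * X))" using \<delta>(1) m1 by simp
    then have "norm (vd u x) \<le> \<epsilon> * (m * X)" by (rule mult_left_le_imp_le) (use \<delta>(1) m1 in simp)
    then show ?thesis by (simp add: u_def X_def nth_derivative_Suc'[of "Suc k"])
  qed
  then show ?case by blast
qed

lemma cn_vd_F_small:
  fixes \<epsilon> :: real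
  assumes deg: "degree_zero \<alpha> A" and \<epsilon>: "0 < \<epsilon>"
  shows "\<exists>M\<ge>1. \<forall>m\<ge>M. \<forall>x. 1 / real m * cn r (1 / real m) (vd (F m)) x \<le> \<epsilon>"
proof -
  have e: "0 < \<epsilon> / 2 ^ r" using \<epsilon> by simp
  obtain M where M: "\<And>k m x. M k \<le> m \<Longrightarrow> norm (nth_derivative (Suc k) (F m) x) \<le> \<epsilon> / 2 ^ r * real m ^ Suc k"
    using nth_derivative_F_sublinear[OF deg e] by metis
  define N where "N = Suc (\<Sum>k\<le>r. M k)"
  have "1 / real m * cn r (1 / real m) (vd (F m)) x \<le> \<epsilon>" if m: "N \<le> m" for m x
  proof -
    have m1: "1 \<le> m" using m by (simp add: N_def)
    have "cn r (1 / real m) (vd (F m)) x \<le> 2 ^ r * (\<epsilon> / 2 ^ r * m)"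
    proof (rule cn_le_nth_derivative)
      fix k assume "k \<le> r"
      then have "M k \<le> (\<Sum>k\<le>r. M k)" by (intro member_le_sum) auto
      then have "M k \<le> m" using m by (simp add: N_def)
      from M[OF this, of x] show "(1 / real m) ^ k * norm (nth_derivative k (vd (F m)) x) \<le> \<epsilon> / 2 ^ r * m"
        using m1 by (simp add: nth_derivative_Suc power_divide field_simps)
    qed simp
    then show ?thesis using m1 by (simp add: field_simps)
  qed
  then show ?thesis by (intro exI[of _ N]) (simp add: N_def)
qed

text \<open>By \<open>conv_beta_le\<close> the scale \<open>b n\<close> is at most 1 / m for the
  return time m of the next step, so the bounds at scale 1 / m apply. For odd n the iterate is an
  inverse, that is, a conjugate quaternion at a shifted point, with the same norms.\<close>

lemma cn_vd_G_small:
  fixes \<epsilon> :: real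
  assumes deg: "degree_zero \<alpha> A" and \<epsilon>: "0 < \<epsilon>"
  shows "\<forall>\<^sub>F n in sequentially. \<forall>x. b n * cn r (b n) (vd (G (Suc n))) x \<le> \<epsilon>
    \<and> b (Suc n) * cn r (b (Suc n)) (vd (G (Suc n))) x \<le> \<epsilon>"
proof -
  obtain M where M: "1 \<le> M" "\<And>m x. M \<le> m \<Longrightarrow> 1 / real m * cn r (1 / real m) (vd (F m)) x \<le> \<epsilon>"
    using cn_vd_F_small[OF deg \<epsilon>] by blast
  have "b n * cn r (b n) (vd (G (Suc n))) x \<le> \<epsilon> \<and> b (Suc n) * cn r (b (Suc n)) (vd (G (Suc n))) x \<le> \<epsilon>" if n: "M \<le> n" for n x
  proof -
    define m where "m = nat (q (Suc n))"
    have m: "int m = q (Suc n)" "M \<le> m" using conv_den_ge[of n] n by (auto simp: m_def)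
    have m1: "1 \<le> m" using m M by simp
    have bm: "b n \<le> 1 / real m"
      using conv_beta_le[of n] m1 m(1)[symmetric] by (simp add: field_simps)
    have cG: "cn r t (vd (G (Suc n))) x = cn r t (vd (lift_iter (rtime (Suc n)))) x" for t x
    proof -
      have "(\<forall>x\<in>UNIV. G (Suc n) x = lift_iter (rtime (Suc n)) x) \<or> (\<forall>x\<in>UNIV. G (Suc n) x = - lift_iter (rtime (Suc n)) x)"
        by (rule rot_lift_unique) (auto intro!: smooth_continuous smooth_G smooth_lift_iter simp: norm_G norm_lift_iter rot_G rot_lift_iter)
      then have "G (Suc n) = lift_iter (rtime (Suc n)) \<or> G (Suc n) = (\<lambda>x. - lift_iter (rtime (Suc n)) x)" by auto
      then show ?thesis
        by (elim disjE) (simp_all add: vd_minus[OF smooth_lift_iter] cn_minus[OF smooth_vd[OF smooth_lift_iter]] del: G.simps)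
    qed
    have cL: "\<exists>y. cn r t (vd (lift_iter (rtime (Suc n)))) x = cn r t (vd (F m)) y" for t x
    proof (cases "even n")
      case True
      then have "lift_iter (rtime (Suc n)) = F m" by (simp add: lift_iter_def fun_eq_iff m(1)[symmetric])
      then show ?thesis by auto
    next
      case False
      define d where "d = - (real m * \<alpha>)"
      have "lift_iter (rtime (Suc n)) = (\<lambda>x. qcnj (F m (x + d)))"
        using False m1 by (simp add: d_def lift_iter_def fun_eq_iff m(1)[symmetric] inverse_unit[OF norm_F])
      then have "vd (lift_iter (rtime (Suc n))) = (\<lambda>x. qcnj (vd (F m) (x + d)))"
        by (simp only: vd_linear[OF bounded_linear_qcnj smooth_shift[OF smooth_F]] fun_cong[OF vd_shift[OF smooth_F]])
      then show ?thesis
        using cn_isometry[OF bounded_linear_qcnj _ smooth_shift[OF smooth_vd[OF smooth_F]]] cn_shift[OF smooth_vd[OF smooth_F]]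
        by (metis (no_types, lifting) norm_units(4))
    qed
    have "t * cn r t (vd (G (Suc n))) x \<le> \<epsilon>" if t: "0 \<le> t" "t \<le> 1 / real m" for t
    proof -
      obtain y where "cn r t (vd (G (Suc n))) x = cn r t (vd (F m)) y" using cG cL by metis
      also have "\<dots> \<le> cn r (1 / real m) (vd (F m)) y" using t by (rule cn_mono_scale)
      finally have "t * cn r t (vd (G (Suc n))) x \<le> 1 / real m * cn r (1 / real m) (vd (F m)) y"
        using t by (intro mult_mono) auto
      then show ?thesis using M(2)[OF m(2), of y] by linarith
    qed
    then show ?thesis using bm b_nonneg b_dec[of n] by (meson less_imp_le order_trans)
  qed
  then show ?thesis unfolding eventually_sequentially by blast
qed

lemma degree_zero_imp_flat:
  assumes deg: "degree_zero \<alpha> A"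
  shows "flat_renormalization (conv_beta \<alpha>) (partial_quotient \<alpha>) G"
proof (unfold_locales)
  fix \<epsilon> :: real and r assume \<epsilon>: "0 < \<epsilon>"
  note s = cn_vd_G_small[OF deg \<epsilon>, of r]
  from eventually_conj[OF this sequentially_offset[OF this, of 1]]
  have "\<forall>\<^sub>F n in sequentially. \<forall>x. b (n + 1) * cn r (b (n + 1)) (vd (G (n + 1))) x \<le> \<epsilon> \<and> b (n + 1) * cn r (b (n + 1)) (vd (G (Suc (n + 1)))) x \<le> \<epsilon>"
    by eventually_elim simp
  then show "\<forall>\<^sub>F n in sequentially. \<forall>x. b n * cn r (b n) (vd (G n)) x \<le> \<epsilon> \<and> b n * cn r (b n) (vd (G (Suc n))) x \<le> \<epsilon>"
    by (rule eventually_sequentially_seg[THEN iffD1])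
qed

end

section \<open>Exponentials of skew-symmetric matrices\<close>

text \<open>The matrix of the commutator with p, which is twice the cross product with the imaginary
  part of p; this explains the angles \<open>2 * norm p\<close> below.\<close>

definition skew :: "quat \<Rightarrow> real^3^3" where "skew p = conj_mat p 1 - conj_mat 1 p"

lemma bounded_linear_skew: "bounded_linear skew"
  unfolding skew_def[abs_def] linear_conv_bounded_linear[symmetric]
  by (simp add: linear_iff conj_mat_def vec_eq_iff forall_3 algebra_simps)

lemma skew_scaleR: "skew (c *\<^sub>R p) = c *\<^sub>R skew p"
  by (rule linear_scale[OF bounded_linear.linear[OF bounded_linear_skew]])

lemma skew_so3: "skew p \<in> so3"
  by (simp add: so3_def skew_def transpose_def conj_mat_def vec_eq_iff forall_3 axis_def)

lemma skew_cube:
  assumes "qRe p = 0"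
  shows "skew p ** (skew p ** skew p) = - (2 * norm p)\<^sup>2 *\<^sub>R skew p"
proof -
  have n: "(2 * norm p)\<^sup>2 = 4 * ((qIm1 p)\<^sup>2 + (qIm2 p)\<^sup>2 + (qIm3 p)\<^sup>2)"
    by (simp add: power_mult_distrib norm_quat_sq assms)
  show ?thesis
    unfolding n using assms
    by (simp add: skew_def vec_eq_iff forall_3 matrix_matrix_mult_def sum_3 conj_mat_def axis_def power2_eq_square algebra_simps)
qed

text \<open>Rodrigues' formula. By \<open>skew_cube\<close> all positive powers reduce to multiples
  of the matrix and its square, with the coefficients of the sine and cosine series.\<close>

lemma matrix_exp_skew:
  assumes p: "qRe p = 0" and \<theta>: "\<theta> = 2 * norm p" "\<theta> \<noteq> 0"
  shows "matrix_exp (skew p) = mat 1 + (sin \<theta> / \<theta>) *\<^sub>R skew p + ((1 - cos \<theta>) / \<theta>\<^sup>2) *\<^sub>R (skew p ** skew p)"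
proof -
  let ?M = "skew p"
  interpret m: bounded_bilinear "(**) :: real^3^3 \<Rightarrow> real^3^3 \<Rightarrow> real^3^3" by (rule bounded_bilinear_matrix_mult)
  have cube: "?M ** (?M ** ?M) = - \<theta>\<^sup>2 *\<^sub>R ?M" using skew_cube[OF p] by (simp add: \<theta>)
  have pow: "(1 / fact (Suc n)) *\<^sub>R matrix_power ?M (Suc n)
      = (sin_coeff (Suc n) * \<theta> ^ Suc n / \<theta>) *\<^sub>R ?M - (cos_coeff (Suc n) * \<theta> ^ Suc n / \<theta>\<^sup>2) *\<^sub>R (?M ** ?M)" for n
  proof (induction n)
    case 0
    then show ?case using \<theta>(2) by (simp add: matrix_power_def sin_coeff_def cos_coeff_def)
  next
    case (Suc n)
    have "(1 / fact (Suc (Suc n))) *\<^sub>R matrix_power ?M (Suc (Suc n)) = (1 / real (Suc (Suc n))) *\<^sub>R (?M ** ((1 / fact (Suc n)) *\<^sub>R matrix_power ?M (Suc n)))"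
      by (simp add: matrix_power_def m.scaleR_right field_simps)
    also have "\<dots> = (1 / real (Suc (Suc n))) *\<^sub>R ((sin_coeff (Suc n) * \<theta> ^ Suc n / \<theta>) *\<^sub>R (?M ** ?M) + (cos_coeff (Suc n) * \<theta> ^ Suc n) *\<^sub>R ?M)"
      unfolding Suc m.diff_right m.scaleR_right cube using \<theta>(2) by simp
    also have "\<dots> = (sin_coeff (Suc (Suc n)) * \<theta> ^ Suc (Suc n) / \<theta>) *\<^sub>R ?M - (cos_coeff (Suc (Suc n)) * \<theta> ^ Suc (Suc n) / \<theta>\<^sup>2) *\<^sub>R (?M ** ?M)"
    proof -
      have a: "- s / k * \<theta> ^ Suc (Suc n) / \<theta>\<^sup>2 = - (1 / k * (s * \<theta> ^ Suc n / \<theta>))"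
        "s / k * \<theta> ^ Suc (Suc n) / \<theta> = 1 / k * (s * \<theta> ^ Suc n)" for s k
        using \<theta>(2) by (simp_all add: power2_eq_square)
      show ?thesis unfolding sin_coeff_Suc[of "Suc n"] cos_coeff_Suc[of "Suc n"] a by (simp only: scaleR_add_right scaleR_scaleR scaleR_minus_left diff_minus_eq_add add.commute)
    qed
    finally show ?case .
  qed
  \<comment> \<open>At n = 0 the closed form for the terms is not the identity matrix but a multiple
    of the square; R corrects this one term.\<close>
  define R where "R = mat 1 + (1 / \<theta>\<^sup>2) *\<^sub>R (?M ** ?M)"
  have summand: "(1 / fact n) *\<^sub>R matrix_power ?M n
      = (if n = 0 then R else 0) + (sin_coeff n *\<^sub>R \<theta> ^ n) *\<^sub>R ((1 / \<theta>) *\<^sub>R ?M) - (cos_coeff n *\<^sub>R \<theta> ^ n) *\<^sub>R ((1 / \<theta>\<^sup>2) *\<^sub>R (?M ** ?M))" for n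
    using pow[of "n - 1"] by (cases n) (simp_all add: matrix_power_def R_def sin_coeff_def cos_coeff_def)
  have "(\<lambda>n. (1 / fact n) *\<^sub>R matrix_power ?M n) sums
      (R + sin \<theta> *\<^sub>R ((1 / \<theta>) *\<^sub>R ?M) - cos \<theta> *\<^sub>R ((1 / \<theta>\<^sup>2) *\<^sub>R (?M ** ?M)))"
    unfolding summand
    by (intro sums_add sums_diff sums_scaleR_left sin_converges cos_converges sums_single)
  then have "matrix_exp ?M = R + sin \<theta> *\<^sub>R ((1 / \<theta>) *\<^sub>R ?M) - cos \<theta> *\<^sub>R ((1 / \<theta>\<^sup>2) *\<^sub>R (?M ** ?M))"
    unfolding matrix_exp_def by (rule sums_unique[symmetric])
  then show ?thesis by (simp add: R_def diff_divide_distrib scaleR_diff_left)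
qed

lemma matrix_exp_0: "matrix_exp 0 = mat 1"
proof -
  have "matrix_power 0 n = (if n = 0 then mat 1 else 0)" for n
    by (cases n) (simp_all add: matrix_power_def)
  then have "(\<lambda>n. (1 / fact n) *\<^sub>R matrix_power 0 n) = (\<lambda>n. if n = 0 then mat 1 else 0)" by auto
  then have "(\<lambda>n. (1 / fact n) *\<^sub>R matrix_power 0 n) sums mat 1"
    using sums_single[of 0 "\<lambda>_. mat 1 :: real^3^3"] by simp
  then show ?thesis unfolding matrix_exp_def by (rule sums_unique[symmetric])
qed

text \<open>The rational form of Rodrigues' formula: v points along the axis and its norm is the
  tangent of half the rotation angle.\<close>

lemma rot_one_plus:
  assumes "qRe v = 0"
  shows "rot (1 + v) = mat 1 + (1 / (1 + (norm v)\<^sup>2)) *\<^sub>R skew v + (1 / (2 * (1 + (norm v)\<^sup>2))) *\<^sub>R (skew v ** skew v)"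
proof -
  define d where "d = 1 + (norm v)\<^sup>2"
  have d: "d = 1 + (qIm1 v)\<^sup>2 + (qIm2 v)\<^sup>2 + (qIm3 v)\<^sup>2" "0 < d"
    using norm_quat_sq[of v] assms by (simp_all add: d_def add_pos_nonneg)
  have "(norm (1 + v))\<^sup>2 = d" using norm_quat_sq[of "1 + v"] assms by (simp add: d(1))
  then have "rot (1 + v) = (1 / d) *\<^sub>R conj_mat (1 + v) (qcnj (1 + v))"
    unfolding rot_def inverse_eq_qcnj
    by (simp add: bounded_bilinear.scaleR_right[OF bounded_bilinear_conj_mat])
  moreover have "2 *\<^sub>R conj_mat (1 + v) (qcnj (1 + v)) = (2 * d) *\<^sub>R mat 1 + 2 *\<^sub>R skew v + skew v ** skew v"
    unfolding d(1) using assms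
    by (simp add: skew_def vec_eq_iff forall_3 matrix_matrix_mult_def sum_3 conj_mat_def axis_def mat_def power2_eq_square algebra_simps)
  then have "conj_mat (1 + v) (qcnj (1 + v)) = (1 / 2) *\<^sub>R ((2 * d) *\<^sub>R mat 1 + 2 *\<^sub>R skew v + skew v ** skew v)"
    by (metis scaleR_half_double scaleR_2 scaleR_add_right)
  ultimately show ?thesis using d(2) unfolding d_def[symmetric] by (simp add: scaleR_add_right)
qed

lemma smooth_on_power_series:
  fixes c :: "nat \<Rightarrow> real"
  assumes "\<And>x. \<bar>x\<bar> < 1 \<Longrightarrow> summable (\<lambda>k. c k * x ^ k)"
  shows "smooth_on {-1<..<1} (\<lambda>x. \<Sum>k. c k * x ^ k)"
proof (rule smooth_onI)
  fix n show "smooth_upto n {-1<..<1} (\<lambda>x. \<Sum>k. c k * x ^ k)"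
    using assms
  proof (induction n arbitrary: c)
    case (Suc n)
    have "summable (\<lambda>k. diffs c k * x ^ k)" if "\<bar>x\<bar> < 1" for x
      using Suc.prems that by (intro termdiff_converges[of x 1 c]) auto
    then have "smooth_upto n {-1<..<1} (\<lambda>x. \<Sum>k. diffs c k * x ^ k)" by (rule Suc.IH)
    moreover have "((\<lambda>x. \<Sum>k. c k * x ^ k) has_vector_derivative (\<Sum>k. diffs c k * x ^ k)) (at x)" if "x \<in> {-1<..<1}" for x
      unfolding has_real_derivative_iff_has_vector_derivative[symmetric]
      using Suc.prems that by (intro termdiffs_strong'[of 1]) auto
    ultimately show ?case by (intro smooth_upto_SucI) auto
  qed simp
qed

text \<open>The function \<open>arctan (sqrt s) / sqrt s\<close>, continued analytically through \<open>s = 0\<close>.\<close>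

definition arctan_sqrt :: "real \<Rightarrow> real" where
  "arctan_sqrt s = (\<Sum>k. ((-1) ^ k / real (2 * k + 1)) * s ^ k)"

lemma summable_arctan_sqrt: "\<bar>s\<bar> < 1 \<Longrightarrow> summable (\<lambda>k. ((-1) ^ k / real (2 * k + 1)) * s ^ k :: real)"
proof (rule summable_comparison_test'[of "\<lambda>k. \<bar>s\<bar> ^ k" 0])
  show "\<bar>s\<bar> < 1 \<Longrightarrow> summable (\<lambda>k. \<bar>s\<bar> ^ k)" by (rule summable_geometric) simp
  show "norm (((-1) ^ k / real (2 * k + 1)) * s ^ k) \<le> \<bar>s\<bar> ^ k" for k
    using mult_right_mono[of "1 / real (2 * k + 1)" 1 "\<bar>s\<bar> ^ k"] by (simp add: abs_mult power_abs)
qed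

lemma smooth_on_arctan_sqrt: "smooth_on {-1<..<1} arctan_sqrt"
  unfolding arctan_sqrt_def[abs_def] by (rule smooth_on_power_series[OF summable_arctan_sqrt])

lemma arctan_sqrt_square: "arctan_sqrt (t\<^sup>2) * t = arctan t" if "\<bar>t\<bar> < 1" for t
proof -
  have "\<bar>t\<^sup>2\<bar> < 1" using that by (simp add: power2_less_1_iff[symmetric] abs_square_less_1)
  then have "arctan_sqrt (t\<^sup>2) * t = (\<Sum>k. ((-1) ^ k / real (2 * k + 1)) * (t\<^sup>2) ^ k * t)"
    unfolding arctan_sqrt_def by (rule suminf_mult2[OF summable_arctan_sqrt])
  also have "\<dots> = (\<Sum>k. (-1) ^ k * (1 / real (k * 2 + 1) * t ^ (k * 2 + 1)))"
    by (intro suminf_cong) (simp add: power_mult[symmetric] mult.commute)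
  also have "\<dots> = arctan t" using that by (simp add: arctan_series)
  finally show ?thesis .
qed

text \<open>The rotation angle is 2 arctan |v|, so the exponent is (arctan |v| / |v|) v. Written
  with \<open>arctan_sqrt\<close> of the squared norm it is smooth in v, also at v = 0.\<close>

lemma rot_eq_matrix_exp:
  assumes P: "qRe P \<noteq> 0" and v: "v = inverse (qRe P) *\<^sub>R (P - qRe P *\<^sub>R 1)" "norm v < 1"
  shows "rot P = matrix_exp (skew (arctan_sqrt (inner v v) *\<^sub>R v))"
proof -
  have v0: "qRe v = 0" by (simp add: v(1))
  have "P = qRe P *\<^sub>R (1 + v)" using P by (simp add: v(1) scaleR_add_right)
  then have P1: "rot P = rot (1 + v)" using P rot_scaleR by metis
  show ?thesis
  proof (cases "v = 0")
    case True
    have "skew 0 = 0" using skew_scaleR[of 0 0] by simp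
    then show ?thesis unfolding P1 True by (simp add: matrix_exp_0)
  next
    case False
    define \<tau> c \<theta> where "\<tau> = norm v" and "c = arctan_sqrt (inner v v)" and "\<theta> = 2 * arctan \<tau>"
    have \<tau>: "0 < \<tau>" "\<tau> < 1" using False v(2) by (auto simp: \<tau>_def)
    have c: "c * \<tau> = arctan \<tau>" using arctan_sqrt_square[of \<tau>] \<tau> by (simp add: c_def dot_square_norm \<tau>_def)
    have at: "0 < arctan \<tau>" using \<tau> by simp
    have c0: "0 < c" using c at \<tau>(1) by (metis zero_less_mult_pos2)
    have \<theta>: "\<theta> = 2 * norm (c *\<^sub>R v)" "\<theta> \<noteq> 0" "\<theta> = 2 * c * \<tau>" using c c0 at by (simp_all add: \<theta>_def \<tau>_def)
    have sq: "sqrt (1 + \<tau>\<^sup>2) * sqrt (1 + \<tau>\<^sup>2) = 1 + \<tau>\<^sup>2" by simp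
    have pos: "0 < 1 + \<tau>\<^sup>2" by (simp add: add_pos_nonneg)
    have s: "sin \<theta> = 2 * \<tau> / (1 + \<tau>\<^sup>2)"
      unfolding \<theta>_def sin_double sin_arctan cos_arctan by simp
    have co: "1 - cos \<theta> = 2 * \<tau>\<^sup>2 / (1 + \<tau>\<^sup>2)"
      unfolding \<theta>_def cos_double_sin sin_arctan by (simp add: power_divide)
    have "matrix_exp (skew (c *\<^sub>R v)) = mat 1 + (sin \<theta> / \<theta> * c) *\<^sub>R skew v + ((1 - cos \<theta>) / \<theta>\<^sup>2 * c\<^sup>2) *\<^sub>R (skew v ** skew v)"
      using matrix_exp_skew[of "c *\<^sub>R v", OF _ \<theta>(1,2)] v0
      by (simp add: skew_scaleR bounded_bilinear.scaleR_left[OF bounded_bilinear_matrix_mult]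
          bounded_bilinear.scaleR_right[OF bounded_bilinear_matrix_mult] power2_eq_square)
    moreover have "sin \<theta> / \<theta> * c = 1 / (1 + \<tau>\<^sup>2)" 
    proof -
      have "2 * \<tau> / x / (2 * c * \<tau>) * c = 1 / x" if "x \<noteq> 0" for x using that c0 \<tau>(1) by (simp add: field_simps)
      then show ?thesis unfolding s by (subst \<theta>(3)) (use pos in simp)
    qed
    moreover have "(1 - cos \<theta>) / \<theta>\<^sup>2 * c\<^sup>2 = 1 / (2 * (1 + \<tau>\<^sup>2))"
    proof -
      have "2 * \<tau>\<^sup>2 / x / (2 * c * \<tau>)\<^sup>2 * c\<^sup>2 = 1 / (2 * x)" if "x \<noteq> 0" for x
        using that c0 \<tau>(1) by (simp add: power_mult_distrib field_simps)
      then show ?thesis unfolding co by (subst \<theta>(3)) (use pos in simp)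
    qed
    ultimately show ?thesis unfolding P1 rot_one_plus[OF v0] by (simp add: \<tau>_def c_def)
  qed
qed

section \<open>Almost reducibility\<close>

text \<open>A one-parameter group with \<open>turn 1\<close> inverse to qi: conjugation by it takes
  the constant first generator qi over a period to 1.\<close>

definition turn :: "real \<Rightarrow> quat" where "turn y = cos (pi / 2 * y) *\<^sub>R 1 - sin (pi / 2 * y) *\<^sub>R qi"

lemma turn_add: "turn (x + y) = turn x * turn y"
  by (simp add: turn_def quat_eq_iff distrib_left cos_add sin_add)

lemma turn_1: "turn 1 = - qi"
  by (simp add: turn_def quat_eq_iff)

lemma norm_turn: "norm (turn y) = 1"
proof -
  have "(norm (turn y))\<^sup>2 = 1" by (simp add: norm_quat_sq turn_def)
  then show ?thesis by (simp add: power2_eq_1_iff) (metis norm_ge_zero not_one_le_zero neg_0_le_iff_le)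
qed

lemma turn_nonzero: "turn y \<noteq> 0" using norm_turn[of y] by auto

lemma vd_turn: "(turn has_vector_derivative (- (pi / 2)) *\<^sub>R (qi * turn y)) (at y)"
proof -
  have "((\<lambda>y. cos (pi / 2 * y)) has_vector_derivative - sin (pi / 2 * y) * (pi / 2)) (at y)"
    "((\<lambda>y. sin (pi / 2 * y)) has_vector_derivative cos (pi / 2 * y) * (pi / 2)) (at y)"
    unfolding has_real_derivative_iff_has_vector_derivative[symmetric] by (auto intro!: derivative_eq_intros)
  then have "(turn has_vector_derivative (- sin (pi / 2 * y) * (pi / 2)) *\<^sub>R 1 - (cos (pi / 2 * y) * (pi / 2)) *\<^sub>R qi) (at y)"
    unfolding turn_def[abs_def]
    by (intro has_vector_derivative_diff bounded_linear.has_vector_derivative[OF bounded_linear_scaleR_left])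
  moreover have "(- sin (pi / 2 * y) * (pi / 2)) *\<^sub>R 1 - (cos (pi / 2 * y) * (pi / 2)) *\<^sub>R qi = (- (pi / 2)) *\<^sub>R (qi * turn y)"
    by (simp add: quat_eq_iff turn_def)
  ultimately show ?thesis by simp
qed

lemma smooth_turn: "smooth turn"
proof -
  have "smooth (\<lambda>y. cos (pi / 2 * y + 0))" "smooth (\<lambda>y. sin (pi / 2 * y + 0))"
    by (rule smooth_affine[OF smooth_cos], rule smooth_affine[OF smooth_sin])
  then show ?thesis unfolding turn_def[abs_def] by (intro smooth_diff smooth_scaleR) auto
qed

lemma cn_turn: "cn r 1 turn y = (1 + pi / 2) ^ r"
proof (induction r)
  case (Suc r)
  have "vd turn = (\<lambda>y. (- (pi / 2)) *\<^sub>R (qi * turn y))" using vd_eqI[OF vd_turn] by auto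
  then have "cn r 1 (vd turn) y = (pi / 2) * cn r 1 (\<lambda>y. qi * turn y) y"
    using cn_scaleR_const[OF smooth_mult[OF smooth_const smooth_turn], of r 1 "- (pi / 2)" qi y] by simp
  also have "cn r 1 (\<lambda>y. qi * turn y) y = cn r 1 turn y" by (rule cn_unit_mult[OF _ smooth_turn]) simp
  finally show ?case using Suc by (simp add: algebra_simps)
qed (simp add: norm_turn)

lemma inverse_turn: "inverse (turn y) = qcnj (turn y)" by (rule inverse_unit[OF norm_turn])

lemma smooth_inverse_turn: "smooth (\<lambda>y. inverse (turn y))"
  by (rule smooth_inverse[OF smooth_turn turn_nonzero])

lemma cn_inverse_turn: "cn r 1 (\<lambda>y. inverse (turn y)) y = (1 + pi / 2) ^ r"
  unfolding inverse_turn using cn_isometry[OF bounded_linear_qcnj norm_units(4) smooth_turn] cn_turn by metis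

lemma conjugate_turn_periodic:
  assumes "f (y + 1) = qi * f y * inverse qi"
  shows "turn (y + 1) * f (y + 1) * inverse (turn (y + 1)) = turn y * f y * inverse (turn y)"
proof -
  have "inverse qi = - qi" by (rule inverse_square_minus_one) (simp add: units_mult)
  moreover have "qi * (qi * z) = - z" for z by (simp add: mult.assoc[symmetric] units_mult)
  ultimately show ?thesis
    unfolding turn_add turn_1 assms
    by (simp add: nonzero_inverse_mult_distrib turn_nonzero mult.assoc)
qed

lemma rot_conjugate: "p \<noteq> 0 \<Longrightarrow> q \<noteq> 0 \<Longrightarrow> r \<noteq> 0 \<Longrightarrow> rot p ** rot q ** matrix_inv (rot r) = rot (p * q * inverse r)"
  by (simp add: rot_mult rot_inverse)

text \<open>At index m the hypothesis has order m, so it controls every fixed order k once m is at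
  least k. The 4 in the tolerance keeps the real part above 3 / 4 and the quotient v of imaginary
  and real part below 1 / 2, inside the domain of the logarithm.\<close>

lemma near_one_log:
  fixes P :: "nat \<Rightarrow> real \<Rightarrow> quat"
  assumes P: "\<And>m. smooth (P m)" "\<And>m x. P m (x + 1) = P m x"
    and near: "\<And>m x. cn m 1 (\<lambda>x. P m x - 1) x \<le> 1 / (real m + 4)"
  obtains U where "\<And>m. U m \<in> smooth_torus so3" "smooth_tendsto_zero U" "\<And>m x. rot (P m x) = matrix_exp (U m x)"
proof -
  define \<eta> where "\<eta> m = 1 / (real m + 4)" for m :: nat
  have \<eta>: "0 < \<eta> m" "\<eta> m \<le> 1 / 4" for m by (auto simp: \<eta>_def field_simps)
  define v where "v m x = inverse (qRe (P m x)) *\<^sub>R (P m x - qRe (P m x) *\<^sub>R 1)" for m x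
  have sRe: "smooth (\<lambda>x. qRe (P m x))" for m by (rule smooth_linear[OF bounded_linear_sel(1) P(1)])
  have cRe: "cn m 1 (\<lambda>x. qRe (P m x) - 1) x \<le> \<eta> m" for m x
    using cn_linear[OF bounded_linear_sel(1), of 1 1 "\<lambda>x. P m x - 1" m x] abs_sel_le_norm(1) near[of m x]
      smooth_diff[OF P(1)[of m] smooth_const[of 1]]
    by (simp add: \<eta>_def)
  have Re: "3 / 4 \<le> qRe (P m x)" for m x
    using norm_le_cn[of 1 "\<lambda>x. qRe (P m x) - 1" x m] cRe[of m x] \<eta>(2)[of m] by (simp add: abs_le_iff)
  then have Re0: "qRe (P m x) \<noteq> 0" for m x by (smt (verit) divide_pos_pos)
  have sinv: "smooth (\<lambda>x. inverse (qRe (P m x)))" for m by (rule smooth_inverse[OF sRe Re0])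
  have cinv: "cn m 1 (\<lambda>x. inverse (qRe (P m x))) x \<le> 2" for m x
  proof -
    have "cn m 1 (\<lambda>x. inverse (qRe (P m x)) - inverse 1) x \<le> \<eta> m / (1 - \<eta> m)"
      using \<eta>(2)[of m] by (intro cn_inverse_near sRe Re0 cRe) auto
    also have "\<dots> \<le> 1" using \<eta>[of m] by (simp add: field_simps)
    finally show ?thesis using cn_le_const_add[OF _ sinv[of m], where t = 1 and r = m and x = x and c = 1] by simp
  qed
  define T where "T p = p - qRe p *\<^sub>R 1" for p :: quat
  have T: "bounded_linear T" "norm (T p) \<le> 1 * norm p" for p
  proof -
    show "bounded_linear T" unfolding linear_conv_bounded_linear[symmetric] T_def[abs_def] by (simp add: linear_iff quat_eq_iff algebra_simps)
    have "(norm (T p))\<^sup>2 \<le> (norm p)\<^sup>2" by (simp add: norm_quat_sq T_def)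
    then show "norm (T p) \<le> 1 * norm p" using power2_le_imp_le by fastforce
  qed
  have TP: "P m x - qRe (P m x) *\<^sub>R 1 = T (P m x - 1)" for m x by (simp add: T_def quat_eq_iff)
  have sT: "smooth (\<lambda>x. T (P m x - 1))" for m by (rule smooth_linear[OF T(1) smooth_diff[OF P(1) smooth_const]])
  have cT: "cn m 1 (\<lambda>x. T (P m x - 1)) x \<le> \<eta> m" for m x
    using cn_linear[OF T, of 1 "\<lambda>x. P m x - 1" m x] near[of m x] smooth_diff[OF P(1)[of m] smooth_const[of 1]] by (simp add: \<eta>_def)
  have sv: "smooth (v m)" for m unfolding v_def[abs_def] TP by (rule smooth_scaleR[OF sinv sT])
  have cv: "cn m 1 (v m) x \<le> 2 * \<eta> m" for m x
  proof -
    have "cn m 1 (v m) x \<le> cn m 1 (\<lambda>x. inverse (qRe (P m x))) x * cn m 1 (\<lambda>x. T (P m x - 1)) x"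
      unfolding v_def[abs_def] TP by (rule cn_scaleR[OF _ sinv sT]) simp
    also have "\<dots> \<le> 2 * \<eta> m" by (intro mult_mono cinv cT) auto
    finally show ?thesis .
  qed
  have nv: "norm (v m x) \<le> 1 / 2" for m x
    using norm_le_cn[of 1 "v m" x m] cv[of m x] \<eta>(2)[of m] by simp
  have ss: "smooth (\<lambda>x. inner (v m x) (v m x))" for m by (rule smooth_bilinear[OF bounded_bilinear_inner sv sv])
  have sr: "inner (v m x) (v m x) \<in> {0..1/2}" for m x
    using power_mono[OF nv[of m x], of 2] by (simp add: dot_square_norm power2_eq_square)
  have si: "inner (v m x) (v m x) \<in> {-1<..<1}" for m x
    using sr[of m x] by simp (use inner_ge_zero[of "v m x"] in linarith)
  have sW: "smooth (\<lambda>x. arctan_sqrt (inner (v m x) (v m x)))" for m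
    by (rule smooth_compose[OF smooth_on_arctan_sqrt _ ss]) (use si in auto)
  define U where "U m x = skew (arctan_sqrt (inner (v m x) (v m x)) *\<^sub>R v m x)" for m x
  have sU: "smooth (U m)" for m unfolding U_def[abs_def] by (rule smooth_linear[OF bounded_linear_skew smooth_scaleR[OF sW sv]])
  obtain Ks where Ks: "0 < Ks" "\<And>p. norm (skew p) \<le> Ks * norm p"
    using bounded_linear.pos_bounded[OF bounded_linear_skew] by (metis mult.commute)
  have small: "\<exists>C\<ge>0. \<forall>m\<ge>k. \<forall>x. cn k 1 (U m) x \<le> C * \<eta> m" for k
  proof -
    have T: "open {-1<..<1::real}" "{0..1/2} \<subseteq> {-1<..<1::real}" "(0::real) \<in> {0..1/2}" by auto
    obtain K where K: "0 \<le> K" "\<And>f t x. \<lbrakk>smooth f; range f \<subseteq> {0..1/2}; 0 \<le> t; cn k t (\<lambda>x. f x - 0) x \<le> 1\<rbrakk>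
        \<Longrightarrow> cn k t (\<lambda>x. arctan_sqrt (f x) - arctan_sqrt 0) x \<le> K * cn k t (\<lambda>x. f x - 0) x"
      using cn_compose[OF T smooth_on_arctan_sqrt, of k 1] by blast
    have "cn k 1 (U m) x \<le> (Ks * (\<bar>arctan_sqrt 0\<bar> + K) * 2) * \<eta> m" if m: "k \<le> m" for m x
    proof -
      have cvk: "cn k 1 (v m) x \<le> 2 * \<eta> m" using cn_mono[OF _ m, of 1 "v m" x] cv[of m x] by simp
      have "cn k 1 (\<lambda>x. inner (v m x) (v m x)) x \<le> cn k 1 (v m) x * cn k 1 (v m) x"
        by (rule cn_bilinear[OF bounded_bilinear_inner _ _ sv sv]) (simp_all add: Cauchy_Schwarz_ineq2)
      also have "\<dots> \<le> 1 * 1" using cvk \<eta>(2)[of m] by (intro mult_mono) auto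
      finally have c1: "cn k 1 (\<lambda>x. inner (v m x) (v m x) - 0) x \<le> 1" by simp
      have "cn k 1 (\<lambda>x. arctan_sqrt (inner (v m x) (v m x)) - arctan_sqrt 0) x \<le> K * cn k 1 (\<lambda>x. inner (v m x) (v m x) - 0) x"
        using sr by (intro K(2)[OF ss _ _ c1]) auto
      also have "\<dots> \<le> K * 1" using c1 K(1) by (intro mult_left_mono)
      finally have c2: "cn k 1 (\<lambda>x. arctan_sqrt (inner (v m x) (v m x))) x \<le> \<bar>arctan_sqrt 0\<bar> + K"
        using cn_le_const_add[OF _ sW[of m], where t = 1 and r = k and x = x and c = "arctan_sqrt 0"] by simp
      have "cn k 1 (U m) x \<le> Ks * cn k 1 (\<lambda>x. arctan_sqrt (inner (v m x) (v m x)) *\<^sub>R v m x) x"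
        unfolding U_def[abs_def] by (rule cn_linear[OF bounded_linear_skew Ks(2) _ smooth_scaleR[OF sW sv]]) simp
      also have "\<dots> \<le> Ks * (cn k 1 (\<lambda>x. arctan_sqrt (inner (v m x) (v m x))) x * cn k 1 (v m) x)"
        using Ks(1) by (intro mult_left_mono cn_scaleR sW sv) auto
      also have "\<dots> \<le> Ks * ((\<bar>arctan_sqrt 0\<bar> + K) * (2 * \<eta> m))"
        using Ks(1) K(1) by (intro mult_left_mono mult_mono c2 cvk) auto
      finally show ?thesis by simp
    qed
    then show ?thesis using Ks(1) K(1) by (intro exI[of _ "Ks * (\<bar>arctan_sqrt 0\<bar> + K) * 2"]) auto
  qed
  show thesis
  proof (rule that[of U])
    show "U m \<in> smooth_torus so3" for m
      using sU skew_so3 P(2) by (auto simp: smooth_torus_def periodic1_def U_def v_def)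
    show "rot (P m x) = matrix_exp (U m x)" for m x
      unfolding U_def by (rule rot_eq_matrix_exp[OF Re0]) (use nv[of m x] in \<open>simp_all add: v_def\<close>)
    show "smooth_tendsto_zero U"
      unfolding smooth_tendsto_zero_def
    proof (intro allI uniform_limitI)
      fix k and e :: real assume e: "0 < e"
      obtain C where C: "0 \<le> C" "\<And>m x. k \<le> m \<Longrightarrow> cn k 1 (U m) x \<le> C * \<eta> m" using small by blast
      obtain M :: nat where M: "C / e < M" using reals_Archimedean2 by blast
      have "dist (nth_derivative k (U m) x) 0 < e" if m: "max k M \<le> m" for m x
      proof -
        have "norm (nth_derivative k (U m) x) \<le> cn k 1 (U m) x" using nth_derivative_le_cn[of 1 k k "U m" x] by simp
        also have "\<dots> \<le> C * \<eta> m" using C(2) m by simp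
        also have "\<dots> < e"
        proof -
          have "C < e * M" using M e by (simp add: field_simps)
          also have "e * M \<le> e * (real m + 4)" using m e by (intro mult_left_mono) auto
          finally show ?thesis by (simp add: \<eta>_def field_simps)
        qed
        finally show ?thesis by simp
      qed
      then show "\<forall>\<^sub>F m in sequentially. \<forall>x\<in>UNIV. dist (nth_derivative k (U m) x) 0 < e"
        unfolding eventually_sequentially by blast
    qed
  qed
qed

context lifted_cocycle
begin

lemma renorm_C_eq: "renorm_C \<alpha> A n y = rot (G n (b n * y))"
  unfolding renorm_C_def rot_G ..

lemma renorm_A_eq: "renorm_A \<alpha> A n y = rot (G (Suc n) (b n * y))"
  unfolding renorm_A_def rot_G by simp

text \<open>A gauge \<open>g0\<close> of moderate quality fixes the representative; better and
  better gauges \<open>g m\<close> at the same step provide the conjugations as quotients by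
  \<open>g0\<close>. All gauges send the first generator to the same qi, so the quotients commute
  with it up to the shift and become periodic after conjugation by \<open>turn\<close>.\<close>

lemma representative_almost_reducible:
  assumes deg: "degree_zero \<alpha> A"
  shows "\<exists>N. renorm_representative \<alpha> A n N \<and>
    almost_reducible (2 * gauss_iter \<alpha> n) (\<lambda>x. N (x + gauss_iter \<alpha> n) ** N x)"
proof -
  interpret flat_renormalization "conv_beta \<alpha>" "partial_quotient \<alpha>" G by (rule degree_zero_imp_flat[OF deg])
  define t s where "t = b n" and "s = gauss_iter \<alpha> n"
  have t: "0 \<le> t" "b (Suc n) = t * s" using b_nonneg conv_beta_Suc[of n] by (simp_all add: t_def s_def mult.commute)
  have ts: "t * (y + s) = t * y + b (Suc n)" "t * (y + 2 * s) = t * y + b (Suc n) + b (Suc n)" for y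
    by (simp_all add: t(2) algebra_simps)
  obtain g0 where g0: "gauge n 0 1 g0" using gauges_exist[of 1] by auto
  define \<kappa> where "\<kappa> = 1 + pi / 2"
  have \<kappa>: "1 \<le> \<kappa>" by (simp add: \<kappa>_def)
  \<comment> \<open>The powers of \<kappa> are the norms of \<open>turn\<close> and its inverse at
    order m, and 3 comes from squaring an element within \<delta> of qj. The result is the tolerance
    demanded by \<open>near_one_log\<close>.\<close>
  define \<delta> where "\<delta> m = 1 / (3 * (\<kappa> ^ m * \<kappa> ^ m) * (real m + 4))" for m
  have \<kappa>m: "1 \<le> \<kappa> ^ m * \<kappa> ^ m" for m using \<kappa> mult_mono[of 1 "\<kappa> ^ m" 1 "\<kappa> ^ m"] by (simp add: one_le_power)
  have \<delta>: "0 < \<delta> m" "\<delta> m \<le> 1" "\<kappa> ^ m * (3 * \<delta> m) * \<kappa> ^ m = 1 / (real m + 4)" for m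
  proof -
    show "0 < \<delta> m" using \<kappa>m[of m] by (simp add: \<delta>_def)
    have "1 * 1 \<le> 3 * (\<kappa> ^ m * \<kappa> ^ m) * (real m + 4)" using \<kappa>m[of m] by (intro mult_mono) auto
    then show "\<delta> m \<le> 1" by (simp add: \<delta>_def divide_le_eq_1)
    show "\<kappa> ^ m * (3 * \<delta> m) * \<kappa> ^ m = 1 / (real m + 4)" using \<kappa> by (simp add: \<delta>_def)
  qed
  have "\<forall>m. \<exists>g. gauge n m (\<delta> m) g" using gauges_exist \<delta>(1) by blast
  from choice[OF this] obtain g where g: "\<And>m. gauge n m (\<delta> m) (g m)" by blast
  note nz = gaugeD(2)[OF g0] gaugeD(2)[OF g] turn_nonzero G_nonzero
  note sm = gaugeD(1)[OF g0] gaugeD(1)[OF g]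
  have sc: "smooth (\<lambda>y. f (t * y))" if "smooth f" for f :: "real \<Rightarrow> quat"
    using smooth_affine[OF that, of t 0] by simp
  have qi: "inverse qi = - qi" "qi * (qi * z) = - z" for z
    by (rule inverse_square_minus_one, simp_all add: units_mult mult.assoc[symmetric])
  have gi: "h (t * (y + 1)) * G n (t * y) * inverse (h (t * y)) = qi" if "gauge n r e h" for h r e y
    using gaugeD(3)[OF that, of "t * y"] by (simp add: tw_def t_def distrib_left)
  have gs: "h (t * y + b (Suc n)) * G (Suc n) (t * y) = tw h (Suc n) (t * y) * h (t * y)" if "gauge n r e h" for h r e y
    using gaugeD(2)[OF that] by (simp add: tw_def mult.assoc)

  define B where "B y = rot (turn y * g0 (t * y))" for y
  have B: "normalizing_conjugation \<alpha> A n B"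
    unfolding normalizing_conjugation_def smooth_line_def
  proof (intro conjI allI CollectI)
    show "smooth B" unfolding B_def[abs_def] by (rule smooth_rot[OF smooth_mult[OF smooth_turn sc[OF sm(1)]]]) (simp add: nz)
    show "range B \<subseteq> SO3" using rot_SO3 nz by (auto simp: B_def)
    fix y
    have "B (y + 1) ** renorm_C \<alpha> A n y ** matrix_inv (B y)
        = rot (turn y * - qi * (g0 (t * (y + 1)) * G n (t * y) * inverse (g0 (t * y))) * inverse (turn y))"
      using nz by (simp add: B_def renorm_C_eq t_def rot_conjugate turn_add turn_1 nonzero_inverse_mult_distrib mult.assoc)
    also have "\<dots> = mat 1" unfolding gi[OF g0] using nz by (simp add: mult.assoc qi)
    finally show "B (y + 1) ** renorm_C \<alpha> A n y ** matrix_inv (B y) = mat 1" .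
  qed
  define Nq where "Nq y = turn (y + s) * tw g0 (Suc n) (t * y) * inverse (turn y)" for y
  have Nq0: "Nq y \<noteq> 0" for y using nz tw_nonzero[of g0] by (simp add: Nq_def)
  have N: "B (y + s) ** renorm_A \<alpha> A n y ** matrix_inv (B y) = rot (Nq y)" for y
    using nz by (simp add: B_def renorm_A_eq t_def[symmetric] rot_conjugate ts Nq_def tw_def nonzero_inverse_mult_distrib mult.assoc)

  define W where "W m x = tw (g m) (Suc n) (x + b (Suc n)) * tw (g m) (Suc n) x" for m x
  define P where "P m y = - (turn y * W m (t * y) * inverse (turn y))" for m y
  define Dq where "Dq m y = turn y * (g m (t * y) * inverse (g0 (t * y))) * inverse (turn y)" for m y
  have sW: "smooth (W m)" for m
    unfolding W_def[abs_def] by (rule smooth_mult[OF smooth_shift[OF smooth_tw] smooth_tw]) (simp_all add: sm nz)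
  have sP: "smooth (P m)" for m
    unfolding P_def[abs_def] by (rule smooth_minus[OF smooth_mult[OF smooth_mult[OF smooth_turn sc[OF sW]] smooth_inverse_turn]])
  have W_shift: "W m (t * (y + 1)) = qi * W m (t * y) * inverse qi" for m y
  proof -
    have F: "tw (g m) (Suc n) (x + t) = qi * tw (g m) (Suc n) x * qi" for x
      unfolding t_def by (rule tw_Suc_shift[of "g m", OF nz(2) gaugeD(3)[OF g]]) (simp add: units_mult)
    have "W m (t * (y + 1)) = tw (g m) (Suc n) ((t * y + b (Suc n)) + t) * tw (g m) (Suc n) (t * y + t)"
      by (simp add: W_def algebra_simps)
    then show ?thesis unfolding F by (simp add: W_def mult.assoc qi)
  qed
  have P_periodic: "P m (y + 1) = P m y" for m y
    unfolding P_def using conjugate_turn_periodic[of "\<lambda>y. W m (t * y)", OF W_shift] by simp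
  have P_near: "cn m 1 (\<lambda>y. P m y - 1) y \<le> 1 / (real m + 4)" for m y
  proof -
    have W1: "cn m 1 (\<lambda>y. W m (t * y) + 1) z \<le> 3 * \<delta> m" for z
    proof -
      have *: "cn m 1 (\<lambda>y. tw (g m) (Suc n) (t * y + d) - qj) z \<le> \<delta> m" for d
      proof -
        have "cn m 1 (\<lambda>y. tw (g m) (Suc n) (t * y + d) - qj) z = cn m (t * 1) (\<lambda>x. tw (g m) (Suc n) x - qj) (t * z + d)"
          by (rule cn_affine[OF smooth_diff[OF smooth_tw smooth_const] t(1)]) (simp_all add: sm nz)
        then show ?thesis using gaugeD(4)[OF g, of m "t * z + d"] by (simp add: t_def)
      qed
      have sF: "smooth (\<lambda>y. tw (g m) (Suc n) (t * y + d))" for d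
        by (rule smooth_affine[OF smooth_tw]) (simp_all add: sm nz)
      have "1 + cn m 1 (\<lambda>y. tw (g m) (Suc n) (t * y + b (Suc n)) * tw (g m) (Suc n) (t * y + 0) - qj * qj) z
        \<le> (1 + cn m 1 (\<lambda>y. tw (g m) (Suc n) (t * y + b (Suc n)) - qj) z) * (1 + cn m 1 (\<lambda>y. tw (g m) (Suc n) (t * y + 0) - qj) z)"
        by (rule cn_mult_near[OF _ sF sF]) simp_all
      also have "\<dots> \<le> (1 + \<delta> m) * (1 + \<delta> m)" using \<delta>(1)[of m] by (intro mult_mono add_left_mono *) auto
      also have "\<dots> \<le> 1 + 3 * \<delta> m" using \<delta>(1,2)[of m] mult_left_mono[of "\<delta> m" 1 "\<delta> m"] by (simp add: algebra_simps)
      finally show ?thesis by (simp add: W_def units_mult)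
    qed
    have s1: "smooth (\<lambda>y. W m (t * y) + 1)" by (rule smooth_add[OF sc[OF sW] smooth_const])
    have "P m z - 1 = - (turn z * (W m (t * z) + 1) * inverse (turn z))" for z
      using nz by (simp add: P_def algebra_simps)
    then have "cn m 1 (\<lambda>y. P m y - 1) y = cn m 1 (\<lambda>y. turn y * (W m (t * y) + 1) * inverse (turn y)) y"
      using cn_minus[OF smooth_mult[OF smooth_mult[OF smooth_turn s1] smooth_inverse_turn], of m 1 y] by simp
    also have "\<dots> \<le> cn m 1 (\<lambda>y. turn y * (W m (t * y) + 1)) y * cn m 1 (\<lambda>y. inverse (turn y)) y"
      by (rule cn_mult[OF _ smooth_mult[OF smooth_turn s1] smooth_inverse_turn]) simp
    also have "\<dots> \<le> (cn m 1 turn y * cn m 1 (\<lambda>y. W m (t * y) + 1) y) * cn m 1 (\<lambda>y. inverse (turn y)) y"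
      by (intro mult_right_mono cn_mult smooth_turn s1) auto
    also have "\<dots> \<le> (\<kappa> ^ m * (3 * \<delta> m)) * \<kappa> ^ m"
      unfolding cn_turn cn_inverse_turn \<kappa>_def[symmetric] using \<kappa> by (intro mult_right_mono mult_left_mono W1) auto
    finally show ?thesis unfolding \<delta>(3) .
  qed
  obtain U where U: "\<And>m. U m \<in> smooth_torus so3" "smooth_tendsto_zero U" "\<And>m x. rot (P m x) = matrix_exp (U m x)"
    by (rule near_one_log[of P, OF sP P_periodic P_near]) (rule that)
  have Dq0: "Dq m y \<noteq> 0" for m y using nz by (simp add: Dq_def)
  have D: "(\<lambda>y. rot (Dq m y)) \<in> smooth_torus SO3" for m
    unfolding smooth_torus_def periodic1_def
  proof (intro conjI allI CollectI)
    have "smooth (Dq m)"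
      unfolding Dq_def[abs_def]
      by (rule smooth_mult[OF smooth_mult[OF smooth_turn smooth_mult[OF sc[OF sm(2)] smooth_inverse[OF sc[OF sm(1)] nz(1)]]] smooth_inverse_turn])
    then show "smooth (\<lambda>y. rot (Dq m y))" by (rule smooth_rot[OF _ Dq0])
    show "range (\<lambda>y. rot (Dq m y)) \<subseteq> SO3" using rot_SO3 Dq0 by auto
    fix y
    have "g m (t * (y + 1)) * inverse (g0 (t * (y + 1))) = qi * (g m (t * y) * inverse (g0 (t * y))) * inverse qi"
    proof -
      have h: "h (t * (y + 1)) = qi * h (t * y) * inverse (G n (t * y))" if "gauge n r e h" for h r e
      proof -
        have "qi * h (t * y) * inverse (G n (t * y)) = h (t * (y + 1)) * (G n (t * y) * (inverse (h (t * y)) * h (t * y)) * inverse (G n (t * y)))"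
          unfolding gi[OF that, of y, symmetric] by (simp only: mult.assoc)
        then show ?thesis using gaugeD(2)[OF that] G_nonzero by simp
      qed
      have c: "inverse (G n z) * (G n z * w) = w" for z w using G_nonzero by (simp add: mult.assoc[symmetric])
      show ?thesis unfolding h[OF g] h[OF g0] using nz by (simp add: nonzero_inverse_mult_distrib mult.assoc c)
    qed
    then show "rot (Dq m (y + 1)) = rot (Dq m y)"
      unfolding Dq_def using conjugate_turn_periodic[of "\<lambda>y. g m (t * y) * inverse (g0 (t * y))"] by simp
  qed
  have main: "rot (Dq m (y + 2 * s)) ** (rot (Nq (y + s)) ** rot (Nq y)) ** matrix_inv (rot (Dq m y)) = rot (turn (2 * s)) ** matrix_exp (U m y)" for m y
  proof -
    have c: "inverse (turn z) * (turn z * w) = w" for z w using turn_nonzero by (simp add: mult.assoc[symmetric])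
    have c0: "inverse (g0 z) * (g0 z * w) = w" for z w using nz by (simp add: mult.assoc[symmetric])
    have cG: "g m (x + b (Suc n)) * G (Suc n) x = tw (g m) (Suc n) x * g m x" for x
      using nz by (simp add: tw_def mult.assoc)
    have y2: "y + s + s = y + 2 * s" by simp
    have "Dq m (y + 2 * s) * (Nq (y + s) * Nq y) * inverse (Dq m y)
        = turn (y + 2 * s) * (g m (t * y + b (Suc n) + b (Suc n)) * (G (Suc n) (t * y + b (Suc n)) * (G (Suc n) (t * y) * inverse (g m (t * y))))) * inverse (turn y)"
      unfolding Dq_def Nq_def tw_def ts y2 using nz by (simp add: nonzero_inverse_mult_distrib mult.assoc c c0)
    also have "g m (t * y + b (Suc n) + b (Suc n)) * (G (Suc n) (t * y + b (Suc n)) * (G (Suc n) (t * y) * inverse (g m (t * y)))) = W m (t * y)"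
      unfolding W_def tw_def using nz by (simp add: mult.assoc) (simp add: mult.assoc[symmetric])
    \<comment> \<open>The conjugation by \<open>turn\<close> is evaluated at shifted arguments,
      which leaves the constant factor \<open>turn (2 * s)\<close>; its rotation is the constant
      part, the same for all m.\<close>
    also have "turn (y + 2 * s) = turn (2 * s) * turn y" by (simp add: turn_add[symmetric] add.commute)
    finally have "Dq m (y + 2 * s) * (Nq (y + s) * Nq y) * inverse (Dq m y) = - (turn (2 * s) * P m y)"
      by (simp add: P_def mult.assoc)
    moreover have "P m y \<noteq> 0"
      using nz tw_nonzero[of "g m"] by (simp add: P_def W_def)
    moreover have "rot (Dq m (y + 2 * s)) ** (rot (Nq (y + s)) ** rot (Nq y)) ** matrix_inv (rot (Dq m y))
        = rot (Dq m (y + 2 * s) * (Nq (y + s) * Nq y) * inverse (Dq m y))"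
      using Dq0 Nq0 by (simp add: rot_mult rot_inverse)
    ultimately show ?thesis
      by (simp add: rot_mult U(3) turn_nonzero)
  qed
  have "renorm_representative \<alpha> A n (\<lambda>y. rot (Nq y))"
    unfolding renorm_representative_def using B N by (intro exI[of _ B]) (auto simp: s_def)
  moreover have "almost_reducible (2 * s) (\<lambda>y. rot (Nq (y + s)) ** rot (Nq y))"
    unfolding almost_reducible_def
    using D U(1,2) main rot_SO3[OF turn_nonzero]
    by (intro exI[of _ "\<lambda>m y. rot (Dq m y)"] exI[of _ "\<lambda>m. rot (turn (2 * s))"] exI[of _ U]) auto
  ultimately show ?thesis unfolding s_def by blast
qed

end

theorem corollary1p4:
  fixes \<alpha> :: real and A :: "real \<Rightarrow> real^3^3"
  assumes "0 < \<alpha>" and "\<alpha> < 1" and "\<alpha> \<notin> \<rat>"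
    and "A \<in> smooth_torus SO3"
    and "degree_zero \<alpha> A"
    and "\<not> homotopic_torus_SO3 A (\<lambda>_. mat 1)"
    and "\<alpha> \<in> RDC_tilde"
  shows "infinite {n. \<exists>N. renorm_representative \<alpha> A n N \<and>
           almost_reducible (2 * gauss_iter \<alpha> n) (\<lambda>x. N (x + gauss_iter \<alpha> n) ** N x)}"
proof -
  obtain Q where "smooth Q" "\<And>x. norm (Q x) = 1" "\<And>x. rot (Q x) = A x" "\<And>x. Q (x + 1) = - Q x"
    using antiperiodic_lift[OF assms(4,6)] by blast
  then interpret lifted_cocycle \<alpha> A Q
    using assms(1-3) by unfold_locales auto
  show ?thesis using representative_almost_reducible[OF assms(5)] by simp
qed

end
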